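(* Let $k\ge 3$ be an integer. There exist constants $B_{1,k},B_{2,k},\dots\in\mathbb C$ such that for every $N\in\mathbb N$, as $n\to\infty$, \[ p_k(n)=\frac{C(k)\,e^{A(k)n^{1/3}}}{n^{\frac{5k-6}{6(k-2)}}}\left(1+\sum_{j=1}^{N}\frac{B_{j,k}}{n^{j/3}}+O_N\!\left(n^{-\frac{N+1}{3}}\right)\right), \] where \[ C(k):=\frac{(k-2)^{\frac{6-k}{6(k-2)}}\,\Gamma\!\left(\frac{2}{k-2}\right)\zeta\!\left(\frac32\right)^{\frac{k}{3(k-2)}}}{2^{\frac{3k-2}{2(k-2)}}\sqrt3\,\pi^{\frac{4k-9}{3(k-2)}}},\qquad A(k):=\frac32\left(\sqrt{\frac{\pi}{k-2}}\,\zeta\!\left(\frac32\right)\right)^{2/3}. \]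
   Context: For an integer $k\ge3$, the $n$-th $k$-gonal number is $P_k(n):=\frac12\left((k-2)n^2+(4-k)n\right)$. Let $p_k(n)$ denote the number of partitions of $n$ into $k$-gonal numbers (parts taken from $\{P_k(m):m\in\mathbb N\}$, with repetition, order irrelevant), i.e. $\sum_{n\ge0}p_k(n)q^n=\prod_{m\ge1}(1-q^{P_k(m)})^{-1}$. $\zeta$ is the Riemann zeta function and $\Gamma$ the gamma function. *)

theory Defs
  imports "HOL-Analysis.Analysis" "HOL-Library.Multiset" "HOL-Library.Landau_Symbols"
begin

definition polygonal :: "int \<Rightarrow> nat \<Rightarrow> int" where
  "polygonal k m = ((k - 2) * (int m)\<^sup>2 + (4 - k) * int m) div 2"

text \<open>The division in the definition is exact.\<close>

lemma two_mult_polygonal: "2 * polygonal k m = (k - 2) * (int m)\<^sup>2 + (4 - k) * int m"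
proof -
  have "(k - 2) * (int m)\<^sup>2 + (4 - k) * int m = k * (int m * (int m - 1)) + 2 * (2 * int m - (int m)\<^sup>2)"
    by (simp add: algebra_simps power2_eq_square)
  moreover have "even (int m * (int m - 1))" by simp
  ultimately have "even ((k - 2) * (int m)\<^sup>2 + (4 - k) * int m)" by simp
  then show ?thesis unfolding polygonal_def by (rule dvd_mult_div_cancel)
qed

text \<open>Partitions are multisets of parts. The index \<open>m = 0\<close> is excluded: \<open>polygonal k 0 = 0\<close>
  is not a part.\<close>

definition polygonal_partitions :: "int \<Rightarrow> nat \<Rightarrow> int multiset set" where
  "polygonal_partitions k n =
     {M. set_mset M \<subseteq> {polygonal k m | m. m \<ge> 1} \<and> sum_mset M = int n}"

definition p_gonal :: "int \<Rightarrow> nat \<Rightarrow> nat" where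
  "p_gonal k n = card (polygonal_partitions k n)"

lemma polygonal_pos:
  assumes "k \<ge> 3" "m \<ge> 1"
  shows "polygonal k m \<ge> 1"
proof -
  have "2 * polygonal k m = (k - 2) * (int m * (int m - 1)) + 2 * int m"
    unfolding two_mult_polygonal by (simp add: algebra_simps power2_eq_square)
  moreover have "(k - 2) * (int m * (int m - 1)) \<ge> 0" using assms by simp
  ultimately show ?thesis using assms by linarith
qed

text \<open>For \<open>k \<ge> 3\<close> the cardinality in the definition of \<^term>\<open>p_gonal\<close> is that of a finite set.\<close>

lemma finite_polygonal_partitions:
  assumes "k \<ge> 3"
  shows "finite (polygonal_partitions k n)"
proof -
  have bounds: "int (size M) \<le> sum_mset M \<and> (\<forall>x\<in>#M. x \<le> sum_mset M)"
    if "\<forall>x\<in>#M. (1::int) \<le> x" for M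
    using that by (induction M) force+
  have "polygonal_partitions k n \<subseteq> mset ` {xs. set xs \<subseteq> {1..int n} \<and> length xs \<le> n}"
  proof
    fix M assume M: "M \<in> polygonal_partitions k n"
    then have pos: "\<forall>x\<in>#M. 1 \<le> x"
      using polygonal_pos[OF assms] unfolding polygonal_partitions_def by blast
    have sum: "sum_mset M = int n" using M unfolding polygonal_partitions_def by blast
    obtain xs where xs: "M = mset xs" by (metis ex_mset)
    have "set xs \<subseteq> {1..int n} \<and> length xs \<le> n"
      using bounds[OF pos] pos sum unfolding xs by auto
    then show "M \<in> mset ` {xs. set xs \<subseteq> {1..int n} \<and> length xs \<le> n}" using xs by blast
  qed
  then show ?thesis
    by (rule finite_subset) (intro finite_imageI finite_lists_length_le finite_atLeastAtMost_int)
qed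

text \<open>The Riemann zeta function on the half-line \<open>s > 1\<close>, where it equals its Dirichlet series;
  only \<open>\<zeta>(3/2)\<close> is needed. For \<open>s \<le> 1\<close> the value is meaningless.\<close>

definition zeta :: "real \<Rightarrow> real" where
  "zeta s = (\<Sum>n. 1 / real (Suc n) powr s)"

definition A_gonal :: "int \<Rightarrow> real" where
  "A_gonal k = 3 / 2 * (sqrt (pi / (of_int k - 2)) * zeta (3 / 2)) powr (2 / 3)"

definition C_gonal :: "int \<Rightarrow> real" where
  "C_gonal k = (let \<kappa> = real_of_int k in
     ((\<kappa> - 2) powr ((6 - \<kappa>) / (6 * (\<kappa> - 2))) * Gamma (2 / (\<kappa> - 2))
       * zeta (3 / 2) powr (\<kappa> / (3 * (\<kappa> - 2))))
     / (2 powr ((3 * \<kappa> - 2) / (2 * (\<kappa> - 2))) * sqrt 3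
       * pi powr ((4 * \<kappa> - 9) / (3 * (\<kappa> - 2)))))"

end

theory Submission
  imports Defs "HOL-Complex_Analysis.Complex_Analysis" "HOL-Real_Asymp.Real_Asymp" "HOL-Probability.Distributions"
begin

text \<open>The generating function at \<open>q = exp (- z)\<close> is \<open>exp (H z)\<close>, where \<open>H\<close> sums \<open>- Ln (1 - exp (- z Q))\<close> over
  the polygonal numbers \<open>Q = a m (m + c)\<close>. Differentiating gives \<open>- z H'(z) = \<Sum> bern (z Q)\<close> with the Bernoulli
  function \<open>bern X = X / (exp X - 1)\<close>, which is holomorphic at \<open>0\<close>; hence Euler--Maclaurin summation in
  \<open>\<surd>z m\<close> expands it in powers of \<open>\<surd>z\<close>, uniformly near the positive axis, and integration yields
  \<open>H z = L / \<surd>z + \<kappa> Ln z + D0 + \<dots>\<close>. The integration constant \<open>D0\<close> is found on the real axis from the product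
  \<open>\<Prod> (1 + Y\<^sup>2 / (m (m + c)))\<close>, a perturbation of the product for \<open>sinh\<close> whose defect is a Gamma value.

  The number of partitions of \<open>n\<close> is the Cauchy integral of \<open>exp (H z + n z)\<close> over the segment
  \<open>Re z = t\<^sup>2\<close>, \<open>\<bar>Im z\<bar> \<le> pi\<close>, with saddle point at \<open>n = L / (2 t\<^sup>3)\<close>. The arc \<open>\<bar>Im z\<bar> \<le> r t\<^sup>2\<close> is treated by the
  Laplace method and gives an expansion in powers of \<open>t\<close>, that is, of \<open>n powr (- 1/3)\<close>. On the rest,
  \<open>Re (H z)\<close> is smaller than \<open>H (Re z)\<close> by a multiple of \<open>1 / t\<close>: the phases \<open>Im z Q\<close> cannot all be close to
  \<open>2 pi \<int>\<close>, because \<open>Q(d)\<close> is a combination of four values of \<open>Q\<close> taken near arbitrary \<open>m\<close>, and \<open>Q(1) = 1\<close>.\<close>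

section \<open>Uniform asymptotic expansions\<close>

text \<open>The saddle integral runs over \<open>z = t\<^sup>2 * w\<close> with
  \<open>w = 1 + \<i> * u\<close>, and Laplace's method Taylor expands the amplitude at
  \<open>u = 0\<close>. So every expansion in \<open>t\<close> must hold uniformly for
  \<open>w\<close> in a complex neighbourhood of \<open>1\<close>, with coefficients holomorphic in
  \<open>w\<close>. This shapes the calculus below: expansions carry a parameter of arbitrary type
  (a point, a pair of points, or a whole summand function), and holomorphy of a coefficient is never
  read off a formula but inherited from the expanded functions through uniform limits.

  With \<open>n = L / (2 * t ^ 3)\<close> the exponent \<open>L / sqrt z + n * z\<close> becomes
  \<open>L / t\<close> times \<open>1 / sqrt w + w / 2\<close>, which is stationary at
  \<open>w = 1\<close> with value \<open>3 / 2\<close>. The large parameter is thus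
  \<open>L / t\<close>, a multiple of \<open>n powr (1 / 3)\<close>. The Gaussian width is
  \<open>sqrt (t / L)\<close>, so half-integral powers of \<open>t\<close> threaten to appear;
  parity removes them.

  Of all coefficients only three have to be known: \<open>L\<close>, which fixes the exponential,
  \<open>\<kappa>\<close>, which fixes the power of \<open>n\<close>, and \<open>D0\<close>, which
  fixes the constant.\<close>

definition uexp_coeffs ::
  "'p set \<Rightarrow> nat \<Rightarrow> (real \<Rightarrow> 'p \<Rightarrow> complex) \<Rightarrow> (nat \<Rightarrow> 'p \<Rightarrow> complex) \<Rightarrow> bool" where
  "uexp_coeffs P J A G \<longleftrightarrow> (\<forall>j. \<exists>B. \<forall>p\<in>P. norm (G j p) \<le> B) \<and>
     (\<exists>C. \<forall>\<^sub>F t in at_right 0. \<forall>p\<in>P. norm (A t p - (\<Sum>j\<le>J. G j p * of_real t ^ j)) \<le> C * t ^ Suc J)"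

text \<open>The closure rules below need only the existence of coefficients; their values are
  recovered later from uniqueness and limits. The bound in \<open>uexp_coeffs\<close> is demanded at
  every index, so that one coefficient family can serve all orders \<open>J\<close> at once.\<close>

definition uexp :: "'p set \<Rightarrow> nat \<Rightarrow> (real \<Rightarrow> 'p \<Rightarrow> complex) \<Rightarrow> bool" where
  "uexp P J A \<longleftrightarrow> (\<exists>G. uexp_coeffs P J A G)"

lemma uexp_coeffsI:
  assumes "\<And>j. \<exists>B. \<forall>p\<in>P. norm (G j p) \<le> B"
  assumes "\<forall>\<^sub>F t in at_right 0. \<forall>p\<in>P. norm (A t p - (\<Sum>j\<le>J. G j p * of_real t ^ j)) \<le> C * t ^ Suc J"
  shows "uexp_coeffs P J A G"
  using assms unfolding uexp_coeffs_def by blast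

lemma uexp_coeffsE:
  assumes "uexp_coeffs P J A G"
  obtains C where "C \<ge> 0" "\<forall>\<^sub>F t in at_right 0. \<forall>p\<in>P. norm (A t p - (\<Sum>j\<le>J. G j p * of_real t ^ j)) \<le> C * t ^ Suc J"
proof -
  obtain C where C: "\<forall>\<^sub>F t in at_right 0. \<forall>p\<in>P. norm (A t p - (\<Sum>j\<le>J. G j p * of_real t ^ j)) \<le> C * t ^ Suc J"
    using assms unfolding uexp_coeffs_def by blast
  have "\<forall>\<^sub>F t in at_right 0. \<forall>p\<in>P. norm (A t p - (\<Sum>j\<le>J. G j p * of_real t ^ j)) \<le> max C 0 * t ^ Suc J"
    using C eventually_at_right_less[of "0::real"]
  proof eventually_elim
    case (elim t)
    have "C * t ^ Suc J \<le> max C 0 * t ^ Suc J" using elim by (intro mult_right_mono) auto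
    with elim(1) show ?case by (meson order_trans)
  qed
  then show ?thesis using that[of "max C 0"] by simp
qed

lemma uexp_coeffs_boundedE:
  assumes "uexp_coeffs P J A G"
  obtains B where "B \<ge> 0" "\<And>p. p \<in> P \<Longrightarrow> norm (G j p) \<le> B"
proof -
  obtain B where B: "\<forall>p\<in>P. norm (G j p) \<le> B" using assms unfolding uexp_coeffs_def by blast
  show ?thesis using B that[of "max B 0"] by force
qed

lemma eventually_small_right: "0 < e \<Longrightarrow> \<forall>\<^sub>F t in at_right (0::real). 0 < t \<and> t < e"
  using eventually_at_right_real[of 0 e] by simp

lemma uexp_coeffs_cong:
  assumes "uexp_coeffs P J A G" "\<forall>\<^sub>F t in at_right 0. \<forall>p\<in>P. A t p = A' t p"
  shows "uexp_coeffs P J A' G"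
proof -
  obtain C where C: "\<forall>\<^sub>F t in at_right 0. \<forall>p\<in>P. norm (A t p - (\<Sum>j\<le>J. G j p * of_real t ^ j)) \<le> C * t ^ Suc J"
    using assms unfolding uexp_coeffs_def by blast
  show ?thesis
  proof (rule uexp_coeffsI)
    show "\<exists>B. \<forall>p\<in>P. norm (G j p) \<le> B" for j using assms(1) unfolding uexp_coeffs_def by blast
    show "\<forall>\<^sub>F t in at_right 0. \<forall>p\<in>P. norm (A' t p - (\<Sum>j\<le>J. G j p * of_real t ^ j)) \<le> C * t ^ Suc J"
      using C assms(2) by eventually_elim auto
  qed
qed

lemma uexp_cong:
  assumes "uexp P J A" "\<forall>\<^sub>F t in at_right 0. \<forall>p\<in>P. A t p = A' t p"
  shows "uexp P J A'"
  using assms uexp_coeffs_cong unfolding uexp_def by blast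

lemma uexp_coeffs_add:
  assumes "uexp_coeffs P J A G" "uexp_coeffs P J A' G'"
  shows "uexp_coeffs P J (\<lambda>t p. A t p + A' t p) (\<lambda>j p. G j p + G' j p)"
proof -
  obtain C where C: "\<forall>\<^sub>F t in at_right 0. \<forall>p\<in>P. norm (A t p - (\<Sum>j\<le>J. G j p * of_real t ^ j)) \<le> C * t ^ Suc J"
    using assms(1) by (elim uexp_coeffsE)
  obtain C' where C': "\<forall>\<^sub>F t in at_right 0. \<forall>p\<in>P. norm (A' t p - (\<Sum>j\<le>J. G' j p * of_real t ^ j)) \<le> C' * t ^ Suc J"
    using assms(2) by (elim uexp_coeffsE)
  show ?thesis
  proof (rule uexp_coeffsI)
    fix j
    obtain B where "\<And>p. p \<in> P \<Longrightarrow> norm (G j p) \<le> B" using assms(1) uexp_coeffs_boundedE by metis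
    moreover obtain B' where "\<And>p. p \<in> P \<Longrightarrow> norm (G' j p) \<le> B'" using assms(2) uexp_coeffs_boundedE by metis
    ultimately show "\<exists>B. \<forall>p\<in>P. norm (G j p + G' j p) \<le> B"
      by (intro exI[of _ "B + B'"]) (meson add_mono norm_triangle_mono)
    show "\<forall>\<^sub>F t in at_right 0. \<forall>p\<in>P. norm (A t p + A' t p - (\<Sum>j\<le>J. (G j p + G' j p) * of_real t ^ j)) \<le> (C + C') * t ^ Suc J"
      using C C'
    proof eventually_elim
      case (elim t)
      show ?case
      proof
        fix p assume p: "p \<in> P"
        have "A t p + A' t p - (\<Sum>j\<le>J. (G j p + G' j p) * of_real t ^ j) =
          (A t p - (\<Sum>j\<le>J. G j p * of_real t ^ j)) + (A' t p - (\<Sum>j\<le>J. G' j p * of_real t ^ j))"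
          by (simp add: algebra_simps sum.distrib)
        then show "norm (A t p + A' t p - (\<Sum>j\<le>J. (G j p + G' j p) * of_real t ^ j)) \<le> (C + C') * t ^ Suc J"
          using norm_triangle_mono[OF elim(1)[rule_format, OF p] elim(2)[rule_format, OF p]]
          by (simp add: algebra_simps)
      qed
    qed
  qed
qed

lemma uexp_add: "uexp P J A \<Longrightarrow> uexp P J A' \<Longrightarrow> uexp P J (\<lambda>t p. A t p + A' t p)"
  unfolding uexp_def using uexp_coeffs_add by blast

lemma uexp_coeffs_cmult:
  assumes "uexp_coeffs P J A G" "\<And>p. p \<in> P \<Longrightarrow> norm (c p) \<le> K"
  shows "uexp_coeffs P J (\<lambda>t p. c p * A t p) (\<lambda>j p. c p * G j p)"
proof -
  obtain C where C: "C \<ge> 0" "\<forall>\<^sub>F t in at_right 0. \<forall>p\<in>P. norm (A t p - (\<Sum>j\<le>J. G j p * of_real t ^ j)) \<le> C * t ^ Suc J"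
    using assms(1) by (elim uexp_coeffsE)
  show ?thesis
  proof (rule uexp_coeffsI)
    fix j
    obtain B where "\<And>p. p \<in> P \<Longrightarrow> norm (G j p) \<le> B" using assms(1) uexp_coeffs_boundedE by metis
    then show "\<exists>B. \<forall>p\<in>P. norm (c p * G j p) \<le> B"
      using assms(2) by (intro exI[of _ "K * B"]) (auto simp: norm_mult intro!: mult_mono' )
    show "\<forall>\<^sub>F t in at_right 0. \<forall>p\<in>P. norm (c p * A t p - (\<Sum>j\<le>J. c p * G j p * of_real t ^ j)) \<le> (K * C) * t ^ Suc J"
      using C(2)
    proof eventually_elim
      case (elim t)
      show ?case
      proof
        fix p assume p: "p \<in> P"
        have "c p * A t p - (\<Sum>j\<le>J. c p * G j p * of_real t ^ j) = c p * (A t p - (\<Sum>j\<le>J. G j p * of_real t ^ j))"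
          by (simp add: algebra_simps sum_distrib_left)
        then have "norm (c p * A t p - (\<Sum>j\<le>J. c p * G j p * of_real t ^ j)) = norm (c p) * norm (A t p - (\<Sum>j\<le>J. G j p * of_real t ^ j))"
          by (simp add: norm_mult)
        also have "\<dots> \<le> K * (C * t ^ Suc J)"
          using elim p assms(2)[OF p] by (intro mult_mono') auto
        finally show "norm (c p * A t p - (\<Sum>j\<le>J. c p * G j p * of_real t ^ j)) \<le> (K * C) * t ^ Suc J"
          by (simp only: mult.assoc)
      qed
    qed
  qed
qed

lemma uexp_cmult:
  assumes "uexp P J A" "\<And>p. p \<in> P \<Longrightarrow> norm (c p) \<le> K"
  shows "uexp P J (\<lambda>t p. c p * A t p)"
  using uexp_coeffs_cmult[of P J A _ c K] assms unfolding uexp_def by blast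

text \<open>For \<open>t < 1\<close> the term of order \<open>Suc J\<close> is itself
  \<open>O(t ^ Suc J)\<close>, because its coefficient is bounded over \<open>P\<close>, and it
  moves into the error.\<close>

lemma uexp_coeffs_SucD:
  assumes "uexp_coeffs P (Suc J) A G"
  shows "uexp_coeffs P J A G"
proof -
  obtain C where C: "C \<ge> 0" "\<forall>\<^sub>F t in at_right 0. \<forall>p\<in>P. norm (A t p - (\<Sum>j\<le>Suc J. G j p * of_real t ^ j)) \<le> C * t ^ Suc (Suc J)"
    using assms(1) by (elim uexp_coeffsE)
  obtain B where B: "B \<ge> 0" "\<And>p. p \<in> P \<Longrightarrow> norm (G (Suc J) p) \<le> B" using assms(1) uexp_coeffs_boundedE by metis
  show ?thesis
  proof (rule uexp_coeffsI)
    show "\<exists>B. \<forall>p\<in>P. norm (G j p) \<le> B" for j using assms(1) unfolding uexp_coeffs_def by blast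
    show "\<forall>\<^sub>F t in at_right 0. \<forall>p\<in>P. norm (A t p - (\<Sum>j\<le>J. G j p * of_real t ^ j)) \<le> (C + B) * t ^ Suc J"
      using C(2) eventually_small_right[of 1, simplified]
    proof eventually_elim
      case (elim t)
      show ?case
      proof
        fix p assume p: "p \<in> P"
        have "A t p - (\<Sum>j\<le>J. G j p * of_real t ^ j) =
          (A t p - (\<Sum>j\<le>Suc J. G j p * of_real t ^ j)) + G (Suc J) p * of_real t ^ Suc J" by simp
        also have "norm \<dots> \<le> C * t ^ Suc (Suc J) + B * t ^ Suc J"
          using elim p B by (intro norm_triangle_mono) (auto simp: norm_mult norm_power intro!: mult_right_mono)
        also have "C * t ^ Suc (Suc J) \<le> C * t ^ Suc J"
          using elim C by (intro mult_left_mono power_decreasing) auto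
        finally show "norm (A t p - (\<Sum>j\<le>J. G j p * of_real t ^ j)) \<le> (C + B) * t ^ Suc J"
          by (simp only: ring_distribs)
      qed
    qed
  qed
qed

lemma uexp_coeffs_le: "uexp_coeffs P J A G \<Longrightarrow> J' \<le> J \<Longrightarrow> uexp_coeffs P J' A G"
  by (induction J) (use uexp_coeffs_SucD le_Suc_eq in blast)+

text \<open>The factor \<open>t\<close> shifts every coefficient by one place and improves the error
  by one order. This gain lets the Euler--Maclaurin induction climb from \<open>J\<close> to
  \<open>Suc J\<close>.\<close>

lemma uexp_coeffs_times_t:
  assumes "uexp_coeffs P J A G"
  shows "uexp_coeffs P (Suc J) (\<lambda>t p. of_real t * A t p) (\<lambda>j p. case j of 0 \<Rightarrow> 0 | Suc i \<Rightarrow> G i p)"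
proof -
  obtain C where C: "C \<ge> 0" "\<forall>\<^sub>F t in at_right 0. \<forall>p\<in>P. norm (A t p - (\<Sum>j\<le>J. G j p * of_real t ^ j)) \<le> C * t ^ Suc J"
    using assms(1) by (elim uexp_coeffsE)
  show ?thesis
  proof (rule uexp_coeffsI)
    fix j
    show "\<exists>B. \<forall>p\<in>P. norm (case j of 0 \<Rightarrow> 0 | Suc i \<Rightarrow> G i p) \<le> B"
      using assms uexp_coeffs_def by (cases j) (auto simp: uexp_coeffs_def)
    show "\<forall>\<^sub>F t in at_right 0. \<forall>p\<in>P. norm (of_real t * A t p - (\<Sum>j\<le>Suc J. (case j of 0 \<Rightarrow> 0 | Suc i \<Rightarrow> G i p) * of_real t ^ j)) \<le> C * t ^ Suc (Suc J)"
      using C(2) eventually_small_right[of 1, simplified]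
    proof eventually_elim
      case (elim t)
      show ?case
      proof
        fix p assume p: "p \<in> P"
        have "of_real t * A t p - (\<Sum>j\<le>Suc J. (case j of 0 \<Rightarrow> 0 | Suc i \<Rightarrow> G i p) * of_real t ^ j)
          = of_real t * (A t p - (\<Sum>j\<le>J. G j p * of_real t ^ j))"
          by (subst sum.atMost_Suc_shift) (simp add: algebra_simps sum_distrib_left)
        then have "norm (of_real t * A t p - (\<Sum>j\<le>Suc J. (case j of 0 \<Rightarrow> 0 | Suc i \<Rightarrow> G i p) * of_real t ^ j))
          = t * norm (A t p - (\<Sum>j\<le>J. G j p * of_real t ^ j))" using elim by (simp add: norm_mult)
        also have "\<dots> \<le> t * (C * t ^ Suc J)" using elim p by (intro mult_left_mono) auto
        finally show "norm (of_real t * A t p - (\<Sum>j\<le>Suc J. (case j of 0 \<Rightarrow> 0 | Suc i \<Rightarrow> G i p) * of_real t ^ j)) \<le> C * t ^ Suc (Suc J)"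
          by (simp add: algebra_simps)
      qed
    qed
  qed
qed

lemma uexp_times_t: "uexp P J A \<Longrightarrow> uexp P (Suc J) (\<lambda>t p. of_real t * A t p)"
  unfolding uexp_def using uexp_coeffs_times_t by blast

lemma uexp_le: "uexp P J A \<Longrightarrow> J' \<le> J \<Longrightarrow> uexp P J' A"
  unfolding uexp_def using uexp_coeffs_le by blast

lemma uexp_times_power: "uexp P J A \<Longrightarrow> uexp P J (\<lambda>t p. of_real t ^ i * A t p)"
proof (induction i)
  case (Suc i)
  then show ?case
    using uexp_le[OF uexp_times_t[of P J "\<lambda>t p. of_real t ^ i * A t p"], of J] by (simp add: mult.assoc)
qed simp

lemma uexp_bigo:
  assumes "\<forall>\<^sub>F t in at_right 0. \<forall>p\<in>P. norm (A t p) \<le> C * t ^ Suc J"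
  shows "uexp_coeffs P J A (\<lambda>_ _. 0)"
  using assms by (intro uexp_coeffsI) auto

lemma uexp_const:
  assumes "\<And>p. p \<in> P \<Longrightarrow> norm (g p) \<le> K"
  shows "uexp P J (\<lambda>t p. g p)"
proof -
  have "uexp_coeffs P J (\<lambda>t p. g p) (\<lambda>j p. if j = 0 then g p else 0)"
  proof (rule uexp_coeffsI)
    show "\<exists>B. \<forall>p\<in>P. norm (if j = 0 then g p else 0) \<le> B" for j using assms by (intro exI[of _ "max K 0"]) (auto simp: le_max_iff_disj)
    have "(\<Sum>j\<le>J. (if j = 0 then g p else 0) * of_real t ^ j) = g p" for t :: real and p
      by (subst sum.atMost_shift) simp
    then show "\<forall>\<^sub>F t in at_right 0. \<forall>p\<in>P. norm (g p - (\<Sum>j\<le>J. (if j = 0 then g p else 0) * of_real t ^ j)) \<le> 0 * t ^ Suc J"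
      by simp
  qed
  then show ?thesis unfolding uexp_def by blast
qed

lemma uexp_sum:
  assumes "finite I" "\<And>i. i \<in> I \<Longrightarrow> uexp P J (A i)"
  shows "uexp P J (\<lambda>t p. \<Sum>i\<in>I. A i t p)"
  using assms
proof (induction I rule: finite_induct)
  case empty
  show ?case using uexp_const[of P "\<lambda>_. 0" 0] by simp
next
  case (insert x F)
  then show ?case using uexp_add[of P J "A x" "\<lambda>t p. \<Sum>i\<in>F. A i t p"] by simp
qed

text \<open>An expansion proved once for a whole class of functions, taken as parameters, passes in
  this way to every family \<open>h p\<close> drawn from the class.\<close>

lemma uexp_coeffs_reparam:
  assumes "uexp_coeffs P' J A G" "\<And>p. p \<in> P \<Longrightarrow> h p \<in> P'"
  shows "uexp_coeffs P J (\<lambda>t p. A t (h p)) (\<lambda>j p. G j (h p))"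
proof -
  obtain C where C: "\<forall>\<^sub>F t in at_right 0. \<forall>p\<in>P'. norm (A t p - (\<Sum>j\<le>J. G j p * of_real t ^ j)) \<le> C * t ^ Suc J"
    using assms(1) by (elim uexp_coeffsE)
  show ?thesis
  proof (rule uexp_coeffsI)
    show "\<exists>B. \<forall>p\<in>P. norm (G j (h p)) \<le> B" for j
      using assms unfolding uexp_coeffs_def by meson
    show "\<forall>\<^sub>F t in at_right 0. \<forall>p\<in>P. norm (A t (h p) - (\<Sum>j\<le>J. G j (h p) * of_real t ^ j)) \<le> C * t ^ Suc J"
      using C by eventually_elim (use assms(2) in auto)
  qed
qed

lemma uexp_reparam: "uexp P' J A \<Longrightarrow> (\<And>p. p \<in> P \<Longrightarrow> h p \<in> P') \<Longrightarrow> uexp P J (\<lambda>t p. A t (h p))"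
  unfolding uexp_def using uexp_coeffs_reparam[of P' J A _ P h] by blast

text \<open>Subtracting the terms below \<open>j\<close> and dividing by \<open>t ^ j\<close> leaves
  \<open>G j\<close> plus an error \<open>O(t)\<close>, uniformly on \<open>P\<close>. Uniqueness of
  the coefficients and their inheritance of continuity or holomorphy both rest on this.\<close>

lemma uexp_coeffs_uniform_limit:
  assumes G: "uexp_coeffs P J A G" and j: "j \<le> J"
  shows "uniform_limit P (\<lambda>t p. (A t p - (\<Sum>i<j. G i p * of_real t ^ i)) / of_real t ^ j) (G j) (at_right 0)"
proof (rule uniform_limitI)
  fix e :: real assume e: "e > 0"
  obtain C where C: "C \<ge> 0" "\<forall>\<^sub>F t in at_right 0. \<forall>p\<in>P. norm (A t p - (\<Sum>i\<le>j. G i p * of_real t ^ i)) \<le> C * t ^ Suc j"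
    using uexp_coeffs_le[OF G j] by (elim uexp_coeffsE)
  have "0 < e / (C + 1)" using e C by simp
  from eventually_small_right[OF this] C(2)
  show "\<forall>\<^sub>F t in at_right 0. \<forall>p\<in>P. dist ((A t p - (\<Sum>i<j. G i p * of_real t ^ i)) / of_real t ^ j) (G j p) < e"
  proof eventually_elim
    case (elim t)
    show ?case
    proof
      fix p assume p: "p \<in> P"
      have "(A t p - (\<Sum>i<j. G i p * of_real t ^ i)) / of_real t ^ j - G j p
         = (A t p - (\<Sum>i\<le>j. G i p * of_real t ^ i)) / of_real t ^ j"
        using elim by (simp add: field_simps lessThan_Suc_atMost[symmetric])
      then have "dist ((A t p - (\<Sum>i<j. G i p * of_real t ^ i)) / of_real t ^ j) (G j p)
         = norm (A t p - (\<Sum>i\<le>j. G i p * of_real t ^ i)) / t ^ j"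
        using elim by (simp add: dist_norm norm_divide norm_power)
      also have "\<dots> \<le> (C * t ^ Suc j) / t ^ j" using elim p by (intro divide_right_mono) auto
      also have "\<dots> = C * t" using elim by simp
      also have "\<dots> \<le> (C + 1) * t" using elim by simp
      also have "\<dots> < e" using elim C by (simp add: field_simps)
      finally show "dist ((A t p - (\<Sum>i<j. G i p * of_real t ^ i)) / of_real t ^ j) (G j p) < e" .
    qed
  qed
qed

lemma uexp_coeffs_unique:
  assumes G: "uexp_coeffs P J A G" and G': "uexp_coeffs P J' A G'" and p: "p \<in> P"
  shows "j \<le> J \<Longrightarrow> j \<le> J' \<Longrightarrow> G j p = G' j p"
proof (induction j rule: less_induct)
  case (less j)
  have l: "((\<lambda>t. (A t p - (\<Sum>i<j. G i p * of_real t ^ i)) / of_real t ^ j) \<longlongrightarrow> G j p) (at_right 0)"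
    using uexp_coeffs_uniform_limit[OF G less.prems(1)] p by (rule tendsto_uniform_limitI)
  have l': "((\<lambda>t. (A t p - (\<Sum>i<j. G' i p * of_real t ^ i)) / of_real t ^ j) \<longlongrightarrow> G' j p) (at_right 0)"
    using uexp_coeffs_uniform_limit[OF G' less.prems(2)] p by (rule tendsto_uniform_limitI)
  have "(\<Sum>i<j. G i p * of_real t ^ i) = (\<Sum>i<j. G' i p * of_real t ^ i)" for t :: real
    using less by (intro sum.cong) auto
  then have "((\<lambda>t. (A t p - (\<Sum>i<j. G i p * of_real t ^ i)) / of_real t ^ j) \<longlongrightarrow> G' j p) (at_right 0)"
    using l' by simp
  then show ?case using l by (intro tendsto_unique[OF trivial_limit_at_right_real])
qed

text \<open>Each coefficient is a uniform limit of combinations of \<open>A t\<close> and the previous coefficients.\<close>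

lemma uexp_coeffs_closed:
  assumes G: "uexp_coeffs P J A G"
    and A: "\<forall>\<^sub>F t in at_right 0. \<C> (A t)"
    and lin: "\<And>f g c. \<C> f \<Longrightarrow> \<C> g \<Longrightarrow> \<C> (\<lambda>p. f p + c * g p)"
    and lim: "\<And>f (g :: 'p \<Rightarrow> complex). uniform_limit P f g (at_right (0::real)) \<Longrightarrow> \<forall>\<^sub>F t in at_right 0. \<C> (f t) \<Longrightarrow> \<C> g"
  shows "j \<le> J \<Longrightarrow> \<C> (G j)"
proof (induction j rule: less_induct)
  case (less j)
  have sum: "k \<le> j \<Longrightarrow> \<C> f \<Longrightarrow> \<C> (\<lambda>p. f p - (\<Sum>i<k. G i p * of_real t ^ i))" for f k and t :: real
  proof (induction k)
    case (Suc k)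
    have "\<C> (\<lambda>p. (f p - (\<Sum>i<k. G i p * of_real t ^ i)) + (- (of_real t ^ k)) * G k p)"
      using Suc less by (intro lin) auto
    then show ?case by (simp add: algebra_simps)
  qed simp
  show ?case
  proof (rule lim[OF uexp_coeffs_uniform_limit[OF G less.prems]])
    show "\<forall>\<^sub>F t in at_right 0. \<C> (\<lambda>p. (A t p - (\<Sum>i<j. G i p * of_real t ^ i)) / of_real t ^ j)"
      using A
    proof eventually_elim
      case (elim t)
      define f where "f = (\<lambda>p. A t p - (\<Sum>i<j. G i p * of_real t ^ i))"
      have f: "\<C> f" unfolding f_def using sum[OF order_refl elim] .
      \<comment> \<open>The closure hypothesis only offers \<open>f + c * g\<close>, so division by
        \<open>t ^ j\<close> is written as adding a multiple of \<open>f\<close> to itself.\<close>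
      have "\<C> (\<lambda>p. f p + (1 / of_real t ^ j - 1) * f p)" by (intro lin f)
      also have "(\<lambda>p. f p + (1 / of_real t ^ j - 1) * f p) =
          (\<lambda>p. (A t p - (\<Sum>i<j. G i p * of_real t ^ i)) / of_real t ^ j)"
        by (rule ext) (simp add: f_def ring_distribs divide_simps)
      finally show ?case .
    qed
  qed
qed

text \<open>Holomorphy is local, so Weierstrass' theorem on closed discs inside \<open>S\<close>
  suffices.\<close>

lemma holomorphic_on_uniform_limit:
  fixes f :: "'a \<Rightarrow> complex \<Rightarrow> complex"
  assumes S: "open S" and f: "\<forall>\<^sub>F t in F. f t holomorphic_on S"
    and lim: "uniform_limit S f g F" and F: "F \<noteq> bot"
  shows "g holomorphic_on S"
proof -
  have "\<exists>d>0. g holomorphic_on ball z d" if z: "z \<in> S" for z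
  proof -
    obtain d where d: "d > 0" "cball z d \<subseteq> S" using S z open_contains_cball by blast
    have "\<forall>\<^sub>F t in F. continuous_on (cball z d) (f t) \<and> f t holomorphic_on ball z d"
      using f
    proof eventually_elim
      case (elim t)
      have "f t holomorphic_on cball z d" using elim d(2) by (rule holomorphic_on_subset)
      then show ?case
        by (intro conjI holomorphic_on_imp_continuous_on) (auto intro: holomorphic_on_subset)
    qed
    then have "g holomorphic_on ball z d"
      by (rule holomorphic_uniform_limit[OF _ uniform_limit_on_subset[OF lim d(2)] F])
    then show ?thesis using d(1) by blast
  qed
  then have "g field_differentiable at z within S" if "z \<in> S" for z
    using that holomorphic_on_imp_differentiable_at[of g "ball z _" z]
    by (metis centre_in_ball field_differentiable_at_within open_ball)
  then show ?thesis unfolding holomorphic_on_def by blast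
qed

lemma uexp_coeffs_holomorphic:
  assumes G: "uexp_coeffs P J A G" and S: "open P"
    and A: "\<forall>\<^sub>F t in at_right 0. A t holomorphic_on P" and j: "j \<le> J"
  shows "G j holomorphic_on P"
proof (rule uexp_coeffs_closed[OF G A _ _ j])
  show "g holomorphic_on P"
    if "uniform_limit P f g (at_right (0::real))" "\<forall>\<^sub>F t in at_right 0. f t holomorphic_on P" for f g
    using holomorphic_on_uniform_limit[OF S that(2,1)] by simp
qed (intro holomorphic_intros)

text \<open>By uniqueness the families chosen for different orders agree wherever both are
  determined, so the diagonal \<open>H j j\<close> is compatible with all of them.\<close>

lemma uexp_coeffs_all_orders:
  assumes "\<And>J. uexp P J A"
  obtains G where "\<And>J. uexp_coeffs P J A G"
proof -
  define H where "H = (\<lambda>J. SOME G. uexp_coeffs P J A G)"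
  have H: "uexp_coeffs P J A (H J)" for J
    using assms[of J] unfolding H_def uexp_def by (rule someI_ex)
  define G where "G = (\<lambda>j. H j j)"
  have "uexp_coeffs P J A G" for J
  proof -
    have eq: "H J j p = G j p" if "p \<in> P" "j \<le> J" for j p
      unfolding G_def by (rule uexp_coeffs_unique[OF H H that(1)]) (use that in auto)
    obtain C where C: "\<forall>\<^sub>F t in at_right 0. \<forall>p\<in>P. norm (A t p - (\<Sum>j\<le>J. H J j p * of_real t ^ j)) \<le> C * t ^ Suc J"
      using H[of J] by (elim uexp_coeffsE)
    show ?thesis
    proof (rule uexp_coeffsI)
      show "\<exists>B. \<forall>p\<in>P. norm (G j p) \<le> B" for j
        using H[of j] unfolding uexp_coeffs_def G_def by blast
      show "\<forall>\<^sub>F t in at_right 0. \<forall>p\<in>P. norm (A t p - (\<Sum>j\<le>J. G j p * of_real t ^ j)) \<le> C * t ^ Suc J"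
        using C by eventually_elim (simp add: eq)
    qed
  qed
  with that show ?thesis by blast
qed

text \<open>Cauchy's inequality is applied on the circle of radius \<open>r / 2\<close>, as the
  bound \<open>B\<close> is known on the open ball; hence the factor \<open>2 / r\<close>. For
  \<open>norm z \<le> r / 4\<close> the bounds on consecutive terms shrink by at least one half, and
  the tail is at most twice its first bound.\<close>

lemma Taylor_bounded:
  assumes holf: "f holomorphic_on ball 0 r" and r: "0 < r" and B: "\<And>z. z \<in> ball 0 r \<Longrightarrow> norm (f z) \<le> B"
  shows "norm ((deriv ^^ j) f 0 / fact j) \<le> B * (2 / r) ^ j"
    and "z \<in> cball 0 (r / 4) \<Longrightarrow> norm (f z - (\<Sum>j\<le>J. (deriv ^^ j) f 0 / fact j * z ^ j)) \<le> 2 * B * (2 * norm z / r) ^ Suc J"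
proof -
  have B0: "B \<ge> 0" using order_trans[OF norm_ge_zero B[of 0]] r by simp
  have *: "norm ((deriv ^^ j) f 0 / fact j) \<le> B * (2 / r) ^ j" for j
  proof -
    have "norm ((deriv ^^ j) f 0) \<le> fact j * B / (r / 2) ^ j"
    proof (rule Cauchy_inequality)
      show "f holomorphic_on ball 0 (r / 2)" using holf r by (rule_tac holomorphic_on_subset) auto
      show "continuous_on (cball 0 (r / 2)) f"
        by (rule continuous_on_subset[OF holomorphic_on_imp_continuous_on[OF holf]]) (use r in auto)
      show "norm (0 - x) = r / 2 \<Longrightarrow> norm (f x) \<le> B" for x using B[of x] r by simp
    qed (use r in auto)
    then show ?thesis using r by (simp add: norm_divide field_simps)
  qed
  then show "norm ((deriv ^^ j) f 0 / fact j) \<le> B * (2 / r) ^ j" .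
  assume z: "z \<in> cball 0 (r / 4)"
  define x where "x = 2 * norm z / r"
  have x: "0 \<le> x" "x \<le> 1/2" using z r by (auto simp: x_def field_simps)
  define c where "c = (\<lambda>j. (deriv ^^ j) f 0 / fact j * z ^ j)"
  have "c sums f z"
    using holomorphic_power_series[OF holf, of z] z r by (simp add: c_def)
  then have "(\<lambda>j. c (j + Suc J)) sums (f z - (\<Sum>j<Suc J. c j))" by (subst sums_iff_shift) simp
  moreover have cb: "norm (c (j + Suc J)) \<le> B * x ^ Suc J * (1/2) ^ j" for j
  proof -
    have "norm (c (j + Suc J)) \<le> B * (2 / r) ^ (j + Suc J) * norm z ^ (j + Suc J)"
      unfolding c_def norm_mult norm_power by (intro mult_right_mono *) auto
    also have "\<dots> = B * x ^ Suc J * x ^ j" by (simp add: x_def power_add power_mult_distrib power_divide field_simps)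
    also have "\<dots> \<le> B * x ^ Suc J * (1/2) ^ j" using x B0 by (intro mult_left_mono power_mono) auto
    finally show ?thesis .
  qed
  moreover have gs: "(\<lambda>j. B * x ^ Suc J * (1/2) ^ j) sums (B * x ^ Suc J * 2)"
    using geometric_sums[of "1/2 :: real"] by (intro sums_mult) simp
  ultimately have "norm (f z - (\<Sum>j<Suc J. c j)) \<le> B * x ^ Suc J * 2"
    using norm_suminf_le[of "\<lambda>j. c (j + Suc J)" "\<lambda>j. B * x ^ Suc J * (1/2) ^ j"] by (simp add: sums_iff)
  then show "norm (f z - (\<Sum>j\<le>J. (deriv ^^ j) f 0 / fact j * z ^ j)) \<le> 2 * B * (2 * norm z / r) ^ Suc J"
    unfolding lessThan_Suc_atMost x_def c_def by (simp only: mult_ac)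
qed

lemma uexp_coeffs_Taylor:
  assumes hol: "\<And>p. p \<in> P \<Longrightarrow> h p holomorphic_on ball 0 r" and r: "0 < r"
    and B: "\<And>p z. p \<in> P \<Longrightarrow> z \<in> ball 0 r \<Longrightarrow> norm (h p z) \<le> B"
  shows "uexp_coeffs P J (\<lambda>t p. h p (of_real t)) (\<lambda>j p. (deriv ^^ j) (h p) 0 / fact j)"
proof (rule uexp_coeffsI)
  show "\<exists>K. \<forall>p\<in>P. norm ((deriv ^^ j) (h p) 0 / fact j) \<le> K" for j
    using Taylor_bounded(1)[OF hol r B] by blast
  have "0 < r / 4" using r by simp
  from eventually_small_right[OF this]
  show "\<forall>\<^sub>F t in at_right 0. \<forall>p\<in>P. norm (h p (of_real t) - (\<Sum>j\<le>J. (deriv ^^ j) (h p) 0 / fact j * of_real t ^ j))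
    \<le> (2 * B * (2 / r) ^ Suc J) * t ^ Suc J"
  proof eventually_elim
    case (elim t)
    show ?case
      using Taylor_bounded(2)[OF hol r B, of _ "of_real t" J] elim
      by (auto simp: power_mult_distrib power_divide mult_ac)
  qed
qed

lemma uexp_Taylor:
  assumes "\<And>p. p \<in> P \<Longrightarrow> h p holomorphic_on ball 0 r" "0 < r"
    and "\<And>p z. p \<in> P \<Longrightarrow> z \<in> ball 0 r \<Longrightarrow> norm (h p z) \<le> B"
  shows "uexp P J (\<lambda>t p. h p (of_real t))"
  unfolding uexp_def by (rule exI, rule uexp_coeffs_Taylor[where h = h and r = r and B = B]) (fact assms)+

lemma norm_exp_minus_one_le:
  fixes z :: complex
  assumes "norm z \<le> 1"
  shows "norm (exp z - 1) \<le> 3 * norm z"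
proof -
  have "norm (exp z - exp 0) \<le> 3 * norm (z - 0)"
  proof (rule field_differentiable_bound[of "cball 0 1" exp exp])
    fix x :: complex assume "x \<in> cball 0 1"
    then have "Re x \<le> 1" using complex_Re_le_cmod[of x] by simp
    then have "exp (Re x) \<le> exp 1" by simp
    also have "\<dots> \<le> 3" by (rule exp_le)
    finally show "norm (exp x) \<le> 3" by simp
  qed (use assms in \<open>auto intro!: DERIV_exp has_field_derivative_at_within\<close>)
  then show ?thesis by simp
qed

text \<open>The exponential of the polynomial part is an entire function of \<open>t\<close>,
  bounded on the unit disc uniformly in \<open>p\<close>, and so has a Taylor expansion; the
  remainder \<open>R\<close> of \<open>A\<close> contributes a factor
  \<open>exp R = 1 + O(R)\<close>.\<close>

lemma uexp_exp:
  assumes "uexp P J A"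
  shows "uexp P J (\<lambda>t p. exp (A t p))"
proof -
  obtain G where G: "uexp_coeffs P J A G" using assms unfolding uexp_def by blast
  obtain C where C: "C \<ge> 0" "\<forall>\<^sub>F t in at_right 0. \<forall>p\<in>P. norm (A t p - (\<Sum>j\<le>J. G j p * of_real t ^ j)) \<le> C * t ^ Suc J"
    using G by (elim uexp_coeffsE)
  have "\<exists>B. \<forall>p\<in>P. norm (G j p) \<le> B" for j using G unfolding uexp_coeffs_def by blast
  then obtain B where B: "\<And>j p. p \<in> P \<Longrightarrow> norm (G j p) \<le> B j" by metis
  define h where "h = (\<lambda>p z. exp (\<Sum>j\<le>J. G j p * z ^ j))"
  define K where "K = exp (\<Sum>j\<le>J. \<bar>B j\<bar>)"
  have hb: "norm (h p z) \<le> K" if "p \<in> P" "z \<in> ball 0 1" for p z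
  proof -
    have "norm (\<Sum>j\<le>J. G j p * z ^ j) \<le> (\<Sum>j\<le>J. \<bar>B j\<bar>)"
    proof (rule order_trans[OF norm_sum sum_mono])
      fix j assume "j \<in> {..J}"
      have "norm (G j p * z ^ j) \<le> \<bar>B j\<bar> * 1"
        unfolding norm_mult norm_power using B[OF that(1), of j] that(2)
        by (intro mult_mono power_le_one) auto
      then show "norm (G j p * z ^ j) \<le> \<bar>B j\<bar>" by simp
    qed
    then show ?thesis unfolding h_def K_def norm_exp_eq_Re by (meson complex_Re_le_cmod exp_le_cancel_iff order_trans)
  qed
  have h: "uexp P J (\<lambda>t p. h p (of_real t))"
  proof (rule uexp_Taylor)
    show "h p holomorphic_on ball 0 1" for p unfolding h_def by (intro holomorphic_intros)
  qed (use hb in auto)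
  have "\<exists>C. \<forall>\<^sub>F t in at_right 0. \<forall>p\<in>P. norm (exp (A t p) - h p (of_real t)) \<le> C * t ^ Suc J"
  proof (intro exI)
    have "0 < 1 / (C + 1)" using C by simp
    from C(2) eventually_small_right[OF this] eventually_small_right[of 1, simplified]
    show "\<forall>\<^sub>F t in at_right 0. \<forall>p\<in>P. norm (exp (A t p) - h p (of_real t)) \<le> (K * 3 * C) * t ^ Suc J"
    proof eventually_elim
      case (elim t)
      show ?case
      proof
        fix p assume p: "p \<in> P"
        define R where "R = A t p - (\<Sum>j\<le>J. G j p * of_real t ^ j)"
        have R: "norm R \<le> C * t ^ Suc J" using elim p by (simp add: R_def)
        have "t ^ Suc J \<le> t ^ 1" using elim by (intro power_decreasing) auto
        then have "C * t ^ Suc J \<le> (C + 1) * t" using C elim by (intro mult_mono) (auto simp del: power_Suc)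
        also have "\<dots> \<le> 1" using elim C by (simp add: field_simps)
        finally have R1: "norm R \<le> 1" using R by simp
        have "exp (A t p) - h p (of_real t) = h p (of_real t) * (exp R - 1)"
          unfolding h_def R_def by (simp add: algebra_simps flip: exp_add)
        then have "norm (exp (A t p) - h p (of_real t)) \<le> K * (3 * norm R)"
          unfolding norm_mult using hb[OF p, of "of_real t"] elim norm_exp_minus_one_le[OF R1]
          by (auto simp: norm_mult intro!: mult_mono')
        also have "\<dots> \<le> K * (3 * (C * t ^ Suc J))" using R by (intro mult_left_mono) (auto simp: K_def)
        finally show "norm (exp (A t p) - h p (of_real t)) \<le> (K * 3 * C) * t ^ Suc J" by (simp only: mult.assoc)
      qed
    qed
  qed
  then have "uexp P J (\<lambda>t p. exp (A t p) - h p (of_real t))"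
    unfolding uexp_def by (blast intro: uexp_bigo)
  from uexp_add[OF this h] show ?thesis by simp
qed

section \<open>Euler--Maclaurin summation along complex rays\<close>

definition strip :: "real \<Rightarrow> complex set" where
  "strip e = {z. - e < Re z \<and> \<bar>Im z\<bar> < e}"

text \<open>The class itself is the parameter set of the uniform expansions, so its decay bound
  carries the fixed constant \<open>1\<close>; other functions enter after division by a constant.
  Decay of order two makes sums and integrals converge, and the room around the axis pays for Cauchy
  estimates of derivatives.\<close>

definition decay_class :: "real \<Rightarrow> (complex \<Rightarrow> complex) set" where
  "decay_class e = {f. f holomorphic_on strip e \<and> (\<forall>z\<in>strip e. norm (f z) \<le> 1 / (1 + (norm z)\<^sup>2))}"

lemma strip_eq: "strip e = {z. Re z > - e} \<inter> {z. Im z < e} \<inter> {z. Im z > - e}"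
  unfolding strip_def by auto

lemma open_strip: "open (strip e)"
  unfolding strip_eq by (intro open_Int open_halfspace_Re_gt open_halfspace_Im_lt open_halfspace_Im_gt)

lemma convex_strip: "convex (strip e)"
  unfolding strip_eq by (intro convex_Int convex_halfspace_Re_gt convex_halfspace_Im_lt convex_halfspace_Im_gt)

lemma of_real_in_strip: "0 < e \<Longrightarrow> 0 \<le> x \<Longrightarrow> of_real x \<in> strip e"
  unfolding strip_def by simp

lemma strip_mono: "e \<le> e' \<Longrightarrow> strip e \<subseteq> strip e'"
  unfolding strip_def by auto

text \<open>Discs of radius \<open>e / 4\<close> about points of \<open>strip (e/2)\<close> stay in
  \<open>strip e\<close>, so Cauchy's inequality keeps the quadratic decay at the price of half the
  width.\<close>

lemma decay_class_higher_deriv_bound: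
  assumes e: "0 < e"
  obtains K where "K > 0" "\<And>f z. f \<in> decay_class e \<Longrightarrow> z \<in> strip (e/2) \<Longrightarrow> norm ((deriv ^^ n) f z) \<le> K / (1 + (norm z)\<^sup>2)"
proof -
  \<comment> \<open>The factor \<open>2 + 2 * e\<^sup>2\<close> compares
    \<open>1 + (norm z)\<^sup>2\<close> with \<open>1 + (norm y)\<^sup>2\<close> when
    \<open>y\<close> lies within \<open>e\<close> of \<open>z\<close>.\<close>
  define K where "K = fact n * (2 + 2 * e\<^sup>2) / (e / 4) ^ n"
  have "norm ((deriv ^^ n) f z) \<le> K / (1 + (norm z)\<^sup>2)" if f: "f \<in> decay_class e" and z: "z \<in> strip (e/2)" for f z
  proof -
    have sub: "cball z (e/4) \<subseteq> strip e"
    proof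
      fix y assume "y \<in> cball z (e/4)"
      then have "norm (z - y) \<le> e/4" by (simp add: dist_norm)
      then have "\<bar>Re z - Re y\<bar> \<le> e/4" "\<bar>Im z - Im y\<bar> \<le> e/4"
        using abs_Re_le_cmod[of "z - y"] abs_Im_le_cmod[of "z - y"] by auto
      then show "y \<in> strip e" using z e unfolding strip_def mem_Collect_eq by linarith
    qed
    have hol: "f holomorphic_on strip e" and bd: "\<And>y. y \<in> strip e \<Longrightarrow> norm (f y) \<le> 1 / (1 + (norm y)\<^sup>2)"
      using f unfolding decay_class_def by auto
    have "norm ((deriv ^^ n) f z) \<le> fact n * ((2 + 2 * e\<^sup>2) / (1 + (norm z)\<^sup>2)) / (e/4) ^ n"
    proof (rule Cauchy_inequality)
      show "f holomorphic_on ball z (e/4)" using hol by (rule holomorphic_on_subset) (use sub in auto)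
      show "continuous_on (cball z (e/4)) f"
        using holomorphic_on_imp_continuous_on[OF hol] by (rule continuous_on_subset) (use sub in auto)
      fix y assume y: "norm (z - y) = e/4"
      then have "norm (f y) \<le> 1 / (1 + (norm y)\<^sup>2)" using sub by (intro bd) (auto simp: dist_norm)
      also have "\<dots> \<le> (2 + 2 * e\<^sup>2) / (1 + (norm z)\<^sup>2)"
      proof -
        have "norm z \<le> norm y + e" using norm_triangle_sub[of z y] y e by simp
        then have "(norm z)\<^sup>2 \<le> (norm y + e)\<^sup>2" by (intro power_mono) auto
        also have "\<dots> \<le> 2 * (norm y)\<^sup>2 + 2 * e\<^sup>2"
          using sum_squares_bound[of "norm y" e] by (simp add: power2_sum)
        finally have "(norm z)\<^sup>2 \<le> 2 * (norm y)\<^sup>2 + 2 * e\<^sup>2" .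
        moreover have "(2 + 2 * e\<^sup>2) * (1 + (norm y)\<^sup>2) = 2 + 2 * (norm y)\<^sup>2 + 2 * e\<^sup>2 + 2 * (e\<^sup>2 * (norm y)\<^sup>2)"
          by (simp add: algebra_simps)
        moreover have "0 \<le> e\<^sup>2 * (norm y)\<^sup>2" by simp
        ultimately have "1 + (norm z)\<^sup>2 \<le> (2 + 2 * e\<^sup>2) * (1 + (norm y)\<^sup>2)" by linarith
        then show ?thesis by (simp add: divide_simps add_pos_nonneg mult.commute)
      qed
      finally show "norm (f y) \<le> (2 + 2 * e\<^sup>2) / (1 + (norm z)\<^sup>2)" .
    qed (use e in auto)
    then show ?thesis by (simp add: K_def field_simps)
  qed
  moreover have "K > 0" using e by (simp add: K_def add_pos_nonneg)
  ultimately show ?thesis using that by blast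
qed

lemma decay_class_higher_deriv_scaled:
  assumes e: "0 < e"
  obtains K where "K > 0" "\<And>f. f \<in> decay_class e \<Longrightarrow> (\<lambda>z. (deriv ^^ n) f z / of_real K) \<in> decay_class (e/2)"
proof -
  obtain K where K: "K > 0" "\<And>f z. f \<in> decay_class e \<Longrightarrow> z \<in> strip (e/2) \<Longrightarrow> norm ((deriv ^^ n) f z) \<le> K / (1 + (norm z)\<^sup>2)"
    using decay_class_higher_deriv_bound[OF e, of n] by metis
  have "(\<lambda>z. (deriv ^^ n) f z / of_real K) \<in> decay_class (e/2)" if f: "f \<in> decay_class e" for f
  proof -
    have "f holomorphic_on strip e" using f unfolding decay_class_def by auto
    then have "(deriv ^^ n) f holomorphic_on strip (e/2)"
      by (intro holomorphic_on_subset[OF holomorphic_higher_deriv[OF _ open_strip] strip_mono]) (use e in auto)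
    then have "(\<lambda>z. (deriv ^^ n) f z / of_real K) holomorphic_on strip (e/2)"
      using K(1) by (intro holomorphic_on_divide holomorphic_on_const) auto
    then show ?thesis
      using K(2)[OF f] K(1) unfolding decay_class_def by (auto simp: norm_divide field_simps)
  qed
  with K(1) that show ?thesis by blast
qed

text \<open>Each term with \<open>m \<ge> 1\<close> is at most the increment of
  \<open>arctan\<close> over the preceding cell, which bounds the sum by
  \<open>t + pi / 2 < 3\<close>, independently of \<open>t\<close>.\<close>

lemma sum_inverse_quadratic_le:
  fixes t :: real
  assumes t: "0 < t" "t \<le> 1"
  shows "summable (\<lambda>m. t / (1 + (t * real m)\<^sup>2))" and "(\<Sum>m. t / (1 + (t * real m)\<^sup>2)) \<le> 3"
proof -
  have *: "(\<Sum>m<Suc n. t / (1 + (t * real m)\<^sup>2)) \<le> t + arctan (t * real n)" for n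
  proof (induction n)
    case (Suc n)
    have "\<exists>z. z > t * real n \<and> z < t * real (Suc n) \<and> arctan (t * real (Suc n)) - arctan (t * real n) = (t * real (Suc n) - t * real n) * inverse (1 + z\<^sup>2)"
      by (rule MVT2) (use t in \<open>auto intro!: DERIV_arctan\<close>)
    then obtain z where z: "z > t * real n" "z < t * real (Suc n)" "arctan (t * real (Suc n)) - arctan (t * real n) = t * inverse (1 + z\<^sup>2)"
      by (auto simp: algebra_simps)
    have "z\<^sup>2 \<le> (t * real (Suc n))\<^sup>2" using z t by (intro power_mono) (auto intro: order_trans[of 0 "t * real n"])
    then have "t / (1 + (t * real (Suc n))\<^sup>2) \<le> t * inverse (1 + z\<^sup>2)"
      using t by (simp add: divide_inverse add_pos_nonneg)
    with Suc z show ?case by simp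
  qed (simp)
  have b: "(\<Sum>m<n. t / (1 + (t * real m)\<^sup>2)) \<le> 3" for n
  proof (cases n)
    case (Suc k)
    have "arctan (t * real k) < pi / 2" by (rule arctan_ubound)
    then show ?thesis using *[of k] t pi_less_4 Suc by simp
  qed simp
  show "summable (\<lambda>m. t / (1 + (t * real m)\<^sup>2))"
    by (rule summableI_nonneg_bounded[OF _ b]) (use t in auto)
  then show "(\<Sum>m. t / (1 + (t * real m)\<^sup>2)) \<le> 3" using b by (rule suminf_le_const)
qed

text \<open>The offset \<open>\<sigma>\<close> will be \<open>1 + c / 2\<close>, which may exceed
  \<open>1\<close>; the sample points need not lie in their cells.\<close>

definition riemann_sum :: "real \<Rightarrow> real \<Rightarrow> (complex \<Rightarrow> complex) \<Rightarrow> complex" where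
  "riemann_sum \<sigma> t f = of_real t * (\<Sum>m. f (of_real (t * (real m + \<sigma>))))"

lemma decay_class_term_bound:
  assumes "f \<in> decay_class e" "0 < e" "0 \<le> \<sigma>" "0 < t"
  shows "norm (f (of_real (t * (real m + \<sigma>)))) \<le> 1 / (1 + (t * real m)\<^sup>2)"
proof -
  have "norm (f (of_real (t * (real m + \<sigma>)))) \<le> 1 / (1 + (t * (real m + \<sigma>))\<^sup>2)"
    using assms of_real_in_strip[of e "t * (real m + \<sigma>)"] unfolding decay_class_def
    by (auto simp: norm_of_real simp flip: of_real_add of_real_mult simp del: of_real_mult of_real_add)
  also have "\<dots> \<le> 1 / (1 + (t * real m)\<^sup>2)"
    using assms by (intro divide_left_mono add_left_mono power_mono mult_left_mono mult_pos_pos) (auto intro: add_pos_nonneg)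
  finally show ?thesis .
qed

lemma decay_class_summable:
  assumes "f \<in> decay_class e" "0 < e" "0 \<le> \<sigma>" "0 < t" "t \<le> 1"
  shows "summable (\<lambda>m. norm (f (of_real (t * (real m + \<sigma>)))))" "summable (\<lambda>m. f (of_real (t * (real m + \<sigma>))))"
proof -
  have "summable (\<lambda>m. (1/t) * (t / (1 + (t * real m)\<^sup>2)))"
    by (intro summable_mult sum_inverse_quadratic_le) (use assms in auto)
  then have "summable (\<lambda>m. 1 / (1 + (t * real m)\<^sup>2))" using assms by simp
  then show "summable (\<lambda>m. norm (f (of_real (t * (real m + \<sigma>)))))"
    by (rule summable_comparison_test'[where N = 0]) (use decay_class_term_bound[OF assms(1-4)] in simp)
  then show "summable (\<lambda>m. f (of_real (t * (real m + \<sigma>))))" by (rule summable_norm_cancel)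
qed

lemma riemann_sum_bound:
  assumes "f \<in> decay_class e" "0 < e" "0 \<le> \<sigma>" "0 < t" "t \<le> 1"
  shows "norm (riemann_sum \<sigma> t f) \<le> 3"
proof -
  have sq: "summable (\<lambda>m. t / (1 + (t * real m)\<^sup>2))" using assms by (intro sum_inverse_quadratic_le) auto
  have "norm (riemann_sum \<sigma> t f) = norm (\<Sum>m. of_real t * f (of_real (t * (real m + \<sigma>))))"
    unfolding riemann_sum_def by (subst suminf_mult[OF decay_class_summable(2)[OF assms]]) simp
  also have "\<dots> \<le> (\<Sum>m. t / (1 + (t * real m)\<^sup>2))"
  proof (rule norm_suminf_le[OF _ sq])
    show "norm (of_real t * f (of_real (t * (real m + \<sigma>)))) \<le> t / (1 + (t * real m)\<^sup>2)" for m
      using mult_left_mono[OF decay_class_term_bound[OF assms(1-4), of m], of t] assms by (simp add: norm_mult)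
  qed
  also have "\<dots> \<le> 3" using assms by (intro sum_inverse_quadratic_le) auto
  finally show ?thesis .
qed

lemma decay_class_primitive:
  assumes "f \<in> decay_class e"
  obtains F where "\<And>z. z \<in> strip e \<Longrightarrow> (F has_field_derivative f z) (at z)"
proof -
  have "f holomorphic_on strip e" using assms unfolding decay_class_def by auto
  then obtain F where "\<And>z. z \<in> strip e \<Longrightarrow> (F has_field_derivative f z) (at z within strip e)"
    using holomorphic_convex_primitive'[OF convex_strip open_strip] by metis
  then show ?thesis using that at_within_open[OF _ open_strip] by metis
qed

text \<open>An improper integral along the positive axis, phrased as a limit so that it can be read
  off from a primitive. It is meaningful once \<open>ray_integral_limit\<close> supplies
  convergence.\<close>

definition ray_integral :: "(complex \<Rightarrow> complex) \<Rightarrow> complex" where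
  "ray_integral f = Lim at_top (\<lambda>x::real. integral {0..x} (\<lambda>y. f (of_real y)))"

lemma integral_primitive:
  assumes e: "0 < e" and F: "\<And>z. z \<in> strip e \<Longrightarrow> (F has_field_derivative f z) (at z)" and x: "0 \<le> x"
  shows "((\<lambda>y. f (of_real y)) has_integral (F (of_real x) - F 0)) {0..x}"
  using fundamental_theorem_of_calculus[of 0 x "\<lambda>y. F (of_real y)" "\<lambda>y. f (of_real y)"] x
    has_vector_derivative_real_field[OF F[OF of_real_in_strip[OF e]]] by simp

text \<open>On the axis \<open>norm f\<close> is at most the derivative of \<open>arctan\<close>, so
  increments of \<open>F\<close> are dominated by those of a function with a limit at infinity.
  Convergence along the integers then extends to real arguments.\<close>

lemma ray_integral_limit:
  assumes f: "f \<in> decay_class e" and e: "0 < e"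
    and F: "\<And>z. z \<in> strip e \<Longrightarrow> (F has_field_derivative f z) (at z)"
  shows "((\<lambda>x. F (of_real x)) \<longlongrightarrow> F 0 + ray_integral f) at_top"
proof -
  have diff: "norm (F (of_real y) - F (of_real x)) \<le> arctan y - arctan x" if xy: "0 \<le> x" "x \<le> y" for x y
  proof (cases "x = y")
    case False
    then have "x < y" using xy by simp
    then show ?thesis
    proof (rule differentiable_bound_general[where f = "\<lambda>x. F (of_real x)" and f' = "\<lambda>x. f (of_real x)" and \<phi> = arctan and \<phi>' = "\<lambda>x. inverse (1 + x\<^sup>2)"])
      have vd: "0 \<le> u \<Longrightarrow> ((\<lambda>x. F (of_real x)) has_vector_derivative f (of_real u)) (at u within S)" for u S
        by (rule has_vector_derivative_real_field[OF F[OF of_real_in_strip[OF e]]])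
      show "continuous_on {x..y} (\<lambda>x. F (complex_of_real x))"
        by (rule continuous_on_vector_derivative[OF vd]) (use xy in auto)
      show "continuous_on {x..y} arctan" by (intro continuous_intros)
      show "x < u \<Longrightarrow> u < y \<Longrightarrow> ((\<lambda>x. F (complex_of_real x)) has_vector_derivative f (complex_of_real u)) (at u)" for u
        using vd[of u] xy by simp
      show "x < u \<Longrightarrow> u < y \<Longrightarrow> (arctan has_vector_derivative inverse (1 + u\<^sup>2)) (at u)" for u
        using DERIV_arctan[of u] by (simp add: has_real_derivative_iff_has_vector_derivative)
      show "x < u \<Longrightarrow> u < y \<Longrightarrow> norm (f (complex_of_real u)) \<le> inverse (1 + u\<^sup>2)" for u
        using f of_real_in_strip[OF e, of u] xy unfolding decay_class_def by (force simp: norm_of_real inverse_eq_divide)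
    qed
  qed simp
  have "Cauchy (\<lambda>n. F (of_real (real n)))"
  proof (rule CauchyI)
    fix d :: real assume d: "d > 0"
    have "(\<lambda>n. arctan (real n)) \<longlonglongrightarrow> pi / 2"
      by (rule filterlim_compose[OF tendsto_arctan_at_top filterlim_real_sequentially])
    then have "Cauchy (\<lambda>n. arctan (real n))" by (rule LIMSEQ_imp_Cauchy)
    from CauchyD[OF this d] obtain M where M: "\<And>m n. m \<ge> M \<Longrightarrow> n \<ge> M \<Longrightarrow> norm (arctan (real m) - arctan (real n)) < d" by blast
    have "norm (F (of_real (real m)) - F (of_real (real n))) < d" if "m \<ge> M" "n \<ge> M" for m n
    proof (cases "n \<le> m")
      case True
      then show ?thesis using diff[of "real n" "real m"] M[OF that] by simp
    next
      case False
      then show ?thesis using diff[of "real m" "real n"] M[OF that] by (simp add: norm_minus_commute)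
    qed
    then show "\<exists>M. \<forall>m\<ge>M. \<forall>n\<ge>M. norm (F (of_real (real m)) - F (of_real (real n))) < d" by blast
  qed
  then obtain l where l: "(\<lambda>n. F (of_real (real n))) \<longlonglongrightarrow> l"
    using Cauchy_convergent convergent_def by blast
  have bnd: "norm (l - F (of_real x)) \<le> pi / 2 - arctan x" if x: "0 \<le> x" for x
  proof (rule tendsto_upperbound)
    show "(\<lambda>n. norm (F (of_real (real n)) - F (of_real x))) \<longlonglongrightarrow> norm (l - F (of_real x))"
      by (intro tendsto_intros l)
    show "\<forall>\<^sub>F n in sequentially. norm (F (of_real (real n)) - F (of_real x)) \<le> pi / 2 - arctan x"
      using eventually_ge_at_top[of "nat \<lceil>x\<rceil>"]
    proof eventually_elim
      case (elim n)
      then have "x \<le> real n" by linarith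
      from diff[OF x this] arctan_ubound[of "real n"] show ?case by linarith
    qed
  qed simp
  have lim: "((\<lambda>x. F (of_real x)) \<longlongrightarrow> l) at_top"
  proof (rule LIM_zero_cancel, rule Lim_null_comparison)
    show "\<forall>\<^sub>F x in at_top. norm (F (of_real x) - l) \<le> pi / 2 - arctan x"
      using eventually_ge_at_top[of 0] by eventually_elim (use bnd norm_minus_commute in metis)
    show "((\<lambda>x. pi / 2 - arctan x) \<longlongrightarrow> 0) at_top"
      using tendsto_diff[OF tendsto_const tendsto_arctan_at_top, of "pi/2"] by simp
  qed
  have "((\<lambda>x::real. integral {0..x} (\<lambda>y. f (of_real y))) \<longlongrightarrow> l - F 0) at_top"
  proof (rule Lim_transform_eventually)
    show "((\<lambda>x. F (of_real x) - F 0) \<longlongrightarrow> l - F 0) at_top" by (intro tendsto_intros lim)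
    show "\<forall>\<^sub>F x in at_top. F (of_real x) - F 0 = integral {0..x} (\<lambda>y. f (of_real y))"
      using eventually_ge_at_top[of "0::real"]
      by eventually_elim (rule integral_unique[symmetric], rule integral_primitive[OF e F])
  qed
  then have "ray_integral f = l - F 0" unfolding ray_integral_def by (intro tendsto_Lim) auto
  then show ?thesis using lim by simp
qed


text \<open>The integral of the Taylor polynomial about the sample point over each cell expresses \<open>ray_integral f\<close> through
  the Riemann sums of all derivatives of \<open>f\<close>. Solving these triangular relations recursively makes
  Bernoulli numbers unnecessary.\<close>

definition EM_coeff :: "real \<Rightarrow> nat \<Rightarrow> real" where
  "EM_coeff \<sigma> i = ((1 - \<sigma>) ^ Suc i - (- \<sigma>) ^ Suc i) / fact (Suc i)"

text \<open>A primitive \<open>F\<close> of \<open>f\<close> is Taylor expanded about each sample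
  point; its difference over a cell produces the weights \<open>EM_coeff\<close>, and the
  differences telescope. The error is \<open>O(t ^ (R + 2))\<close> per cell with weight
  \<open>1 / (1 + (t * m)\<^sup>2)\<close>, and summing the weights costs one power of
  \<open>t\<close>.\<close>

lemma EM_remainder:
  assumes e: "0 < e" and \<sigma>: "0 \<le> \<sigma>"
  obtains C where "C > 0" "\<And>f t. f \<in> decay_class e \<Longrightarrow> 0 < t \<Longrightarrow> t \<le> 1 \<Longrightarrow>
    norm (ray_integral f - (\<Sum>i\<le>R. of_real (EM_coeff \<sigma> i * t ^ i) * riemann_sum \<sigma> t ((deriv ^^ i) f))) \<le> C * t ^ Suc R"
proof -
  obtain K where K: "K > 0" "\<And>f z. f \<in> decay_class e \<Longrightarrow> z \<in> strip (e/2) \<Longrightarrow> norm ((deriv ^^ Suc R) f z) \<le> K / (1 + (norm z)\<^sup>2)"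
    using decay_class_higher_deriv_bound[OF e, of "Suc R"] by metis
  define C where "C = 6 * K * (1 + \<sigma>) ^ Suc (Suc R)"
  have "norm (ray_integral f - (\<Sum>i\<le>R. of_real (EM_coeff \<sigma> i * t ^ i) * riemann_sum \<sigma> t ((deriv ^^ i) f))) \<le> C * t ^ Suc R"
    if f: "f \<in> decay_class e" and t: "0 < t" "t \<le> 1" for f t
  proof -
    obtain F where F: "\<And>z. z \<in> strip e \<Longrightarrow> (F has_field_derivative f z) (at z)"
      using decay_class_primitive[OF f] by metis
    have hol: "f holomorphic_on strip e" using f unfolding decay_class_def by auto
    \<comment> \<open>The successive derivatives of \<open>F\<close>, with \<open>F\<close> itself
      at index \<open>0\<close>.\<close>
    define g where "g = (\<lambda>i. if i = 0 then F else (deriv ^^ (i - 1)) f)"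
    have g: "(g i has_field_derivative g (Suc i) z) (at z)" if "z \<in> strip e" for i z
      using F[OF that] has_field_derivative_higher_deriv[OF hol open_strip that, of "i - 1"]
      by (cases i) (auto simp: g_def)
    define z where "z = (\<lambda>m. complex_of_real (t * (real m + \<sigma>)))"
    define D where "D = (\<lambda>m. F (of_real (t * real (Suc m))) - F (of_real (t * real m)) -
      (\<Sum>i\<le>R. of_real (t ^ Suc i * EM_coeff \<sigma> i) * (deriv ^^ i) f (z m)))"
    define Q where "Q = K * (t * (1 + \<sigma>)) ^ Suc (Suc R)"
    have T: "norm (F (of_real y) - (\<Sum>i\<le>Suc R. g i (z m) * (of_real y - z m) ^ i / fact i)) \<le> Q / (1 + (t * real m)\<^sup>2)"
      if y: "t * real m \<le> y" "y \<le> t * real (Suc m)" for m y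
    proof -
      define S where "S = complex_of_real ` {t * real m..}"
      have S: "S \<subseteq> strip e" using of_real_in_strip[OF e] t unfolding S_def
        by (auto intro!: of_real_in_strip[OF e] intro: order_trans[of 0 "t * real m"])
      have "norm (g 0 (of_real y) - (\<Sum>i\<le>Suc R. g i (z m) * (of_real y - z m) ^ i / fact i))
        \<le> K / (1 + (t * real m)\<^sup>2) * norm (of_real y - z m) ^ Suc (Suc R) / fact (Suc R)"
      proof (rule complex_Taylor[of S])
        show "convex S" unfolding S_def by (intro convex_linear_image convex_real_interval) (auto intro: bounded_linear.linear bounded_linear_of_real)
        show "(g i has_field_derivative g (Suc i) x) (at x within S)" if "x \<in> S" for i x
          using g[of x i] that S by (auto intro: has_field_derivative_at_within)
        show "norm (g (Suc (Suc R)) x) \<le> K / (1 + (t * real m)\<^sup>2)" if x: "x \<in> S" for x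
        proof -
          obtain u where u: "x = of_real u" "t * real m \<le> u" using x unfolding S_def by auto
          have u0: "0 \<le> u" using u t by (auto intro: order_trans[of 0 "t * real m"])
          have "norm ((deriv ^^ Suc R) f x) \<le> K / (1 + (norm x)\<^sup>2)"
            unfolding u by (intro K(2)[OF f] of_real_in_strip) (use e u0 in auto)
          also have "\<dots> \<le> K / (1 + (t * real m)\<^sup>2)"
            using K(1) u u0 t by (intro divide_left_mono add_left_mono mult_pos_pos) (auto intro!: add_pos_nonneg power_mono)
          finally show ?thesis by (simp add: g_def)
        qed
        show "z m \<in> S" "of_real y \<in> S" using t \<sigma> y unfolding S_def z_def by (auto intro!: imageI simp del: of_real_mult of_real_add)
      qed
      also have "\<dots> \<le> K / (1 + (t * real m)\<^sup>2) * norm (of_real y - z m) ^ Suc (Suc R) / 1"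
        using K(1) fact_ge_1[of "Suc R", where 'a = real]
          by (intro divide_left_mono mult_nonneg_nonneg) (auto simp del: power_Suc fact_Suc)
      \<comment> \<open>The bound \<open>1 + \<sigma>\<close> is valid whether or not the sample
        point lies in its cell.\<close>
      also have "norm (complex_of_real y - z m) \<le> t * (1 + \<sigma>)"
      proof -
        have "norm (complex_of_real y - z m) = \<bar>y - t * (real m + \<sigma>)\<bar>"
          unfolding z_def by (metis norm_of_real of_real_diff)
        also have "\<dots> \<le> t * (1 + \<sigma>)" using y mult_nonneg_nonneg[OF less_imp_le[OF t(1)] \<sigma>] t(1)
          by (simp only: abs_le_iff ring_distribs of_nat_Suc mult_1_right) linarith
        finally show ?thesis .
      qed
      then have "K / (1 + (t * real m)\<^sup>2) * norm (of_real y - z m) ^ Suc (Suc R) / 1 \<le> K / (1 + (t * real m)\<^sup>2) * (t * (1 + \<sigma>)) ^ Suc (Suc R)"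
        unfolding div_by_1 using K(1) by (intro mult_left_mono power_mono) auto
      finally show ?thesis by (simp add: g_def Q_def)
    qed
    have D: "norm (D m) \<le> (2 * Q / t) * (t / (1 + (t * real m)\<^sup>2))" for m
    proof -
      \<comment> \<open>Offsets of the two end points of the cell from the sample point; the
        difference of their powers gives \<open>EM_coeff\<close>.\<close>
      have a: "of_real (t * real (Suc m)) - z m = of_real (t * (1 - \<sigma>))" "of_real (t * real m) - z m = of_real (t * (- \<sigma>))"
        unfolding z_def by (auto simp: algebra_simps)
      have s: "(\<Sum>i\<le>Suc R. g i (z m) * c ^ i / fact i) = F (z m) + (\<Sum>i\<le>R. (deriv ^^ i) f (z m) * c ^ Suc i / fact (Suc i))" for c
        by (subst sum.atMost_Suc_shift) (simp add: g_def del: power_Suc fact_Suc)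
      have "t ^ Suc i * EM_coeff \<sigma> i = (t * (1 - \<sigma>)) ^ Suc i / fact (Suc i) - (t * (- \<sigma>)) ^ Suc i / fact (Suc i)" for i
        unfolding EM_coeff_def power_mult_distrib
        by (simp only: right_diff_distrib[of "t ^ Suc i"] diff_divide_distrib times_divide_eq_right)
      then have key: "of_real (t ^ Suc i * EM_coeff \<sigma> i) * d =
        d * of_real (t * (1 - \<sigma>)) ^ Suc i / fact (Suc i) - d * of_real (t * (- \<sigma>)) ^ Suc i / fact (Suc i)" for i and d :: complex
        by (simp only: of_real_diff of_real_divide of_real_power of_real_fact) (simp only: right_diff_distrib' left_diff_distrib' times_divide_eq_left times_divide_eq_right mult.commute)
      have "D m = (F (of_real (t * real (Suc m))) - (\<Sum>i\<le>Suc R. g i (z m) * (of_real (t * real (Suc m)) - z m) ^ i / fact i))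
        - (F (of_real (t * real m)) - (\<Sum>i\<le>Suc R. g i (z m) * (of_real (t * real m) - z m) ^ i / fact i))"
        unfolding D_def a s key sum_subtractf by (simp only: algebra_simps)
      also have "norm \<dots> \<le> Q / (1 + (t * real m)\<^sup>2) + Q / (1 + (t * real m)\<^sup>2)"
        by (rule order_trans[OF norm_triangle_ineq4 add_mono]) (intro T; use t in \<open>simp add: algebra_simps\<close>)+
      finally show ?thesis using t by simp
    qed
    have sumD: "summable (\<lambda>m. (2 * Q / t) * (t / (1 + (t * real m)\<^sup>2)))"
      by (intro summable_mult sum_inverse_quadratic_le t)
    have lim: "(\<lambda>n. F (of_real (t * real n))) \<longlonglongrightarrow> F 0 + ray_integral f"
      by (rule filterlim_compose[OF ray_integral_limit[OF f e F]])
         (assumption, rule filterlim_tendsto_pos_mult_at_top[OF tendsto_const t(1) filterlim_real_sequentially])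
    have tel: "(\<lambda>m. F (of_real (t * real (Suc m))) - F (of_real (t * real m))) sums ray_integral f"
      using telescope_sums[OF lim] by simp
    have smi: "summable (\<lambda>m. (deriv ^^ i) f (z m))" for i
    proof -
      obtain L where L: "L > 0" "(\<lambda>z. (deriv ^^ i) f z / of_real L) \<in> decay_class (e/2)"
        using decay_class_higher_deriv_scaled[OF e, of i] f by metis
      have "summable (\<lambda>m. of_real L * ((deriv ^^ i) f (z m) / of_real L))"
        unfolding z_def by (rule summable_mult[OF decay_class_summable(2)[OF L(2)]]) (use e \<sigma> t in auto)
      then show ?thesis using L(1) by simp
    qed
    have "(\<lambda>m. \<Sum>i\<le>R. of_real (t ^ Suc i * EM_coeff \<sigma> i) * (deriv ^^ i) f (z m)) sums
      (\<Sum>i\<le>R. of_real (t ^ Suc i * EM_coeff \<sigma> i) * (\<Sum>m. (deriv ^^ i) f (z m)))"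
      by (intro sums_sum sums_mult summable_sums smi)
    also have "(\<Sum>i\<le>R. of_real (t ^ Suc i * EM_coeff \<sigma> i) * (\<Sum>m. (deriv ^^ i) f (z m))) =
      (\<Sum>i\<le>R. of_real (EM_coeff \<sigma> i * t ^ i) * riemann_sum \<sigma> t ((deriv ^^ i) f))"
      unfolding riemann_sum_def z_def by (intro sum.cong) auto
    finally have "D sums (ray_integral f - (\<Sum>i\<le>R. of_real (EM_coeff \<sigma> i * t ^ i) * riemann_sum \<sigma> t ((deriv ^^ i) f)))"
      unfolding D_def using sums_diff[OF tel] by blast
    then have "norm (ray_integral f - (\<Sum>i\<le>R. of_real (EM_coeff \<sigma> i * t ^ i) * riemann_sum \<sigma> t ((deriv ^^ i) f)))
       \<le> (\<Sum>m. (2 * Q / t) * (t / (1 + (t * real m)\<^sup>2)))"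
      using norm_suminf_le[OF D sumD] by (simp add: sums_iff)
    also have "\<dots> = (2 * Q / t) * (\<Sum>m. t / (1 + (t * real m)\<^sup>2))"
      by (intro suminf_mult sum_inverse_quadratic_le t)
    also have "\<dots> \<le> (2 * Q / t) * 3"
      using K(1) t \<sigma> by (intro mult_left_mono sum_inverse_quadratic_le) (auto simp: Q_def)
    also have "\<dots> = C * t ^ Suc R" using t by (simp add: Q_def C_def power_mult_distrib)
    finally show ?thesis .
  qed
  moreover have "C > 0" using K \<sigma> by (simp add: C_def)
  ultimately show ?thesis using that by blast
qed

lemma riemann_sum_scale:
  assumes "(\<lambda>z. g z / of_real K) \<in> decay_class e" "K > 0" "0 < e" "0 \<le> \<sigma>" "0 < t" "t \<le> 1"
  shows "riemann_sum \<sigma> t g = of_real K * riemann_sum \<sigma> t (\<lambda>z. g z / of_real K)"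
proof -
  have "(\<Sum>m. of_real K * (g (of_real (t * (real m + \<sigma>))) / of_real K)) = of_real K * (\<Sum>m. g (of_real (t * (real m + \<sigma>))) / of_real K)"
    by (rule suminf_mult[OF decay_class_summable(2)[OF assms(1)]]) (use assms in auto)
  then show ?thesis using assms(2) unfolding riemann_sum_def by simp
qed

lemma EM_coeff_0 [simp]: "EM_coeff \<sigma> 0 = 1" and EM_coeff_1: "EM_coeff \<sigma> (Suc 0) = 1/2 - \<sigma>"
  by (simp_all add: EM_coeff_def power2_eq_square field_simps)

text \<open>The crudest case of the Euler--Maclaurin estimate, taken at \<open>t = 1\<close>,
  compares the integral with a Riemann sum that is bounded over the class.\<close>

lemma ray_integral_bound:
  assumes "0 < e"
  obtains B where "\<And>f. f \<in> decay_class e \<Longrightarrow> norm (ray_integral f) \<le> B"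
proof -
  obtain C where C: "C > 0" "\<And>f t. f \<in> decay_class e \<Longrightarrow> 0 < t \<Longrightarrow> t \<le> 1 \<Longrightarrow>
    norm (ray_integral f - (\<Sum>i\<le>0. of_real (EM_coeff 1 i * t ^ i) * riemann_sum 1 t ((deriv ^^ i) f))) \<le> C * t ^ Suc 0"
    using EM_remainder[OF assms zero_le_one, of 0] by blast
  have "norm (ray_integral f) \<le> C + 3" if f: "f \<in> decay_class e" for f
  proof -
    have "norm (ray_integral f - riemann_sum 1 1 f) \<le> C" using C(2)[OF f, of 1] by simp
    moreover have "norm (riemann_sum 1 1 f) \<le> 3" using riemann_sum_bound[OF f assms, of 1 1] by simp
    ultimately show ?thesis using norm_triangle_sub[of "ray_integral f" "riemann_sum 1 1 f"] by simp
  qed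
  with that show ?thesis by blast
qed

text \<open>The Riemann sums of the derivatives enter with at least one factor \<open>t\<close>, so
  order \<open>J\<close> for them yields order \<open>Suc J\<close> for \<open>f\<close>. Each step
  uses the class of half the width, hence the induction with \<open>e\<close> arbitrary.\<close>

lemma EM_uexp:
  assumes \<sigma>: "0 \<le> \<sigma>"
  shows "0 < e \<Longrightarrow> uexp (decay_class e) J (riemann_sum \<sigma>)"
proof (induction J arbitrary: e)
  case (0 e)
  obtain C where C: "C > 0" "\<And>f t. f \<in> decay_class e \<Longrightarrow> 0 < t \<Longrightarrow> t \<le> 1 \<Longrightarrow>
    norm (ray_integral f - (\<Sum>i\<le>0. of_real (EM_coeff \<sigma> i * t ^ i) * riemann_sum \<sigma> t ((deriv ^^ i) f))) \<le> C * t ^ Suc 0"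
    using EM_remainder[OF 0 \<sigma>, of 0] by blast
  obtain B where B: "\<And>f. f \<in> decay_class e \<Longrightarrow> norm (ray_integral f) \<le> B" using ray_integral_bound[OF 0] by metis
  have "\<forall>\<^sub>F t in at_right 0. \<forall>f\<in>decay_class e. norm (riemann_sum \<sigma> t f - ray_integral f) \<le> C * t ^ Suc 0"
    using eventually_small_right[of 1, simplified]
    by eventually_elim (use C(2) in \<open>auto simp: norm_minus_commute\<close>)
  then have "uexp (decay_class e) 0 (\<lambda>t f. riemann_sum \<sigma> t f - ray_integral f)" unfolding uexp_def by (blast intro: uexp_bigo)
  from uexp_add[OF this uexp_const[of "decay_class e" ray_integral B, OF B]] show ?case by simp
next
  case (Suc J e)
  obtain C where C: "C > 0" "\<And>f t. f \<in> decay_class e \<Longrightarrow> 0 < t \<Longrightarrow> t \<le> 1 \<Longrightarrow>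
    norm (ray_integral f - (\<Sum>i\<le>Suc J. of_real (EM_coeff \<sigma> i * t ^ i) * riemann_sum \<sigma> t ((deriv ^^ i) f))) \<le> C * t ^ Suc (Suc J)"
    using EM_remainder[OF Suc.prems \<sigma>, of "Suc J"] by blast
  obtain B where B: "\<And>f. f \<in> decay_class e \<Longrightarrow> norm (ray_integral f) \<le> B" using ray_integral_bound[OF Suc.prems] by metis
  have d: "uexp (decay_class e) J (\<lambda>t f. riemann_sum \<sigma> t ((deriv ^^ i) f))" for i
  proof -
    obtain K where K: "K > 0" "\<And>f. f \<in> decay_class e \<Longrightarrow> (\<lambda>z. (deriv ^^ i) f z / of_real K) \<in> decay_class (e/2)"
      using decay_class_higher_deriv_scaled[OF Suc.prems, of i] by metis
    have "uexp (decay_class e) J (\<lambda>t f. of_real K * riemann_sum \<sigma> t (\<lambda>z. (deriv ^^ i) f z / of_real K))"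
      by (rule uexp_cmult[OF uexp_reparam[OF Suc.IH[of "e/2"]], where K = K]) (use K Suc.prems in auto)
    moreover have "\<forall>\<^sub>F t in at_right 0. \<forall>f\<in>decay_class e. of_real K * riemann_sum \<sigma> t (\<lambda>z. (deriv ^^ i) f z / of_real K) = riemann_sum \<sigma> t ((deriv ^^ i) f)"
      using eventually_small_right[of 1, simplified]
      by eventually_elim (use riemann_sum_scale[OF K(2) K(1)] Suc.prems \<sigma> in auto)
    ultimately show ?thesis by (rule uexp_cong)
  qed
  \<comment> \<open>The derivative terms with one factor \<open>t\<close> taken out; the sign is
    negative because the relation is solved for the Riemann sum of \<open>f\<close> itself.\<close>
  define A where "A = (\<lambda>t f. \<Sum>i\<le>J. - of_real (EM_coeff \<sigma> (Suc i)) * (of_real t ^ i * riemann_sum \<sigma> t ((deriv ^^ Suc i) f)))"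
  have "uexp (decay_class e) J A"
    unfolding A_def
    by (intro uexp_sum uexp_cmult[where K = "\<bar>EM_coeff \<sigma> (Suc _)\<bar>"] uexp_times_power d) (auto simp del: of_real_mult)
  from uexp_times_t[OF this]
  have main: "uexp (decay_class e) (Suc J) (\<lambda>t f. of_real t * A t f + ray_integral f)"
    by (rule uexp_add[OF _ uexp_const[of "decay_class e" ray_integral B, OF B]])
  have "\<forall>\<^sub>F t in at_right 0. \<forall>f\<in>decay_class e. norm (riemann_sum \<sigma> t f - (of_real t * A t f + ray_integral f)) \<le> C * t ^ Suc (Suc J)"
    using eventually_small_right[of 1, simplified]
  proof eventually_elim
    case (elim t)
    show ?case
    proof
      fix f assume f: "f \<in> decay_class e"
      have eq: "(\<Sum>i\<le>Suc J. of_real (EM_coeff \<sigma> i * t ^ i) * riemann_sum \<sigma> t ((deriv ^^ i) f)) = riemann_sum \<sigma> t f - of_real t * A t f"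
        unfolding A_def
        by (subst sum.atMost_Suc_shift) (simp add: sum_distrib_left sum_negf mult_ac)
      then show "norm (riemann_sum \<sigma> t f - (of_real t * A t f + ray_integral f)) \<le> C * t ^ Suc (Suc J)"
        using C(2)[OF f, of t, unfolded eq] elim norm_minus_commute[of "ray_integral f" "riemann_sum \<sigma> t f - of_real t * A t f"]
        by (simp add: algebra_simps del: power_Suc)
    qed
  qed
  then have "uexp (decay_class e) (Suc J) (\<lambda>t f. riemann_sum \<sigma> t f - (of_real t * A t f + ray_integral f))"
    unfolding uexp_def by (blast intro: uexp_bigo)
  from uexp_add[OF this main] show ?case by simp
qed

text \<open>The coefficient of \<open>t\<close> is explicit because the integral of
  \<open>deriv f\<close> along the ray is \<open>- f 0\<close>. This is the form in which
  \<open>\<kappa>\<close> will appear.\<close>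

lemma EM_low_order:
  assumes e: "0 < e" and \<sigma>: "0 \<le> \<sigma>"
  obtains C where "C > 0" "\<And>f t. f \<in> decay_class e \<Longrightarrow> 0 < t \<Longrightarrow> t \<le> 1 \<Longrightarrow>
    norm (riemann_sum \<sigma> t f - (ray_integral f + of_real ((1/2 - \<sigma>) * t) * f 0)) \<le> C * t\<^sup>2"
proof -
  obtain C where C: "C > 0" "\<And>f t. f \<in> decay_class e \<Longrightarrow> 0 < t \<Longrightarrow> t \<le> 1 \<Longrightarrow>
    norm (ray_integral f - (\<Sum>i\<le>1. of_real (EM_coeff \<sigma> i * t ^ i) * riemann_sum \<sigma> t ((deriv ^^ i) f))) \<le> C * t ^ Suc 1"
    using EM_remainder[OF e \<sigma>, of 1] by blast
  obtain K where K: "K > 0" "\<And>f. f \<in> decay_class e \<Longrightarrow> (\<lambda>z. (deriv ^^ 1) f z / of_real K) \<in> decay_class (e/2)"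
    using decay_class_higher_deriv_scaled[OF e, of 1] by metis
  have e2: "0 < e/2" using e by simp
  obtain C' where C': "C' > 0" "\<And>f t. f \<in> decay_class (e/2) \<Longrightarrow> 0 < t \<Longrightarrow> t \<le> 1 \<Longrightarrow>
    norm (ray_integral f - (\<Sum>i\<le>0. of_real (EM_coeff \<sigma> i * t ^ i) * riemann_sum \<sigma> t ((deriv ^^ i) f))) \<le> C' * t ^ Suc 0"
    using EM_remainder[OF e2 \<sigma>, of 0] by blast
  define M where "M = C + \<bar>1/2 - \<sigma>\<bar> * (K * C')"
  have "norm (riemann_sum \<sigma> t f - (ray_integral f + of_real ((1/2 - \<sigma>) * t) * f 0)) \<le> M * t\<^sup>2"
    if f: "f \<in> decay_class e" and t: "0 < t" "t \<le> 1" for f t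
  proof -
    have hol: "f holomorphic_on strip e" using f unfolding decay_class_def by auto
    have g: "(\<lambda>z. deriv f z / of_real K) \<in> decay_class (e/2)" using K(2)[OF f] by simp
    have f0: "((\<lambda>x. f (of_real x)) \<longlongrightarrow> 0) at_top"
    proof (rule Lim_null_comparison)
      show "\<forall>\<^sub>F x in at_top. norm (f (of_real x)) \<le> 1 / (1 + x\<^sup>2)"
        using eventually_ge_at_top[of 0] by eventually_elim
          (use f of_real_in_strip[OF e] in \<open>force simp: decay_class_def\<close>)
      show "((\<lambda>x::real. 1 / (1 + x\<^sup>2)) \<longlongrightarrow> 0) at_top" by real_asymp
    qed
    have J: "ray_integral (\<lambda>z. deriv f z / of_real K) = - f 0 / of_real K"
    proof -
      have "((\<lambda>x. f (of_real x) / of_real K) \<longlongrightarrow> f 0 / of_real K + ray_integral (\<lambda>z. deriv f z / of_real K)) at_top"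
      proof (rule ray_integral_limit[OF g e2])
        fix z assume "z \<in> strip (e/2)"
        then have "z \<in> strip e" using strip_mono[of "e/2" e] e by auto
        then have "(f has_field_derivative deriv f z) (at z)" by (rule holomorphic_derivI[OF hol open_strip])
        then show "((\<lambda>z. f z / of_real K) has_field_derivative deriv f z / of_real K) (at z)" by (rule DERIV_cdivide)
      qed
      moreover have "((\<lambda>x. f (of_real x) / of_real K) \<longlongrightarrow> 0 / of_real K) at_top"
        using K(1) by (intro tendsto_divide f0) auto
      ultimately have "f 0 / of_real K + ray_integral (\<lambda>z. deriv f z / of_real K) = 0 / of_real K"
        by (rule tendsto_unique[rotated]) simp
      then show ?thesis by (simp add: add_eq_0_iff)
    qed
    have "norm (ray_integral (\<lambda>z. deriv f z / of_real K) - riemann_sum \<sigma> t (\<lambda>z. deriv f z / of_real K)) \<le> C' * t"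
      using C'(2)[OF g t] by simp
    moreover have SSd: "riemann_sum \<sigma> t (deriv f) = of_real K * riemann_sum \<sigma> t (\<lambda>z. deriv f z / of_real K)"
      by (rule riemann_sum_scale[OF g K(1) e2 \<sigma> t])
    moreover have "of_real K * (ray_integral (\<lambda>z. deriv f z / of_real K) - riemann_sum \<sigma> t (\<lambda>z. deriv f z / of_real K)) = - f 0 - riemann_sum \<sigma> t (deriv f)"
      unfolding J SSd using K(1) by (simp add: algebra_simps)
    then have "norm (- f 0 - riemann_sum \<sigma> t (deriv f)) = K * norm (ray_integral (\<lambda>z. deriv f z / of_real K) - riemann_sum \<sigma> t (\<lambda>z. deriv f z / of_real K))"
      using K(1) by (metis abs_of_pos norm_mult norm_of_real)
    ultimately have 1: "norm (- f 0 - riemann_sum \<sigma> t (deriv f)) \<le> K * (C' * t)"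
      using K(1) by simp
    have 2: "norm (ray_integral f - (riemann_sum \<sigma> t f + of_real ((1/2 - \<sigma>) * t) * riemann_sum \<sigma> t (deriv f))) \<le> C * t\<^sup>2"
      using C(2)[OF f t] by (simp add: EM_coeff_1 power2_eq_square)
    have "riemann_sum \<sigma> t f - (ray_integral f + of_real ((1/2 - \<sigma>) * t) * f 0) =
      - (ray_integral f - (riemann_sum \<sigma> t f + of_real ((1/2 - \<sigma>) * t) * riemann_sum \<sigma> t (deriv f))) + of_real ((1/2 - \<sigma>) * t) * (- f 0 - riemann_sum \<sigma> t (deriv f))"
      by (simp add: algebra_simps)
    also have "norm \<dots> \<le> C * t\<^sup>2 + (\<bar>1/2 - \<sigma>\<bar> * t) * (K * (C' * t))"
      using 1 2 t by (intro norm_triangle_mono) (simp_all only: norm_minus_cancel norm_mult norm_of_real abs_mult, auto intro!: mult_left_mono)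
    also have "\<dots> = M * t\<^sup>2" by (simp add: M_def algebra_simps power2_eq_square)
    finally show ?thesis .
  qed
  moreover have "M > 0" using C(1) C'(1) K(1) by (simp add: M_def add_pos_nonneg)
  ultimately show ?thesis using that by blast
qed


lemma ray_integral_tendsto:
  assumes f: "f \<in> decay_class e" and e: "0 < e"
  shows "((\<lambda>x. integral {0..x} (\<lambda>y. f (of_real y))) \<longlongrightarrow> ray_integral f) at_top"
proof -
  obtain F where F: "\<And>z. z \<in> strip e \<Longrightarrow> (F has_field_derivative f z) (at z)"
    using decay_class_primitive[OF f] by metis
  show ?thesis
  proof (rule Lim_transform_eventually)
    show "((\<lambda>x. F (of_real x) - F 0) \<longlongrightarrow> ray_integral f) at_top"
      using tendsto_diff[OF ray_integral_limit[OF f e F] tendsto_const[of "F 0"]] by simp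
    show "\<forall>\<^sub>F x in at_top. F (of_real x) - F 0 = integral {0..x} (\<lambda>y. f (of_real y))"
      using eventually_ge_at_top[of "0::real"]
      by eventually_elim (rule integral_unique[symmetric], rule integral_primitive[OF e F])
  qed
qed

text \<open>As \<open>ray_integral\<close> is a \<open>Lim\<close>, scaling has to go through actual
  convergence, which is known for the normalised function.\<close>

lemma ray_integral_scale:
  assumes g: "(\<lambda>z. g z / of_real K) \<in> decay_class e" and K: "K > 0" and e: "0 < e"
  shows "((\<lambda>x. integral {0..x} (\<lambda>y. g (of_real y))) \<longlongrightarrow> ray_integral g) at_top" "ray_integral g = of_real K * ray_integral (\<lambda>z. g z / of_real K)"
proof -
  have "((\<lambda>x. of_real K * integral {0..x} (\<lambda>y. g (of_real y) / of_real K)) \<longlongrightarrow> of_real K * ray_integral (\<lambda>z. g z / of_real K)) at_top"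
    by (intro tendsto_mult tendsto_const ray_integral_tendsto[OF g e])
  moreover have "of_real K * integral {0..x} (\<lambda>y. g (of_real y) / of_real K) = integral {0..x} (\<lambda>y. g (of_real y))" for x :: real
    using K by simp
  ultimately have l: "((\<lambda>x. integral {0..x} (\<lambda>y. g (of_real y))) \<longlongrightarrow> of_real K * ray_integral (\<lambda>z. g z / of_real K)) at_top" by simp
  then show "ray_integral g = of_real K * ray_integral (\<lambda>z. g z / of_real K)" unfolding ray_integral_def[of g] by (intro tendsto_Lim) auto
  with l show "((\<lambda>x. integral {0..x} (\<lambda>y. g (of_real y))) \<longlongrightarrow> ray_integral g) at_top" by simp
qed

text \<open>The bound given by the decay class is the same for all parameters, so the series
  converges uniformly by the M-test.\<close>

lemma riemann_sum_holomorphic: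
  assumes U: "open U" and e: "0 < e" "0 \<le> \<sigma>" "0 < t" "t \<le> 1"
    and f: "\<And>p. p \<in> U \<Longrightarrow> f p \<in> decay_class e" and hol: "\<And>x. 0 \<le> x \<Longrightarrow> (\<lambda>p. f p (of_real x)) holomorphic_on U"
  shows "(\<lambda>p. riemann_sum \<sigma> t (f p)) holomorphic_on U"
proof -
  have "uniform_limit U (\<lambda>n p. \<Sum>m<n. f p (of_real (t * (real m + \<sigma>)))) (\<lambda>p. \<Sum>m. f p (of_real (t * (real m + \<sigma>)))) sequentially"
  proof (rule Weierstrass_m_test)
    show "norm (f p (of_real (t * (real m + \<sigma>)))) \<le> 1 / (1 + (t * real m)\<^sup>2)" if "p \<in> U" for m p
      by (rule decay_class_term_bound[OF f[OF that]]) (use e in auto)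
    have "summable (\<lambda>m. (1/t) * (t / (1 + (t * real m)\<^sup>2)))"
      by (intro summable_mult sum_inverse_quadratic_le) (use e in auto)
    then show "summable (\<lambda>m. 1 / (1 + (t * real m)\<^sup>2))" using e by simp
  qed
  moreover have "\<forall>\<^sub>F n in sequentially. (\<lambda>p. \<Sum>m<n. f p (of_real (t * (real m + \<sigma>)))) holomorphic_on U"
    by (intro always_eventually allI holomorphic_on_sum hol) (use e in auto)
  ultimately have "(\<lambda>p. \<Sum>m. f p (of_real (t * (real m + \<sigma>)))) holomorphic_on U"
    by (intro holomorphic_on_uniform_limit[OF U]) auto
  then show ?thesis unfolding riemann_sum_def by (intro holomorphic_intros)
qed

section \<open>Expansions on cones\<close>

text \<open>The vertex is at \<open>- \<delta>\<close> and not at \<open>0\<close>: the region has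
  to contain a neighbourhood of the origin, where the arguments of small index accumulate, together
  with a narrow sector along the axis.\<close>

definition cone :: "real \<Rightarrow> real \<Rightarrow> complex set" where
  "cone \<theta> \<delta> = {X. \<bar>Im X\<bar> < \<theta> * (Re X + \<delta>)}"

text \<open>For \<open>x = r + \<i> * y\<close> with small \<open>y\<close>,
  \<open>Im (x\<^sup>2) = 2 * r * y\<close> is at most \<open>h * (1 + r\<^sup>2)\<close> in
  modulus: small relative to \<open>r\<^sup>2\<close>, up to a constant that the shifted vertex
  absorbs. A factor \<open>w\<close> near \<open>1\<close> and a shift \<open>s\<close> near
  \<open>0\<close> do no harm. The lower bound on the norm turns decay of order one in the cone into
  decay of order two in the strip.\<close>

lemma quadratic_in_cone:
  assumes a: "0 < (a::real)" and \<theta>: "0 < \<theta>" and \<delta>: "0 < \<delta>"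
  obtains h c where "0 < h" "h \<le> 1" "0 < c"
    "\<And>x w s. x \<in> strip h \<Longrightarrow> w \<in> ball 1 h \<Longrightarrow> s \<in> ball 0 h \<Longrightarrow>
      w * of_real a * (x\<^sup>2 - s) \<in> cone \<theta> \<delta> \<and> c * (1 + (norm x)\<^sup>2) \<le> 1 + norm (w * of_real a * (x\<^sup>2 - s))"
proof -
  \<comment> \<open>The bound \<open>\<theta> / 4\<close> controls the part growing with
    \<open>(Re x)\<^sup>2\<close>; the last one keeps the constant part within the room
    \<open>\<theta> * \<delta>\<close> that the vertex provides.\<close>
  define h where "h = min (1/2) (min (\<theta> / 4) (\<theta> * \<delta> / (a * (1 + \<theta>) * 8)))"
  have h: "0 < h" "h \<le> 1/2" using a \<theta> \<delta> by (simp_all add: h_def)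
  have "h \<le> \<theta> / 4" unfolding h_def by (meson min.cobounded1 min.cobounded2 order_trans)
  then have h4: "4 * h \<le> \<theta>" by simp
  have "h \<le> \<theta> * \<delta> / (a * (1 + \<theta>) * 8)" by (simp add: h_def)
  moreover have "0 < a * (1 + \<theta>) * 8" using a \<theta> by simp
  ultimately have "h * (a * (1 + \<theta>) * 8) \<le> \<theta> * \<delta>" by (simp only: pos_le_divide_eq)
  then have h2: "8 * h * (1 + \<theta>) * a \<le> \<theta> * \<delta>" by (simp add: mult_ac)
  define c where "c = 1 / (10 + 2 / a)"
  have c: "c > 0" using a by (simp add: c_def add_pos_pos)
  have "w * of_real a * (x\<^sup>2 - s) \<in> cone \<theta> \<delta> \<and> c * (1 + (norm x)\<^sup>2) \<le> 1 + norm (w * of_real a * (x\<^sup>2 - s))"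
    if x: "x \<in> strip h" and w: "w \<in> ball 1 h" and s: "s \<in> ball 0 h" for x w s
  proof -
    define r y where "r = Re x" and "y = Im x"
    have y: "\<bar>y\<bar> \<le> h" using x by (simp add: strip_def y_def)
    have y2: "y\<^sup>2 \<le> h"
    proof -
      have "y\<^sup>2 = \<bar>y\<bar> * \<bar>y\<bar>" by (simp add: power2_eq_square)
      also have "\<dots> \<le> h * 1" using y h by (intro mult_mono) auto
      finally show ?thesis by simp
    qed
    define X where "X = x\<^sup>2 - s"
    have sR: "\<bar>Re s\<bar> \<le> h" "\<bar>Im s\<bar> \<le> h" "norm s \<le> h"
      using s abs_Re_le_cmod[of s] abs_Im_le_cmod[of s] by auto
    have reX: "Re X \<ge> r\<^sup>2 - 2 * h" using y2 sR by (simp add: X_def r_def y_def Re_power2)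
    have imX: "\<bar>Im X\<bar> \<le> h * r\<^sup>2 + 2 * h"
    proof -
      have "2 * \<bar>r\<bar> * \<bar>y\<bar> \<le> (1 + r\<^sup>2) * h"
        using y sum_squares_bound[of 1 "\<bar>r\<bar>"] h by (intro mult_mono) auto
      moreover have "Im X = 2 * r * y - Im s" by (simp add: X_def r_def y_def Im_power2)
      moreover have "\<bar>2 * r * y\<bar> = 2 * \<bar>r\<bar> * \<bar>y\<bar>" by (simp add: abs_mult)
      ultimately have "\<bar>Im X\<bar> \<le> (1 + r\<^sup>2) * h + h" using sR by linarith
      then show ?thesis by (simp add: algebra_simps)
    qed
    have nX: "norm X \<le> r\<^sup>2 + 2 * h"
    proof -
      have "norm X \<le> (norm x)\<^sup>2 + norm s" unfolding X_def by (metis norm_power norm_triangle_ineq4)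
      also have "(norm x)\<^sup>2 = r\<^sup>2 + y\<^sup>2" by (simp add: cmod_power2 r_def y_def)
      finally show ?thesis using y2 sR by simp
    qed
    have "norm (w * X - X) \<le> h * (r\<^sup>2 + 2 * h)"
    proof -
      have "w * X - X = (w - 1) * X" by (simp add: algebra_simps)
      then have "norm (w * X - X) = norm (w - 1) * norm X" by (simp add: norm_mult)
      also have "\<dots> \<le> h * (r\<^sup>2 + 2 * h)" using w nX h by (intro mult_mono) (auto simp: dist_norm norm_minus_commute)
      finally show ?thesis .
    qed
    also have "\<dots> \<le> h * r\<^sup>2 + h" using h by (simp add: algebra_simps)
    finally have d: "norm (w * X - X) \<le> h * r\<^sup>2 + h" .
    have re: "Re (w * X) \<ge> r\<^sup>2 / 2 - 4 * h"
    proof -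
      have "h * r\<^sup>2 \<le> 1/2 * r\<^sup>2" using h by (intro mult_right_mono) auto
      then show ?thesis using d abs_Re_le_cmod[of "w * X - X"] reX h by simp
    qed
    have im: "\<bar>Im (w * X)\<bar> \<le> 2 * (h * r\<^sup>2) + 4 * h"
      using d abs_Im_le_cmod[of "w * X - X"] imX h by simp
    have eq: "w * of_real a * (x\<^sup>2 - s) = of_real a * (w * X)" by (simp add: X_def)
    have "\<bar>Im (of_real a * (w * X))\<bar> < \<theta> * (Re (of_real a * (w * X)) + \<delta>)"
    proof -
      have 1: "\<bar>Im (of_real a * (w * X))\<bar> \<le> a * (2 * (h * r\<^sup>2) + 4 * h)"
        using im a by (simp add: abs_mult)
      have 2: "\<theta> * (a * (r\<^sup>2 / 2 - 4 * h) + \<delta>) \<le> \<theta> * (Re (of_real a * (w * X)) + \<delta>)"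
        using re a \<theta> by simp
      have "4 * h * r\<^sup>2 \<le> \<theta> * r\<^sup>2" using h4 by (intro mult_right_mono) auto
      then have "a * (4 * h * r\<^sup>2) \<le> a * (\<theta> * r\<^sup>2)" using a by (intro mult_left_mono) auto
      moreover have "0 < a * h" using a h by simp
      moreover have "0 < \<theta> * (a * h)" using a h \<theta> by simp
      ultimately have "a * (2 * (h * r\<^sup>2) + 4 * h) < \<theta> * (a * (r\<^sup>2 / 2 - 4 * h) + \<delta>)"
        using h2 by (simp add: algebra_simps)
      with 1 2 show ?thesis by linarith
    qed
    moreover have "c * (1 + (norm x)\<^sup>2) \<le> 1 + norm (of_real a * (w * X))"
    proof -
      define N where "N = norm (of_real a * (w * X))"
      have N0: "N \<ge> 0" by (simp add: N_def)
      have "a * (r\<^sup>2 / 2 - 4 * h) \<le> N"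
        using re a complex_Re_le_cmod[of "of_real a * (w * X)"] unfolding N_def
        by (simp) (meson mult_left_mono less_imp_le order_trans)
      then have "r\<^sup>2 \<le> 2 * N / a + 8 * h" using a by (simp add: field_simps)
      moreover have "(norm x)\<^sup>2 = r\<^sup>2 + y\<^sup>2" by (simp add: cmod_power2 r_def y_def)
      ultimately have "1 + (norm x)\<^sup>2 \<le> 10 + 2 * N / a" using y2 h by linarith
      also have "\<dots> \<le> (10 + 2 / a) * (1 + N)" using N0 a by (simp add: field_simps)
      finally show ?thesis unfolding c_def N_def[symmetric] using a by (simp add: divide_simps add_pos_pos mult.commute)
    qed
    ultimately show ?thesis unfolding eq cone_def by simp
  qed
  with h c show ?thesis using that[of h c] by simp
qed

text \<open>The shift \<open>e0 * t\<^sup>2\<close> that spoils the exact square is treated as an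
  independent complex parameter \<open>s\<close>: the Euler--Maclaurin expansion holds uniformly in
  \<open>(w, s)\<close> with coefficients holomorphic in \<open>s\<close>, and only afterwards is
  \<open>s = e0 * t\<^sup>2\<close> inserted, by Taylor expansion.\<close>

lemma quadratic_sum_expansion:
  assumes a: "0 < (a::real)" and e0: "0 \<le> (e0::real)" and \<sigma>: "0 \<le> \<sigma>" and \<theta>: "0 < \<theta>" and \<delta>: "0 < \<delta>"
    and \<psi>: "\<psi> holomorphic_on cone \<theta> \<delta>" and K: "0 < K" and bd: "\<And>X. X \<in> cone \<theta> \<delta> \<Longrightarrow> norm (\<psi> X) \<le> K / (1 + norm X)"
  obtains h where "0 < h" "\<And>J. \<exists>G. uexp_coeffs (ball 1 h) J
      (\<lambda>t w. of_real t * (\<Sum>m. \<psi> (w * of_real (t\<^sup>2 * (a * ((real m + \<sigma>)\<^sup>2 - e0)))))) G \<and>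
      (\<forall>j\<le>J. G j holomorphic_on ball 1 h) \<and>
      (J \<ge> 1 \<longrightarrow> (\<forall>w\<in>ball 1 h. G 0 w = ray_integral (\<lambda>x. \<psi> (w * of_real a * x\<^sup>2)) \<and> G 1 w = of_real (1/2 - \<sigma>) * \<psi> 0))"
      "\<And>w. w \<in> ball 1 h \<Longrightarrow> ((\<lambda>x. integral {0..x} (\<lambda>y. \<psi> (w * of_real a * (of_real y)\<^sup>2))) \<longlongrightarrow> ray_integral (\<lambda>x. \<psi> (w * of_real a * x\<^sup>2))) at_top"
proof -
  obtain h c where hc: "0 < h" "h \<le> 1" "0 < c"
    "\<And>x w s. x \<in> strip h \<Longrightarrow> w \<in> ball 1 h \<Longrightarrow> s \<in> ball 0 h \<Longrightarrow>
      w * of_real a * (x\<^sup>2 - s) \<in> cone \<theta> \<delta> \<and> c * (1 + (norm x)\<^sup>2) \<le> 1 + norm (w * of_real a * (x\<^sup>2 - s))"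
    using quadratic_in_cone[OF a \<theta> \<delta>] by blast
  define M where "M = K / c"
  have M: "M > 0" using K hc by (simp add: M_def)
  define f where "f = (\<lambda>w s x. \<psi> (w * of_real a * (x\<^sup>2 - s)))"
  have f: "(\<lambda>x. f w s x / of_real M) \<in> decay_class h" if "w \<in> ball 1 h" "s \<in> ball 0 h" for w s
  proof -
    have "(\<lambda>x. f w s x) holomorphic_on strip h"
      unfolding f_def by (intro holomorphic_on_compose_gen[OF _ \<psi>, unfolded o_def] holomorphic_intros)
        (use hc(4) that in blast)
    then have 1: "(\<lambda>x. f w s x / of_real M) holomorphic_on strip h"
      using M by (intro holomorphic_intros) auto
    have "norm (f w s x / of_real M) \<le> 1 / (1 + (norm x)\<^sup>2)" if x: "x \<in> strip h" for x
    proof -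
      note * = hc(4)[OF x \<open>w \<in> ball 1 h\<close> \<open>s \<in> ball 0 h\<close>]
      have "norm (f w s x) \<le> K / (1 + norm (w * of_real a * (x\<^sup>2 - s)))" unfolding f_def using * by (intro bd) simp
      also have "\<dots> \<le> K / (c * (1 + (norm x)\<^sup>2))"
        using K hc(3) * by (intro divide_left_mono mult_pos_pos) (auto intro: add_pos_nonneg)
      also have "\<dots> = M * (1 / (1 + (norm x)\<^sup>2))" by (simp add: M_def)
      finally show ?thesis using M by (simp add: norm_divide field_simps)
    qed
    with 1 show ?thesis unfolding decay_class_def by simp
  qed
  define r where "r = h / (1 + e0)"
  have r: "0 < r" "r \<le> h" using hc e0 by (auto simp: r_def field_simps)
  have r2: "of_real e0 * u\<^sup>2 \<in> ball (0::complex) h" if "u \<in> ball 0 r" for u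
  proof -
    have u: "norm u < r" "norm u \<le> 1" using that r hc by auto
    have "norm (of_real e0 * u\<^sup>2) = e0 * (norm u * norm u)" using e0 by (simp add: norm_mult power2_eq_square)
    also have "\<dots> \<le> e0 * (norm u * 1)" using u e0 by (intro mult_left_mono) auto
    also have "\<dots> < h"
    proof -
      have "e0 * norm u \<le> e0 * r" using u e0 by (intro mult_left_mono) auto
      also have "\<dots> < h" using e0 hc by (simp add: r_def field_simps)
      finally show ?thesis by simp
    qed
    finally show ?thesis by simp
  qed
  define S where "S = (\<lambda>t p. riemann_sum \<sigma> t (\<lambda>x. f (fst p) (snd p) x / of_real M))"
  let ?P = "ball (1::complex) h \<times> ball (0::complex) h"
  have ues: "uexp ?P J S" for J
    unfolding S_def by (rule uexp_reparam[OF EM_uexp[OF \<sigma> hc(1)]]) (use f in auto)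
  have eqS: "of_real t * (\<Sum>m. \<psi> (w * of_real (t\<^sup>2 * (a * ((real m + \<sigma>)\<^sup>2 - e0))))) = of_real M * S t (w, of_real (e0 * t\<^sup>2))"
    if t: "0 < t" "t < r" and w: "w \<in> ball 1 h" for t w
  proof -
    have s: "of_real (e0 * t\<^sup>2) \<in> ball (0::complex) h" using r2[of "of_real t"] t by simp
    have "of_real M * S t (w, of_real (e0 * t\<^sup>2)) = riemann_sum \<sigma> t (f w (of_real (e0 * t\<^sup>2)))"
      unfolding S_def fst_conv snd_conv
      by (rule riemann_sum_scale[symmetric, OF f[OF w s] M hc(1) \<sigma>]) (use t r hc in auto)
    also have "\<dots> = of_real t * (\<Sum>m. \<psi> (w * of_real (t\<^sup>2 * (a * ((real m + \<sigma>)\<^sup>2 - e0)))))"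
      unfolding riemann_sum_def f_def by (simp add: algebra_simps power_mult_distrib power2_eq_square)
    finally show ?thesis by simp
  qed
  have main: "\<exists>G. uexp_coeffs (ball 1 h) J
      (\<lambda>t w. of_real t * (\<Sum>m. \<psi> (w * of_real (t\<^sup>2 * (a * ((real m + \<sigma>)\<^sup>2 - e0)))))) G \<and>
      (\<forall>j\<le>J. G j holomorphic_on ball 1 h) \<and>
      (J \<ge> 1 \<longrightarrow> (\<forall>w\<in>ball 1 h. G 0 w = ray_integral (\<lambda>x. \<psi> (w * of_real a * x\<^sup>2)) \<and> G 1 w = of_real (1/2 - \<sigma>) * \<psi> 0))" for J
  proof -
    obtain G where G: "uexp_coeffs ?P J S G" using ues[of J] unfolding uexp_def by blast
    have Gs: "(\<lambda>s. G j (w, s)) holomorphic_on ball 0 h" if j: "j \<le> J" and w: "w \<in> ball 1 h" for j w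
    proof (rule uexp_coeffs_holomorphic[OF _ open_ball _ j])
      show "uexp_coeffs (ball 0 h) J (\<lambda>t s. S t (w, s)) (\<lambda>j s. G j (w, s))"
        using uexp_coeffs_reparam[OF G, of "ball 0 h" "\<lambda>s. (w, s)"] w by auto
      show "\<forall>\<^sub>F t in at_right 0. (\<lambda>s. S t (w, s)) holomorphic_on ball 0 h"
        using eventually_small_right[of 1, simplified]
      proof eventually_elim
        case (elim t)
        show ?case unfolding S_def fst_conv snd_conv
        proof (rule riemann_sum_holomorphic[OF open_ball hc(1) \<sigma>])
          show "(\<lambda>s. f w s (of_real x) / of_real M) holomorphic_on ball 0 h" if "0 \<le> x" for x
            unfolding f_def using M
            by (intro holomorphic_on_divide holomorphic_on_const holomorphic_on_compose_gen[OF _ \<psi>, unfolded o_def] holomorphic_intros)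
              (use hc(4)[OF of_real_in_strip[OF hc(1) that] w] in auto)
        qed (use f w elim in auto)
      qed
    qed
    \<comment> \<open>Coefficient \<open>j\<close> at \<open>s = e0 * u\<^sup>2\<close> is a bounded
      holomorphic function of \<open>u\<close> near \<open>0\<close>, so it has an expansion uniform
      in \<open>w\<close>.\<close>
    have T: "uexp (ball 1 h) J (\<lambda>t w. G j (w, of_real e0 * (of_real t)\<^sup>2))" if j: "j \<le> J" for j
    proof -
      obtain B where B: "\<And>p. p \<in> ?P \<Longrightarrow> norm (G j p) \<le> B" using uexp_coeffs_boundedE[OF G] by metis
      show ?thesis
      proof (rule uexp_Taylor[where h = "\<lambda>w u. G j (w, of_real e0 * u\<^sup>2)", OF _ r(1)])
        show "(\<lambda>u. G j (w, of_real e0 * u\<^sup>2)) holomorphic_on ball 0 r" if w: "w \<in> ball 1 h" for w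
          by (rule holomorphic_on_compose_gen[OF _ Gs[OF j w], unfolded o_def]) (use r2 in \<open>auto intro!: holomorphic_intros\<close>)
        show "norm (G j (w, of_real e0 * u\<^sup>2)) \<le> B" if "w \<in> ball 1 h" "u \<in> ball 0 r" for w u
          using B r2 that by blast
      qed
    qed
    obtain C where C: "C \<ge> 0" "\<forall>\<^sub>F t in at_right 0. \<forall>p\<in>?P. norm (S t p - (\<Sum>j\<le>J. G j p * of_real t ^ j)) \<le> C * t ^ Suc J"
      using G by (elim uexp_coeffsE)
    have "uexp (ball 1 h) J (\<lambda>t w. \<Sum>j\<le>J. of_real t ^ j * G j (w, of_real e0 * (of_real t)\<^sup>2))"
      by (intro uexp_sum uexp_times_power T) auto
    moreover have "\<forall>\<^sub>F t in at_right 0. \<forall>w\<in>ball 1 h. norm (S t (w, of_real (e0 * t\<^sup>2)) - (\<Sum>j\<le>J. of_real t ^ j * G j (w, of_real e0 * (of_real t)\<^sup>2))) \<le> C * t ^ Suc J"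
      using C(2) eventually_small_right[OF r(1)]
    proof eventually_elim
      case (elim t)
      show ?case
      proof
        fix w :: complex assume w: "w \<in> ball 1 h"
        have "of_real e0 * (of_real t)\<^sup>2 \<in> ball (0::complex) h" using r2[of "of_real t"] elim by simp
        then show "norm (S t (w, of_real (e0 * t\<^sup>2)) - (\<Sum>j\<le>J. of_real t ^ j * G j (w, of_real e0 * (of_real t)\<^sup>2))) \<le> C * t ^ Suc J"
          using elim(1)[rule_format, of "(w, of_real e0 * (of_real t)\<^sup>2)"] w by (simp add: mult.commute)
      qed
    qed
    then have "uexp (ball 1 h) J (\<lambda>t w. S t (w, of_real (e0 * t\<^sup>2)) - (\<Sum>j\<le>J. of_real t ^ j * G j (w, of_real e0 * (of_real t)\<^sup>2)))"
      unfolding uexp_def by (blast intro: uexp_bigo)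
    ultimately have "uexp (ball 1 h) J (\<lambda>t w. S t (w, of_real (e0 * t\<^sup>2)))"
      using uexp_add by fastforce
    then have uM: "uexp (ball 1 h) J (\<lambda>t w. of_real M * S t (w, of_real (e0 * t\<^sup>2)))"
      by (rule uexp_cmult[where K = M]) (use M in auto)
    have ev: "\<forall>\<^sub>F t in at_right 0. \<forall>w\<in>ball 1 h. of_real M * S t (w, of_real (e0 * t\<^sup>2)) =
       of_real t * (\<Sum>m. \<psi> (w * of_real (t\<^sup>2 * (a * ((real m + \<sigma>)\<^sup>2 - e0)))))"
      using eventually_small_right[OF r(1)] by eventually_elim (use eqS in simp)
    define A where "A = (\<lambda>t w. of_real t * (\<Sum>m. \<psi> (w * of_real (t\<^sup>2 * (a * ((real m + \<sigma>)\<^sup>2 - e0))))))"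
    have "uexp (ball 1 h) J A" unfolding A_def by (rule uexp_cong[OF uM ev])
    then obtain G' where G': "uexp_coeffs (ball 1 h) J A G'" unfolding uexp_def by blast
    have hol: "G' j holomorphic_on ball 1 h" if j: "j \<le> J" for j
    proof (rule uexp_coeffs_holomorphic[OF G' open_ball _ j])
      show "\<forall>\<^sub>F t in at_right 0. A t holomorphic_on ball 1 h"
        using eventually_small_right[OF r(1)]
      proof eventually_elim
        case (elim t)
        have s: "of_real (e0 * t\<^sup>2) \<in> ball (0::complex) h" using r2[of "of_real t"] elim by simp
        have "(\<lambda>w. S t (w, of_real (e0 * t\<^sup>2))) holomorphic_on ball 1 h"
          unfolding S_def fst_conv snd_conv
        proof (rule riemann_sum_holomorphic[OF open_ball hc(1) \<sigma>])
          show "(\<lambda>w. f w (of_real (e0 * t\<^sup>2)) (of_real x) / of_real M) holomorphic_on ball 1 h" if "0 \<le> x" for x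
            unfolding f_def using M
            by (intro holomorphic_on_divide holomorphic_on_const holomorphic_on_compose_gen[OF _ \<psi>, unfolded o_def] holomorphic_intros)
              (use hc(4)[OF of_real_in_strip[OF hc(1) that] _ s] in auto)
        qed (use f s elim r hc in auto)
        then have "(\<lambda>w. of_real M * S t (w, of_real (e0 * t\<^sup>2))) holomorphic_on ball 1 h" by (intro holomorphic_intros)
        then show ?case unfolding A_def by (rule holomorphic_transform) (use eqS elim in auto)
      qed
    qed
    have low: "G' 0 w = ray_integral (\<lambda>x. \<psi> (w * of_real a * x\<^sup>2)) \<and> G' 1 w = of_real (1/2 - \<sigma>) * \<psi> 0"
      if J: "J \<ge> 1" and w: "w \<in> ball 1 h" for w
    proof -
      obtain C where C: "C > 0" "\<And>f t. f \<in> decay_class h \<Longrightarrow> 0 < t \<Longrightarrow> t \<le> 1 \<Longrightarrow>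
          norm (riemann_sum \<sigma> t f - (ray_integral f + of_real ((1/2 - \<sigma>) * t) * f 0)) \<le> C * t\<^sup>2"
        using EM_low_order[OF hc(1) \<sigma>] by blast
      define j where "j = (\<lambda>s. ray_integral (\<lambda>x. f w s x / of_real M))"
      \<comment> \<open>Identifying the leading coefficient for every \<open>s\<close>, not only for
        \<open>s = 0\<close>, makes the integral \<open>j\<close> holomorphic in
        \<open>s\<close>.\<close>
      have Gj: "G 0 (w, s) = j s" if s: "s \<in> ball 0 h" for s
      proof -
        have "((\<lambda>t. (S t (w, s) - (\<Sum>i<0. G i (w, s) * of_real t ^ i)) / of_real t ^ 0) \<longlongrightarrow> G 0 (w, s)) (at_right 0)"
          by (rule tendsto_uniform_limitI[OF uexp_coeffs_uniform_limit[OF G]]) (use w s in auto)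
        then have l1: "((\<lambda>t. S t (w, s)) \<longlongrightarrow> G 0 (w, s)) (at_right 0)" by simp
        have "((\<lambda>t. S t (w, s) - j s) \<longlongrightarrow> 0) (at_right 0)"
        proof (rule Lim_null_comparison)
          show "\<forall>\<^sub>F t in at_right 0. norm (S t (w, s) - j s) \<le> C * t\<^sup>2 + norm (of_real ((1/2 - \<sigma>) * t) * (f w s 0 / of_real M))"
            using eventually_small_right[of 1, simplified]
          proof eventually_elim
            case (elim t)
            show ?case
              using C(2)[OF f[OF w s], of t] elim norm_triangle_sub[of "S t (w, s) - j s" "of_real ((1/2 - \<sigma>) * t) * (f w s 0 / of_real M)"]
              unfolding S_def j_def fst_conv snd_conv by (simp add: algebra_simps)
          qed
          show "((\<lambda>t. C * t\<^sup>2 + norm (of_real ((1/2 - \<sigma>) * t) * (f w s 0 / of_real M))) \<longlongrightarrow> 0) (at_right 0)"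
            using M by (auto intro!: tendsto_eq_intros)
        qed
        then have "((\<lambda>t. S t (w, s)) \<longlongrightarrow> j s) (at_right 0)" by (rule LIM_zero_cancel)
        with l1 show ?thesis by (rule tendsto_unique[rotated]) simp
      qed
      have "(\<lambda>s. j s) holomorphic_on ball 0 h"
        by (rule holomorphic_transform[OF Gs[OF _ w]]) (use Gj in auto)
      then have jd: "(j has_field_derivative deriv j 0) (at 0)"
        by (rule holomorphic_derivI[OF _ open_ball]) (use hc in auto)
      define v where "v = (\<lambda>s. f w s 0 / of_real M)"
      have "(\<lambda>s. v s) holomorphic_on ball 0 h"
        unfolding v_def f_def using M
        by (intro holomorphic_on_divide holomorphic_on_const holomorphic_on_compose_gen[OF _ \<psi>, unfolded o_def] holomorphic_intros)
          (use hc(4)[OF of_real_in_strip[OF hc(1) order_refl] w] in auto)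
      then have "continuous_on (ball 0 h) v" by (rule holomorphic_on_imp_continuous_on)
      then have vc: "isCont v 0" using hc(1) by (simp add: continuous_on_eq_continuous_at)
      have lim_s: "((\<lambda>t::real. of_real e0 * (of_real t)\<^sup>2 :: complex) \<longlongrightarrow> 0) (at_right 0)"
        by (auto intro!: tendsto_eq_intros)
      have lv: "((\<lambda>t::real. v (of_real e0 * (of_real t)\<^sup>2)) \<longlongrightarrow> v 0) (at_right 0)"
        by (rule isCont_tendsto_compose[OF vc lim_s])
      have lj: "((\<lambda>t::real. j (of_real e0 * (of_real t)\<^sup>2)) \<longlongrightarrow> j 0) (at_right 0)"
        by (rule isCont_tendsto_compose[OF DERIV_isCont[OF jd] lim_s])
      \<comment> \<open>Passing from \<open>s = 0\<close> to \<open>s = e0 * t\<^sup>2\<close>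
        alters the integral by \<open>O(t\<^sup>2)\<close> only and so leaves the coefficient of
        \<open>t\<close> untouched.\<close>
      have lj1: "((\<lambda>t::real. (j (of_real e0 * (of_real t)\<^sup>2) - j 0) / of_real t) \<longlongrightarrow> 0) (at_right 0)"
      proof -
        have "((\<lambda>u. j (of_real e0 * u\<^sup>2)) has_field_derivative deriv j (of_real e0 * 0\<^sup>2) * (of_real e0 * (2 * 0))) (at 0)"
          by (rule DERIV_chain2[of j]) (use jd in \<open>auto intro!: derivative_eq_intros\<close>)
        then have "((\<lambda>u. (j (of_real e0 * u\<^sup>2) - j 0) / u) \<longlongrightarrow> 0) (at 0)"
          by (simp add: has_field_derivative_iff)
        moreover have "filterlim (\<lambda>t::real. complex_of_real t) (at 0) (at_right 0)"
          unfolding filterlim_at by (auto intro!: tendsto_eq_intros simp: eventually_at_filter)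
        ultimately show ?thesis by (rule filterlim_compose)
      qed
      have app: "norm (S t (w, of_real (e0 * t\<^sup>2)) - (j (of_real e0 * (of_real t)\<^sup>2) + of_real ((1/2 - \<sigma>) * t) * v (of_real e0 * (of_real t)\<^sup>2))) \<le> C * t\<^sup>2"
        if t: "0 < t" "t < r" for t
      proof -
        have s: "of_real e0 * (of_real t)\<^sup>2 \<in> ball (0::complex) h" using r2[of "of_real t"] t by simp
        show ?thesis using C(2)[OF f[OF w s], of t] t r hc unfolding S_def j_def v_def fst_conv snd_conv by simp
      qed
      have eqA: "A t w = of_real M * S t (w, of_real (e0 * t\<^sup>2))" if t: "0 < t" "t < r" for t
        using eqS[OF t w] unfolding A_def by simp
      have l0: "((\<lambda>t. A t w) \<longlongrightarrow> G' 0 w) (at_right 0)"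
        using tendsto_uniform_limitI[OF uexp_coeffs_uniform_limit[OF G', of 0] w] by simp
      have l1: "((\<lambda>t. (A t w - G' 0 w) / of_real t) \<longlongrightarrow> G' 1 w) (at_right 0)"
        using tendsto_uniform_limitI[OF uexp_coeffs_uniform_limit[OF G' J] w] by simp
      define E where "E = (\<lambda>t. S t (w, of_real (e0 * t\<^sup>2)) - (j (of_real e0 * (of_real t)\<^sup>2) + of_real ((1/2 - \<sigma>) * t) * v (of_real e0 * (of_real t)\<^sup>2)))"
      have E1: "((\<lambda>t. E t / of_real t) \<longlongrightarrow> 0) (at_right 0)"
      proof (rule Lim_null_comparison)
        show "\<forall>\<^sub>F t in at_right 0. norm (E t / of_real t) \<le> C * t"
          using eventually_small_right[OF r(1)]
          by eventually_elim (use app in \<open>auto simp: E_def norm_divide field_simps power2_eq_square\<close>)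
        show "((\<lambda>t. C * t) \<longlongrightarrow> 0) (at_right 0)" by (auto intro!: tendsto_eq_intros)
      qed
      have E0: "((\<lambda>t. E t) \<longlongrightarrow> 0) (at_right 0)"
      proof (rule Lim_transform_eventually)
        show "((\<lambda>t. E t / of_real t * of_real t) \<longlongrightarrow> 0) (at_right 0)"
          using tendsto_mult[OF E1 tendsto_of_real[OF tendsto_ident_at]] by (simp only: mult_zero_left)
        show "\<forall>\<^sub>F t in at_right 0. E t / of_real t * of_real t = E t"
          using eventually_small_right[OF r(1)] by eventually_elim auto
      qed
      have "((\<lambda>t. of_real M * (E t + (j (of_real e0 * (of_real t)\<^sup>2) + of_real ((1/2 - \<sigma>) * t) * v (of_real e0 * (of_real t)\<^sup>2)))) \<longlongrightarrow> of_real M * (0 + (j 0 + of_real ((1/2 - \<sigma>) * 0) * v 0))) (at_right 0)"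
        by (intro tendsto_intros E0 lj lv)
      moreover have "\<forall>\<^sub>F t in at_right 0. of_real M * (E t + (j (of_real e0 * (of_real t)\<^sup>2) + of_real ((1/2 - \<sigma>) * t) * v (of_real e0 * (of_real t)\<^sup>2))) = A t w"
        using eventually_small_right[OF r(1)] by eventually_elim (auto simp: E_def eqA)
      ultimately have "((\<lambda>t. A t w) \<longlongrightarrow> of_real M * (0 + (j 0 + of_real ((1/2 - \<sigma>) * 0) * v 0))) (at_right 0)"
        by (rule Lim_transform_eventually)
      then have "((\<lambda>t. A t w) \<longlongrightarrow> of_real M * j 0) (at_right 0)" by simp
      with l0 have g0: "G' 0 w = of_real M * j 0" by (rule tendsto_unique[rotated]) simp
      have "((\<lambda>t. of_real M * (E t / of_real t + ((j (of_real e0 * (of_real t)\<^sup>2) - j 0) / of_real t + of_real (1/2 - \<sigma>) * v (of_real e0 * (of_real t)\<^sup>2)))) \<longlongrightarrow> of_real M * (0 + (0 + of_real (1/2 - \<sigma>) * v 0))) (at_right 0)"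
        by (intro tendsto_intros E1 lj1 lv)
      moreover have "\<forall>\<^sub>F t in at_right 0. of_real M * (E t / of_real t + ((j (of_real e0 * (of_real t)\<^sup>2) - j 0) / of_real t + of_real (1/2 - \<sigma>) * v (of_real e0 * (of_real t)\<^sup>2))) = (A t w - G' 0 w) / of_real t"
        using eventually_small_right[OF r(1)] by eventually_elim (auto simp: E_def eqA g0 field_simps)
      ultimately have "((\<lambda>t. (A t w - G' 0 w) / of_real t) \<longlongrightarrow> of_real M * (0 + (0 + of_real (1/2 - \<sigma>) * v 0))) (at_right 0)"
        by (rule Lim_transform_eventually)
      with l1 have "G' 1 w = of_real M * (0 + (0 + of_real (1/2 - \<sigma>) * v 0))" by (rule tendsto_unique[rotated]) simp
      also have "\<dots> = of_real (1/2 - \<sigma>) * \<psi> 0" using less_imp_neq[OF M] by (simp add: v_def f_def)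
      finally have g1: "G' 1 w = of_real (1/2 - \<sigma>) * \<psi> 0" .
      have "of_real M * j 0 = ray_integral (f w 0)"
        unfolding j_def by (rule ray_integral_scale(2)[symmetric, OF f[OF w] M hc(1)]) (use hc in auto)
      then show ?thesis using g0 g1 by (simp add: f_def)
    qed
    show ?thesis
      using G' hol low unfolding A_def by blast
  qed
  show ?thesis
  proof (rule that[OF hc(1) main])
    fix w :: complex assume w: "w \<in> ball 1 h"
    show "((\<lambda>x. integral {0..x} (\<lambda>y. \<psi> (w * of_real a * (of_real y)\<^sup>2))) \<longlongrightarrow> ray_integral (\<lambda>x. \<psi> (w * of_real a * x\<^sup>2))) at_top"
      using ray_integral_scale(1)[OF f[OF w, of 0] M hc(1)] hc(1) by (simp add: f_def)
  qed
qed

section \<open>The Bernoulli function\<close>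

definition expm1_quot :: "complex \<Rightarrow> complex" where
  "expm1_quot X = (if X = 0 then 1 else (exp X - 1) / X)"

definition bern :: "complex \<Rightarrow> complex" where
  "bern X = (if X = 0 then 1 else X / (exp X - 1))"

lemma bern_eq: "bern X = inverse (expm1_quot X)"
  by (simp add: bern_def expm1_quot_def)

lemma holomorphic_expm1_quot: "expm1_quot holomorphic_on UNIV"
proof -
  have "((\<lambda>X::complex. (exp X - 1) / X) \<longlongrightarrow> 1) (at 0)"
    using DERIV_exp[of "0::complex"] by (simp add: has_field_derivative_iff)
  then have "(\<lambda>y. if y = 0 then 1 else (exp y - 1) / y) holomorphic_on (UNIV::complex set)"
    by (intro removable_singularity) (auto intro!: holomorphic_intros)
  then show ?thesis by (simp add: expm1_quot_def[abs_def])
qed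

lemma expm1_quot_nonzero:
  assumes "\<bar>Im X\<bar> < 2 * pi"
  shows "expm1_quot X \<noteq> 0"
proof
  assume 0: "expm1_quot X = 0"
  then have X: "X \<noteq> 0" "exp X = 1" by (auto simp: expm1_quot_def split: if_splits)
  then obtain n :: int where n: "Re X = 0" "Im X = of_int (2 * n) * pi" using exp_eq_1 by blast
  have "\<bar>of_int (2 * n) * pi\<bar> < 2 * pi" using assms n by simp
  then have "\<bar>of_int n :: real\<bar> * (2 * pi) < 1 * (2 * pi)" by (simp add: abs_mult)
  then have "\<bar>of_int n :: real\<bar> < 1" by (subst (asm) mult_less_cancel_right) auto
  then have "n = 0" by linarith
  then show False using n X by (simp add: complex_eq_iff)
qed

lemma cone_bounds:
  assumes "X \<in> cone 1 (1/2)"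
  shows "Re X > - 1/2" "\<bar>Im X\<bar> < Re X + 1/2"
  using assms unfolding cone_def by auto

text \<open>The poles of \<open>bern\<close> are the nonzero multiples of
  \<open>2 * pi * \<i>\<close>, which both alternatives exclude.\<close>

lemma holomorphic_bern:
  assumes "\<And>X. X \<in> A \<Longrightarrow> \<bar>Im X\<bar> < 2 * pi \<or> Re X > 0"
  shows "bern holomorphic_on A"
proof -
  have "expm1_quot X \<noteq> 0" if "X \<in> A" for X
  proof (cases "Re X > 0")
    case True
    then have "norm (exp X) \<noteq> 1" by simp
    then have "exp X \<noteq> 1" by (metis norm_one)
    then show ?thesis using True by (auto simp: expm1_quot_def)
  qed (use assms[OF that] expm1_quot_nonzero in auto)
  then show ?thesis unfolding bern_eq[abs_def]
    by (intro holomorphic_on_inverse holomorphic_on_subset[OF holomorphic_expm1_quot]) auto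
qed

lemma holomorphic_bern_cone: "bern holomorphic_on cone 1 (1/2)"
proof (rule holomorphic_bern)
  fix X assume X: "X \<in> cone 1 (1/2)"
  show "\<bar>Im X\<bar> < 2 * pi \<or> Re X > 0"
    using cone_bounds[OF X] pi_gt3 by linarith
qed

text \<open>For \<open>Re X \<ge> 1\<close> the cone gives \<open>norm X \<le> 3 * Re X\<close>,
  while the denominator grows at least quadratically in \<open>Re X\<close>. The rest of the cone
  lies in a compact rectangle free of poles.\<close>

lemma bern_bound:
  obtains K where "K > 0" "\<And>X. X \<in> cone 1 (1/2) \<Longrightarrow> norm (bern X) \<le> K / (1 + norm X)"
proof -
  define T where "T = cbox (Complex (-1) (-2)) (Complex 1 2)"
  have "bern holomorphic_on T"
    by (rule holomorphic_bern) (use pi_gt3 in \<open>auto simp: T_def in_cbox_complex_iff\<close>)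
  then have "compact (bern ` T)"
    unfolding T_def by (intro compact_continuous_image holomorphic_on_imp_continuous_on) auto
  then obtain m where m: "\<And>X. X \<in> T \<Longrightarrow> norm (bern X) \<le> m"
    using compact_imp_bounded bounded_iff by (metis imageI)
  define K where "K = max 18 (4 * m)"
  have "norm (bern X) \<le> K / (1 + norm X)" if X: "X \<in> cone 1 (1/2)" for X
  proof -
    note b = cone_bounds[OF X]
    have n: "norm X \<le> \<bar>Re X\<bar> + \<bar>Im X\<bar>" by (rule cmod_le)
    have "norm (bern X) * (1 + norm X) \<le> K"
    proof (cases "Re X \<ge> 1")
      case True
      define R where "R = Re X"
      have R: "R \<ge> 1" "norm X \<le> 3 * R" using True b n by (auto simp: R_def)
      have "R + R\<^sup>2 / 2 \<le> exp R - 1" using exp_lower_Taylor_quadratic[of R] R by simp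
      also have "\<dots> \<le> norm (exp X - 1)" using norm_triangle_ineq2[of "exp X" 1] by (simp add: R_def)
      finally have e: "R + R\<^sup>2 / 2 \<le> norm (exp X - 1)" .
      have pos: "0 < R + R\<^sup>2 / 2" using R by (simp add: add_pos_nonneg)
      have "norm (bern X) = norm X / norm (exp X - 1)"
        using True by (auto simp: bern_def norm_divide)
      also have "\<dots> \<le> 3 * R / (R + R\<^sup>2 / 2)" using R e pos by (intro frac_le) auto
      also have "\<dots> = 6 / (2 + R)" using R pos by (simp add: field_simps power2_eq_square)
      finally have "norm (bern X) * (1 + norm X) \<le> 6 / (2 + R) * (1 + 3 * R)"
        using R by (intro mult_mono) auto
      also have "\<dots> \<le> 18" using R by (simp add: field_simps)
      finally show ?thesis by (simp add: K_def)
    next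
      case False
      then have "X \<in> T" using b by (auto simp: T_def in_cbox_complex_iff)
      then have "norm (bern X) \<le> m" by (rule m)
      moreover have "norm X \<le> 3" using n b False by linarith
      ultimately have "norm (bern X) * (1 + norm X) \<le> m * 4"
        using order_trans[OF norm_ge_zero[of "bern X"]] by (intro mult_mono) auto
      then show ?thesis by (simp add: K_def)
    qed
    then show ?thesis by (simp add: field_simps add_pos_nonneg)
  qed
  then show ?thesis using that[of K] by (simp add: K_def)
qed

lemma bern_of_real: "0 < x \<Longrightarrow> bern (of_real x) = of_real (x / (exp x - 1))"
  by (simp add: bern_def exp_of_real)

lemma bern_series:
  assumes x: "0 < (x::real)"
  shows "(\<lambda>r. x * exp (- (real (Suc r) * x))) sums (x / (exp x - 1))"
proof -
  have "(\<lambda>r. exp (- x) ^ r) sums (1 / (1 - exp (- x)))"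
    by (rule geometric_sums) (use x in auto)
  then have "(\<lambda>r. (x * exp (- x)) * exp (- x) ^ r) sums ((x * exp (- x)) * (1 / (1 - exp (- x))))"
    by (rule sums_mult)
  moreover have "(x * exp (- x)) * exp (- x) ^ r = x * exp (- (real (Suc r) * x))" for r
    by (simp add: exp_of_nat_mult[symmetric] exp_add[symmetric] algebra_simps)
  moreover have "(x * exp (- x)) * (1 / (1 - exp (- x))) = x / (exp x - 1)"
    using x by (simp add: exp_minus field_simps)
  ultimately show ?thesis by simp
qed

text \<open>Scaling \<open>y\<close> by \<open>1 / sqrt b\<close> reduces this to the second moment
  of the standard Gaussian.\<close>

lemma nn_integral_square_gaussian:
  assumes b: "0 < (b::real)"
  shows "(\<integral>\<^sup>+y. ennreal (y\<^sup>2 * exp (- (b * y\<^sup>2))) * indicator {0..} y \<partial>lborel) = ennreal (sqrt pi / 4 / (b * sqrt b))"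
proof -
  have g: "(\<integral>\<^sup>+y. ennreal (y\<^sup>2 * exp (- y\<^sup>2)) * indicator {0..} y \<partial>lborel) = ennreal (sqrt pi / 4)"
  proof -
    have "has_bochner_integral lborel (\<lambda>x. indicator {0..} x *\<^sub>R (exp (- x\<^sup>2) * x ^ (2 * 1))) (sqrt pi / 2 * (fact (2 * 1) / (2 ^ (2 * 1) * fact 1)))"
      by (rule gaussian_moment_even_pos)
    then have "(\<integral>\<^sup>+x. ennreal (indicator {0..} x *\<^sub>R (exp (- x\<^sup>2) * x ^ (2 * 1))) \<partial>lborel) = ennreal (sqrt pi / 2 * (fact (2 * 1) / (2 ^ (2 * 1) * fact 1)))"
      by (intro nn_integral_eq_integral[THEN trans]) (auto simp: has_bochner_integral_iff)
    moreover have "ennreal (indicator {0..} x *\<^sub>R (exp (- x\<^sup>2) * x ^ (2 * 1))) = ennreal (x\<^sup>2 * exp (- x\<^sup>2)) * indicator {0..} x" for x :: real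
      by (simp add: indicator_def mult.commute)
    ultimately show ?thesis by simp
  qed
  define c where "c = 1 / sqrt b"
  have c: "c > 0" "b * c\<^sup>2 = 1" using b by (auto simp: c_def power_divide)
  have "(\<integral>\<^sup>+y. ennreal (y\<^sup>2 * exp (- (b * y\<^sup>2))) * indicator {0..} y \<partial>lborel) =
    ennreal \<bar>c\<bar> * (\<integral>\<^sup>+y. ennreal ((0 + c * y)\<^sup>2 * exp (- (b * (0 + c * y)\<^sup>2))) * indicator {0..} (0 + c * y) \<partial>lborel)"
    by (rule nn_integral_real_affine) (use c in auto)
  also have "(\<integral>\<^sup>+y. ennreal ((0 + c * y)\<^sup>2 * exp (- (b * (0 + c * y)\<^sup>2))) * indicator {0..} (0 + c * y) \<partial>lborel)
    = (\<integral>\<^sup>+y. ennreal (c\<^sup>2) * (ennreal (y\<^sup>2 * exp (- y\<^sup>2)) * indicator {0..} y) \<partial>lborel)"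
  proof (rule nn_integral_cong)
    fix y :: real
    have "b * (0 + c * y)\<^sup>2 = y\<^sup>2" using c(2) by (simp add: power_mult_distrib mult.assoc[symmetric])
    then show "ennreal ((0 + c * y)\<^sup>2 * exp (- (b * (0 + c * y)\<^sup>2))) * indicator {0..} (0 + c * y) =
       ennreal (c\<^sup>2) * (ennreal (y\<^sup>2 * exp (- y\<^sup>2)) * indicator {0..} y)"
      using c(1) by (auto simp: indicator_def power_mult_distrib ennreal_mult'[symmetric] zero_le_mult_iff mult.assoc)
  qed
  also have "\<dots> = ennreal (c\<^sup>2) * ennreal (sqrt pi / 4)" by (subst nn_integral_cmult) (auto simp: g)
  also have "ennreal \<bar>c\<bar> * (ennreal (c\<^sup>2) * ennreal (sqrt pi / 4)) = ennreal (c * (c\<^sup>2 * (sqrt pi / 4)))"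
    using c by (simp add: ennreal_mult'[symmetric])
  also have "c * (c\<^sup>2 * (sqrt pi / 4)) = sqrt pi / 4 / (b * sqrt b)"
    using b by (simp add: c_def power_divide)
  finally show ?thesis .
qed

lemma summable_zeta: "1 < s \<Longrightarrow> summable (\<lambda>n. 1 / real (Suc n) powr s)"
proof -
  assume "1 < s"
  then have "summable (\<lambda>n. real n powr (- s))" by (simp add: summable_real_powr_iff)
  then have "summable (\<lambda>n. real (Suc n) powr (- s))" by (subst summable_Suc_iff)
  then show ?thesis by (simp add: powr_minus_divide)
qed

text \<open>The geometric series writes the integrand as a sum of
  \<open>a * y\<^sup>2 * exp (- r * a * y\<^sup>2)\<close> over \<open>r \<ge> 1\<close>, whose
  integrals are proportional to \<open>1 / (r * sqrt r)\<close>; this is the source of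
  \<open>zeta (3/2)\<close>. All terms are nonnegative, so sum and integral commute in the extended
  reals.\<close>

lemma ray_integral_bern:
  assumes a: "0 < a"
  shows "ray_integral (\<lambda>x. bern (of_real a * x\<^sup>2)) = of_real (sqrt (pi / a) * zeta (3/2) / 4)"
proof -
  obtain h c where hc: "0 < h" "h \<le> 1" "0 < c"
    "\<And>x w s. x \<in> strip h \<Longrightarrow> w \<in> ball 1 h \<Longrightarrow> s \<in> ball 0 h \<Longrightarrow>
      w * of_real a * (x\<^sup>2 - s) \<in> cone 1 (1/2) \<and> c * (1 + (norm x)\<^sup>2) \<le> 1 + norm (w * of_real a * (x\<^sup>2 - s))"
    using quadratic_in_cone[OF a, of 1 "1/2"] by auto
  define f where "f = (\<lambda>x. bern (of_real a * x\<^sup>2))"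
  have cone: "of_real a * x\<^sup>2 \<in> cone 1 (1/2)" "c * (1 + (norm x)\<^sup>2) \<le> 1 + norm (of_real a * x\<^sup>2)" if "x \<in> strip h" for x
    using hc(4)[OF that, of 1 0] hc(1) by auto
  have holf: "f holomorphic_on strip h"
    unfolding f_def by (intro holomorphic_on_compose_gen[OF _ holomorphic_bern_cone, unfolded o_def] holomorphic_intros)
      (use cone in auto)
  obtain K where K: "K > 0" "\<And>X. X \<in> cone 1 (1/2) \<Longrightarrow> norm (bern X) \<le> K / (1 + norm X)" using bern_bound by blast
  define M where "M = K / c"
  have M: "M > 0" using K hc by (simp add: M_def)
  have cl: "(\<lambda>x. f x / of_real M) \<in> decay_class h"
  proof -
    have "norm (f x / of_real M) \<le> 1 / (1 + (norm x)\<^sup>2)" if x: "x \<in> strip h" for x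
    proof -
      have "norm (f x) \<le> K / (1 + norm (of_real a * x\<^sup>2))" unfolding f_def by (intro K cone x)
      also have "\<dots> \<le> K / (c * (1 + (norm x)\<^sup>2))"
        using K(1) hc(3) cone(2)[OF x] by (intro divide_left_mono mult_pos_pos) (auto intro: add_pos_nonneg)
      also have "\<dots> = M * (1 / (1 + (norm x)\<^sup>2))" by (simp add: M_def)
      finally show ?thesis using M by (simp add: norm_divide field_simps)
    qed
    moreover have "(\<lambda>x. f x / of_real M) holomorphic_on strip h" using holf M by (intro holomorphic_intros) auto
    ultimately show ?thesis unfolding decay_class_def by auto
  qed
  obtain F where F: "\<And>z. z \<in> strip h \<Longrightarrow> (F has_field_derivative f z / of_real M) (at z)"
    using decay_class_primitive[OF cl] by metis
  have lim: "((\<lambda>x. F (of_real x)) \<longlongrightarrow> F 0 + ray_integral (\<lambda>x. f x / of_real M)) at_top"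
    by (rule ray_integral_limit[OF cl hc(1) F])
  define b where "b = (\<lambda>y::real. Re (f (of_real y)))"
  define Fr where "Fr = (\<lambda>y::real. M * Re (F (of_real y)))"
  have JJf: "ray_integral f = of_real M * ray_integral (\<lambda>x. f x / of_real M)" by (rule ray_integral_scale(2)[OF cl M hc(1)])
  have limr: "(Fr \<longlongrightarrow> Fr 0 + Re (ray_integral f)) at_top"
    unfolding Fr_def JJf using tendsto_mult[OF tendsto_const[of M] tendsto_Re[OF lim]] by (simp add: distrib_left)
  have der: "(Fr has_real_derivative b y) (at y)" if "0 \<le> y" for y
  proof -
    have "((\<lambda>x. F (of_real x)) has_vector_derivative f (of_real y) / of_real M) (at y)"
      by (rule has_vector_derivative_real_field[OF F[OF of_real_in_strip[OF hc(1) that]]])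
    then have "((\<lambda>x. Re (F (of_real x))) has_vector_derivative Re (f (of_real y) / of_real M)) (at y)"
      by (rule bounded_linear.has_vector_derivative[OF bounded_linear_Re])
    then have "((\<lambda>x. Re (F (of_real x))) has_real_derivative Re (f (of_real y) / of_real M)) (at y)"
      by (simp add: has_real_derivative_iff_has_vector_derivative)
    from DERIV_cmult[OF this, of M] show ?thesis using M by (simp add: Fr_def b_def)
  qed
  have f_pos: "f (of_real y) = of_real (a * y\<^sup>2 / (exp (a * y\<^sup>2) - 1))" if "y \<noteq> 0" for y
    using bern_of_real[of "a * y\<^sup>2"] a that by (simp add: f_def)
  have f0: "f 0 = 1" by (simp add: f_def bern_def)
  have b_pos: "b y = a * y\<^sup>2 / (exp (a * y\<^sup>2) - 1)" if "y \<noteq> 0" for y using f_pos[OF that] by (simp add: b_def)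
  have b0: "b y \<ge> 0" for y
    by (cases "y = 0") (use a in \<open>simp_all add: b_pos, simp add: b_def f0\<close>)
  have beq: "b = (\<lambda>y. if y = 0 then 1 else a * y\<^sup>2 / (exp (a * y\<^sup>2) - 1))"
    using b_pos f0 by (auto simp: b_def)
  have [measurable]: "b \<in> borel_measurable borel" unfolding beq by measurable
  \<comment> \<open>The integrand is real on the ray, so it is enough to compute the real
    part.\<close>
  have cong: "ray_integral f = of_real (Re (ray_integral f))"
  proof -
    have "((\<lambda>x. Im (integral {0..x} (\<lambda>y. f (of_real y)))) \<longlongrightarrow> Im (ray_integral f)) at_top"
      by (intro tendsto_Im ray_integral_scale(1)[OF cl M hc(1)])
    moreover have "Im (integral {0..x} (\<lambda>y. f (of_real y))) = 0" for x :: real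
    proof -
      have "f (of_real y) = of_real (b y)" for y
        by (cases "y = 0") (use f_pos f0 in \<open>auto simp: b_def\<close>)
      moreover have "integral {0..x} (\<lambda>y. complex_of_real (b y)) \<in> \<real>"
      proof (cases "(\<lambda>y. complex_of_real (b y)) integrable_on {0..x}")
        case True
        then have "b integrable_on {0..x}" using integrable_linear[OF True bounded_linear_Re] by (simp add: o_def)
        then have "integral {0..x} (complex_of_real \<circ> b) = complex_of_real (integral {0..x} b)"
          by (rule integral_linear[OF _ bounded_linear_of_real])
        then show ?thesis by (simp add: o_def)
      qed (simp add: not_integrable_integral)
      ultimately show ?thesis by (simp add: complex_is_Real_iff)
    qed
    ultimately have "Im (ray_integral f) = 0" by (simp add: tendsto_const_iff)
    then show ?thesis by (simp add: complex_eq_iff)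
  qed
  have "(\<integral>\<^sup>+y. ennreal (b y) * indicator {0..} y \<partial>lborel) = ennreal (Fr 0 + Re (ray_integral f) - Fr 0)"
    by (rule nn_integral_FTC_atLeast[OF _ der b0 limr]) auto
  then have 1: "(\<integral>\<^sup>+y. ennreal (b y) * indicator {0..} y \<partial>lborel) = ennreal (Re (ray_integral f))" by simp
  have Re0: "Re (ray_integral f) \<ge> 0"
  proof (rule tendsto_lowerbound)
    show "((\<lambda>x. Fr x - Fr 0) \<longlongrightarrow> Re (ray_integral f)) at_top" using tendsto_diff[OF limr tendsto_const[of "Fr 0"]] by simp
    show "\<forall>\<^sub>F x in at_top. 0 \<le> Fr x - Fr 0"
      using eventually_ge_at_top[of "0::real"]
      by eventually_elim (use DERIV_nonneg_imp_nondecreasing[of 0 _ Fr] der b0 in auto)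
  qed simp
  define u where "u = (\<lambda>r::nat. \<lambda>y::real. a * (y\<^sup>2 * exp (- ((real (Suc r) * a) * y\<^sup>2))))"
  have "(\<integral>\<^sup>+y. ennreal (b y) * indicator {0..} y \<partial>lborel) = (\<integral>\<^sup>+y. (\<Sum>r. ennreal (u r y) * indicator {0..} y) \<partial>lborel)"
  proof (rule nn_integral_cong_AE)
    \<comment> \<open>At \<open>y = 0\<close> the series sums to \<open>0\<close> although
      \<open>bern 0 = 1\<close>; a single point is negligible.\<close>
    have "AE y in lborel. y \<noteq> (0::real)" by (rule AE_lborel_singleton)
    then show "AE y in lborel. ennreal (b y) * indicator {0..} y = (\<Sum>r. ennreal (u r y) * indicator {0..} y)"
    proof eventually_elim
      case (elim y)
      have "(\<lambda>r. a * y\<^sup>2 * exp (- (real (Suc r) * (a * y\<^sup>2)))) sums b y"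
        unfolding b_pos[OF elim] by (rule bern_series) (use a elim in auto)
      then have s: "(\<lambda>r. u r y) sums b y" by (simp add: u_def mult.assoc)
      have "(\<Sum>r. ennreal (u r y)) = ennreal (b y)"
        using s a by (intro sums_unique[symmetric] , subst sums_ennreal) (auto simp: u_def b0)
      then show ?case by simp
    qed
  qed
  also have "\<dots> = (\<Sum>r. \<integral>\<^sup>+y. ennreal (u r y) * indicator {0..} y \<partial>lborel)"
    by (rule nn_integral_suminf) (simp add: u_def)
  also have "\<dots> = (\<Sum>r. ennreal (sqrt (pi / a) / 4 * (1 / real (Suc r) powr (3/2))))"
  proof (rule suminf_cong)
    fix r
    define B where "B = real (Suc r) * a"
    have B: "B > 0" using a by (simp add: B_def)
    have "(\<integral>\<^sup>+y. ennreal (u r y) * indicator {0..} y \<partial>lborel) = (\<integral>\<^sup>+y. ennreal a * (ennreal (y\<^sup>2 * exp (- (B * y\<^sup>2))) * indicator {0..} y) \<partial>lborel)"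
      unfolding u_def B_def using a by (simp add: ennreal_mult' mult.assoc)
    also have "\<dots> = ennreal a * ennreal (sqrt pi / 4 / (B * sqrt B))"
      by (subst nn_integral_cmult) (auto simp: nn_integral_square_gaussian[OF B])
    also have "\<dots> = ennreal (a * (sqrt pi / 4 / (B * sqrt B)))" using a by (intro ennreal_mult'[symmetric]) simp
    also have "a * (sqrt pi / 4 / (B * sqrt B)) = sqrt (pi / a) / 4 * (1 / real (Suc r) powr (3/2))"
    proof -
      have "real (Suc r) powr (3/2) = real (Suc r) powr (1 + 1/2)" by simp
      also have "\<dots> = real (Suc r) * sqrt (real (Suc r))"
        unfolding powr_add by (simp add: powr_half_sqrt)
      finally have p: "real (Suc r) powr (3/2) = real (Suc r) * sqrt (real (Suc r))" .
      show ?thesis unfolding p B_def real_sqrt_mult real_sqrt_divide using a by (simp add: field_simps del: of_nat_Suc)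
    qed
    finally show "(\<integral>\<^sup>+y. ennreal (u r y) * indicator {0..} y \<partial>lborel) = ennreal (sqrt (pi / a) / 4 * (1 / real (Suc r) powr (3/2)))" .
  qed
  also have "\<dots> = ennreal (\<Sum>r. sqrt (pi / a) / 4 * (1 / real (Suc r) powr (3/2)))"
  proof (rule suminf_ennreal2)
    show "0 \<le> sqrt (pi / a) / 4 * (1 / real (Suc r) powr (3/2))" for r using a by simp
    show "summable (\<lambda>r. sqrt (pi / a) / 4 * (1 / real (Suc r) powr (3/2)))"
      by (intro summable_mult summable_zeta) simp
  qed
  also have "(\<Sum>r. sqrt (pi / a) / 4 * (1 / real (Suc r) powr (3/2))) = sqrt (pi / a) / 4 * zeta (3/2)"
    unfolding zeta_def by (rule suminf_mult[OF summable_zeta]) simp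
  finally have "ennreal (Re (ray_integral f)) = ennreal (sqrt (pi / a) / 4 * zeta (3/2))" using 1 by simp
  moreover have "0 \<le> sqrt (pi / a) / 4 * zeta (3/2)"
    unfolding zeta_def using a by (intro mult_nonneg_nonneg suminf_nonneg summable_zeta) auto
  ultimately have "Re (ray_integral f) = sqrt (pi / a) / 4 * zeta (3/2)" using Re0 by simp
  then have "ray_integral f = of_real (sqrt (pi / a) / 4 * zeta (3/2))" using cong by (simp only:)
  then show ?thesis unfolding f_def by simp
qed

section \<open>The constant term\<close>

text \<open>\<open>log_factor X - ln (1 + 1 / X)\<close> with its removable singularity at \<open>0\<close> filled in: it decays at infinity, so that
  Euler--Maclaurin summation applies to it, and the sum of the logarithms is an explicit product.\<close>

definition reg_log_factor :: "complex \<Rightarrow> complex" where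
  "reg_log_factor X = - Ln ((1 + X) * (if X = 0 then 1 else (1 - exp (- X)) / X))"

text \<open>The argument of the logarithm is positive on the nonnegative axis, so its real part
  stays positive near the compact segment from \<open>0\<close> to \<open>4\<close>; beyond that it
  differs from \<open>1\<close> by \<open>O(1 / Re X)\<close> and by less than \<open>1 / 2\<close>.
  A narrow cone therefore avoids the branch cut throughout.\<close>

lemma reg_log_factor_cone:
  obtains \<theta> \<delta> K where "0 < \<theta>" "0 < \<delta>" "0 < K" "reg_log_factor holomorphic_on cone \<theta> \<delta>"
    "\<And>X. X \<in> cone \<theta> \<delta> \<Longrightarrow> norm (reg_log_factor X) \<le> K / (1 + norm X)"
proof -
  define Y where "Y = (\<lambda>X::complex. (1 + X) * (if X = 0 then 1 else (1 - exp (- X)) / X))"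
  have holY: "Y holomorphic_on UNIV"
  proof -
    have "((\<lambda>X::complex. 1 - exp (- X)) has_field_derivative 1) (at 0)"
      by (auto intro!: derivative_eq_intros)
    then have "((\<lambda>X::complex. (1 - exp (- X)) / X) \<longlongrightarrow> 1) (at 0)"
      by (simp add: has_field_derivative_iff)
    then have "(\<lambda>X. if X = 0 then 1 else (1 - exp (- X)) / X) holomorphic_on (UNIV::complex set)"
      by (intro removable_singularity) (auto intro!: holomorphic_intros)
    then show ?thesis unfolding Y_def by (intro holomorphic_on_mult) (auto intro!: holomorphic_intros)
  qed
  define U where "U = {X. 0 < Re (Y X)}"
  have "open U"
    unfolding U_def
    by (intro open_Collect_less continuous_intros holomorphic_on_imp_continuous_on holY)
  have pos: "0 < Re (Y (of_real x))" if "0 \<le> x" for x :: real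
  proof (cases "x = 0")
    case False
    then have "Y (of_real x) = of_real ((1 + x) * ((1 - exp (- x)) / x))"
      by (simp add: Y_def exp_of_real[symmetric])
    then show ?thesis using that False by simp
  qed (simp add: Y_def)
  define S where "S = complex_of_real ` {0..4}"
  have "compact S" unfolding S_def by (intro compact_continuous_image continuous_intros) auto
  moreover have "S \<subseteq> U" using pos by (auto simp: S_def U_def)
  ultimately obtain \<epsilon> where \<epsilon>: "\<epsilon> > 0" "(\<Union>x\<in>S. ball x \<epsilon>) \<subseteq> U"
    using compact_subset_open_imp_ball_epsilon_subset \<open>open U\<close> by metis
  define d where "d = min (\<epsilon> / 4) (1/2)"
  have d: "0 < d" "d \<le> 1/2" "d + d < \<epsilon>" using \<epsilon>(1) by (auto simp: d_def min_def)
  define T where "T = cbox (Complex (- d) (- d)) (Complex 4 d)"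
  have TU: "T \<subseteq> U"
  proof
    fix X assume X: "X \<in> T"
    then have b: "- d \<le> Re X" "Re X \<le> 4" "\<bar>Im X\<bar> \<le> d" by (auto simp: T_def in_cbox_complex_iff)
    define x where "x = max 0 (Re X)"
    have x: "complex_of_real x \<in> S" using b by (auto simp: S_def x_def)
    have "norm (of_real x - X) \<le> \<bar>Re (of_real x - X)\<bar> + \<bar>Im (of_real x - X)\<bar>" by (rule cmod_le)
    also have "\<dots> \<le> d + d" using b by (intro add_mono) (auto simp: x_def)
    also have "\<dots> < \<epsilon>" by (rule d)
    finally have "X \<in> ball (of_real x) \<epsilon>" by (simp add: dist_norm)
    then show "X \<in> U" using x \<epsilon>(2) by blast
  qed
  have hol_U: "reg_log_factor holomorphic_on U"
  proof -
    have "Y X \<notin> \<real>\<^sub>\<le>\<^sub>0" if "X \<in> U" for X using that by (auto simp: U_def complex_nonpos_Reals_iff)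
    then have "(\<lambda>X. - Ln (Y X)) holomorphic_on U"
      by (intro holomorphic_intros holomorphic_on_subset[OF holY]) auto
    then show ?thesis by (simp add: reg_log_factor_def[abs_def] Y_def)
  qed
  have "compact (reg_log_factor ` T)"
    unfolding T_def
    by (intro compact_continuous_image holomorphic_on_imp_continuous_on holomorphic_on_subset[OF hol_U])
       (use TU in \<open>auto simp: T_def\<close>)
  then obtain m where m: "\<And>X. X \<in> T \<Longrightarrow> norm (reg_log_factor X) \<le> m"
    using compact_imp_bounded bounded_iff by (metis imageI)
  \<comment> \<open>Over \<open>Re X \<le> 4\<close> the cone has half-width at most
    \<open>5 * \<theta> = d\<close> and stays inside the rectangle \<open>T\<close>.\<close>
  define \<theta> where "\<theta> = d / 5"
  have \<theta>: "0 < \<theta>" "\<theta> \<le> 1/10" using d by (auto simp: \<theta>_def)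
  define K where "K = max 18 (6 * m)"
  have large: "Re (Y X) > 0 \<and> norm (reg_log_factor X) \<le> 6 / Re X" if X: "Re X > 4" for X
  proof -
    define R where "R = Re X"
    have R: "R > 4" "R \<le> norm X" using X complex_Re_le_cmod by (auto simp: R_def)
    have X0: "X \<noteq> 0" using X by auto
    have "Y X - 1 = 1 / X - exp (- X) * (1 + 1 / X)"
      using X0 by (simp add: Y_def field_simps)
    also have "norm \<dots> \<le> norm (1 / X) + norm (exp (- X)) * norm (1 + 1 / X)"
      by (metis norm_mult norm_triangle_ineq4)
    also have "norm (1 / X) \<le> 1 / R" unfolding norm_divide norm_one using R by (intro divide_left_mono mult_pos_pos) auto
    also have "norm (1 + 1 / X) \<le> 2"
    proof -
      have "norm (1 / X) \<le> 1 / R" unfolding norm_divide norm_one using R by (intro divide_left_mono mult_pos_pos) auto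
      also have "\<dots> \<le> 1" using R by simp
      finally show ?thesis using norm_triangle_ineq[of 1 "1 / X"] by simp
    qed
    also have "norm (exp (- X)) \<le> 1 / (R * 3)"
    proof -
      have "4 * R \<le> R * R" using R by (intro mult_right_mono) auto
      then have "R * 3 \<le> 1 + R + R\<^sup>2 / 2" by (simp add: power2_eq_square)
      also have "\<dots> \<le> exp R" by (rule exp_lower_Taylor_quadratic) (use R in simp)
      finally have "1 / exp R \<le> 1 / (R * 3)" using R by (intro divide_left_mono) auto
      then show ?thesis by (simp add: R_def exp_minus inverse_eq_divide norm_divide)
    qed
    finally have 1: "norm (Y X - 1) \<le> 1 / R + 1 / (R * 3) * 2" by simp
    also have "\<dots> < 1 / 2" using R by (simp add: field_simps)
    finally have h: "norm (Y X - 1) < 1/2" .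
    have "norm (Ln (1 + (Y X - 1))) \<le> 2 * norm (Y X - 1)" by (rule norm_Ln_le[OF h])
    also have "\<dots> \<le> 6 / R" using 1 R by (simp add: field_simps)
    finally have "norm (reg_log_factor X) \<le> 6 / R" by (simp add: reg_log_factor_def Y_def)
    moreover have "Re (Y X) > 0" using h abs_Re_le_cmod[of "Y X - 1"] by simp
    ultimately show ?thesis by (simp add: R_def)
  qed
  have cb: "- d < Re X \<and> \<bar>Im X\<bar> < \<theta> * (Re X + d) \<and> (Re X \<le> 4 \<longrightarrow> X \<in> T)" if "X \<in> cone \<theta> d" for X
  proof -
    have i: "\<bar>Im X\<bar> < \<theta> * (Re X + d)" using that by (simp add: cone_def)
    then have "0 < \<theta> * (Re X + d)" by linarith
    then have r: "- d < Re X" using \<theta>(1) by (simp add: zero_less_mult_iff)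
    have "X \<in> T" if "Re X \<le> 4"
    proof -
      have "\<theta> * (Re X + d) \<le> \<theta> * 5" using that d \<theta> by (intro mult_left_mono) auto
      then have "\<bar>Im X\<bar> < d" using i by (simp add: \<theta>_def)
      then show ?thesis using that r by (auto simp: T_def in_cbox_complex_iff)
    qed
    with i r show ?thesis by blast
  qed
  have sub: "cone \<theta> d \<subseteq> U"
  proof
    fix X assume X: "X \<in> cone \<theta> d"
    show "X \<in> U" using cb[OF X] TU large[of X] by (cases "Re X \<le> 4") (auto simp: U_def)
  qed
  show ?thesis
  proof (rule that[OF \<theta>(1) d(1), of K])
    show "0 < K" by (simp add: K_def)
    show "reg_log_factor holomorphic_on cone \<theta> d" by (rule holomorphic_on_subset[OF hol_U sub])
    fix X assume X: "X \<in> cone \<theta> d"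
    note c = cb[OF X]
    have n: "norm X \<le> \<bar>Re X\<bar> + \<bar>Im X\<bar>" by (rule cmod_le)
    have "norm (reg_log_factor X) * (1 + norm X) \<le> K"
    proof (cases "Re X \<le> 4")
      case True
      then have XT: "X \<in> T" using c by blast
      then have "\<bar>Im X\<bar> \<le> d" by (auto simp: T_def in_cbox_complex_iff)
      then have "norm X \<le> 5" using n True c d by linarith
      then have "norm (reg_log_factor X) * (1 + norm X) \<le> m * 6"
        using order_trans[OF norm_ge_zero m[OF XT]] m[OF XT] by (intro mult_mono) auto
      then show ?thesis by (simp add: K_def)
    next
      case False
      define R where "R = Re X"
      have R: "R > 4" using False by (simp add: R_def)
      have "\<bar>R\<bar> = R" using R by simp
      have "\<theta> * (R + d) \<le> (1/10) * (R + d)" using \<theta> R d by (intro mult_right_mono) auto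
      then have "\<bar>Im X\<bar> < (1/10) * (R + d)"
        using c[THEN conjunct2, THEN conjunct1] unfolding R_def[symmetric] by (rule less_le_trans[rotated])
      moreover have "norm X \<le> R + \<bar>Im X\<bar>" using n \<open>\<bar>R\<bar> = R\<close> by (simp only: R_def)
      ultimately have "norm X \<le> R + (1/10 * R + 1/10 * d)" by (simp only: distrib_left)
      then have "1 + norm X \<le> 3 * R" using R d by linarith
      then have "norm (reg_log_factor X) * (1 + norm X) \<le> 6 / R * (3 * R)"
        using large[of X] R by (intro mult_mono) (auto simp: R_def)
      then show ?thesis using R by (simp add: K_def)
    qed
    then show "norm (reg_log_factor X) \<le> K / (1 + norm X)" by (simp add: field_simps add_pos_nonneg)
  qed
qed

lemma reg_log_factor_0: "reg_log_factor 0 = 0"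
  by (simp add: reg_log_factor_def)

lemma reg_log_factor_of_real:
  assumes x: "0 < x"
  shows "reg_log_factor (of_real x) = of_real (- ln (1 - exp (- x)) - ln (1 + 1 / x))"
proof -
  have 1: "(1 + complex_of_real x) * ((1 - exp (- complex_of_real x)) / complex_of_real x) = of_real ((1 - exp (- x)) * (1 + 1 / x))"
    using x by (simp add: exp_of_real[symmetric] field_simps)
  have 2: "0 < (1 - exp (- x)) * (1 + 1 / x)" using x by (simp add: add_pos_pos)
  have 3: "ln ((1 - exp (- x)) * (1 + 1 / x)) = ln (1 - exp (- x)) + ln (1 + 1 / x)"
    using x by (intro ln_mult_pos) (auto simp: add_pos_pos)
  have "reg_log_factor (of_real x) = - Ln (of_real ((1 - exp (- x)) * (1 + 1 / x)))"
    using x unfolding reg_log_factor_def 1[symmetric] by simp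
  also have "\<dots> = - of_real (ln ((1 - exp (- x)) * (1 + 1 / x)))" by (simp only: Ln_of_real[OF 2])
  finally show ?thesis unfolding 3 by simp
qed

section \<open>Products over quadratic sequences\<close>

lemma summable_inverse_shifted_quadratic:
  assumes c: "-1 < (c::real)"
  shows "summable (\<lambda>m. 1 / (real (Suc m) * (real (Suc m) + c)))"
proof -
  \<comment> \<open>Gives \<open>k + c \<ge> d * k\<close> for all \<open>k \<ge> 1\<close>, also
    for negative \<open>c\<close>.\<close>
  define d where "d = min 1 (1 + c)"
  have d: "d > 0" using c by (simp add: d_def)
  have "summable (\<lambda>m. 1 / real m ^ 2)" using inverse_power_summable[of 2, where 'a = real] by (simp add: inverse_eq_divide)
  then have "summable (\<lambda>m. 1 / real (Suc m) ^ 2)" by (subst summable_Suc_iff)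
  then have s: "summable (\<lambda>m. 1 / d * (1 / real (Suc m) ^ 2))" by (rule summable_mult)
  show ?thesis
  proof (rule summable_comparison_test'[OF s, where N = 0])
    fix m :: nat
    define k where "k = real (Suc m)"
    have k: "k \<ge> 1" by (simp add: k_def)
    have "d * k \<le> k + c"
    proof (cases "c \<ge> 0")
      case True
      then show ?thesis using k d by (simp add: d_def)
    next
      case False
      then have "k * c \<le> 1 * c" using k by (intro mult_right_mono_neg) auto
      then show ?thesis using False by (simp add: d_def algebra_simps)
    qed
    then have "d * k ^ 2 \<le> k * (k + c)" using k by (simp add: power2_eq_square mult.left_commute)
    moreover have "0 < d * k ^ 2" using d k by simp
    ultimately have "1 / (k * (k + c)) \<le> 1 / (d * k ^ 2)" by (intro divide_left_mono) (auto intro: mult_pos_pos)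
    moreover have "k * (k + c) > 0" using k c by simp
    ultimately show "norm (1 / (real (Suc m) * (real (Suc m) + c))) \<le> 1 / d * (1 / real (Suc m) ^ 2)"
      unfolding k_def[symmetric] by simp
  qed
qed

text \<open>The product formula of the sine, taken at the imaginary argument
  \<open>\<i> * Y\<close>.\<close>

lemma sinh_product:
  assumes Y: "0 < (Y::real)"
  shows "(\<lambda>M. \<Sum>m<M. ln (1 + Y\<^sup>2 / (real (Suc m))\<^sup>2)) \<longlonglongrightarrow> ln (sinh (pi * Y) / (pi * Y))"
proof -
  have "(\<lambda>n. of_real pi * (\<i> * of_real Y) * (\<Prod>k=1..n. 1 - (\<i> * of_real Y)\<^sup>2 / of_nat k ^ 2)) \<longlonglongrightarrow> sin (of_real pi * (\<i> * of_real Y))"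
    by (rule sin_product_formula_complex)
  also have "sin (of_real pi * (\<i> * of_real Y)) = \<i> * of_real (sinh (pi * Y))"
  proof -
    have "sin (\<i> * of_real x) = \<i> * of_real (sinh x)" for x
      by (simp add: sin_exp_eq sinh_field_def exp_of_real[symmetric] exp_minus) (simp add: algebra_simps)
    from this[of "pi * Y"] show ?thesis by (simp add: mult_ac)
  qed
  also have "(\<lambda>n. of_real pi * (\<i> * of_real Y) * (\<Prod>k=1..n. 1 - (\<i> * complex_of_real Y)\<^sup>2 / of_nat k ^ 2)) =
     (\<lambda>n. \<i> * of_real (pi * Y * (\<Prod>m<n. 1 + Y\<^sup>2 / (real (Suc m))\<^sup>2)))"
  proof
    fix n
    have "(\<Prod>k=1..n. 1 - (\<i> * complex_of_real Y)\<^sup>2 / of_nat k ^ 2) = (\<Prod>m<n. 1 - (\<i> * complex_of_real Y)\<^sup>2 / of_nat (Suc m) ^ 2)"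
      by (rule prod.reindex_bij_witness[of _ Suc "\<lambda>k. k - 1"]) auto
    also have "\<dots> = of_real (\<Prod>m<n. 1 + Y\<^sup>2 / (real (Suc m))\<^sup>2)"
      by (simp add: power_mult_distrib)
    finally show "of_real pi * (\<i> * of_real Y) * (\<Prod>k=1..n. 1 - (\<i> * complex_of_real Y)\<^sup>2 / of_nat k ^ 2) = \<i> * of_real (pi * Y * (\<Prod>m<n. 1 + Y\<^sup>2 / (real (Suc m))\<^sup>2))"
      by simp
  qed
  finally have "(\<lambda>n. Im (\<i> * of_real (pi * Y * (\<Prod>m<n. 1 + Y\<^sup>2 / (real (Suc m))\<^sup>2)))) \<longlonglongrightarrow> Im (\<i> * of_real (sinh (pi * Y)))"
    by (rule tendsto_Im)
  then have "(\<lambda>n. pi * Y * (\<Prod>m<n. 1 + Y\<^sup>2 / (real (Suc m))\<^sup>2)) \<longlonglongrightarrow> sinh (pi * Y)"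
    by (simp only: Im_i_times Re_complex_of_real)
  from tendsto_divide[OF this tendsto_const[of "pi * Y"]]
  have "(\<lambda>n. \<Prod>m<n. 1 + Y\<^sup>2 / (real (Suc m))\<^sup>2) \<longlonglongrightarrow> sinh (pi * Y) / (pi * Y)" using Y by simp
  then have "(\<lambda>n. ln (\<Prod>m<n. 1 + Y\<^sup>2 / (real (Suc m))\<^sup>2)) \<longlonglongrightarrow> ln (sinh (pi * Y) / (pi * Y))"
    by (rule tendsto_ln) (use Y in simp)
  moreover have "ln (\<Prod>m<n. 1 + Y\<^sup>2 / (real (Suc m))\<^sup>2) = (\<Sum>m<n. ln (1 + Y\<^sup>2 / (real (Suc m))\<^sup>2))" for n
  proof (rule ln_prod)
    fix i
    have "0 < 1 + Y\<^sup>2 / (real (Suc i))\<^sup>2" by (simp add: add_pos_nonneg)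
    then show "1 + Y\<^sup>2 / (real (Suc i))\<^sup>2 \<noteq> 0" by simp
  qed simp
  ultimately show ?thesis by simp
qed

text \<open>Gauss's limit formula in logarithmic form: the Pochhammer symbol of \<open>1 + c\<close>
  is \<open>fact n\<close> times the product of the \<open>1 + c / real (Suc m)\<close>.\<close>

lemma ln_Gamma_product:
  assumes c: "-1 < (c::real)"
  shows "(\<lambda>M. c * ln (real M) - (\<Sum>m<M. ln (1 + c / real (Suc m)))) \<longlonglongrightarrow> ln (Gamma (1 + c))"
proof -
  have "Gamma_series' (1 + c) \<longlonglongrightarrow> Gamma (1 + c)" by (rule Gamma_series'_LIMSEQ)
  then have "(\<lambda>n. ln (Gamma_series' (1 + c) n)) \<longlonglongrightarrow> ln (Gamma (1 + c))"
    by (rule tendsto_ln) (rule less_imp_neq[symmetric], rule Gamma_real_pos, use c in simp)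
  moreover have "\<forall>\<^sub>F n in sequentially. ln (Gamma_series' (1 + c) n) = c * ln (real n) - (\<Sum>m<n. ln (1 + c / real (Suc m)))"
    using eventually_gt_at_top[of 0]
  proof eventually_elim
    case (elim n)
    have pos: "0 < 1 + c / real (Suc m)" for m
    proof -
      have "0 < (real (Suc m) + c) / real (Suc m)" using c by (intro divide_pos_pos) auto
      then show ?thesis by (simp add: add_divide_distrib)
    qed
    have "pochhammer (1 + c) n = (\<Prod>m<n. real (Suc m) * (1 + c / real (Suc m)))"
      unfolding pochhammer_prod by (intro prod.cong) (auto simp: field_simps lessThan_atLeast0)
    also have "\<dots> = fact n * (\<Prod>m<n. 1 + c / real (Suc m))"
      unfolding prod.distrib by (simp add: fact_prod_Suc lessThan_atLeast0)
    finally have "Gamma_series' (1 + c) n = fact (n - 1) * exp ((1 + c) * ln (real n)) / (fact n * (\<Prod>m<n. 1 + c / real (Suc m)))"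
      by (simp add: Gamma_series'_def)
    also have "fact n = real n * fact (n - 1)" using elim by (simp add: fact_reduce)
    also have "exp ((1 + c) * ln (real n)) = real n * exp (c * ln (real n))"
      using elim by (simp add: distrib_right exp_add)
    also have "fact (n - 1) * (real n * exp (c * ln (real n))) / (real n * fact (n - 1) * (\<Prod>m<n. 1 + c / real (Suc m))) =
      exp (c * ln (real n)) / (\<Prod>m<n. 1 + c / real (Suc m))" using elim by simp
    finally show ?case
      using pos by (simp add: ln_div prod_pos ln_prod less_imp_neq[OF pos, symmetric] del: of_nat_Suc)
  qed
  ultimately show ?thesis by (rule Lim_transform_eventually)
qed

text \<open>Each logarithm is close to \<open>c * k / (k\<^sup>2 + Y\<^sup>2)\<close>, and this is
  close to the increment of \<open>c * g\<close> over one step, so the sum nearly telescopes. Both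
  errors are bounded by multiples of \<open>1 / (m\<^sup>2 + Y\<^sup>2)\<close>, which sum to
  \<open>O(1 / Y)\<close> uniformly in \<open>M\<close>.\<close>

lemma log_correction_bound:
  fixes c Y :: real
  assumes Y: "1 \<le> Y" "\<bar>c\<bar> \<le> Y"
  shows "\<bar>(\<Sum>m<M. ln (1 + c * real (Suc m) / ((real (Suc m))\<^sup>2 + Y\<^sup>2))) - c / 2 * ln (((real M)\<^sup>2 + Y\<^sup>2) / Y\<^sup>2)\<bar> \<le> (2 * c\<^sup>2 + \<bar>c\<bar>) * (3 / Y)"
proof -
  define g where "g = (\<lambda>x::real. ln (x\<^sup>2 + Y\<^sup>2) / 2)"
  have p: "0 < x\<^sup>2 + Y\<^sup>2" for x :: real using Y by (intro add_nonneg_pos) auto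
  have Y0: "Y \<noteq> 0" using Y by auto
  have g': "(g has_real_derivative x / (x\<^sup>2 + Y\<^sup>2)) (at x)" for x
    unfolding g_def using p[of x] Y0 by (auto intro!: derivative_eq_intros simp: field_simps)
  have g'': "((\<lambda>x. x / (x\<^sup>2 + Y\<^sup>2)) has_real_derivative (Y\<^sup>2 - x\<^sup>2) / (x\<^sup>2 + Y\<^sup>2)\<^sup>2) (at x)" for x
    using p[of x] Y0 by (auto intro!: derivative_eq_intros simp: power2_eq_square)
  have trm: "\<bar>ln (1 + c * real (Suc m) / ((real (Suc m))\<^sup>2 + Y\<^sup>2)) - c * (g (real (Suc m)) - g (real m))\<bar> \<le> (2 * c\<^sup>2 + \<bar>c\<bar>) * (1 / ((real m)\<^sup>2 + Y\<^sup>2))" for m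
  proof -
    define k where "k = real (Suc m)"
    define x where "x = c * k / (k\<^sup>2 + Y\<^sup>2)"
    have k: "k \<ge> 1" "real m = k - 1" by (auto simp: k_def)
    have mk: "(real m)\<^sup>2 \<le> k\<^sup>2" using k by (intro power_mono) auto
    have "\<bar>x\<bar> = \<bar>c\<bar> * k / (k\<^sup>2 + Y\<^sup>2)" using k p[of k] by (simp add: x_def abs_mult)
    also have "\<dots> \<le> Y * k / (k\<^sup>2 + Y\<^sup>2)" using Y k p[of k] by (intro divide_right_mono mult_right_mono) auto
    also have "\<dots> \<le> 1/2" using sum_squares_bound[of k Y] p[of k] by (simp add: field_simps)
    finally have "\<bar>ln (1 + x) - x\<bar> \<le> 2 * x\<^sup>2" by (rule abs_ln_one_plus_x_minus_x_bound)
    also have "x\<^sup>2 = c\<^sup>2 * (k\<^sup>2 / (k\<^sup>2 + Y\<^sup>2) / (k\<^sup>2 + Y\<^sup>2))" by (simp add: x_def power_divide power_mult_distrib power2_eq_square)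
    also have "k\<^sup>2 / (k\<^sup>2 + Y\<^sup>2) \<le> 1" using p[of k] by simp
    then have "c\<^sup>2 * (k\<^sup>2 / (k\<^sup>2 + Y\<^sup>2) / (k\<^sup>2 + Y\<^sup>2)) \<le> c\<^sup>2 * (1 / (k\<^sup>2 + Y\<^sup>2))"
      using p[of k] by (intro mult_left_mono divide_right_mono) auto
    also have "\<dots> \<le> c\<^sup>2 * (1 / ((real m)\<^sup>2 + Y\<^sup>2))"
      using p[of k] p[of "real m"] mk by (intro mult_left_mono divide_left_mono) auto
    finally have 1: "\<bar>ln (1 + x) - x\<bar> \<le> 2 * c\<^sup>2 * (1 / ((real m)\<^sup>2 + Y\<^sup>2))" by simp
    \<comment> \<open>The mean value theorem is used twice: to write the increment of
      \<open>g\<close> as its derivative at \<open>\<xi>\<close>, and to compare that derivative at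
      \<open>\<xi>\<close> and at \<open>k\<close>.\<close>
    obtain \<xi> where \<xi>: "real m < \<xi>" "\<xi> < k" "g k - g (real m) = (k - real m) * (\<xi> / (\<xi>\<^sup>2 + Y\<^sup>2))"
      using MVT2[of "real m" k g "\<lambda>x. x / (x\<^sup>2 + Y\<^sup>2)"] g' k by auto
    obtain \<zeta> where \<zeta>: "\<xi> < \<zeta>" "\<zeta> < k" "k / (k\<^sup>2 + Y\<^sup>2) - \<xi> / (\<xi>\<^sup>2 + Y\<^sup>2) = (k - \<xi>) * ((Y\<^sup>2 - \<zeta>\<^sup>2) / (\<zeta>\<^sup>2 + Y\<^sup>2)\<^sup>2)"
      using MVT2[of \<xi> k "\<lambda>x. x / (x\<^sup>2 + Y\<^sup>2)" "\<lambda>x. (Y\<^sup>2 - x\<^sup>2) / (x\<^sup>2 + Y\<^sup>2)\<^sup>2"] g'' \<xi> by auto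
    have "\<bar>k / (k\<^sup>2 + Y\<^sup>2) - \<xi> / (\<xi>\<^sup>2 + Y\<^sup>2)\<bar> \<le> 1 * (1 / ((real m)\<^sup>2 + Y\<^sup>2))"
    proof -
      have "\<bar>(Y\<^sup>2 - \<zeta>\<^sup>2) / (\<zeta>\<^sup>2 + Y\<^sup>2)\<^sup>2\<bar> = \<bar>Y\<^sup>2 - \<zeta>\<^sup>2\<bar> / (\<zeta>\<^sup>2 + Y\<^sup>2) / (\<zeta>\<^sup>2 + Y\<^sup>2)"
        using p[of \<zeta>] by (simp add: power2_eq_square)
      also have "\<dots> \<le> 1 / (\<zeta>\<^sup>2 + Y\<^sup>2)"
        using p[of \<zeta>] by (intro divide_right_mono) (auto simp: abs_le_iff)
      also have "\<dots> \<le> 1 / ((real m)\<^sup>2 + Y\<^sup>2)"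
        using \<xi> \<zeta> p[of \<zeta>] p[of "real m"] by (intro divide_left_mono add_right_mono power_mono) auto
      finally show ?thesis unfolding \<zeta>(3) abs_mult using \<xi> \<zeta> k by (intro mult_mono) auto
    qed
    then have "\<bar>c\<bar> * \<bar>k / (k\<^sup>2 + Y\<^sup>2) - \<xi> / (\<xi>\<^sup>2 + Y\<^sup>2)\<bar> \<le> \<bar>c\<bar> * (1 / ((real m)\<^sup>2 + Y\<^sup>2))" by (intro mult_left_mono) auto
    moreover have "x - c * (g k - g (real m)) = c * (k / (k\<^sup>2 + Y\<^sup>2) - \<xi> / (\<xi>\<^sup>2 + Y\<^sup>2))"
    proof -
      have "k - real m = 1" using k by simp
      then show ?thesis unfolding \<xi>(3) by (simp add: x_def right_diff_distrib)
    qed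
    ultimately have 2: "\<bar>x - c * (g k - g (real m))\<bar> \<le> \<bar>c\<bar> * (1 / ((real m)\<^sup>2 + Y\<^sup>2))" by (simp only: abs_mult)
    show ?thesis using 1 2 unfolding k_def[symmetric] x_def[symmetric] distrib_right by linarith
  qed
  have "(\<Sum>m<M. 1 / ((real m)\<^sup>2 + Y\<^sup>2)) \<le> 3 / Y"
  proof -
    have t: "0 < 1 / Y" "1 / Y \<le> 1" using Y by auto
    have eq: "1 / ((real m)\<^sup>2 + Y\<^sup>2) = 1 / Y * ((1 / Y) / (1 + (1 / Y * real m)\<^sup>2))" for m
      using Y p[of "real m"] by (simp add: field_simps power2_eq_square)
    have "(\<Sum>m<M. (1 / Y) / (1 + (1 / Y * real m)\<^sup>2)) \<le> (\<Sum>m. (1 / Y) / (1 + (1 / Y * real m)\<^sup>2))"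
      by (rule sum_le_suminf[OF sum_inverse_quadratic_le(1)[OF t]]) (use Y in auto)
    also have "\<dots> \<le> 3" by (rule sum_inverse_quadratic_le(2)[OF t])
    finally have "1 / Y * (\<Sum>m<M. (1 / Y) / (1 + (1 / Y * real m)\<^sup>2)) \<le> 1 / Y * 3" using Y by (intro mult_left_mono) auto
    then show ?thesis unfolding eq sum_distrib_left by simp
  qed
  then have s: "(2 * c\<^sup>2 + \<bar>c\<bar>) * (\<Sum>m<M. 1 / ((real m)\<^sup>2 + Y\<^sup>2)) \<le> (2 * c\<^sup>2 + \<bar>c\<bar>) * (3 / Y)"
    by (intro mult_left_mono) auto
  have tel: "(\<Sum>m<M. g (real (Suc m)) - g (real m)) = ln (((real M)\<^sup>2 + Y\<^sup>2) / Y\<^sup>2) / 2"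
    using sum_lessThan_telescope[of "\<lambda>m. g (real m)" M] p[of "real M"] Y
    by (simp add: g_def ln_div diff_divide_distrib)
  have "\<bar>(\<Sum>m<M. ln (1 + c * real (Suc m) / ((real (Suc m))\<^sup>2 + Y\<^sup>2))) - c * (\<Sum>m<M. g (real (Suc m)) - g (real m))\<bar>
     \<le> (\<Sum>m<M. \<bar>ln (1 + c * real (Suc m) / ((real (Suc m))\<^sup>2 + Y\<^sup>2)) - c * (g (real (Suc m)) - g (real m))\<bar>)"
    unfolding sum_distrib_left sum_subtractf[symmetric] by (rule sum_abs)
  also have "\<dots> \<le> (\<Sum>m<M. (2 * c\<^sup>2 + \<bar>c\<bar>) * (1 / ((real m)\<^sup>2 + Y\<^sup>2)))" by (intro sum_mono trm)
  also have "\<dots> \<le> (2 * c\<^sup>2 + \<bar>c\<bar>) * (3 / Y)" using s by (simp only: sum_distrib_left)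
  finally show ?thesis unfolding tel by simp
qed

text \<open>Each factor splits as \<open>(1 + Y\<^sup>2 / k\<^sup>2) * (1 + c * k / (k\<^sup>2 +
  Y\<^sup>2)) / (1 + c / k)\<close>. The first parts give \<open>sinh\<close>, the last the Gamma
  value, the middle ones a power of \<open>Y\<close> up to \<open>O(1 / Y)\<close> in the logarithm.
  For \<open>c \<noteq> 0\<close> the last two diverge like opposite powers of \<open>M\<close>;
  only their combination has a limit.\<close>

lemma quadratic_product_asymptotics:
  assumes c: "-1 < (c::real)"
  shows "((\<lambda>Y. (\<Sum>m. ln (1 + Y\<^sup>2 / (real (Suc m) * (real (Suc m) + c)))) -
    (pi * Y - ln (2 * pi) + ln (Gamma (1 + c)) - (1 + c) * ln Y)) \<longlongrightarrow> 0) at_top"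
proof (rule Lim_null_comparison)
  show "((\<lambda>Y. (2 * c\<^sup>2 + \<bar>c\<bar>) * (3 / Y) + \<bar>ln (1 - exp (- 2 * pi * Y))\<bar>) \<longlongrightarrow> 0) at_top"
  proof -
    have "((\<lambda>Y. (2 * c\<^sup>2 + \<bar>c\<bar>) * (3 / Y)) \<longlongrightarrow> 0) at_top" by real_asymp
    moreover have "((\<lambda>Y::real. ln (1 - exp (- 2 * pi * Y))) \<longlongrightarrow> 0) at_top" using pi_gt_zero by real_asymp
    ultimately show ?thesis using tendsto_add tendsto_rabs by fastforce
  qed
  show "\<forall>\<^sub>F Y in at_top. norm ((\<Sum>m. ln (1 + Y\<^sup>2 / (real (Suc m) * (real (Suc m) + c)))) -
    (pi * Y - ln (2 * pi) + ln (Gamma (1 + c)) - (1 + c) * ln Y)) \<le> (2 * c\<^sup>2 + \<bar>c\<bar>) * (3 / Y) + \<bar>ln (1 - exp (- 2 * pi * Y))\<bar>"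
    using eventually_ge_at_top[of "max 1 \<bar>c\<bar>"]
  proof eventually_elim
    case (elim Y)
    then have Y: "1 \<le> Y" "\<bar>c\<bar> \<le> Y" by auto
    define f where "f = (\<lambda>m. ln (1 + Y\<^sup>2 / (real (Suc m) * (real (Suc m) + c))))"
    have kc: "0 < real (Suc m) + c" for m using c by simp
    have f: "0 \<le> f m" "f m \<le> Y\<^sup>2 * (1 / (real (Suc m) * (real (Suc m) + c)))" for m
    proof -
      have "0 \<le> Y\<^sup>2 / (real (Suc m) * (real (Suc m) + c))" using kc[of m] by (intro divide_nonneg_nonneg mult_nonneg_nonneg) auto
      then show "0 \<le> f m" "f m \<le> Y\<^sup>2 * (1 / (real (Suc m) * (real (Suc m) + c)))"
        unfolding f_def using ln_add_one_self_le_self[of "Y\<^sup>2 / (real (Suc m) * (real (Suc m) + c))"] by (auto intro!: ln_ge_zero)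
    qed
    have "summable f"
      by (rule summable_comparison_test'[OF summable_mult[OF summable_inverse_shifted_quadratic[OF c], of "Y\<^sup>2"], where N = 0])
        (use f in simp)
    then have lim: "(\<lambda>M. \<Sum>m<M. f m) \<longlonglongrightarrow> (\<Sum>m. f m)" by (rule summable_LIMSEQ)
    have split: "f m = ln (1 + Y\<^sup>2 / (real (Suc m))\<^sup>2) + ln (1 + c * real (Suc m) / ((real (Suc m))\<^sup>2 + Y\<^sup>2)) - ln (1 + c / real (Suc m))" for m
    proof -
      define k where "k = real (Suc m)"
      have k: "k > 0" "k + c > 0" using c by (auto simp: k_def)
      have Y2: "0 < Y\<^sup>2" using Y by simp
      have p1: "0 < k\<^sup>2 + Y\<^sup>2" "0 < k\<^sup>2 + c * k + Y\<^sup>2"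
        using k Y2 mult_pos_pos[OF k(1) k(2)] by (auto simp: power2_eq_square algebra_simps intro: add_pos_pos)
      have "f m = ln ((k\<^sup>2 + c * k + Y\<^sup>2) / (k * (k + c)))"
      proof -
        have "1 + Y\<^sup>2 / (k * (k + c)) = (k * (k + c) + Y\<^sup>2) / (k * (k + c))"
          using k by (simp only: add_divide_distrib) simp
        also have "k * (k + c) + Y\<^sup>2 = k\<^sup>2 + c * k + Y\<^sup>2" by (simp add: algebra_simps power2_eq_square)
        finally show ?thesis unfolding f_def k_def[symmetric] by simp
      qed
      also have "\<dots> = ln (k\<^sup>2 + c * k + Y\<^sup>2) - (ln k + ln (k + c))"
        using p1 k by (simp add: ln_div ln_mult_pos)
      finally have 0: "f m = ln (k\<^sup>2 + c * k + Y\<^sup>2) - (ln k + ln (k + c))" .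
      have "1 + Y\<^sup>2 / k\<^sup>2 = (k\<^sup>2 + Y\<^sup>2) / k\<^sup>2" using k by (simp add: field_simps)
      then have 1: "ln (1 + Y\<^sup>2 / k\<^sup>2) = ln (k\<^sup>2 + Y\<^sup>2) - 2 * ln k"
        using p1 k by (simp add: ln_div ln_realpow)
      have "1 + c * k / (k\<^sup>2 + Y\<^sup>2) = (k\<^sup>2 + c * k + Y\<^sup>2) / (k\<^sup>2 + Y\<^sup>2)" using p1 k by (simp add: field_simps)
      then have 2: "ln (1 + c * k / (k\<^sup>2 + Y\<^sup>2)) = ln (k\<^sup>2 + c * k + Y\<^sup>2) - ln (k\<^sup>2 + Y\<^sup>2)"
        using p1 by (simp add: ln_div)
      have "1 + c / k = (k + c) / k" using k by (simp add: field_simps)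
      then have 3: "ln (1 + c / k) = ln (k + c) - ln k" using k by (simp add: ln_div)
      show ?thesis unfolding k_def[symmetric] 0 1 2 3 by simp
    qed
    \<comment> \<open>The divergent terms are paired: \<open>c * ln M\<close> is added to the Gamma
      part and taken away again inside the last logarithm.\<close>
    define g where "g = (\<lambda>M. (\<Sum>m<M. ln (1 + Y\<^sup>2 / (real (Suc m))\<^sup>2)) + (c * ln (real M) - (\<Sum>m<M. ln (1 + c / real (Suc m))))
        + c / 2 * ln (((real M)\<^sup>2 + Y\<^sup>2) / (Y\<^sup>2 * (real M)\<^sup>2)))"
    have bnd: "\<forall>\<^sub>F M in sequentially. \<bar>(\<Sum>m<M. f m) - g M\<bar> \<le> (2 * c\<^sup>2 + \<bar>c\<bar>) * (3 / Y)"
      using eventually_gt_at_top[of 0]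
    proof eventually_elim
      case (elim M)
      have p: "0 < (real M)\<^sup>2 + Y\<^sup>2" using Y by (intro add_nonneg_pos) auto
      have h: "ln (((real M)\<^sup>2 + Y\<^sup>2) / (Y\<^sup>2 * (real M)\<^sup>2)) = ln (((real M)\<^sup>2 + Y\<^sup>2) / Y\<^sup>2) - 2 * ln (real M)"
        using p Y elim by (simp add: ln_div ln_mult_pos ln_realpow)
      have h2: "c / 2 * ln (((real M)\<^sup>2 + Y\<^sup>2) / (Y\<^sup>2 * (real M)\<^sup>2)) = c / 2 * ln (((real M)\<^sup>2 + Y\<^sup>2) / Y\<^sup>2) - c * ln (real M)"
        unfolding h by (simp add: right_diff_distrib)
      have "(\<Sum>m<M. f m) - g M = (\<Sum>m<M. ln (1 + c * real (Suc m) / ((real (Suc m))\<^sup>2 + Y\<^sup>2))) - c / 2 * ln (((real M)\<^sup>2 + Y\<^sup>2) / Y\<^sup>2)"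
        unfolding g_def split sum.distrib sum_subtractf h2 by simp
      then show ?case using log_correction_bound[OF Y, of M] by simp
    qed
    have "(\<lambda>M. ln (((real M)\<^sup>2 + Y\<^sup>2) / (Y\<^sup>2 * (real M)\<^sup>2))) \<longlonglongrightarrow> ln (1 / Y\<^sup>2)"
    proof (rule tendsto_ln)
      show "(\<lambda>M. ((real M)\<^sup>2 + Y\<^sup>2) / (Y\<^sup>2 * (real M)\<^sup>2)) \<longlonglongrightarrow> 1 / Y\<^sup>2"
        using Y by (simp add: divide_inverse) real_asymp
    qed (use Y in auto)
    then have "g \<longlonglongrightarrow> ln (sinh (pi * Y) / (pi * Y)) + ln (Gamma (1 + c)) + c / 2 * ln (1 / Y\<^sup>2)"
      unfolding g_def using Y by (intro tendsto_add sinh_product ln_Gamma_product c tendsto_mult tendsto_const) auto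
    from tendsto_rabs[OF tendsto_diff[OF lim this]]
    have "\<bar>(\<Sum>m. f m) - (ln (sinh (pi * Y) / (pi * Y)) + ln (Gamma (1 + c)) + c / 2 * ln (1 / Y\<^sup>2))\<bar> \<le> (2 * c\<^sup>2 + \<bar>c\<bar>) * (3 / Y)"
      by (rule tendsto_upperbound[OF _ bnd]) simp
    moreover have "c / 2 * ln (1 / Y\<^sup>2) = - c * ln Y" using Y by (simp add: ln_div ln_realpow)
    moreover have "ln (sinh (pi * Y) / (pi * Y)) = pi * Y - ln (2 * pi) - ln Y + ln (1 - exp (- 2 * pi * Y))"
    proof -
      have e: "0 < 1 - exp (- 2 * pi * Y)" using Y by simp
      have "sinh (pi * Y) / (pi * Y) = exp (pi * Y) * (1 - exp (- 2 * pi * Y)) / (2 * pi * Y)"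
        by (simp add: sinh_field_def algebra_simps exp_add[symmetric])
      also have "ln \<dots> = ln (exp (pi * Y) * (1 - exp (- 2 * pi * Y))) - ln (2 * pi * Y)"
        using e Y by (intro ln_divide_pos) auto
      also have "ln (exp (pi * Y) * (1 - exp (- 2 * pi * Y))) = pi * Y + ln (1 - exp (- 2 * pi * Y))"
        using e by (subst ln_mult_pos) auto
      also have "ln (2 * pi * Y) = ln (2 * pi) + ln Y" using Y by (subst ln_mult_pos) auto
      finally show ?thesis by simp
    qed
    ultimately show ?case unfolding f_def[symmetric] by (simp add: algebra_simps)
  qed
qed

section \<open>The logarithm of the generating function\<close>

definition log_factor :: "complex \<Rightarrow> complex" where
  "log_factor X = - Ln (1 - exp (- X))"

lemma one_minus_exp_neg_not_nonpos:
  assumes "0 < Re X"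
  shows "1 - exp (- X) \<notin> \<real>\<^sub>\<le>\<^sub>0"
proof -
  have "Re (exp (- X)) \<le> norm (exp (- X))" by (rule complex_Re_le_cmod)
  also have "\<dots> < 1" using assms by simp
  finally show ?thesis by (simp add: complex_nonpos_Reals_iff)
qed

lemma log_factor_deriv:
  assumes X: "0 < Re X"
  shows "(log_factor has_field_derivative - bern X / X) (at X)"
proof -
  have nz: "1 - exp (- X) \<noteq> 0" "X \<noteq> 0" using one_minus_exp_neg_not_nonpos[OF X] X by auto
  then have "exp X \<noteq> 1" by (auto simp: exp_minus)
  have "((\<lambda>X. - Ln (1 - exp (- X))) has_field_derivative - (exp (- X) / (1 - exp (- X)))) (at X)"
    using one_minus_exp_neg_not_nonpos[OF X] by (auto intro!: derivative_eq_intros simp: divide_inverse)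
  also have "- (exp (- X) / (1 - exp (- X))) = - bern X / X"
    using nz \<open>exp X \<noteq> 1\<close> by (simp add: bern_def exp_minus divide_simps)
  finally show ?thesis by (simp add: log_factor_def[abs_def])
qed

text \<open>Much weaker than the true exponential decay; a bound of the form \<open>1 / Re X\<close>
  suffices because the reciprocals of \<open>Q\<close> are summable.\<close>

lemma log_factor_bound:
  assumes X: "2 \<le> Re X"
  shows "norm (log_factor X) \<le> 2 / Re X"
proof -
  have e: "exp (- Re X) < 1/2"
  proof -
    have "1 + Re X \<le> exp (Re X)" by (rule exp_ge_add_one_self)
    then have "2 < exp (Re X)" using X by linarith
    then show ?thesis by (simp add: exp_minus field_simps)
  qed
  have "norm (Ln (1 + - exp (- X))) \<le> 2 * norm (- exp (- X))"
    by (rule norm_Ln_le) (use e in simp)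
  also have "\<dots> = 2 * exp (- Re X)" by simp
  also have "exp (- Re X) \<le> 1 / Re X"
  proof -
    have "Re X \<le> exp (Re X)" using exp_ge_add_one_self[of "Re X"] by linarith
    then have "1 / exp (Re X) \<le> 1 / Re X" using X by (intro divide_left_mono) auto
    then show ?thesis by (simp add: exp_minus divide_inverse)
  qed
  finally show ?thesis by (simp add: log_factor_def)
qed

lemma log_factor_of_real: "0 < x \<Longrightarrow> log_factor (of_real x) = of_real (- ln (1 - exp (- x)))"
proof -
  assume x: "0 < x"
  have "log_factor (of_real x) = - Ln (of_real (1 - exp (- x)))"
    by (simp add: log_factor_def exp_of_real[symmetric])
  also have "\<dots> = of_real (- ln (1 - exp (- x)))" using x by (subst Ln_of_real) auto
  finally show ?thesis .
qed

text \<open>For \<open>k\<close>-gonal numbers \<open>a = (k - 2) / 2\<close> and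
  \<open>c = (4 - k) / (k - 2) = 2 / (k - 2) - 1\<close>, so that \<open>c > - 1\<close>. The
  relation \<open>a * (1 + c) = 1\<close>, saying that the first value is \<open>1\<close>, enters
  with the minor arcs.\<close>

locale quad_seq =
  fixes a c :: real
  assumes a: "0 < a" and c: "- 1 < c"
begin

definition Q :: "nat \<Rightarrow> real" where
  "Q m = a * (real (Suc m) * (real (Suc m) + c))"

definition H :: "complex \<Rightarrow> complex" where
  "H z = (\<Sum>m. log_factor (z * of_real (Q m)))"

lemma Q_pos: "0 < Q m"
  unfolding Q_def using a c by (intro mult_pos_pos) auto

lemma Q_eq: "Q m = a * ((real m + (1 + c / 2))\<^sup>2 - (c / 2)\<^sup>2)"
  unfolding Q_def by (simp add: power2_eq_square algebra_simps)

lemma summable_inverse_Q: "summable (\<lambda>m. 1 / Q m)"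
proof -
  have "summable (\<lambda>m. 1 / a * (1 / (real (Suc m) * (real (Suc m) + c))))"
    by (intro summable_mult summable_inverse_shifted_quadratic c)
  then show ?thesis by (simp add: Q_def)
qed

lemma eventually_Q_ge: "\<forall>\<^sub>F m in sequentially. R \<le> Q m"
proof -
  have "(\<lambda>m. 1 / Q m) \<longlonglongrightarrow> 0" by (rule summable_LIMSEQ_zero[OF summable_inverse_Q])
  then have "\<forall>\<^sub>F m in sequentially. 1 / Q m < 1 / max 1 R"
    by (rule order_tendstoD) simp
  then show ?thesis
  proof eventually_elim
    case (elim m)
    then have "max 1 R < Q m" using Q_pos[of m] by (simp add: divide_simps split: if_splits)
    then show ?case by simp
  qed
qed

text \<open>On a half-plane \<open>Re w > r > 0\<close> the terms are eventually dominated by a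
  multiple of \<open>1 / Q m\<close>, so the series may be differentiated term by term.\<close>

lemma H_properties:
  assumes z: "0 < Re z"
  shows "(\<lambda>m. log_factor (z * of_real (Q m))) sums H z"
    and "(H has_field_derivative - (\<Sum>m. bern (z * of_real (Q m))) / z) (at z)"
    and "summable (\<lambda>m. bern (z * of_real (Q m)))"
proof -
  define r where "r = Re z / 2"
  have r: "r > 0" "r < Re z" using z by (auto simp: r_def)
  define S where "S = {w. r < Re w}"
  have S: "open S" unfolding S_def by (rule open_halfspace_Re_gt)
  have zS: "z \<in> S" using r by (simp add: S_def)
  have Rep: "0 < Re (w * of_real (Q m))" if "w \<in> S" for w m using that r Q_pos[of m] by (simp add: S_def)
  obtain g g' where g: "\<forall>x\<in>S. ((\<lambda>m. log_factor (x * of_real (Q m))) sums g x) \<and> ((\<lambda>m. - bern (x * of_real (Q m)) / x) sums g' x) \<and> (g has_field_derivative g' x) (at x)"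
  proof (rule series_and_derivative_comparison[OF S])
    show "summable (\<lambda>m. 2 / r * (1 / Q m))" by (rule summable_mult[OF summable_inverse_Q])
    show "((\<lambda>x. log_factor (x * of_real (Q m))) has_field_derivative - bern (x * of_real (Q m)) / x) (at x)" if x: "x \<in> S" for m x
    proof -
      have x0: "x \<noteq> 0" using Rep[OF x, of m] by auto
      have "((\<lambda>x. log_factor (x * of_real (Q m))) has_field_derivative (- bern (x * of_real (Q m)) / (x * of_real (Q m))) * of_real (Q m)) (at x)"
        by (rule DERIV_chain2[where f = log_factor and g = "\<lambda>x. x * of_real (Q m)" and x = x, OF log_factor_deriv[OF Rep[OF x]]]) (auto intro!: derivative_eq_intros)
      then show ?thesis using Q_pos[of m] x0 by simp
    qed
    show "\<forall>\<^sub>F m in sequentially. \<forall>x\<in>S. norm (log_factor (x * of_real (Q m))) \<le> 2 / r * (1 / Q m)"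
      using eventually_Q_ge[of "2 / r"]
    proof eventually_elim
      case (elim m)
      show ?case
      proof
        fix x assume x: "x \<in> S"
        have rq: "r * Q m \<le> Re (x * of_real (Q m))" using x Q_pos[of m] by (simp add: S_def)
        have "2 \<le> r * Q m" using elim r by (simp add: field_simps)
        then have "norm (log_factor (x * of_real (Q m))) \<le> 2 / Re (x * of_real (Q m))"
          using rq by (intro log_factor_bound) linarith
        also have "\<dots> \<le> 2 / (r * Q m)" using rq r Q_pos[of m] by (intro divide_left_mono mult_pos_pos) (auto intro: less_le_trans[of 0 "r * Q m"])
        finally show "norm (log_factor (x * of_real (Q m))) \<le> 2 / r * (1 / Q m)" by simp
      qed
    qed
  qed blast
  have gH: "g x = H x" if "x \<in> S" for x using g that unfolding H_def by (auto simp: sums_iff)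
  show "(\<lambda>m. log_factor (z * of_real (Q m))) sums H z" using g zS gH by auto
  have z0: "z \<noteq> 0" using z by auto
  have s: "(\<lambda>m. - bern (z * of_real (Q m)) / z) sums g' z" using g zS by blast
  then have "(\<lambda>m. - z * (- bern (z * of_real (Q m)) / z)) sums (- z * g' z)" by (rule sums_mult)
  then have s2: "(\<lambda>m. bern (z * of_real (Q m))) sums (- z * g' z)" using z0 by simp
  then show "summable (\<lambda>m. bern (z * of_real (Q m)))" by (simp add: sums_iff)
  have "(g has_field_derivative g' z) (at z)" using g zS by blast
  then have "(H has_field_derivative g' z) (at z)"
    by (rule has_field_derivative_transform_within_open[OF _ S zS]) (use gH in auto)
  moreover have "g' z = - (\<Sum>m. bern (z * of_real (Q m))) / z"
    using s2 z0 by (simp add: sums_iff)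
  ultimately show "(H has_field_derivative - (\<Sum>m. bern (z * of_real (Q m))) / z) (at z)" by simp
qed

section \<open>Behaviour of the logarithm on the positive real axis\<close>

definition \<kappa> :: real where "\<kappa> = (1 + c) / 2"

text \<open>In the language of Dirichlet series, \<open>- \<kappa>\<close> and \<open>D0\<close> are
  the value and the derivative at \<open>s = 0\<close> of the continuation of the sum of
  \<open>Q m powr (- s)\<close>.\<close>

definition D0 :: real where "D0 = \<kappa> * ln a + ln (Gamma (1 + c)) - ln (2 * pi)"

text \<open>Only the constant \<open>D0\<close> is wanted here; the coefficient \<open>L'\<close> of
  \<open>1 / t\<close> is left open and identified later by comparison. As
  \<open>reg_log_factor\<close> vanishes at \<open>0\<close>, its sum contributes no constant term,
  and all of \<open>D0\<close> comes from the product.\<close>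

lemma H_real_limit:
  obtains L' where "((\<lambda>t::real. H (of_real (t\<^sup>2)) - (L' / of_real t + of_real (2 * \<kappa> * ln t + D0))) \<longlongrightarrow> 0) (at_right 0)"
proof -
  obtain \<theta> \<delta> K where g2: "0 < \<theta>" "0 < \<delta>" "0 < K" "reg_log_factor holomorphic_on cone \<theta> \<delta>"
    "\<And>X. X \<in> cone \<theta> \<delta> \<Longrightarrow> norm (reg_log_factor X) \<le> K / (1 + norm X)"
    using reg_log_factor_cone by blast
  have \<sigma>: "0 \<le> 1 + c / 2" using c by simp
  obtain h where h: "0 < h" "\<And>J. \<exists>G. uexp_coeffs (ball 1 h) J
      (\<lambda>t w. of_real t * (\<Sum>m. reg_log_factor (w * of_real (t\<^sup>2 * (a * ((real m + (1 + c / 2))\<^sup>2 - (c / 2)\<^sup>2)))))) G \<and>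
      (\<forall>j\<le>J. G j holomorphic_on ball 1 h) \<and>
      (J \<ge> 1 \<longrightarrow> (\<forall>w\<in>ball 1 h. G 0 w = ray_integral (\<lambda>x. reg_log_factor (w * of_real a * x\<^sup>2)) \<and> G 1 w = of_real (1/2 - (1 + c / 2)) * reg_log_factor 0))"
    by (rule quadratic_sum_expansion[OF a zero_le_power2[of "c / 2"] \<sigma> g2(1,2,4,3,5)]) (assumption, (rule that; assumption))
  obtain G where G: "uexp_coeffs (ball 1 h) 1
      (\<lambda>t w. of_real t * (\<Sum>m. reg_log_factor (w * of_real (t\<^sup>2 * Q m)))) G" "G 1 1 = 0"
    using h(2)[of 1] h(1) unfolding Q_eq by (auto simp: reg_log_factor_0)
  have "((\<lambda>t. (of_real t * (\<Sum>m. reg_log_factor (1 * of_real (t\<^sup>2 * Q m))) - (\<Sum>i<1. G i 1 * of_real t ^ i)) / of_real t ^ 1) \<longlongrightarrow> G 1 1) (at_right 0)"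
    by (rule tendsto_uniform_limitI[OF uexp_coeffs_uniform_limit[OF G(1)]]) (use h(1) in auto)
  then have l1: "((\<lambda>t. (of_real t * (\<Sum>m. reg_log_factor (of_real (t\<^sup>2 * Q m))) - G 0 1) / of_real t) \<longlongrightarrow> 0) (at_right 0)"
    using G(2) by simp
  \<comment> \<open>With this scaling \<open>1 + 1 / (t\<^sup>2 * Q m)\<close> is exactly a factor
    of the quadratic product.\<close>
  define Y where "Y = (\<lambda>t::real. 1 / (t * sqrt a))"
  have Y: "filterlim Y at_top (at_right 0)"
    unfolding Y_def using a by real_asymp
  define kk where "kk = (\<lambda>Y. (\<Sum>m. ln (1 + Y\<^sup>2 / (real (Suc m) * (real (Suc m) + c)))))"
  have l2: "((\<lambda>t. kk (Y t) - (pi * Y t - ln (2 * pi) + ln (Gamma (1 + c)) - (1 + c) * ln (Y t))) \<longlongrightarrow> 0) (at_right 0)"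
    unfolding kk_def by (rule filterlim_compose[OF quadratic_product_asymptotics[OF c] Y])
  have l2': "((\<lambda>t. complex_of_real (kk (Y t) - (pi * Y t - ln (2 * pi) + ln (Gamma (1 + c)) - (1 + c) * ln (Y t)))) \<longlongrightarrow> of_real 0) (at_right 0)"
    by (rule tendsto_of_real[OF l2])
  have "\<forall>\<^sub>F t in at_right 0. (of_real t * (\<Sum>m. reg_log_factor (of_real (t\<^sup>2 * Q m))) - G 0 1) / of_real t
      + complex_of_real (kk (Y t) - (pi * Y t - ln (2 * pi) + ln (Gamma (1 + c)) - (1 + c) * ln (Y t)))
      = H (of_real (t\<^sup>2)) - ((G 0 1 + of_real (pi / sqrt a)) / of_real t + of_real (2 * \<kappa> * ln t + D0))"
    using eventually_small_right[of 1, simplified]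
  proof eventually_elim
    case (elim t)
    then have t: "0 < t" by simp
    have pos: "0 < t\<^sup>2 * Q m" for m using t Q_pos[of m] by simp
    have arg: "1 / (t\<^sup>2 * Q m) = (Y t)\<^sup>2 / (real (Suc m) * (real (Suc m) + c))" for m
      using a by (simp add: Y_def Q_def power_divide power_mult_distrib)
    have t2: "0 < Re (of_real (t\<^sup>2))" using t by simp
    have sH: "(\<lambda>m. log_factor (of_real (t\<^sup>2) * of_real (Q m))) sums H (of_real (t\<^sup>2))"
      by (rule H_properties(1)[OF t2])
    have sk: "summable (\<lambda>m. ln (1 + (Y t)\<^sup>2 / (real (Suc m) * (real (Suc m) + c))))"
    proof (rule summable_comparison_test'[where N = 0])
      show "summable (\<lambda>m. (Y t)\<^sup>2 * (1 / (real (Suc m) * (real (Suc m) + c))))"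
        by (intro summable_mult summable_inverse_shifted_quadratic c)
      fix m
      have n: "0 \<le> (Y t)\<^sup>2 / (real (Suc m) * (real (Suc m) + c))"
        using c by (intro divide_nonneg_nonneg mult_nonneg_nonneg) auto
      show "norm (ln (1 + (Y t)\<^sup>2 / (real (Suc m) * (real (Suc m) + c)))) \<le> (Y t)\<^sup>2 * (1 / (real (Suc m) * (real (Suc m) + c)))"
        using ln_add_one_self_le_self[OF n] ln_ge_zero[of "1 + (Y t)\<^sup>2 / (real (Suc m) * (real (Suc m) + c))"] n by simp
    qed
    have "(\<lambda>m. log_factor (of_real (t\<^sup>2) * of_real (Q m)) - of_real (ln (1 + (Y t)\<^sup>2 / (real (Suc m) * (real (Suc m) + c))))) sums
       (H (of_real (t\<^sup>2)) - of_real (kk (Y t)))"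
      unfolding kk_def by (intro sums_diff sH sums_of_real summable_sums sk)
    moreover have "log_factor (of_real (t\<^sup>2) * of_real (Q m)) - of_real (ln (1 + (Y t)\<^sup>2 / (real (Suc m) * (real (Suc m) + c)))) = reg_log_factor (of_real (t\<^sup>2 * Q m))" for m
      unfolding reg_log_factor_of_real[OF pos] arg of_real_mult[symmetric] log_factor_of_real[OF pos] by simp
    ultimately have s: "(\<Sum>m. reg_log_factor (of_real (t\<^sup>2 * Q m))) = H (of_real (t\<^sup>2)) - of_real (kk (Y t))"
      by (simp add: sums_iff)
    have lnY: "ln (Y t) = - ln t - ln a / 2"
      using t a by (simp add: Y_def ln_div ln_mult_pos ln_sqrt)
    show ?case
      unfolding s lnY using t a
      by (simp add: Y_def \<kappa>_def D0_def field_simps)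
  qed
  from Lim_transform_eventually[OF tendsto_add[OF l1 l2'] this]
  show ?thesis using that by simp
qed

end

section \<open>From the logarithmic derivative back to the logarithm\<close>

lemma holomorphic_derivative_bound_ball:
  fixes f f' :: "complex \<Rightarrow> complex"
  assumes f: "\<And>w. w \<in> ball z h \<Longrightarrow> (f has_field_derivative f' w) (at w)"
    and B: "\<And>w. w \<in> ball z h \<Longrightarrow> norm (f' w) \<le> B" and h: "h \<le> 1" and w: "w \<in> ball z h"
  shows "norm (f w - f z) \<le> B"
proof -
  have "norm (f w - f z) \<le> B * norm (w - z)"
    by (rule field_differentiable_bound[OF convex_ball[of z h]])
      (use f B w in \<open>auto intro: has_field_derivative_at_within intro!: le_less_trans[OF zero_le_dist]\<close>)
  also have "\<dots> \<le> B * 1"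
    using w h order_trans[OF norm_ge_zero B[OF w]] by (intro mult_left_mono) (auto simp: dist_norm norm_minus_commute)
  finally show ?thesis by simp
qed

lemma dist_one_of_real: "dist (1::complex) (of_real x) = \<bar>1 - x\<bar>"
  by (metis dist_norm norm_of_real of_real_1 of_real_diff)

context quad_seq
begin

text \<open>The ray integral of \<open>bern (a * x\<^sup>2)\<close> is \<open>L / 2\<close>;
  integrating \<open>- z * H' = L / (2 * sqrt z)\<close> doubles it, so that \<open>H\<close>
  behaves like \<open>L / sqrt z\<close>.\<close>

definition L :: real where "L = sqrt (pi / a) * zeta (3/2) / 2"

text \<open>The leading coefficient is evaluated only for real \<open>w > 1\<close>, where
  \<open>w\<close> merges with \<open>a\<close> in \<open>ray_integral_bern\<close>. Both sides are
  holomorphic in \<open>w\<close>, and the identity theorem extends the formula to the ball.\<close>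

lemma bern_expansion:
  obtains h G where "0 < h" "h \<le> 1/2"
    "\<And>J. uexp_coeffs (ball 1 h) J (\<lambda>t w. of_real t * (\<Sum>m. bern (w * of_real (t\<^sup>2) * of_real (Q m)))) G"
    "\<And>j. G j holomorphic_on ball 1 h"
    "\<And>w. w \<in> ball 1 h \<Longrightarrow> G 0 w = of_real (L / 2) / csqrt w"
    "\<And>w. w \<in> ball 1 h \<Longrightarrow> G 1 w = - of_real \<kappa>"
proof -
  obtain K where K: "K > 0" "\<And>X. X \<in> cone 1 (1/2) \<Longrightarrow> norm (bern X) \<le> K / (1 + norm X)" using bern_bound by blast
  have \<sigma>: "0 \<le> 1 + c / 2" using c by simp
  obtain h where h: "0 < h" "\<And>J. \<exists>G. uexp_coeffs (ball 1 h) J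
      (\<lambda>t w. of_real t * (\<Sum>m. bern (w * of_real (t\<^sup>2 * (a * ((real m + (1 + c / 2))\<^sup>2 - (c / 2)\<^sup>2)))))) G \<and>
      (\<forall>j\<le>J. G j holomorphic_on ball 1 h) \<and>
      (J \<ge> 1 \<longrightarrow> (\<forall>w\<in>ball 1 h. G 0 w = ray_integral (\<lambda>x. bern (w * of_real a * x\<^sup>2)) \<and> G 1 w = of_real (1/2 - (1 + c / 2)) * bern 0))"
    by (rule quadratic_sum_expansion[OF a zero_le_power2[of "c / 2"] \<sigma> zero_less_one half_gt_zero[OF zero_less_one] holomorphic_bern_cone K]) (assumption, (rule that; assumption))
  define A where "A = (\<lambda>t w. of_real t * (\<Sum>m. bern (w * of_real (t\<^sup>2) * of_real (Q m))))"
  have h2: "\<exists>G. uexp_coeffs (ball 1 h) J A G \<and> (\<forall>j\<le>J. G j holomorphic_on ball 1 h) \<and>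
      (J \<ge> 1 \<longrightarrow> (\<forall>w\<in>ball 1 h. G 0 w = ray_integral (\<lambda>x. bern (w * of_real a * x\<^sup>2)) \<and> G 1 w = - of_real \<kappa>))" for J
    using h(2)[of J] unfolding A_def Q_eq of_real_mult mult.assoc by (simp add: bern_def \<kappa>_def field_simps)
  have "uexp (ball 1 h) J A" for J using h2[of J] unfolding uexp_def by blast
  then obtain G where G: "\<And>J. uexp_coeffs (ball 1 h) J A G" using uexp_coeffs_all_orders by blast
  have hol: "G j holomorphic_on ball 1 h" for j
  proof -
    obtain G' where G': "uexp_coeffs (ball 1 h) j A G'" "G' j holomorphic_on ball 1 h" using h2[of j] by blast
    show ?thesis by (rule holomorphic_transform[OF G'(2)]) (use uexp_coeffs_unique[OF G'(1) G] in auto)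
  qed
  have low: "G 0 w = ray_integral (\<lambda>x. bern (w * of_real a * x\<^sup>2))" "G 1 w = - of_real \<kappa>" if w: "w \<in> ball 1 h" for w
  proof -
    obtain G' where G': "uexp_coeffs (ball 1 h) 1 A G'" "G' 0 w = ray_integral (\<lambda>x. bern (w * of_real a * x\<^sup>2))" "G' 1 w = - of_real \<kappa>"
      using h2[of 1] w by blast
    show "G 0 w = ray_integral (\<lambda>x. bern (w * of_real a * x\<^sup>2))" "G 1 w = - of_real \<kappa>"
      using uexp_coeffs_unique[OF G'(1) G[of 1] w, of 0] uexp_coeffs_unique[OF G'(1) G[of 1] w, of 1] G'(2,3) by auto
  qed
  \<comment> \<open>A radius of at most \<open>1 / 2\<close> keeps \<open>w\<close> off the branch
    cut of \<open>csqrt\<close>.\<close>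
  define h' where "h' = min h (1/2)"
  have h': "0 < h'" "h' \<le> 1/2" "h' \<le> h" using h by (auto simp: h'_def)
  have sub: "ball 1 h' \<subseteq> ball (1::complex) h" using h' by (intro subset_ball)
  have np: "w \<notin> \<real>\<^sub>\<le>\<^sub>0" if "w \<in> ball 1 h'" for w :: complex
  proof -
    have "\<bar>Re (1 - w)\<bar> < 1/2" using abs_Re_le_cmod[of "1 - w"] that h' by (auto simp: dist_norm)
    then show ?thesis by (auto simp: complex_nonpos_Reals_iff)
  qed
  have G0: "G 0 w = of_real (L / 2) / csqrt w" if w: "w \<in> ball 1 h'" for w
  proof -
    define U where "U = complex_of_real ` {1<..<1+h'}"
    have "G 0 w - of_real (L / 2) / csqrt w = 0"
    proof (rule analytic_continuation[where S = "ball 1 h'" and U = U and \<xi> = 1 and f = "\<lambda>w. G 0 w - of_real (L / 2) / csqrt w"])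
      have "csqrt z \<noteq> 0" if "z \<in> ball 1 h'" for z using np[OF that] by auto
      then show "(\<lambda>w. G 0 w - of_real (L / 2) / csqrt w) holomorphic_on ball 1 h'"
        by (intro holomorphic_on_diff holomorphic_on_divide holomorphic_on_const holomorphic_on_csqrt' holomorphic_on_ident holomorphic_on_subset[OF hol sub])
           (use np in auto)
      show "U \<subseteq> ball 1 h'"
        unfolding U_def by (auto simp: dist_one_of_real dist_commute[of _ 1])
      show "1 islimpt U"
        unfolding islimpt_approachable
      proof (intro allI impI)
        fix e :: real assume e: "0 < e"
        define x where "x = 1 + min e h' / 2"
        have "1 < x" "x < 1 + h'" "x - 1 < e" using e h' by (auto simp: x_def min_def)
        then show "\<exists>x'\<in>U. x' \<noteq> 1 \<and> dist x' 1 < e"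
          unfolding U_def by (intro bexI[of _ "of_real x"]) (auto simp: dist_one_of_real dist_commute[of _ 1])
      qed
      fix z assume "z \<in> U"
      then obtain x where x: "z = of_real x" "1 < x" "x < 1 + h'" by (auto simp: U_def)
      have "z \<in> ball 1 h" using x h' by (auto simp: dist_one_of_real dist_commute[of _ 1])
      then have "G 0 z = ray_integral (\<lambda>y. bern (of_real (x * a) * y\<^sup>2))" using low(1) x by simp
      also have "\<dots> = of_real (sqrt (pi / (x * a)) * zeta (3/2) / 4)" using x a by (intro ray_integral_bern) simp
      also have "sqrt (pi / (x * a)) = sqrt (pi / a) / sqrt x" by (simp add: real_sqrt_divide real_sqrt_mult)
      also have "complex_of_real (sqrt (pi / a) / sqrt x * zeta (3/2) / 4) = of_real (L / 2) / csqrt z"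
        using x by (simp add: L_def)
      finally show "G 0 z - of_real (L / 2) / csqrt z = 0" by simp
    qed (use w h' in auto)
    then show ?thesis by simp
  qed
  show ?thesis
  proof (rule that[OF h'(1,2)])
    show "uexp_coeffs (ball 1 h') J (\<lambda>t w. of_real t * (\<Sum>m. bern (w * of_real (t\<^sup>2) * of_real (Q m)))) G" for J
      by (rule uexp_coeffs_reparam[OF G[of J, unfolded A_def], of "ball 1 h'" "\<lambda>w. w"]) (use sub in auto)
    show "G j holomorphic_on ball 1 h'" for j using hol sub by (rule holomorphic_on_subset)
    show "G 0 w = of_real (L / 2) / csqrt w" if "w \<in> ball 1 h'" for w by (rule G0[OF that])
    show "G 1 w = - of_real \<kappa>" if "w \<in> ball 1 h'" for w using that low(2) sub by blast
  qed
qed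

text \<open>What is left of \<open>H\<close> at \<open>z = w * t\<^sup>2\<close> after removing the
  terms singular in \<open>t\<close>: \<open>L / sqrt z\<close>, and the part
  \<open>2 * \<kappa> * ln t\<close> of \<open>\<kappa> * Ln z\<close>. The other part
  \<open>\<kappa> * Ln w\<close> stays in the coefficient of order \<open>0\<close>.\<close>

definition T :: "real \<Rightarrow> complex \<Rightarrow> complex" where
  "T t w = H (w * of_real (t\<^sup>2)) - of_real L / (of_real t * csqrt w) - of_real (2 * \<kappa> * ln t)"

text \<open>The derivative of \<open>H\<close> is integrated in two directions: at fixed
  \<open>t\<close> from \<open>w = 1\<close> across the ball, which gives the dependence on
  \<open>w\<close>, and along \<open>w = 1\<close> in \<open>t\<close>, where
  \<open>H_real_limit\<close> provides the starting value at \<open>0\<close>.\<close>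

lemma log_expansion:
  obtains h G where "0 < h" "h \<le> 1/2" "\<And>J. uexp_coeffs (ball 1 h) J T G"
    "\<And>j. G j holomorphic_on ball 1 h"
    "\<And>w. w \<in> ball 1 h \<Longrightarrow> G 0 w = of_real D0 + of_real \<kappa> * Ln w"
proof -
  obtain h Gb where h: "0 < h" "h \<le> 1/2"
    and Gb: "\<And>J. uexp_coeffs (ball 1 h) J (\<lambda>t w. of_real t * (\<Sum>m. bern (w * of_real (t\<^sup>2) * of_real (Q m)))) Gb"
    and hol: "\<And>j. Gb j holomorphic_on ball 1 h"
    and Gb0: "\<And>w. w \<in> ball 1 h \<Longrightarrow> Gb 0 w = of_real (L / 2) / csqrt w"
    and Gb1: "\<And>w. w \<in> ball 1 h \<Longrightarrow> Gb 1 w = - of_real \<kappa>"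
    by (rule bern_expansion) (rule that; assumption)
  define B where "B = (\<lambda>t w. of_real t * (\<Sum>m. bern (w * of_real (t\<^sup>2) * of_real (Q m))))"
  have h1: "1 \<in> ball (1::complex) h" using h by simp
  have wprops: "1/2 < Re w" "1/2 \<le> norm w" "w \<notin> \<real>\<^sub>\<le>\<^sub>0" "w \<noteq> 0" if "w \<in> ball 1 h" for w :: complex
  proof -
    have "\<bar>Re (1 - w)\<bar> < 1/2" using abs_Re_le_cmod[of "1 - w"] that h by (auto simp: dist_norm)
    then have "\<bar>1 - Re w\<bar> < 1/2" by simp
    then show re: "1/2 < Re w" by linarith
    then show "1/2 \<le> norm w" using complex_Re_le_cmod[of w] by simp
    from re show "w \<notin> \<real>\<^sub>\<le>\<^sub>0" "w \<noteq> 0" by (auto simp: complex_nonpos_Reals_iff)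
  qed
  have "\<exists>E. \<forall>w\<in>ball 1 h. (E has_field_derivative Gb j w / w) (at w)" for j
  proof -
    have "(\<lambda>w. Gb j w / w) holomorphic_on ball 1 h"
      by (intro holomorphic_on_divide hol holomorphic_on_ident) (use wprops in auto)
    then obtain E where E: "\<And>w. w \<in> ball 1 h \<Longrightarrow> (E has_field_derivative Gb j w / w) (at w within ball 1 h)"
      by (rule holomorphic_convex_primitive'[OF convex_ball open_ball]) (rule that)
    have "(E has_field_derivative Gb j w / w) (at w)" if "w \<in> ball 1 h" for w
      using E[OF that] at_within_open[OF that open_ball] by simp
    then show ?thesis by blast
  qed
  then obtain E' where E': "\<And>j w. w \<in> ball 1 h \<Longrightarrow> (E' j has_field_derivative Gb j w / w) (at w)" by metis
  \<comment> \<open>Primitives normalised to vanish at \<open>w = 1\<close>, the point where the two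
    integrations meet.\<close>
  define E where "E = (\<lambda>j w. E' j w - E' j 1)"
  have E: "(E j has_field_derivative Gb j w / w) (at w)" if "w \<in> ball 1 h" for j w
    unfolding E_def using DERIV_diff[OF E'[OF that] DERIV_const] by simp
  have E1: "E j 1 = 0" for j by (simp add: E_def)
  have Ehol: "E j holomorphic_on ball 1 h" for j
    using E unfolding holomorphic_on_open[OF open_ball] by blast
  have Ebd: "\<exists>M. \<forall>w\<in>ball 1 h. norm (E j w) \<le> M" for j
  proof -
    obtain M where M: "M \<ge> 0" "\<And>w. w \<in> ball 1 h \<Longrightarrow> norm (Gb j w) \<le> M" using uexp_coeffs_boundedE[OF Gb[of 0]] by metis
    have "norm (E j w - E j 1) \<le> 2 * M" if w: "w \<in> ball 1 h" for w
    proof (rule holomorphic_derivative_bound_ball[OF E _ _ w])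
      fix v :: complex assume v: "v \<in> ball 1 h"
      have "norm (Gb j v) / norm v \<le> M / (1/2)" by (rule frac_le[OF M(1) M(2)[OF v] _ wprops(2)[OF v]]) simp
      then show "norm (Gb j v / v) \<le> 2 * M" by (simp add: norm_divide)
    qed (use h in auto)
    then have "\<forall>w\<in>ball 1 h. norm (E j w) \<le> 2 * M" using E1 by simp
    then show ?thesis by blast
  qed
  have ball_unique: "f w = g w" if fg: "\<And>v. v \<in> ball 1 h \<Longrightarrow> (f has_field_derivative d v) (at v)"
     "\<And>v. v \<in> ball 1 h \<Longrightarrow> (g has_field_derivative d v) (at v)" "f 1 = g 1" "w \<in> ball 1 h" for f g d :: "complex \<Rightarrow> complex" and w
  proof -
    have d0: "((\<lambda>w. f w - g w) has_field_derivative 0) (at v)" if "v \<in> ball 1 h" for v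
      using DERIV_diff[OF fg(1)[OF that] fg(2)[OF that]] by simp
    have "norm ((f w - g w) - (f 1 - g 1)) \<le> 0"
      by (rule holomorphic_derivative_bound_ball[where f' = "\<lambda>_. 0" and h = h, OF d0])
         (use fg(4) h in auto)
    then show ?thesis using fg(3) by simp
  qed
  have E0eq: "E 0 w = of_real L * (1 - 1 / csqrt w)" if w: "w \<in> ball 1 h" for w
  proof (rule ball_unique[where f = "E 0" and g = "\<lambda>w. of_real L * (1 - 1 / csqrt w)" and d = "\<lambda>v. Gb 0 v / v", OF E _ _ w], assumption)
    fix v :: complex assume v: "v \<in> ball 1 h"
    note vp = wprops[OF v]
    have cs: "csqrt v \<noteq> 0" "csqrt v * csqrt v = v" using vp by (auto simp flip: power2_eq_square)
    have "((\<lambda>w. of_real L * (1 - 1 / csqrt w)) has_field_derivative of_real L * (inverse (2 * csqrt v) / (csqrt v * csqrt v))) (at v)"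
      using vp cs by (auto intro!: derivative_eq_intros simp: field_simps)
    also have "of_real L * (inverse (2 * csqrt v) / (csqrt v * csqrt v)) = Gb 0 v / v"
      unfolding Gb0[OF v] cs(2) using vp cs(1) by (simp add: field_simps)
    finally show "((\<lambda>w. of_real L * (1 - 1 / csqrt w)) has_field_derivative Gb 0 v / v) (at v)" .
  next
    show "E 0 1 = of_real L * (1 - 1 / csqrt 1)" unfolding E1 csqrt_1 by simp
  qed
  have E1eq: "E 1 w = - of_real \<kappa> * Ln w" if w: "w \<in> ball 1 h" for w
  proof (rule ball_unique[where f = "E 1" and g = "\<lambda>w. - of_real \<kappa> * Ln w" and d = "\<lambda>v. Gb 1 v / v", OF E _ _ w], assumption)
    fix v :: complex assume v: "v \<in> ball 1 h"
    have "((\<lambda>w. - of_real \<kappa> * Ln w) has_field_derivative - of_real \<kappa> * inverse v) (at v)"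
      by (intro DERIV_cmult has_field_derivative_Ln wprops v)
    then show "((\<lambda>w. - of_real \<kappa> * Ln w) has_field_derivative Gb 1 v / v) (at v)"
      unfolding Gb1[OF v] by (simp add: divide_inverse)
  next
    show "E 1 1 = - of_real \<kappa> * Ln 1" unfolding E1 by simp
  qed
  have Bbd: "\<exists>C t0. C \<ge> 0 \<and> 0 < t0 \<and> t0 \<le> 1 \<and> (\<forall>t w. 0 < t \<longrightarrow> t < t0 \<longrightarrow> w \<in> ball 1 h \<longrightarrow> norm (B t w - (\<Sum>j\<le>Suc J. Gb j w * of_real t ^ j)) \<le> C * t ^ Suc (Suc J))" for J
  proof -
    obtain C where C: "C \<ge> 0" "\<forall>\<^sub>F t in at_right 0. \<forall>w\<in>ball 1 h. norm (B t w - (\<Sum>j\<le>Suc J. Gb j w * of_real t ^ j)) \<le> C * t ^ Suc (Suc J)"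
      unfolding B_def by (rule uexp_coeffsE[OF Gb[of "Suc J"]])
    obtain b where "b > 0" "\<And>t. 0 < t \<Longrightarrow> t < b \<Longrightarrow> \<forall>w\<in>ball 1 h. norm (B t w - (\<Sum>j\<le>Suc J. Gb j w * of_real t ^ j)) \<le> C * t ^ Suc (Suc J)"
      using C(2) unfolding eventually_at_right_field by auto
    then show ?thesis using C(1) by (intro exI[of _ C] exI[of _ "min b 1"]) auto
  qed
  have Hd: "(H has_field_derivative - (B t w / of_real t) / (w * of_real (t\<^sup>2))) (at (w * of_real (t\<^sup>2)))" if "0 < t" "w \<in> ball 1 h" for t w
  proof -
    have "0 < Re w * t\<^sup>2" using that wprops(1)[OF that(2)] by simp
    then have "0 < Re (w * of_real (t\<^sup>2))" by simp
    from H_properties(2)[OF this] show ?thesis using that(1) by (simp add: B_def)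
  qed
  \<comment> \<open>The error at \<open>w = 1\<close>, with a complex \<open>z\<close> in place of
    \<open>t\<close>. The factors \<open>2 / real (Suc j)\<close> come from integrating
    \<open>2 * z ^ j\<close>, the \<open>2\<close> being due to the inner derivative of
    \<open>z\<^sup>2\<close>.\<close>
  define r where "r = (\<lambda>J z. H (z\<^sup>2) - of_real L / z - of_real (2 * \<kappa>) * Ln z - of_real D0 + (\<Sum>j<J. of_real (2 / real (Suc j)) * Gb (Suc (Suc j)) 1 * z ^ Suc j))"
  \<comment> \<open>The derivative of \<open>r J\<close> is \<open>O(t ^ J)\<close>, which bounds
    increments only; a value at \<open>0\<close> has still to be supplied.\<close>
  have rdiff: "\<exists>C t0. C \<ge> 0 \<and> 0 < t0 \<and> (\<forall>s t. 0 < s \<longrightarrow> s \<le> t \<longrightarrow> t < t0 \<longrightarrow> norm (r J (of_real t) - r J (of_real s)) \<le> C * t ^ Suc J)" for J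
  proof -
    obtain C t0 where C: "C \<ge> 0" "0 < t0" "\<And>t w. 0 < t \<Longrightarrow> t < t0 \<Longrightarrow> w \<in> ball 1 h \<Longrightarrow> norm (B t w - (\<Sum>j\<le>Suc J. Gb j w * of_real t ^ j)) \<le> C * t ^ Suc (Suc J)"
      using Bbd[of J] by blast
    have der: "(r J has_field_derivative - (2 / of_real (t\<^sup>2)) * (B t 1 - (\<Sum>j\<le>Suc J. Gb j 1 * of_real t ^ j))) (at (of_real t))" if t: "0 < t" for t
    proof -
      define z where "z = complex_of_real t"
      have z: "z \<noteq> 0" "z \<notin> \<real>\<^sub>\<le>\<^sub>0" using t by (auto simp: z_def)
      have "((\<lambda>z. H (z\<^sup>2)) has_field_derivative (- (B t 1 / z) / z\<^sup>2) * (2 * z)) (at z)"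
      proof (rule DERIV_chain2[where f = H and g = "\<lambda>z. z\<^sup>2"])
        show "(H has_field_derivative - (B t 1 / z) / z\<^sup>2) (at (z\<^sup>2))" using Hd[OF t h1] by (simp add: z_def)
        show "((\<lambda>z. z\<^sup>2) has_field_derivative 2 * z) (at z)" by (auto intro!: derivative_eq_intros)
      qed
      moreover have "((\<lambda>z. of_real L / z) has_field_derivative - of_real L / z\<^sup>2) (at z)"
        using z by (auto intro!: derivative_eq_intros simp: power2_eq_square)
      moreover have "((\<lambda>z. of_real (2 * \<kappa>) * Ln z) has_field_derivative of_real (2 * \<kappa>) * inverse z) (at z)"
        by (intro DERIV_cmult has_field_derivative_Ln z)
      moreover have "((\<lambda>z. of_real (2 / real (Suc j)) * Gb (Suc (Suc j)) 1 * z ^ Suc j) has_field_derivative 2 * Gb (Suc (Suc j)) 1 * z ^ j) (at z)" for j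
      proof (rule DERIV_cong[OF DERIV_cmult[OF DERIV_power_Suc[OF DERIV_ident]]])
        have "complex_of_real (2 / real (Suc j)) * of_nat (Suc j) = complex_of_real (2 / real (Suc j) * real (Suc j))"
          by (simp only: of_real_mult of_real_of_nat_eq)
        also have "2 / real (Suc j) * real (Suc j) = 2" by (simp del: of_nat_Suc)
        finally have "complex_of_real (2 / real (Suc j)) * (1 + of_nat j) = 2"
          by (simp only: of_nat_Suc of_real_numeral)
        then have "complex_of_real (2 / real (Suc j)) * (1 + of_nat j) * (Gb (Suc (Suc j)) 1 * z ^ j) = 2 * (Gb (Suc (Suc j)) 1 * z ^ j)"
          by (simp only:)
        then show "complex_of_real (2 / real (Suc j)) * Gb (Suc (Suc j)) 1 * ((1 + of_nat j) * (1 * z ^ j)) = 2 * Gb (Suc (Suc j)) 1 * z ^ j"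
          by (simp only: mult_ac mult_1_left)
      qed
      then have "((\<lambda>z. \<Sum>j<J. of_real (2 / real (Suc j)) * Gb (Suc (Suc j)) 1 * z ^ Suc j) has_field_derivative (\<Sum>j<J. 2 * Gb (Suc (Suc j)) 1 * z ^ j)) (at z)"
        by (intro DERIV_sum)
      ultimately have "(r J has_field_derivative ((- (B t 1 / z) / z\<^sup>2) * (2 * z) - (- of_real L / z\<^sup>2) - of_real (2 * \<kappa>) * inverse z - 0 + (\<Sum>j<J. 2 * Gb (Suc (Suc j)) 1 * z ^ j))) (at z)"
        unfolding r_def by (intro DERIV_add DERIV_diff DERIV_const)
      also have "((- (B t 1 / z) / z\<^sup>2) * (2 * z) - (- of_real L / z\<^sup>2) - of_real (2 * \<kappa>) * inverse z - 0 + (\<Sum>j<J. 2 * Gb (Suc (Suc j)) 1 * z ^ j))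
         = - (2 / z\<^sup>2) * (B t 1 - (\<Sum>j\<le>Suc J. Gb j 1 * z ^ j))"
      proof -
        have s: "(\<Sum>j\<le>Suc J. Gb j 1 * z ^ j) = of_real (L / 2) - of_real \<kappa> * z + z\<^sup>2 * (\<Sum>j<J. Gb (Suc (Suc j)) 1 * z ^ j)"
        proof -
          have "(\<Sum>j\<le>Suc J. Gb j 1 * z ^ j) = (\<Sum>j<Suc (Suc J). Gb j 1 * z ^ j)" by (simp only: lessThan_Suc_atMost)
          also have "\<dots> = Gb 0 1 + Gb 1 1 * z + (\<Sum>j<J. Gb (Suc (Suc j)) 1 * z ^ Suc (Suc j))"
            by (simp add: sum.lessThan_Suc_shift del: sum.lessThan_Suc)
          also have "(\<Sum>j<J. Gb (Suc (Suc j)) 1 * z ^ Suc (Suc j)) = z\<^sup>2 * (\<Sum>j<J. Gb (Suc (Suc j)) 1 * z ^ j)"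
            by (simp add: sum_distrib_left power2_eq_square mult_ac)
          finally show ?thesis using Gb0[OF h1] Gb1[OF h1] by simp
        qed
        show ?thesis unfolding s using z(1)
          by (simp add: divide_simps sum_distrib_left[symmetric] mult.assoc) (simp add: power2_eq_square algebra_simps)
      qed
      finally show ?thesis by (simp add: z_def)
    qed
    have "norm (r J (of_real t) - r J (of_real s)) \<le> (2 * C) * t ^ Suc J" if st: "0 < s" "s \<le> t" "t < t0" for s t
    proof -
      define S where "S = complex_of_real ` {s..t}"
      have "norm (r J (of_real t) - r J (of_real s)) \<le> (2 * C * t ^ J) * norm (complex_of_real t - of_real s)"
      proof (rule field_differentiable_bound[of S])
        show "convex S" unfolding S_def by (intro convex_linear_image convex_real_interval) (auto intro: bounded_linear.linear bounded_linear_of_real)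
        show "complex_of_real t \<in> S" "complex_of_real s \<in> S" using st by (auto simp: S_def)
        show "(r J has_field_derivative - (2 / (z\<^sup>2)) * (B (Re z) 1 - (\<Sum>j\<le>Suc J. Gb j 1 * z ^ j))) (at z within S)" if "z \<in> S" for z
          using der[of "Re z"] that st unfolding S_def by (auto intro: has_field_derivative_at_within)
        show "norm (- (2 / (z\<^sup>2)) * (B (Re z) 1 - (\<Sum>j\<le>Suc J. Gb j 1 * z ^ j))) \<le> 2 * C * t ^ J" if zS: "z \<in> S" for z
        proof -
          obtain u where u: "z = of_real u" "s \<le> u" "u \<le> t" using zS by (auto simp: S_def)
          have u0: "0 < u" "u < t0" using u st by auto
          have "norm (- (2 / (z\<^sup>2)) * (B (Re z) 1 - (\<Sum>j\<le>Suc J. Gb j 1 * z ^ j))) = 2 / u\<^sup>2 * norm (B u 1 - (\<Sum>j\<le>Suc J. Gb j 1 * of_real u ^ j))"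
          proof -
            have "norm (- (2 / (complex_of_real u)\<^sup>2) * X) = 2 / u\<^sup>2 * norm X" for X
              using u0 by (simp add: norm_mult norm_divide norm_power)
            then show ?thesis unfolding u(1) Re_complex_of_real .
          qed
          also have "\<dots> \<le> 2 / u\<^sup>2 * (C * u ^ Suc (Suc J))" using u0 by (intro mult_left_mono C(3) h1) auto
          also have "\<dots> = 2 * C * u ^ J" using u0 by (simp add: power2_eq_square)
          also have "\<dots> \<le> 2 * C * t ^ J" using u u0 C(1) by (intro mult_left_mono power_mono) auto
          finally show ?thesis .
        qed
      qed
      also have "norm (complex_of_real t - of_real s) = t - s"
        using st by (metis abs_of_nonneg diff_ge_0_iff_ge norm_of_real of_real_diff)
      also have "(2 * C * t ^ J) * (t - s) \<le> (2 * C * t ^ J) * t" using st C(1) by (intro mult_left_mono) auto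
      finally show ?thesis by (simp add: mult_ac)
    qed
    then show ?thesis using C(1,2) by (intro exI[of _ "2 * C"] exI[of _ t0]) auto
  qed
  obtain L' where L': "((\<lambda>t::real. H (of_real (t\<^sup>2)) - (L' / of_real t + of_real (2 * \<kappa> * ln t + D0))) \<longlongrightarrow> 0) (at_right 0)"
    by (rule H_real_limit)
  have rr: "r 0 (of_real t) = (H (of_real (t\<^sup>2)) - (L' / of_real t + of_real (2 * \<kappa> * ln t + D0))) + (L' - of_real L) / of_real t" if "0 < t" for t
    using that by (simp add: r_def Ln_of_real diff_divide_distrib)
  \<comment> \<open>If the two coefficients of \<open>1 / t\<close> differed, \<open>r 0\<close>
    would be unbounded near \<open>0\<close>, against the bound on its increments.\<close>
  have LL: "L' = of_real L"
  proof -
    obtain C t0 where C: "C \<ge> 0" "0 < t0" "\<And>s t. 0 < s \<Longrightarrow> s \<le> t \<Longrightarrow> t < t0 \<Longrightarrow> norm (r 0 (of_real t) - r 0 (of_real s)) \<le> C * t ^ Suc 0"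
      using rdiff[of 0] by blast
    define u where "u = t0 / 2"
    have u: "0 < u" "u < t0" using C(2) by (auto simp: u_def)
    define M where "M = norm (r 0 (of_real u)) + C * u"
    have M: "norm (r 0 (of_real s)) \<le> M" if "0 < s" "s < u" for s
    proof -
      have "norm (r 0 (of_real u) - r 0 (of_real s)) \<le> C * u" using C(3)[of s u] that u by simp
      then show ?thesis unfolding M_def using norm_triangle_sub[of "r 0 (of_real s)" "r 0 (of_real u)"] by (simp add: norm_minus_commute)
    qed
    have t0: "((\<lambda>s::real. of_real s * r 0 (of_real s)) \<longlongrightarrow> 0) (at_right 0)"
    proof (rule Lim_null_comparison)
      show "\<forall>\<^sub>F s in at_right 0. norm (of_real s * r 0 (of_real s)) \<le> s * M"
        using eventually_small_right[OF u(1)]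
      proof eventually_elim
        case (elim s)
        then have "s * norm (r 0 (of_real s)) \<le> s * M" using M[of s] by (intro mult_left_mono) auto
        then show ?case using elim by (simp add: norm_mult)
      qed
      show "((\<lambda>s. s * M) \<longlongrightarrow> 0) (at_right 0)" by (auto intro!: tendsto_eq_intros)
    qed
    have id: "((\<lambda>s::real. complex_of_real s) \<longlongrightarrow> of_real 0) (at_right 0)" by (intro tendsto_of_real tendsto_ident_at)
    have "((\<lambda>s::real. of_real s * r 0 (of_real s) - of_real s * (H (of_real (s\<^sup>2)) - (L' / of_real s + of_real (2 * \<kappa> * ln s + D0)))) \<longlongrightarrow> 0 - of_real 0 * 0) (at_right 0)"
      by (intro tendsto_diff tendsto_mult t0 L' id)
    moreover have "\<forall>\<^sub>F s in at_right 0. of_real s * r 0 (of_real s) - of_real s * (H (of_real (s\<^sup>2)) - (L' / of_real s + of_real (2 * \<kappa> * ln s + D0))) = L' - of_real L"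
      using eventually_small_right[OF u(1)] by eventually_elim (simp add: rr distrib_left)
    ultimately have "((\<lambda>s::real. L' - of_real L) \<longlongrightarrow> 0 - of_real 0 * 0) (at_right 0)" by (rule Lim_transform_eventually)
    then show ?thesis by (simp add: tendsto_const_iff)
  qed
  have rlim: "((\<lambda>t::real. r J (of_real t)) \<longlongrightarrow> 0) (at_right 0)" for J
  proof -
    have id: "((\<lambda>s::real. complex_of_real s) \<longlongrightarrow> of_real 0) (at_right 0)" by (intro tendsto_of_real tendsto_ident_at)
    have "((\<lambda>t::real. (H (of_real (t\<^sup>2)) - (L' / of_real t + of_real (2 * \<kappa> * ln t + D0))) + (\<Sum>j<J. of_real (2 / real (Suc j)) * Gb (Suc (Suc j)) 1 * of_real t ^ Suc j)) \<longlongrightarrow> 0 + (\<Sum>j<J. of_real (2 / real (Suc j)) * Gb (Suc (Suc j)) 1 * of_real 0 ^ Suc j)) (at_right 0)"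
      by (intro tendsto_add L' tendsto_sum tendsto_mult tendsto_const tendsto_power id)
    moreover have "\<forall>\<^sub>F t in at_right 0. (H (of_real (t\<^sup>2)) - (L' / of_real t + of_real (2 * \<kappa> * ln t + D0))) + (\<Sum>j<J. of_real (2 / real (Suc j)) * Gb (Suc (Suc j)) 1 * of_real t ^ Suc j) = r J (of_real t)"
      using eventually_small_right[of 1, simplified] by eventually_elim (simp add: r_def LL Ln_of_real)
    ultimately show ?thesis using Lim_transform_eventually by fastforce
  qed
  \<comment> \<open>Letting \<open>s\<close> tend to \<open>0\<close> in the increments gives the
    full order \<open>Suc J\<close>, although \<open>H_real_limit\<close> yields mere
    convergence.\<close>
  have rbd: "\<exists>C t0. C \<ge> 0 \<and> 0 < t0 \<and> (\<forall>t. 0 < t \<longrightarrow> t < t0 \<longrightarrow> norm (r J (of_real t)) \<le> C * t ^ Suc J)" for J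
  proof -
    obtain C t0 where C: "C \<ge> 0" "0 < t0" "\<And>s t. 0 < s \<Longrightarrow> s \<le> t \<Longrightarrow> t < t0 \<Longrightarrow> norm (r J (of_real t) - r J (of_real s)) \<le> C * t ^ Suc J"
      using rdiff[of J] by blast
    have "norm (r J (of_real t)) \<le> C * t ^ Suc J" if t: "0 < t" "t < t0" for t
    proof (rule tendsto_upperbound)
      show "((\<lambda>s::real. norm (r J (of_real t) - r J (of_real s))) \<longlongrightarrow> norm (r J (of_real t))) (at_right 0)"
        using tendsto_norm[OF tendsto_diff[OF tendsto_const rlim[of J]], of "r J (of_real t)"] by simp
      show "\<forall>\<^sub>F s in at_right 0. norm (r J (of_real t) - r J (of_real s)) \<le> C * t ^ Suc J"
        using eventually_small_right[OF t(1)] by eventually_elim (use C(3) t in auto)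
    qed simp
    then show ?thesis using C(1,2) by blast
  qed
  \<comment> \<open>At order \<open>j \<ge> 1\<close> the dependence on \<open>w\<close> comes from
    \<open>E (Suc j)\<close>, with index raised because \<open>B\<close> carries an extra factor
    \<open>t\<close>; the constant comes from the integration along \<open>w = 1\<close>.\<close>
  define G where "G = (\<lambda>j w. if j = 0 then of_real D0 + of_real \<kappa> * Ln w else - (E (Suc j) w + of_real (2 / real j) * Gb (Suc j) 1))"
  have main: "uexp_coeffs (ball 1 h) J T G" for J
  proof -
    obtain C t0 where C: "C \<ge> 0" "0 < t0" "\<And>t w. 0 < t \<Longrightarrow> t < t0 \<Longrightarrow> w \<in> ball 1 h \<Longrightarrow> norm (B t w - (\<Sum>j\<le>Suc J. Gb j w * of_real t ^ j)) \<le> C * t ^ Suc (Suc J)"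
      using Bbd[of J] by blast
    obtain C' t1 where C': "C' \<ge> 0" "0 < t1" "\<And>t. 0 < t \<Longrightarrow> t < t1 \<Longrightarrow> norm (r J (of_real t)) \<le> C' * t ^ Suc J"
      using rbd[of J] by blast
    show ?thesis
    proof (rule uexp_coeffsI)
      fix j
      show "\<exists>M. \<forall>w\<in>ball 1 h. norm (G j w) \<le> M"
      proof (cases j)
        case 0
        obtain K where K: "\<And>w. w \<in> ball 1 h \<Longrightarrow> norm (E 1 w) \<le> K" using Ebd[of 1] by blast
        have "norm (G 0 w) \<le> norm (complex_of_real D0) + K" if "w \<in> ball 1 h" for w
        proof -
          have "G 0 w = of_real D0 - E 1 w" using E1eq[OF that] by (simp add: G_def)
          then show ?thesis using norm_triangle_ineq4[of "of_real D0" "E 1 w"] K[OF that] by simp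
        qed
        then show ?thesis using 0 by blast
      next
        case (Suc i)
        obtain K where K: "\<And>w. w \<in> ball 1 h \<Longrightarrow> norm (E (Suc j) w) \<le> K" using Ebd[of "Suc j"] by blast
        have "norm (G j w) \<le> K + norm (of_real (2 / real j) * Gb (Suc j) 1)" if "w \<in> ball 1 h" for w
          using K[OF that] norm_triangle_ineq[of "E (Suc j) w" "of_real (2 / real j) * Gb (Suc j) 1"] Suc
          unfolding G_def by (simp only: norm_minus_cancel if_False nat.distinct)
        then show ?thesis by blast
      qed
    next
      have "0 < min t0 t1" using C C' by simp
      from eventually_small_right[OF this]
      show "\<forall>\<^sub>F t in at_right 0. \<forall>w\<in>ball 1 h. norm (T t w - (\<Sum>j\<le>J. G j w * of_real t ^ j)) \<le> (2 * C + C') * t ^ Suc J"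
      proof eventually_elim
        case (elim t)
        show ?case
        proof
          fix w :: complex assume w: "w \<in> ball 1 h"
          have t: "0 < t" "t < t0" "t < t1" using elim by auto
          \<comment> \<open>The derivative of \<open>\<phi>\<close> is minus the error in the
            expansion of \<open>B\<close>, divided by \<open>w * t\<close>.\<close>
          define \<phi> where "\<phi> = (\<lambda>w. H (w * of_real (t\<^sup>2)) + (\<Sum>j\<le>Suc J. E j w * of_real t ^ j) / of_real t)"
          have "norm (\<phi> w - \<phi> 1) \<le> 2 * C * t ^ Suc J"
          proof (rule holomorphic_derivative_bound_ball[OF _ _ _ w])
            fix v :: complex assume v: "v \<in> ball 1 h"
            have "((\<lambda>w. H (w * of_real (t\<^sup>2))) has_field_derivative (- (B t v / of_real t) / (v * of_real (t\<^sup>2))) * of_real (t\<^sup>2)) (at v)"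
              by (rule DERIV_chain2[where f = H and g = "\<lambda>w. w * of_real (t\<^sup>2)", OF Hd[OF t(1) v]]) (auto intro!: derivative_eq_intros)
            moreover have "((\<lambda>w. (\<Sum>j\<le>Suc J. E j w * of_real t ^ j) / of_real t) has_field_derivative (\<Sum>j\<le>Suc J. Gb j v / v * of_real t ^ j) / of_real t) (at v)"
              by (intro DERIV_cdivide DERIV_sum DERIV_cmult_right E v)
            ultimately have "(\<phi> has_field_derivative (- (B t v / of_real t) / (v * of_real (t\<^sup>2))) * of_real (t\<^sup>2) + (\<Sum>j\<le>Suc J. Gb j v / v * of_real t ^ j) / of_real t) (at v)"
              unfolding \<phi>_def by (rule DERIV_add)
            moreover have "(- (B t v / of_real t) / (v * of_real (t\<^sup>2))) * of_real (t\<^sup>2) + (\<Sum>j\<le>Suc J. Gb j v / v * of_real t ^ j) / of_real t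
              = - (B t v - (\<Sum>j\<le>Suc J. Gb j v * of_real t ^ j)) / (v * of_real t)"
            proof -
              have "(\<Sum>j\<le>Suc J. Gb j v / v * of_real t ^ j) = (\<Sum>j\<le>Suc J. Gb j v * of_real t ^ j) / v"
                unfolding sum_divide_distrib by simp
              then show ?thesis using t wprops(4)[OF v] by (simp add: field_simps)
            qed
            ultimately show "(\<phi> has_field_derivative - (B t v - (\<Sum>j\<le>Suc J. Gb j v * of_real t ^ j)) / (v * of_real t)) (at v)" by simp
            have "norm (- (B t v - (\<Sum>j\<le>Suc J. Gb j v * of_real t ^ j)) / (v * of_real t)) = norm (B t v - (\<Sum>j\<le>Suc J. Gb j v * of_real t ^ j)) / (norm v * t)"
              using t by (simp only: norm_divide norm_minus_cancel norm_mult norm_of_real)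
            also have "\<dots> \<le> (C * t ^ Suc (Suc J)) / (1/2 * t)"
              using t C wprops(2)[OF v] v by (intro frac_le C(3) mult_right_mono mult_nonneg_nonneg) auto
            also have "\<dots> = 2 * C * t ^ Suc J" using t by simp
            finally show "norm (- (B t v - (\<Sum>j\<le>Suc J. Gb j v * of_real t ^ j)) / (v * of_real t)) \<le> 2 * C * t ^ Suc J" .
          qed (use h in auto)
          moreover have "norm (r J (of_real t)) \<le> C' * t ^ Suc J" by (rule C'(3)) (use t in auto)
          moreover have "T t w - (\<Sum>j\<le>J. G j w * of_real t ^ j) = (\<phi> w - \<phi> 1) + r J (of_real t)"
          proof -
            define z where "z = complex_of_real t"
            have z: "z \<noteq> 0" using t by (simp add: z_def)
            have s: "(\<Sum>j\<le>Suc J. E j w * z ^ j) / z = E 0 w / z + E 1 w + (\<Sum>j<J. E (Suc (Suc j)) w * z ^ Suc j)"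
            proof -
              have "(\<Sum>j\<le>Suc J. E j w * z ^ j) = (\<Sum>j<Suc (Suc J). E j w * z ^ j)" by (simp only: lessThan_Suc_atMost)
              also have "\<dots> = E 0 w + E 1 w * z + (\<Sum>j<J. E (Suc (Suc j)) w * z ^ Suc (Suc j))"
                by (simp add: sum.lessThan_Suc_shift del: sum.lessThan_Suc)
              also have "(\<Sum>j<J. E (Suc (Suc j)) w * z ^ Suc (Suc j)) = (\<Sum>j<J. E (Suc (Suc j)) w * z ^ Suc j) * z"
                unfolding sum_distrib_right by (simp add: mult_ac)
              finally show ?thesis using z by (simp add: add_divide_distrib)
            qed
            have g: "(\<Sum>j\<le>J. G j w * z ^ j) = of_real D0 + of_real \<kappa> * Ln w - (\<Sum>j<J. E (Suc (Suc j)) w * z ^ Suc j) - (\<Sum>j<J. of_real (2 / real (Suc j)) * Gb (Suc (Suc j)) 1 * z ^ Suc j)"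
            proof -
              have "(\<Sum>j\<le>J. G j w * z ^ j) = (\<Sum>j<Suc J. G j w * z ^ j)" by (simp only: lessThan_Suc_atMost)
              also have "\<dots> = G 0 w + (\<Sum>j<J. G (Suc j) w * z ^ Suc j)"
                by (simp add: sum.lessThan_Suc_shift del: sum.lessThan_Suc)
              also have "(\<Sum>j<J. G (Suc j) w * z ^ Suc j) = - (\<Sum>j<J. E (Suc (Suc j)) w * z ^ Suc j) - (\<Sum>j<J. of_real (2 / real (Suc j)) * Gb (Suc (Suc j)) 1 * z ^ Suc j)"
                by (simp only: G_def nat.distinct if_False minus_add_distrib ring_distribs sum.distrib sum_negf diff_conv_add_uminus mult_minus_left)
              finally show ?thesis by (simp add: G_def)
            qed
            have "\<phi> 1 = H (of_real (t\<^sup>2))" by (simp add: \<phi>_def E1)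
            moreover have "r J z = H (of_real (t\<^sup>2)) - of_real L / z - of_real (2 * \<kappa> * ln t) - of_real D0 + (\<Sum>j<J. of_real (2 / real (Suc j)) * Gb (Suc (Suc j)) 1 * z ^ Suc j)"
              using t by (simp add: r_def z_def Ln_of_real)
            ultimately show ?thesis
              unfolding T_def \<phi>_def z_def[symmetric] g s E0eq[OF w] E1eq[OF w]
              using z wprops[OF w] by (simp add: right_diff_distrib diff_divide_distrib)
          qed
          ultimately show "norm (T t w - (\<Sum>j\<le>J. G j w * of_real t ^ j)) \<le> (2 * C + C') * t ^ Suc J"
            using norm_triangle_mono[of "\<phi> w - \<phi> 1" "2 * C * t ^ Suc J" "r J (of_real t)" "C' * t ^ Suc J"]
            by (simp only: distrib_right)
        qed
      qed
    qed
  qed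
  show ?thesis
  proof (rule that[OF h main])
    show "G j holomorphic_on ball 1 h" for j
    proof (cases j)
      case 0
      then show ?thesis unfolding G_def using wprops by (auto intro!: holomorphic_intros)
    next
      case (Suc i)
      then show ?thesis unfolding G_def by (auto intro!: holomorphic_intros Ehol)
    qed
    show "G 0 w = of_real D0 + of_real \<kappa> * Ln w" for w by (simp add: G_def)
  qed
qed

end

section \<open>Laplace expansion at the saddle point\<close>

text \<open>With \<open>w = 1 + \<i> * u\<close> and \<open>v = csqrt w\<close>, the exponent
  \<open>w / 2 + 1 / v\<close> exceeds its stationary value \<open>3 / 2\<close> by
  \<open>(v - 1)\<^sup>2 * (v + 2) / (2 * v)\<close>. The formula is this excess divided by
  \<open>u\<^sup>2 = - (v\<^sup>2 - 1)\<^sup>2\<close> with the double zero cancelled, hence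
  holomorphic at \<open>0\<close>.\<close>

definition saddle :: "complex \<Rightarrow> complex" where
  "saddle u = (let v = csqrt (1 + \<i> * u) in - (v + 2) / (2 * v * (v + 1)\<^sup>2))"

lemma Re_one_plus_i_times: "norm u < 1 \<Longrightarrow> 0 < Re (1 + \<i> * u)"
  using abs_Im_le_cmod[of u] by simp

lemma csqrt_props:
  assumes "0 < Re w"
  shows "csqrt w \<noteq> 0" "csqrt w + 1 \<noteq> 0" "(csqrt w)\<^sup>2 = w" "w \<notin> \<real>\<^sub>\<le>\<^sub>0"
proof -
  show w: "w \<notin> \<real>\<^sub>\<le>\<^sub>0" using assms by (auto simp: complex_nonpos_Reals_iff)
  then show "csqrt w \<noteq> 0" by auto
  show "(csqrt w)\<^sup>2 = w" by simp
  have re: "0 \<le> Re (csqrt w)" by (rule Re_csqrt)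
  show "csqrt w + 1 \<noteq> 0"
  proof
    assume "csqrt w + 1 = 0"
    then have "Re (csqrt w + 1) = 0" by (simp only: zero_complex.sel)
    then show False using re by (simp only: plus_complex.sel one_complex.sel)
  qed
qed

lemma saddle_eq:
  assumes u: "norm u < 1"
  shows "(1 + \<i> * u) / 2 + 1 / csqrt (1 + \<i> * u) = 3 / 2 + u\<^sup>2 * saddle u"
proof -
  define v where "v = csqrt (1 + \<i> * u)"
  have v: "v \<noteq> 0" "v + 1 \<noteq> 0" "v\<^sup>2 = 1 + \<i> * u"
    using csqrt_props[OF Re_one_plus_i_times[OF u]] by (auto simp: v_def)
  have "\<i> * u = (v - 1) * (v + 1)" using v(3) by (simp add: algebra_simps power2_eq_square)
  then have "(\<i> * u)\<^sup>2 = (v - 1)\<^sup>2 * (v + 1)\<^sup>2" by (simp add: power_mult_distrib)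
  then have "- (u\<^sup>2) = (v - 1)\<^sup>2 * (v + 1)\<^sup>2" by (simp add: power_mult_distrib)
  then have u2: "u\<^sup>2 = - ((v - 1)\<^sup>2 * (v + 1)\<^sup>2)" by (metis minus_minus)
  have "u\<^sup>2 * saddle u = (v - 1)\<^sup>2 * (v + 2) / (2 * v)"
    using v unfolding u2 saddle_def v_def[symmetric] Let_def by (simp add: field_simps)
  also have "\<dots> = v\<^sup>2 / 2 + 1 / v - 3 / 2"
    using v(1) by (simp add: field_simps power2_eq_square)
  finally have "u\<^sup>2 * saddle u = v\<^sup>2 / 2 + 1 / v - 3 / 2" .
  then show ?thesis unfolding v(3) v_def[symmetric] by simp
qed

lemma saddle_holomorphic: "saddle holomorphic_on ball 0 1"
proof -
  have "1 + \<i> * u \<notin> \<real>\<^sub>\<le>\<^sub>0" "csqrt (1 + \<i> * u) \<noteq> 0" "csqrt (1 + \<i> * u) + 1 \<noteq> 0" if "u \<in> ball 0 1" for u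
    using csqrt_props[OF Re_one_plus_i_times[of u]] that by auto
  then have "(\<lambda>u. - (csqrt (1 + \<i> * u) + 2) / (2 * csqrt (1 + \<i> * u) * (csqrt (1 + \<i> * u) + 1)\<^sup>2)) holomorphic_on ball 0 1"
    by (intro holomorphic_intros) auto
  then show ?thesis by (simp add: saddle_def[abs_def] Let_def)
qed

lemma saddle_0: "saddle 0 = - 3 / 8"
  by (simp add: saddle_def Let_def)

text \<open>The value at \<open>0\<close> is \<open>- 3 / 8\<close>; the slack up to
  \<open>- 1 / 4\<close> is spent on a neighbourhood by continuity.\<close>

lemma saddle_decay:
  obtains \<rho> where "0 < \<rho>" "\<rho> < 1" "\<And>u. u \<in> ball 0 \<rho> \<Longrightarrow> Re (saddle u) \<le> - 1 / 4"
proof -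
  have "continuous_on (ball 0 1) saddle" by (rule holomorphic_on_imp_continuous_on[OF saddle_holomorphic])
  then have "isCont saddle 0" by (simp add: continuous_on_eq_continuous_at)
  then have "((\<lambda>u. Re (saddle u)) \<longlongrightarrow> Re (saddle 0)) (nhds 0)"
    unfolding isCont_def by (intro tendsto_Re) (simp add: tendsto_nhds_iff)
  then have "\<forall>\<^sub>F u in nhds 0. Re (saddle u) < - 1 / 4"
    by (rule order_tendstoD) (simp add: saddle_0)
  then obtain d where d: "d > 0" "\<And>u. dist u 0 < d \<Longrightarrow> Re (saddle u) < - 1 / 4"
    unfolding eventually_nhds_metric by auto
  show ?thesis
    by (rule that[of "min d (1/2)"]) (use d in \<open>auto intro: less_imp_le\<close>)
qed

text \<open>The weight is the one left by the bound \<open>- 1 / 4\<close> on the phase; these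
  moments dominate all Laplace integrals below.\<close>

lemma integrable_gaussian_moment: "integrable lborel (\<lambda>v::real. exp (- (v\<^sup>2 / 4)) * \<bar>v\<bar> ^ j)"
proof -
  have "integrable lborel (\<lambda>x. std_normal_density x * x ^ j)" by (rule integrable_std_normal_moment)
  then have "integrable lborel (\<lambda>x. sqrt (2 * pi) * (std_normal_density x * x ^ j))" by (rule integrable_mult_right)
  then have "integrable lborel (\<lambda>x::real. exp (- (x\<^sup>2 / 2)) * x ^ j)"
    by (simp add: std_normal_density_def real_sqrt_mult)
  then have "integrable lborel (\<lambda>x::real. norm (exp (- (x\<^sup>2 / 2)) * x ^ j))" by (rule integrable_norm)
  then have "integrable lborel (\<lambda>x::real. exp (- (x\<^sup>2 / 2)) * \<bar>x\<bar> ^ j)" by (simp add: abs_mult power_abs)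
  from lborel_integrable_real_affine[OF this, of "1 / sqrt 2" 0]
  have "integrable lborel (\<lambda>x::real. exp (- (x\<^sup>2 / 4)) * (\<bar>x\<bar> ^ j * (1 / sqrt 2) ^ j))"
    by (simp add: power_divide power_mult_distrib abs_mult field_simps)
  then have "integrable lborel (\<lambda>x::real. sqrt 2 ^ j * (exp (- (x\<^sup>2 / 4)) * (\<bar>x\<bar> ^ j * (1 / sqrt 2) ^ j)))"
    by (rule integrable_mult_right)
  then show ?thesis by (simp add: power_divide)
qed

lemma integral_gaussian_3_8: "(\<integral>v. exp (- (3 / 8 * (v::real)\<^sup>2)) \<partial>lborel) = sqrt (8 * pi / 3)"
proof -
  define \<sigma> where "\<sigma> = sqrt (4 / 3 :: real)"
  have \<sigma>: "\<sigma> > 0" "\<sigma>\<^sup>2 = 4 / 3" by (auto simp: \<sigma>_def)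
  have eq: "exp (- (3 / 8 * v\<^sup>2)) = sqrt (8 * pi / 3) * normal_density 0 \<sigma> v" for v
    by (simp add: normal_density_def \<sigma>(2))
  have "(\<integral>v. exp (- (3 / 8 * (v::real)\<^sup>2)) \<partial>lborel) = sqrt (8 * pi / 3) * (\<integral>v. normal_density 0 \<sigma> v \<partial>lborel)"
    unfolding eq by (rule integral_mult_right_zero)
  also have "(\<integral>v. normal_density 0 \<sigma> v \<partial>lborel) = 1" by (rule integral_normal_density[OF \<sigma>(1)])
  finally show ?thesis by simp
qed

text \<open>After substituting \<open>u = s * v\<close> the integrand is
  \<open>\<Phi> (v\<^sup>2) (s * v)\<close>: the large factor has become the separate parameter
  \<open>y = v\<^sup>2\<close>. Taylor expansion in the other variable gives powers of
  \<open>s\<close> with coefficients bounded by multiples of \<open>exp (- y / 4)\<close>, and their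
  integrals over \<open>v\<close> are the \<open>k j\<close>.\<close>

lemma laplace_expansion:
  fixes q e :: "complex \<Rightarrow> complex"
  assumes \<rho>: "0 < \<rho>" and q: "q holomorphic_on ball 0 \<rho>" "\<And>u. u \<in> ball 0 \<rho> \<Longrightarrow> Re (q u) \<le> - 1 / 4" "q 0 = - 3 / 8"
    and e: "e holomorphic_on ball 0 \<rho>" "\<And>u. u \<in> ball 0 \<rho> \<Longrightarrow> norm (e u) \<le> M"
    and r: "0 < r" "r \<le> \<rho> / 4"
  obtains k C where "k 0 = of_real (sqrt (8 * pi / 3)) * e 0" "\<And>j. odd j \<Longrightarrow> k j = 0"
    "\<And>s. 0 < s \<Longrightarrow> s \<le> 1 \<Longrightarrow>
      norm ((1 / of_real s) * (\<integral>u. indicator {-r..r} u *\<^sub>R (exp (of_real (u\<^sup>2 / s\<^sup>2) * q (of_real u)) * e (of_real u)) \<partial>lborel)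
        - (\<Sum>j\<le>J. k j * of_real s ^ j)) \<le> C * s ^ Suc J"
proof -
  have M: "M \<ge> 0" using e(2)[of 0] \<rho> order_trans[OF norm_ge_zero] by (meson centre_in_ball)
  define \<Phi> where "\<Phi> = (\<lambda>y::real. \<lambda>u. exp (of_real y * q u) * e u)"
  have \<Phi>hol: "\<Phi> y holomorphic_on ball 0 \<rho>" for y unfolding \<Phi>_def by (intro holomorphic_intros q e)
  have \<Phi>bd: "norm (\<Phi> y u) \<le> M * exp (- (y / 4))" if "0 \<le> y" "u \<in> ball 0 \<rho>" for y u
  proof -
    have "y * Re (q u) \<le> y * (- 1 / 4)" using that q(2) by (intro mult_left_mono) auto
    then have "norm (exp (of_real y * q u)) \<le> exp (- (y / 4))" by simp
    then show ?thesis unfolding \<Phi>_def norm_mult using e(2)[OF that(2)]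
      by (subst mult.commute) (intro mult_mono, auto)
  qed
  define \<phi> where "\<phi> = (\<lambda>j y. (deriv ^^ j) (\<Phi> y) 0 / fact j)"
  have \<phi>bd: "norm (\<phi> j y) \<le> M * (2 / \<rho>) ^ j * exp (- (y / 4))" if "0 \<le> y" for j y
    using Taylor_bounded(1)[OF \<Phi>hol \<rho> \<Phi>bd[OF that], of j] by (simp add: \<phi>_def mult_ac)
  have rem: "norm (\<Phi> y z - (\<Sum>j\<le>J. \<phi> j y * z ^ j)) \<le> 2 * (M * exp (- (y / 4))) * (2 * norm z / \<rho>) ^ Suc J" if "0 \<le> y" "norm z \<le> \<rho> / 4" for y z
    using Taylor_bounded(2)[OF \<Phi>hol \<rho> \<Phi>bd[OF that(1)], of z J] that(2) by (simp add: \<phi>_def)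
  \<comment> \<open>Continuity in \<open>y\<close> serves measurability. The factor
    \<open>exp (y / 4)\<close> makes the family bounded, so that its Taylor coefficients are uniform
    limits and inherit continuity.\<close>
  have \<phi>cont: "continuous_on {0..} (\<phi> j)" for j
  proof -
    define A where "A = (\<lambda>t::real. \<lambda>y. of_real (exp (y / 4)) * \<Phi> y (of_real t))"
    have eqd: "(deriv ^^ i) (\<lambda>z. of_real (exp (y / 4)) * \<Phi> y z) 0 = of_real (exp (y / 4)) * (deriv ^^ i) (\<Phi> y) 0" for i y
      by (rule higher_deriv_cmult[OF \<Phi>hol _ open_ball]) (use \<rho> in auto)
    have "uexp_coeffs {0..} j A (\<lambda>i y. (deriv ^^ i) (\<lambda>z. of_real (exp (y / 4)) * \<Phi> y z) 0 / fact i)"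
      unfolding A_def
    proof (rule uexp_coeffs_Taylor[where r = \<rho> and B = M])
      show "(\<lambda>z. of_real (exp (y / 4)) * \<Phi> y z) holomorphic_on ball 0 \<rho>" for y by (intro holomorphic_intros \<Phi>hol)
      show "norm (of_real (exp (y / 4)) * \<Phi> y z) \<le> M" if "y \<in> {0..}" "z \<in> ball 0 \<rho>" for y z
        using mult_left_mono[OF \<Phi>bd[of y z], of "exp (y / 4)"] that by (simp add: norm_mult exp_minus field_simps)
    qed (use \<rho> in auto)
    then have cA: "continuous_on {0..} (\<lambda>y. (deriv ^^ j) (\<lambda>z. of_real (exp (y / 4)) * \<Phi> y z) 0 / fact j)"
    proof (rule uexp_coeffs_closed[where \<C> = "continuous_on {0..}"])
      show "\<forall>\<^sub>F t in at_right 0. continuous_on {0..} (A t)"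
        by (intro always_eventually allI) (auto simp: A_def \<Phi>_def intro!: continuous_intros)
      show "continuous_on {0..} g" if "uniform_limit {0..} f g (at_right (0::real))" "\<forall>\<^sub>F t in at_right 0. continuous_on {0..} (f t)" for f and g :: "real \<Rightarrow> complex"
        by (rule uniform_limit_theorem[OF that(2,1)]) simp
    qed (auto intro!: continuous_intros)
    have "continuous_on {0..} (\<lambda>y. of_real (exp (- (y / 4))) * ((deriv ^^ j) (\<lambda>z. of_real (exp (y / 4)) * \<Phi> y z) 0 / fact j))"
      by (intro continuous_on_mult[OF _ cA]) (auto intro!: continuous_intros)
    then show ?thesis
    proof (rule continuous_on_eq)
      fix y :: real
      have "complex_of_real (exp (- (y / 4))) * of_real (exp (y / 4)) = 1"
        by (simp flip: of_real_mult exp_add)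
      then show "of_real (exp (- (y / 4))) * ((deriv ^^ j) (\<lambda>z. of_real (exp (y / 4)) * \<Phi> y z) 0 / fact j) = \<phi> j y"
        unfolding eqd \<phi>_def by (simp only: times_divide_eq_right mult.assoc[symmetric] mult_1_left)
    qed
  qed
  have \<psi>cont: "continuous_on UNIV (\<lambda>v::real. \<phi> j (v\<^sup>2) * of_real v ^ j)" for j
    by (intro continuous_on_mult continuous_on_compose2[OF \<phi>cont] continuous_intros) auto
  have \<psi>int: "integrable lborel (\<lambda>v::real. \<phi> j (v\<^sup>2) * of_real v ^ j)" for j
  proof (rule Bochner_Integration.integrable_bound)
    show "integrable lborel (\<lambda>v::real. M * (2 / \<rho>) ^ j * (exp (- (v\<^sup>2 / 4)) * \<bar>v\<bar> ^ j))"
      by (rule integrable_mult_right[OF integrable_gaussian_moment])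
    show "(\<lambda>v. \<phi> j (v\<^sup>2) * of_real v ^ j) \<in> borel_measurable lborel"
      using borel_measurable_continuous_onI[OF \<psi>cont] by simp
    show "AE v in lborel. norm (\<phi> j (v\<^sup>2) * of_real v ^ j) \<le> norm (M * (2 / \<rho>) ^ j * (exp (- (v\<^sup>2 / 4)) * \<bar>v\<bar> ^ j))"
    proof (rule AE_I2)
      fix v :: real
      have "norm (\<phi> j (v\<^sup>2) * of_real v ^ j) \<le> M * (2 / \<rho>) ^ j * exp (- (v\<^sup>2 / 4)) * \<bar>v\<bar> ^ j"
        unfolding norm_mult norm_power norm_of_real by (intro mult_right_mono \<phi>bd) auto
      also have "\<dots> = norm (M * (2 / \<rho>) ^ j * (exp (- (v\<^sup>2 / 4)) * \<bar>v\<bar> ^ j))"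
        using M \<rho> by (simp add: abs_mult)
      finally show "norm (\<phi> j (v\<^sup>2) * of_real v ^ j) \<le> norm (M * (2 / \<rho>) ^ j * (exp (- (v\<^sup>2 / 4)) * \<bar>v\<bar> ^ j))" .
    qed
  qed
  define k where "k = (\<lambda>j. \<integral>v. \<phi> j (v\<^sup>2) * of_real v ^ j \<partial>lborel)"
  have k0: "k 0 = of_real (sqrt (8 * pi / 3)) * e 0"
  proof -
    have "\<phi> 0 (v\<^sup>2) * of_real v ^ 0 = of_real (exp (- (3 / 8 * v\<^sup>2))) * e 0" for v :: real
      by (simp add: \<phi>_def \<Phi>_def q(3) exp_of_real[symmetric] mult.commute)
    then have "k 0 = (\<integral>v. of_real (exp (- (3 / 8 * v\<^sup>2))) * e 0 \<partial>lborel)" by (simp add: k_def)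
    also have "\<dots> = (\<integral>v. complex_of_real (exp (- (3 / 8 * v\<^sup>2))) \<partial>lborel) * e 0"
      by (rule integral_mult_left_zero)
    also have "(\<integral>v. complex_of_real (exp (- (3 / 8 * v\<^sup>2))) \<partial>lborel) = of_real (sqrt (8 * pi / 3))"
      by (subst integral_complex_of_real) (simp only: integral_gaussian_3_8)
    finally show ?thesis .
  qed
  have kodd: "k j = 0" if j: "odd j" for j
  proof -
    have "k j = \<bar>-1\<bar> *\<^sub>R (\<integral>v. \<phi> j ((0 + (-1) * v)\<^sup>2) * of_real (0 + (-1) * v) ^ j \<partial>lborel)"
      unfolding k_def by (rule lborel_integral_real_affine) simp
    also have "\<dots> = (\<integral>v. - (\<phi> j (v\<^sup>2) * of_real v ^ j) \<partial>lborel)"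
      using j by simp
    also have "\<dots> = - k j" unfolding k_def by (rule integral_minus)
    finally show ?thesis by simp
  qed
  \<comment> \<open>A Gaussian majorant for both ranges: the first term is the Taylor remainder
    inside the interval, the sum bounds the polynomial outside.\<close>
  define w where "w = (\<lambda>v::real. exp (- (v\<^sup>2 / 4)) * (2 * M * (2 / \<rho>) ^ Suc J * \<bar>v\<bar> ^ Suc J + (\<Sum>j\<le>J. M * (2 / \<rho>) ^ j * (1 / r) ^ Suc J * \<bar>v\<bar> ^ (j + Suc J))))"
  have wint: "integrable lborel w"
  proof -
    have "w = (\<lambda>v. 2 * M * (2 / \<rho>) ^ Suc J * (exp (- (v\<^sup>2 / 4)) * \<bar>v\<bar> ^ Suc J) + (\<Sum>j\<le>J. M * (2 / \<rho>) ^ j * (1 / r) ^ Suc J * (exp (- (v\<^sup>2 / 4)) * \<bar>v\<bar> ^ (j + Suc J))))"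
      unfolding w_def distrib_left sum_distrib_left by (intro ext arg_cong2[where f = "(+)"] sum.cong) (simp_all only: mult_ac)
    then show ?thesis
      by (simp only:) (intro Bochner_Integration.integrable_add Bochner_Integration.integrable_sum integrable_mult_right integrable_gaussian_moment)
  qed
  define C where "C = (\<integral>v. w v \<partial>lborel)"
  have main: "norm ((1 / of_real s) * (\<integral>u. indicator {-r..r} u *\<^sub>R (exp (of_real (u\<^sup>2 / s\<^sup>2) * q (of_real u)) * e (of_real u)) \<partial>lborel)
        - (\<Sum>j\<le>J. k j * of_real s ^ j)) \<le> C * s ^ Suc J" if s: "0 < s" "s \<le> 1" for s
  proof -
    define f where "f = (\<lambda>u::real. indicator {-r..r} u *\<^sub>R \<Phi> (u\<^sup>2 / s\<^sup>2) (of_real u))"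
    define g where "g = (\<lambda>v::real. \<Sum>j\<le>J. \<phi> j (v\<^sup>2) * of_real v ^ j * of_real s ^ j)"
    have fc: "continuous_on {-r..r} (\<lambda>u::real. \<Phi> (u\<^sup>2 / s\<^sup>2) (of_real u))"
    proof -
      have sub: "complex_of_real ` {-r..r} \<subseteq> ball 0 \<rho>" using r \<rho> by auto
      have "continuous_on {-r..r} (\<lambda>u. q (complex_of_real u))" "continuous_on {-r..r} (\<lambda>u. e (complex_of_real u))"
        by (rule continuous_on_compose2[OF holomorphic_on_imp_continuous_on[OF q(1)] _ sub], intro continuous_intros,
            rule continuous_on_compose2[OF holomorphic_on_imp_continuous_on[OF e(1)] _ sub], intro continuous_intros)
      then show ?thesis unfolding \<Phi>_def using s by (intro continuous_intros) auto
    qed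
    have fint: "integrable lborel f"
      using borel_integrable_atLeastAtMost'[OF fc] unfolding f_def set_integrable_def by simp
    have fs: "(1 / of_real s) * (\<integral>u. f u \<partial>lborel) = (\<integral>v. f (0 + s * v) \<partial>lborel)"
      by (subst lborel_integral_real_affine[of s f 0]) (use s in \<open>auto simp: scaleR_conv_of_real\<close>)
    have fint': "integrable lborel (\<lambda>v. f (0 + s * v))" by (rule lborel_integrable_real_affine[OF fint]) (use s in simp)
    have gint: "integrable lborel g"
      unfolding g_def by (intro Bochner_Integration.integrable_sum integrable_mult_left \<psi>int)
    have gs: "(\<integral>v. g v \<partial>lborel) = (\<Sum>j\<le>J. k j * of_real s ^ j)"
      unfolding g_def k_def
      by (subst Bochner_Integration.integral_sum) (auto intro!: integrable_mult_left \<psi>int sum.cong integral_mult_left)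
    have pt: "norm (f (0 + s * v) - g v) \<le> w v * s ^ Suc J" for v
    proof (cases "s * \<bar>v\<bar> \<le> r")
      case True
      have "\<bar>s * v\<bar> \<le> r" using True s by (simp add: abs_mult)
      then have "s * v \<in> {-r..r}" by (auto simp: abs_le_iff)
      then have "f (0 + s * v) = \<Phi> (v\<^sup>2) (of_real (s * v))" using s by (simp add: f_def power_mult_distrib)
      then have "norm (f (0 + s * v) - g v) = norm (\<Phi> (v\<^sup>2) (of_real (s * v)) - (\<Sum>j\<le>J. \<phi> j (v\<^sup>2) * of_real (s * v) ^ j))"
        by (simp add: g_def power_mult_distrib mult_ac)
      also have "\<dots> \<le> 2 * (M * exp (- (v\<^sup>2 / 4))) * (2 * norm (complex_of_real (s * v)) / \<rho>) ^ Suc J"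
        by (rule rem) (use True s r in \<open>auto simp: abs_mult norm_mult\<close>)
      also have "\<dots> = exp (- (v\<^sup>2 / 4)) * (2 * M * (2 / \<rho>) ^ Suc J * \<bar>v\<bar> ^ Suc J) * s ^ Suc J"
        unfolding norm_of_real abs_mult using s by (simp only: power_mult_distrib power_divide abs_of_pos) (simp add: mult_ac)
      also have "\<dots> \<le> w v * s ^ Suc J"
        unfolding w_def using s M \<rho> r
        by (intro mult_right_mono mult_left_mono) (auto intro!: sum_nonneg mult_nonneg_nonneg)
      finally show ?thesis .
    next
      case False
      then have "\<not> \<bar>s * v\<bar> \<le> r" using s by (simp add: abs_mult)
      then have "s * v \<notin> {-r..r}" by (auto simp: abs_le_iff)
      then have "norm (f (0 + s * v) - g v) = norm (g v)" by (simp add: f_def)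
      also have "\<dots> \<le> (\<Sum>j\<le>J. (M * (2 / \<rho>) ^ j * exp (- (v\<^sup>2 / 4))) * \<bar>v\<bar> ^ j * 1)"
      proof -
        have "norm (\<phi> j (v\<^sup>2) * of_real v ^ j * of_real s ^ j) \<le> (M * (2 / \<rho>) ^ j * exp (- (v\<^sup>2 / 4))) * \<bar>v\<bar> ^ j * 1" for j
          unfolding norm_mult norm_power norm_of_real using s M \<rho>
          by (intro mult_mono \<phi>bd power_le_one mult_nonneg_nonneg) auto
        then show ?thesis unfolding g_def by (intro order_trans[OF norm_sum] sum_mono)
      qed
      also have "\<dots> \<le> (\<Sum>j\<le>J. (M * (2 / \<rho>) ^ j * exp (- (v\<^sup>2 / 4))) * \<bar>v\<bar> ^ j * (1 / r * (s * \<bar>v\<bar>)) ^ Suc J)"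
      proof (intro sum_mono mult_left_mono)
        \<comment> \<open>Outside the interval the missing powers of \<open>s\<close> are bought by
          inserting a factor that is at least \<open>1\<close> there.\<close>
        have "1 \<le> 1 / r * (s * \<bar>v\<bar>)" using False r by (simp add: field_simps)
        then show "1 \<le> (1 / r * (s * \<bar>v\<bar>)) ^ Suc J" by (rule one_le_power)
      qed (use M \<rho> in auto)
      also have "\<dots> = exp (- (v\<^sup>2 / 4)) * (\<Sum>j\<le>J. M * (2 / \<rho>) ^ j * (1 / r) ^ Suc J * \<bar>v\<bar> ^ (j + Suc J)) * s ^ Suc J"
        unfolding sum_distrib_left sum_distrib_right power_mult_distrib power_add by (intro sum.cong refl) (simp only: mult_ac)
      also have "\<dots> \<le> w v * s ^ Suc J"
        unfolding w_def using s M \<rho> r by (intro mult_right_mono mult_left_mono) auto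
      finally show ?thesis .
    qed
    have "(1 / of_real s) * (\<integral>u. f u \<partial>lborel) - (\<Sum>j\<le>J. k j * of_real s ^ j) = (\<integral>v. f (0 + s * v) - g v \<partial>lborel)"
      unfolding fs gs[symmetric] by (rule Bochner_Integration.integral_diff[symmetric, OF fint' gint])
    also have "norm \<dots> \<le> (\<integral>v. w v * s ^ Suc J \<partial>lborel)"
      by (rule Bochner_Integration.integral_norm_bound_integral) (use fint' gint wint pt in \<open>auto intro!: Bochner_Integration.integrable_diff\<close>)
    also have "\<dots> = C * s ^ Suc J" unfolding C_def by (rule integral_mult_left_zero)
    finally show ?thesis unfolding f_def \<Phi>_def .
  qed
  show ?thesis by (rule that[OF k0 kodd main])
qed

section \<open>Minor arcs\<close>

lemma norm_one_minus_cis_add: "norm (1 - cis (\<alpha> + \<beta>)) \<le> norm (1 - cis \<alpha>) + norm (1 - cis \<beta>)"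
proof -
  have "1 - cis (\<alpha> + \<beta>) = (1 - cis \<alpha>) + cis \<alpha> * (1 - cis \<beta>)" by (simp add: cis_mult algebra_simps)
  then have "norm (1 - cis (\<alpha> + \<beta>)) \<le> norm (1 - cis \<alpha>) + norm (cis \<alpha> * (1 - cis \<beta>))" by (metis norm_triangle_ineq)
  then show ?thesis by (simp add: norm_mult)
qed

lemma norm_one_minus_cis_minus: "norm (1 - cis (- \<alpha>)) = norm (1 - cis \<alpha>)"
proof -
  have "1 - cis (- \<alpha>) = - cis (- \<alpha>) * (1 - cis \<alpha>)" by (simp add: cis_mult algebra_simps)
  then show ?thesis by (simp add: norm_mult)
qed

lemma norm_one_minus_cis_square: "(norm (1 - cis \<alpha>))\<^sup>2 = 2 * (1 - cos \<alpha>)"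
proof -
  have "(norm (1 - cis \<alpha>))\<^sup>2 = (1 - cos \<alpha>)\<^sup>2 + (sin \<alpha>)\<^sup>2" by (simp add: cmod_power2)
  also have "\<dots> = 1 - 2 * cos \<alpha> + ((cos \<alpha>)\<^sup>2 + (sin \<alpha>)\<^sup>2)" by (simp add: power2_eq_square algebra_simps)
  finally show ?thesis by simp
qed

text \<open>\<open>1 - cos\<close> is half the squared distance of \<open>cis\<close> from
  \<open>1\<close>, and that distance is subadditive. The constant is \<open>4 + 4 + 1 + 1\<close>,
  by Cauchy--Schwarz.\<close>

lemma one_minus_cos_combination:
  "1 - cos (2 * x - 2 * y - z + w) \<le> 10 * ((1 - cos x) + (1 - cos y) + (1 - cos z) + (1 - cos (w::real)))"
proof -
  define n where "n = (\<lambda>\<alpha>. norm (1 - cis \<alpha>))"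
  have A: "n (x + x + (- y + - y) + (- z + w)) \<le> (n x + n x) + (n y + n y) + (n z + n w)"
    using norm_one_minus_cis_add[of "x + x + (- y + - y)" "- z + w"] norm_one_minus_cis_add[of "x + x" "- y + - y"]
      norm_one_minus_cis_add[of x x] norm_one_minus_cis_add[of "- y" "- y"] norm_one_minus_cis_add[of "- z" w]
    unfolding n_def norm_one_minus_cis_minus by linarith
  have B: "x + x + (- y + - y) + (- z + w) = 2 * x - 2 * y - z + w" by simp
  have "n (2 * x - 2 * y - z + w) \<le> 2 * n x + 2 * n y + n z + n w" using A unfolding B by simp
  then have "(n (2 * x - 2 * y - z + w))\<^sup>2 \<le> (2 * n x + 2 * n y + n z + n w)\<^sup>2"
    by (intro power_mono) (auto simp: n_def)
  also have "\<dots> \<le> 10 * ((n x)\<^sup>2 + (n y)\<^sup>2 + (n z)\<^sup>2 + (n w)\<^sup>2)"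
  proof -
    \<comment> \<open>Lagrange's identity for the vectors \<open>(2, 2, 1, 1)\<close> and
      \<open>(n x, n y, n z, n w)\<close>.\<close>
    have "10 * ((n x)\<^sup>2 + (n y)\<^sup>2 + (n z)\<^sup>2 + (n w)\<^sup>2) - (2 * n x + 2 * n y + n z + n w)\<^sup>2
      = (2 * n x - 2 * n y)\<^sup>2 + (n x - 2 * n z)\<^sup>2 + (n x - 2 * n w)\<^sup>2 + (n y - 2 * n z)\<^sup>2 + (n y - 2 * n w)\<^sup>2 + (n z - n w)\<^sup>2"
      by (simp add: power2_eq_square algebra_simps)
    also have "\<dots> \<ge> 0" by (intro add_nonneg_nonneg) auto
    finally show ?thesis by simp
  qed
  finally show ?thesis unfolding n_def norm_one_minus_cis_square by simp
qed

text \<open>With \<open>r = exp (- Re X)\<close>, the squared norm of \<open>1 - exp (- X)\<close>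
  is \<open>(1 - r)\<^sup>2 + t\<close>, which displays the gain over the real point. The
  \<open>5\<close> comes from \<open>ln (1 + t) \<ge> t / (1 + t) \<ge> t / 5\<close>, as
  \<open>t \<le> 4\<close>.\<close>

lemma Re_log_factor_le:
  assumes "0 < Re X"
  shows "Re (log_factor X) \<le> - ln (1 - exp (- Re X)) - exp (- Re X) * (1 - cos (Im X)) / 5"
proof -
  define r where "r = exp (- Re X)"
  define t where "t = 2 * r * (1 - cos (Im X))"
  have r: "0 < r" "r < 1" using assms by (auto simp: r_def)
  have c: "0 \<le> 1 - cos (Im X)" "1 - cos (Im X) \<le> 2" using cos_ge_minus_one[of "Im X"] by auto
  have t0: "0 \<le> t" using r c by (simp add: t_def)
  have "r * (1 - cos (Im X)) \<le> 1 * 2" using r c by (intro mult_mono) auto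
  then have t4: "t \<le> 4" by (simp add: t_def)
  have nz: "1 - exp (- X) \<noteq> 0" using one_minus_exp_neg_not_nonpos[OF assms] by auto
  have "(norm (1 - exp (- X)))\<^sup>2 = (1 - r * cos (Im X))\<^sup>2 + (r * sin (Im X))\<^sup>2"
    by (simp add: cmod_power2 Re_exp Im_exp r_def)
  also have "\<dots> = 1 - 2 * r * cos (Im X) + r\<^sup>2 * ((cos (Im X))\<^sup>2 + (sin (Im X))\<^sup>2)"
  proof -
    have "(1 - r * C)\<^sup>2 + (r * S)\<^sup>2 = 1 - 2 * r * C + r\<^sup>2 * (C\<^sup>2 + S\<^sup>2)" for C S :: real
      by (simp add: power2_eq_square algebra_simps)
    then show ?thesis .
  qed
  also have "\<dots> = 1 - 2 * r * cos (Im X) + r\<^sup>2" by simp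
  also have "\<dots> = (1 - r)\<^sup>2 + t" by (simp add: t_def power2_eq_square algebra_simps)
  finally have n: "(norm (1 - exp (- X)))\<^sup>2 = (1 - r)\<^sup>2 + t" .
  have r1: "0 < 1 - r" "(1 - r)\<^sup>2 \<le> 1" using r by (auto simp: power_le_one)
  have "(1 - r)\<^sup>2 * (1 + t) \<le> (1 - r)\<^sup>2 + t"
    using mult_right_mono[OF r1(2) t0] by (simp add: algebra_simps)
  then have "ln ((1 - r)\<^sup>2 * (1 + t)) \<le> ln ((norm (1 - exp (- X)))\<^sup>2)"
    unfolding n using r1(1) t0 by (intro ln_mono) (auto intro!: mult_pos_pos add_pos_nonneg)
  also have "ln ((norm (1 - exp (- X)))\<^sup>2) = 2 * ln (norm (1 - exp (- X)))" using nz by (simp add: ln_realpow)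
  also have "ln ((1 - r)\<^sup>2 * (1 + t)) = 2 * ln (1 - r) + ln (1 + t)"
    using r1(1) t0 by (subst ln_mult_pos) (auto simp: ln_realpow)
  finally have 1: "2 * ln (1 - r) + ln (1 + t) \<le> 2 * ln (norm (1 - exp (- X)))" .
  have "ln (1 / (1 + t)) \<le> 1 / (1 + t) - 1" using t0 by (intro ln_le_minus_one) simp
  then have "t / (1 + t) \<le> ln (1 + t)" using t0 by (simp add: ln_div field_simps)
  moreover have "t / 5 \<le> t / (1 + t)" using t0 t4 by (intro divide_left_mono) auto
  ultimately have 2: "t / 5 \<le> ln (1 + t)" by linarith
  have "Re (log_factor X) = - ln (norm (1 - exp (- X)))" using nz by (simp add: log_factor_def)
  also have "\<dots> \<le> - ln (1 - r) - t / 10" using 1 2 by simp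
  finally show ?thesis by (simp add: r_def t_def)
qed

section \<open>Differencing for quadratic phases\<close>

context quad_seq
begin

text \<open>\<open>P\<close> is \<open>Q\<close> with the index shifted back to the one of the polygonal numbers, \<open>P 0 = 0\<close> included, for which the
  following identity is homogeneous. It plays the role of Weyl differencing: if \<open>\<theta> P d\<close> is far from \<open>2 pi \<int>\<close>
  then so is one of the four terms on the right, for each \<open>m\<close>.\<close>

definition P :: "nat \<Rightarrow> real" where "P m = a * (real m * (real m + c))"

lemma P_Suc: "P (Suc m) = Q m" by (simp add: P_def Q_def)

lemma P_identity: "P d = 2 * P (m + d) - 2 * P m - P (2 * m + d) + P (2 * m)"
  by (simp add: P_def algebra_simps)

lemma P_mono: "1 \<le> l \<Longrightarrow> l \<le> l' \<Longrightarrow> P l \<le> P l'"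
  unfolding P_def using a c by (intro mult_left_mono mult_mono) auto

text \<open>The identity is averaged over \<open>m\<close> from \<open>1\<close> to
  \<open>M\<close>. As \<open>d \<le> M\<close>, each of the four index maps is injective into
  \<open>{1..3*M}\<close>, so each of the four sums is at most the full one; hence
  \<open>40 = 4 * 10\<close>.\<close>

lemma cos_sum_lower_bound:
  assumes d: "1 \<le> d" "d \<le> M"
  shows "real M * (1 - cos (\<theta> * P d)) \<le> 40 * (\<Sum>l\<in>{1..3*M}. 1 - cos (\<theta> * P l))"
proof -
  define v where "v = (\<lambda>l. 1 - cos (\<theta> * P l))"
  have v0: "0 \<le> v l" for l by (simp add: v_def)
  have "v d \<le> 10 * (v (m + d) + v m + v (2 * m + d) + v (2 * m))" for m
  proof -
    have "\<theta> * P d = 2 * (\<theta> * P (m + d)) - 2 * (\<theta> * P m) - \<theta> * P (2 * m + d) + \<theta> * P (2 * m)"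
      by (subst P_identity[of d m]) (simp add: algebra_simps)
    then show ?thesis unfolding v_def using one_minus_cos_combination by metis
  qed
  then have "(\<Sum>m\<in>{1..M}. v d) \<le> (\<Sum>m\<in>{1..M}. 10 * (v (m + d) + v m + v (2 * m + d) + v (2 * m)))"
    by (intro sum_mono)
  also have "\<dots> = 10 * ((\<Sum>m\<in>{1..M}. v (m + d)) + (\<Sum>m\<in>{1..M}. v m) + (\<Sum>m\<in>{1..M}. v (2 * m + d)) + (\<Sum>m\<in>{1..M}. v (2 * m)))"
    by (simp only: sum_distrib_left[symmetric] sum.distrib)
  finally have 1: "(\<Sum>m\<in>{1..M}. v d) \<le> 10 * ((\<Sum>m\<in>{1..M}. v (m + d)) + (\<Sum>m\<in>{1..M}. v m) + (\<Sum>m\<in>{1..M}. v (2 * m + d)) + (\<Sum>m\<in>{1..M}. v (2 * m)))" .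
  have s: "(\<Sum>m\<in>{1..M}. v (f m)) \<le> (\<Sum>l\<in>{1..3*M}. v l)" if "inj_on f {1..M}" "f ` {1..M} \<subseteq> {1..3*M}" for f
  proof -
    have "(\<Sum>m\<in>{1..M}. v (f m)) = (\<Sum>l\<in>f ` {1..M}. v l)" using that(1) by (simp add: sum.reindex)
    also have "\<dots> \<le> (\<Sum>l\<in>{1..3*M}. v l)" using that(2) v0 by (intro sum_mono2) auto
    finally show ?thesis .
  qed
  have "(\<Sum>m\<in>{1..M}. v (m + d)) \<le> (\<Sum>l\<in>{1..3*M}. v l)" "(\<Sum>m\<in>{1..M}. v m) \<le> (\<Sum>l\<in>{1..3*M}. v l)"
    "(\<Sum>m\<in>{1..M}. v (2 * m + d)) \<le> (\<Sum>l\<in>{1..3*M}. v l)" "(\<Sum>m\<in>{1..M}. v (2 * m)) \<le> (\<Sum>l\<in>{1..3*M}. v l)"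
    using d by (intro s; force simp: inj_on_def)+
  with 1 have "real M * v d \<le> 40 * (\<Sum>l\<in>{1..3*M}. v l)" by simp
  then show ?thesis by (simp add: v_def)
qed

lemma summable_exp_Q:
  assumes \<eta>: "0 < \<eta>"
  shows "summable (\<lambda>m. exp (- (\<eta> * Q m)) * (1 - cos (\<theta> * Q m)))"
proof (rule summable_comparison_test'[where N = 0])
  show "summable (\<lambda>m. 2 / \<eta> * (1 / Q m))" by (rule summable_mult[OF summable_inverse_Q])
  fix m
  have x: "0 < \<eta> * Q m" using \<eta> Q_pos by simp
  have "\<eta> * Q m \<le> exp (\<eta> * Q m)" using exp_ge_add_one_self[of "\<eta> * Q m"] by linarith
  then have "1 / exp (\<eta> * Q m) \<le> 1 / (\<eta> * Q m)" using x by (intro divide_left_mono) auto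
  then have "exp (- (\<eta> * Q m)) \<le> 1 / (\<eta> * Q m)" by (simp add: exp_minus divide_inverse)
  moreover have "\<bar>1 - cos (\<theta> * Q m)\<bar> \<le> 2" using cos_ge_minus_one[of "\<theta> * Q m"] cos_le_one[of "\<theta> * Q m"] by (simp add: abs_le_iff)
  ultimately have "exp (- (\<eta> * Q m)) * \<bar>1 - cos (\<theta> * Q m)\<bar> \<le> 1 / (\<eta> * Q m) * 2" using x by (intro mult_mono) auto
  then show "norm (exp (- (\<eta> * Q m)) * (1 - cos (\<theta> * Q m))) \<le> 2 / \<eta> * (1 / Q m)" by (simp add: abs_mult)
qed

lemma Re_H_le:
  assumes \<eta>: "0 < \<eta>"
  shows "Re (H (Complex \<eta> \<theta>)) \<le> Re (H (of_real \<eta>)) - (\<Sum>m. exp (- (\<eta> * Q m)) * (1 - cos (\<theta> * Q m))) / 5"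
proof -
  have "(\<lambda>m. Re (log_factor (Complex \<eta> \<theta> * of_real (Q m)))) sums Re (H (Complex \<eta> \<theta>))"
    by (intro sums_Re H_properties(1)) (use \<eta> in simp)
  moreover have s2: "(\<lambda>m. Re (log_factor (of_real \<eta> * of_real (Q m)))) sums Re (H (of_real \<eta>))"
    by (intro sums_Re H_properties(1)) (use \<eta> in simp)
  have "(\<lambda>m. Re (log_factor (of_real \<eta> * of_real (Q m))) - exp (- (\<eta> * Q m)) * (1 - cos (\<theta> * Q m)) / 5) sums
     (Re (H (of_real \<eta>)) - (\<Sum>m. exp (- (\<eta> * Q m)) * (1 - cos (\<theta> * Q m))) / 5)"
    by (intro sums_diff s2 sums_divide summable_sums summable_exp_Q \<eta>)
  moreover have "Re (log_factor (Complex \<eta> \<theta> * of_real (Q m))) \<le> Re (log_factor (of_real \<eta> * of_real (Q m))) - exp (- (\<eta> * Q m)) * (1 - cos (\<theta> * Q m)) / 5" for m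
  proof -
    have x: "0 < \<eta> * Q m" using \<eta> Q_pos by simp
    have "log_factor (of_real \<eta> * of_real (Q m)) = of_real (- ln (1 - exp (- (\<eta> * Q m))))"
      using log_factor_of_real[OF x] by simp
    then show ?thesis using Re_log_factor_le[of "Complex \<eta> \<theta> * of_real (Q m)"] x by simp
  qed
  ultimately show ?thesis by (rule sums_le[rotated 1]) 
qed

text \<open>About \<open>1 / sqrt \<eta>\<close> indices carry a weight bounded below, so it is
  enough to bound below the average of \<open>1 - cos (\<theta> * P l)\<close> over them. Averaging
  the identity reduces this to one index \<open>d \<le> M\<close> whose phase
  \<open>\<bar>\<theta>\<bar> * P d\<close> lies between a fixed positive \<open>\<delta>1\<close>
  and \<open>pi\<close>.\<close>

lemma exponential_sum_lower_bound:
  assumes n: "a * (1 + c) = 1" and \<rho>: "0 < \<rho>"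
  obtains \<delta> where "0 < \<delta>" "\<And>\<eta> \<theta>. 0 < \<eta> \<Longrightarrow> \<eta> \<le> 1 \<Longrightarrow> \<rho> * \<eta> \<le> \<bar>\<theta>\<bar> \<Longrightarrow> \<bar>\<theta>\<bar> \<le> pi \<Longrightarrow>
    \<delta> / sqrt \<eta> \<le> (\<Sum>m. exp (- (\<eta> * Q m)) * (1 - cos (\<theta> * Q m)))"
proof -
  define dd where "dd = min 1 (1 + c)"
  \<comment> \<open>Bounds \<open>P (Suc d) / P d\<close>, so that the last phase before passing
    \<open>pi\<close> is still at least \<open>pi / KK\<close>.\<close>
  define KK where "KK = 2 * (1 + 1 / (1 + c))"
  \<comment> \<open>The first bound covers the case that even \<open>d = M\<close> has not passed
    \<open>pi\<close>, where \<open>\<bar>\<theta>\<bar> \<ge> \<rho> * \<eta>\<close> is used; the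
    second covers the other case.\<close>
  define \<delta>1 where "\<delta>1 = min (\<rho> * a * dd / 4) (pi / KK)"
  define E where "E = 9 * a * (1 + \<bar>c\<bar>)"
  \<comment> \<open>The \<open>80\<close> is \<open>40\<close> from the averaging times
    \<open>2\<close> from rounding \<open>1 / sqrt \<eta>\<close> down to \<open>M\<close>.\<close>
  define \<delta> where "\<delta> = exp (- E) * (1 - cos \<delta>1) / 80"
  have dd: "0 < dd" using c by (simp add: dd_def)
  have KK: "2 \<le> KK" using c by (simp add: KK_def)
  have \<delta>1: "0 < \<delta>1" "\<delta>1 < pi"
  proof -
    show "0 < \<delta>1" using \<rho> a dd KK by (simp add: \<delta>1_def)
    have "\<delta>1 \<le> pi / KK" by (simp add: \<delta>1_def)
    also have "\<dots> \<le> pi / 2" using KK by (intro divide_left_mono) auto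
    also have "\<dots> < pi" by simp
    finally show "\<delta>1 < pi" .
  qed
  have cos\<delta>: "0 < 1 - cos \<delta>1" using cos_monotone_0_pi[of 0 \<delta>1] \<delta>1 by simp
  have \<delta>: "0 < \<delta>" using cos\<delta> by (simp add: \<delta>_def)
  have "\<delta> / sqrt \<eta> \<le> (\<Sum>m. exp (- (\<eta> * Q m)) * (1 - cos (\<theta> * Q m)))"
    if \<eta>: "0 < \<eta>" "\<eta> \<le> 1" and \<theta>: "\<rho> * \<eta> \<le> \<bar>\<theta>\<bar>" "\<bar>\<theta>\<bar> \<le> pi" for \<eta> \<theta>
  proof -
    define y where "y = 1 / sqrt \<eta>"
    have y: "1 \<le> y" "y\<^sup>2 * \<eta> = 1" using \<eta> by (auto simp: y_def power_divide)
    define M where "M = nat \<lfloor>y\<rfloor>"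
    have M: "1 \<le> M" "real M \<le> y" "y / 2 \<le> real M"
    proof -
      have "1 \<le> \<lfloor>y\<rfloor>" using y(1) by (simp add: le_floor_iff)
      have rM: "real M = of_int \<lfloor>y\<rfloor>" using y(1) by (simp add: M_def)
      have "1 \<le> real M" using \<open>1 \<le> \<lfloor>y\<rfloor>\<close> unfolding rM by linarith
      then show "1 \<le> M" by simp
      show "real M \<le> y" unfolding rM by simp
      show "y / 2 \<le> real M" using \<open>1 \<le> \<lfloor>y\<rfloor>\<close> unfolding rM by linarith
    qed
    have M2: "(real M)\<^sup>2 * \<eta> \<le> 1" "1 / 4 \<le> (real M)\<^sup>2 * \<eta>"
    proof -
      have "(real M)\<^sup>2 * \<eta> \<le> y\<^sup>2 * \<eta>" using M \<eta> by (intro mult_right_mono power_mono) auto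
      then show "(real M)\<^sup>2 * \<eta> \<le> 1" using y by simp
      have "(y / 2)\<^sup>2 * \<eta> \<le> (real M)\<^sup>2 * \<eta>" using M y \<eta> by (intro mult_right_mono power_mono) auto
      then show "1 / 4 \<le> (real M)\<^sup>2 * \<eta>" using y by (simp add: power_divide)
    qed
    have ex: "exp (- E) \<le> exp (- (\<eta> * P l))" if l: "l \<in> {1..3*M}" for l
    proof -
      have "P l \<le> P (3 * M)" using l by (intro P_mono) auto
      also have "P (3 * M) \<le> a * (3 * real M * (3 * real M * (1 + \<bar>c\<bar>)))"
      proof -
        have "c \<le> \<bar>c\<bar> * (3 * real M)" using M(1) mult_left_mono[of 1 "3 * real M" "\<bar>c\<bar>"] by linarith
        then have "3 * real M + c \<le> 3 * real M * (1 + \<bar>c\<bar>)" by (simp add: algebra_simps)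
        then have "a * (3 * real M * (3 * real M + c)) \<le> a * (3 * real M * (3 * real M * (1 + \<bar>c\<bar>)))"
          using a by (intro mult_left_mono) auto
        then show ?thesis unfolding P_def by simp
      qed
      also have "\<dots> = E * (real M)\<^sup>2" by (simp add: E_def power2_eq_square)
      finally have "\<eta> * P l \<le> E * ((real M)\<^sup>2 * \<eta>)" using mult_left_mono[of "P l" "E * (real M)\<^sup>2" \<eta>] \<eta> by (simp add: mult_ac)
      also have "\<dots> \<le> E * 1" using M2 a by (intro mult_left_mono) (auto simp: E_def)
      finally show ?thesis by simp
    qed
    \<comment> \<open>The largest \<open>d\<close> for which the phase has not yet passed \<open>pi\<close>; it is bounded away from \<open>0\<close> there.\<close>
    define D where "D = {d \<in> {1..M}. \<bar>\<theta>\<bar> * P d \<le> pi}"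
    have P1: "P 1 = 1" using n by (simp add: P_def)
    \<comment> \<open>Here the normalisation \<open>P 1 = 1\<close> enters, together with
      \<open>\<bar>\<theta>\<bar> \<le> pi\<close>.\<close>
    have "1 \<in> D" using M \<theta> P1 by (simp add: D_def)
    then have D: "finite D" "D \<noteq> {}" by (auto simp: D_def)
    define d where "d = Max D"
    have d: "d \<in> D" "\<And>e. e \<in> D \<Longrightarrow> e \<le> d" using D by (auto simp: d_def)
    have d': "1 \<le> d" "d \<le> M" "\<bar>\<theta>\<bar> * P d \<le> pi" using d(1) by (auto simp: D_def)
    have low: "\<delta>1 \<le> \<bar>\<theta>\<bar> * P d"
    proof (cases "d = M")
      case True
      have "dd * real M \<le> real M + c"
      proof (cases "0 \<le> c")
        case True
        then show ?thesis using mult_right_mono[of dd 1 "real M"] by (simp add: dd_def)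
      next
        case False
        then have "c * real M \<le> c * 1" using M(1) by (intro mult_left_mono_neg) auto
        then show ?thesis using False by (simp add: dd_def algebra_simps)
      qed
      then have "real M * (dd * real M) \<le> real M * (real M + c)" by (intro mult_left_mono) auto
      then have "a * (dd * (real M)\<^sup>2) \<le> P M" unfolding P_def using a by (intro mult_left_mono) (auto simp: power2_eq_square mult_ac)
      then have "(\<rho> * \<eta>) * (a * (dd * (real M)\<^sup>2)) \<le> \<bar>\<theta>\<bar> * P M"
        using \<theta> \<eta> \<rho> a dd by (intro mult_mono) auto
      moreover have "\<rho> * a * dd * (1 / 4) \<le> \<rho> * a * dd * ((real M)\<^sup>2 * \<eta>)"
        using M2 \<rho> a dd by (intro mult_left_mono) auto
      ultimately have "\<rho> * a * dd / 4 \<le> \<bar>\<theta>\<bar> * P M" by (simp add: mult_ac)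
      then show ?thesis unfolding True \<delta>1_def by simp
    next
      case False
      then have "Suc d \<in> {1..M}" using d' by simp
      moreover have "Suc d \<notin> D" using d(2)[of "Suc d"] by auto
      ultimately have "pi < \<bar>\<theta>\<bar> * P (Suc d)" by (simp add: D_def not_le)
      also have "P (Suc d) \<le> KK * P d"
      proof -
        define x where "x = real d + c"
        have x: "1 + c \<le> x" "0 < x" using d'(1) c by (auto simp: x_def)
        have "1 \<le> 1 / (1 + c) * x" using x c by (simp add: field_simps)
        then have "x + 1 \<le> (1 + 1 / (1 + c)) * x" by (simp add: algebra_simps)
        then have "real (Suc d) * (x + 1) \<le> (2 * real d) * ((1 + 1 / (1 + c)) * x)"
          using d'(1) x by (intro mult_mono) auto
        then have "a * (real (Suc d) * (x + 1)) \<le> a * ((2 * real d) * ((1 + 1 / (1 + c)) * x))"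
          using a by (intro mult_left_mono) auto
        moreover have "P (Suc d) = a * (real (Suc d) * (x + 1))" by (simp add: P_def x_def algebra_simps)
        moreover have "KK * P d = a * ((2 * real d) * ((1 + 1 / (1 + c)) * x))" by (simp add: P_def KK_def x_def mult_ac)
        ultimately show ?thesis by simp
      qed
      then have "\<bar>\<theta>\<bar> * P (Suc d) \<le> \<bar>\<theta>\<bar> * (KK * P d)" by (intro mult_left_mono) auto
      finally have "pi / KK < \<bar>\<theta>\<bar> * P d" using KK by (simp add: field_simps)
      then show ?thesis by (simp add: \<delta>1_def)
    qed
    have "cos (\<bar>\<theta>\<bar> * P d) \<le> cos \<delta>1" using low d'(3) \<delta>1 by (intro cos_monotone_0_pi_le) auto
    moreover have "cos (\<bar>\<theta>\<bar> * P d) = cos (\<theta> * P d)"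
      by (cases "0 \<le> \<theta>") auto
    ultimately have "real M * (1 - cos \<delta>1) \<le> real M * (1 - cos (\<theta> * P d))" by (intro mult_left_mono) auto
    also have "\<dots> \<le> 40 * (\<Sum>l\<in>{1..3*M}. 1 - cos (\<theta> * P l))" by (rule cos_sum_lower_bound[OF d'(1,2)])
    finally have "exp (- E) * (real M * (1 - cos \<delta>1)) \<le> exp (- E) * (40 * (\<Sum>l\<in>{1..3*M}. 1 - cos (\<theta> * P l)))"
      by (intro mult_left_mono) auto
    also have "\<dots> = 40 * (\<Sum>l\<in>{1..3*M}. exp (- E) * (1 - cos (\<theta> * P l)))" by (simp only: sum_distrib_left[symmetric] mult.left_commute)
    also have "\<dots> \<le> 40 * (\<Sum>l\<in>{1..3*M}. exp (- (\<eta> * P l)) * (1 - cos (\<theta> * P l)))"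
      by (intro mult_left_mono sum_mono mult_right_mono ex) auto
    also have "(\<Sum>l\<in>{1..3*M}. exp (- (\<eta> * P l)) * (1 - cos (\<theta> * P l))) = (\<Sum>m<3*M. exp (- (\<eta> * Q m)) * (1 - cos (\<theta> * Q m)))"
      unfolding P_Suc[symmetric] by (rule sum.reindex_bij_witness[of _ Suc "\<lambda>l. l - 1"]) auto
    also have "\<dots> \<le> (\<Sum>m. exp (- (\<eta> * Q m)) * (1 - cos (\<theta> * Q m)))"
      by (rule sum_le_suminf[OF summable_exp_Q[OF \<eta>(1)]]) auto
    finally have "exp (- E) * (real M * (1 - cos \<delta>1)) \<le> 40 * (\<Sum>m. exp (- (\<eta> * Q m)) * (1 - cos (\<theta> * Q m)))" by simp
    moreover have "exp (- E) * (y / 2 * (1 - cos \<delta>1)) \<le> exp (- E) * (real M * (1 - cos \<delta>1))"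
      using M(3) cos\<delta> by (intro mult_left_mono mult_right_mono) auto
    moreover have "exp (- E) * (y / 2 * (1 - cos \<delta>1)) = 40 * (\<delta> / sqrt \<eta>)"
      by (simp add: \<delta>_def y_def)
    ultimately show ?thesis by linarith
  qed
  with \<delta> that show ?thesis by blast
qed

lemma minor_arc_bound:
  assumes n: "a * (1 + c) = 1" and \<rho>: "0 < \<rho>"
  obtains \<delta> where "0 < \<delta>" "\<And>\<eta> \<theta>. 0 < \<eta> \<Longrightarrow> \<eta> \<le> 1 \<Longrightarrow> \<rho> * \<eta> \<le> \<bar>\<theta>\<bar> \<Longrightarrow> \<bar>\<theta>\<bar> \<le> pi \<Longrightarrow>
    norm (exp (H (Complex \<eta> \<theta>))) \<le> exp (Re (H (of_real \<eta>)) - \<delta> / sqrt \<eta>)"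
proof -
  obtain \<delta> where \<delta>: "0 < \<delta>" "\<And>\<eta> \<theta>. 0 < \<eta> \<Longrightarrow> \<eta> \<le> 1 \<Longrightarrow> \<rho> * \<eta> \<le> \<bar>\<theta>\<bar> \<Longrightarrow> \<bar>\<theta>\<bar> \<le> pi \<Longrightarrow>
    \<delta> / sqrt \<eta> \<le> (\<Sum>m. exp (- (\<eta> * Q m)) * (1 - cos (\<theta> * Q m)))"
    using exponential_sum_lower_bound[OF n \<rho>] by blast
  have "norm (exp (H (Complex \<eta> \<theta>))) \<le> exp (Re (H (of_real \<eta>)) - \<delta> / 5 / sqrt \<eta>)"
    if "0 < \<eta>" "\<eta> \<le> 1" "\<rho> * \<eta> \<le> \<bar>\<theta>\<bar>" "\<bar>\<theta>\<bar> \<le> pi" for \<eta> \<theta>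
    using \<delta>(2)[OF that] Re_H_le[OF that(1), of \<theta>] by simp
  then show ?thesis using that[of "\<delta> / 5"] \<delta>(1) by simp
qed

end

section \<open>The coefficient integral\<close>

text \<open>The total is an integer so that the recurrence removing one part can be followed to
  negative totals, where there are no partitions if the parts are positive.\<close>

definition partitions_into :: "int set \<Rightarrow> int \<Rightarrow> int multiset set" where
  "partitions_into A n = {M. set_mset M \<subseteq> A \<and> sum_mset M = n}"

lemma partitions_into_bounds:
  assumes "\<And>x. x \<in> A \<Longrightarrow> (1::int) \<le> x" "set_mset M \<subseteq> A"
  shows "int (size M) \<le> sum_mset M \<and> (\<forall>x\<in>#M. x \<le> sum_mset M)"
  using assms(2)
proof (induction M)
  case (add x M)
  then have "int (size M) \<le> sum_mset M" "\<forall>y\<in>#M. y \<le> sum_mset M" "1 \<le> x" using assms(1) by auto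
  then show ?case by force
qed simp

lemma finite_partitions_into:
  assumes "\<And>x. x \<in> A \<Longrightarrow> (1::int) \<le> x"
  shows "finite (partitions_into A n)"
proof (rule finite_subset)
  show "partitions_into A n \<subseteq> mset ` {xs. set xs \<subseteq> {1..n} \<and> length xs \<le> nat n}"
  proof
    fix M assume M: "M \<in> partitions_into A n"
    then have b: "int (size M) \<le> n" "\<forall>x\<in>#M. x \<le> n" "set_mset M \<subseteq> A"
      using partitions_into_bounds[OF assms, of A M] by (auto simp: partitions_into_def)
    obtain xs where xs: "M = mset xs" by (metis ex_mset)
    have "set xs \<subseteq> {1..n} \<and> length xs \<le> nat n" using b assms unfolding xs by auto
    then show "M \<in> mset ` {xs. set xs \<subseteq> {1..n} \<and> length xs \<le> nat n}" using xs by blast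
  qed
  show "finite (mset ` {xs. set xs \<subseteq> {1..n} \<and> length xs \<le> nat n})"
    by (intro finite_imageI finite_lists_length_le finite_atLeastAtMost_int)
qed

text \<open>Either \<open>p\<close> does not occur, or one copy of it can be removed.\<close>

lemma card_partitions_into_insert:
  assumes A: "\<And>x. x \<in> insert p A \<Longrightarrow> (1::int) \<le> x" and p: "p \<notin> A"
  shows "card (partitions_into (insert p A) n) = card (partitions_into A n) + card (partitions_into (insert p A) (n - p))"
proof -
  have eq: "partitions_into (insert p A) n = partitions_into A n \<union> add_mset p ` partitions_into (insert p A) (n - p)"
  proof (intro equalityI subsetI)
    fix M assume M: "M \<in> partitions_into (insert p A) n"
    show "M \<in> partitions_into A n \<union> add_mset p ` partitions_into (insert p A) (n - p)"
    proof (cases "p \<in># M")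
      case True
      then obtain N where N: "M = add_mset p N" by (metis multi_member_split)
      then have "N \<in> partitions_into (insert p A) (n - p)" using M by (auto simp: partitions_into_def)
      then show ?thesis using N by blast
    next
      case False
      then show ?thesis using M by (auto simp: partitions_into_def)
    qed
  qed (auto simp: partitions_into_def)
  have disj: "partitions_into A n \<inter> add_mset p ` partitions_into (insert p A) (n - p) = {}"
  proof -
    have "add_mset p N \<notin> partitions_into A n" for N
    proof
      assume "add_mset p N \<in> partitions_into A n"
      then have "set_mset (add_mset p N) \<subseteq> A" unfolding partitions_into_def by blast
      then show False using p by simp
    qed
    then show ?thesis by blast
  qed
  have "card (partitions_into (insert p A) n) = card (partitions_into A n) + card (add_mset p ` partitions_into (insert p A) (n - p))"
    unfolding eq by (intro card_Un_disjoint disj finite_imageI finite_partitions_into) (use A in auto)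
  also have "card (add_mset p ` partitions_into (insert p A) (n - p)) = card (partitions_into (insert p A) (n - p))"
    by (intro card_image) (auto simp: inj_on_def)
  finally show ?thesis .
qed

lemma partitions_into_negative:
  assumes "\<And>x. x \<in> A \<Longrightarrow> (1::int) \<le> x" "n < 0"
  shows "partitions_into A n = {}"
proof -
  have "0 \<le> n" if "M \<in> partitions_into A n" for M
    using partitions_into_bounds[OF assms(1), of A M] that unfolding partitions_into_def by simp
  then show ?thesis using assms(2) by fastforce
qed

lemma partitions_into_empty: "partitions_into {} n = (if n = 0 then {{#}} else {})"
  by (auto simp: partitions_into_def)

section \<open>Coefficient extraction by integration over a period\<close>

lemma exp_int_periodic_integral:
  "integral {-pi..pi} (\<lambda>\<theta>. exp (of_int n * Complex \<eta> \<theta>)) = (if n = 0 then of_real (2 * pi) else 0)"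
proof (cases "n = 0")
  case False
  define F where "F = (\<lambda>z. exp (of_int n * (of_real \<eta> + \<i> * z)) / (of_int n * \<i>))"
  have Fd: "(F has_field_derivative exp (of_int n * (of_real \<eta> + \<i> * z))) (at z)" for z
    unfolding F_def using False by (auto intro!: derivative_eq_intros)
  have "((\<lambda>\<theta>. exp (of_int n * (of_real \<eta> + \<i> * of_real \<theta>))) has_integral (F (of_real pi) - F (of_real (- pi)))) {-pi..pi}"
    by (rule fundamental_theorem_of_calculus[where f = "\<lambda>\<theta>. F (of_real \<theta>)"]) (auto intro!: has_vector_derivative_real_field Fd)
  moreover have "F (of_real pi) = F (of_real (- pi))"
  proof -
    have "exp (of_int n * (of_real \<eta> + \<i> * of_real pi)) = exp (of_int n * (of_real \<eta> + \<i> * of_real (- pi)) + 2 * of_int n * pi * \<i>)"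
      by (simp add: algebra_simps)
    also have "\<dots> = exp (of_int n * (of_real \<eta> + \<i> * of_real (- pi)))"
      using exp_plus_2pin[of "of_int n * (of_real \<eta> + \<i> * of_real (- pi))" n] by (simp add: mult_ac)
    finally show ?thesis by (simp add: F_def)
  qed
  moreover have "Complex \<eta> \<theta> = of_real \<eta> + \<i> * of_real \<theta>" for \<theta> by (simp add: complex_eq_iff)
  ultimately show ?thesis using False by (simp add: integral_unique)
qed (simp add: scaleR_conv_of_real)

definition partition_product :: "int set \<Rightarrow> complex \<Rightarrow> complex" where
  "partition_product A z = (\<Prod>p\<in>A. 1 / (1 - exp (- (z * of_int p))))"

lemma one_minus_exp_nonzero: "0 < Re z \<Longrightarrow> 1 - exp (- z) \<noteq> 0"
  using one_minus_exp_neg_not_nonpos[of z] by auto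

lemma continuous_on_Complex: "continuous_on S (\<lambda>\<theta>. Complex \<eta> \<theta>)"
  unfolding Complex_eq by (intro continuous_intros)

lemma partition_product_continuous:
  assumes "0 < \<eta>" "\<And>x. x \<in> A \<Longrightarrow> (1::int) \<le> x"
  shows "continuous_on {-pi..pi} (\<lambda>\<theta>. partition_product A (Complex \<eta> \<theta>) * exp (of_int n * Complex \<eta> \<theta>))"
  unfolding partition_product_def
proof (intro continuous_intros continuous_on_Complex ballI)
  fix p \<theta> assume "p \<in> A"
  then have "0 < Re (Complex \<eta> \<theta> * of_int p)" using assms(2)[of p] assms(1) by simp
  then show "1 - exp (- (Complex \<eta> \<theta> * of_int p)) \<noteq> 0" by (rule one_minus_exp_nonzero)
qed

text \<open>Induction on the set of parts. Integral and count obey the same recurrence in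
  \<open>n\<close> with step \<open>p\<close>, so their difference is constant along
  \<open>n\<close>, \<open>n - p\<close>, \<open>n - 2 * p\<close> and so on. It tends to
  \<open>0\<close> there: the count vanishes for negative totals, and the integral is
  \<open>O(exp (n * \<eta>))\<close>.\<close>

lemma card_partitions_into_integral:
  assumes "finite A" "\<And>x. x \<in> A \<Longrightarrow> (1::int) \<le> x" "0 < \<eta>"
  shows "integral {-pi..pi} (\<lambda>\<theta>. partition_product A (Complex \<eta> \<theta>) * exp (of_int n * Complex \<eta> \<theta>)) = of_real (2 * pi * card (partitions_into A n))"
  using assms(1,2)
proof (induction A arbitrary: n rule: finite_induct)
  case empty
  show ?case by (simp add: partition_product_def exp_int_periodic_integral partitions_into_empty)
next
  case (insert p A n)
  note pos = insert.prems
  define I where "I = (\<lambda>n::int. integral {-pi..pi} (\<lambda>\<theta>. partition_product (insert p A) (Complex \<eta> \<theta>) * exp (of_int n * Complex \<eta> \<theta>)))"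
  define d where "d = (\<lambda>n::int. I n - of_real (2 * pi * card (partitions_into (insert p A) n)))"
  have int: "(\<lambda>\<theta>. partition_product (insert p A) (Complex \<eta> \<theta>) * exp (of_int n * Complex \<eta> \<theta>)) integrable_on {-pi..pi}" for n
    using integrable_continuous_real[OF partition_product_continuous[OF assms(3) pos]] .
  have p1: "1 \<le> p" using pos by simp
  have step: "d n = d (n - p)" for n
  proof -
    have "I n - I (n - p) = integral {-pi..pi} (\<lambda>\<theta>. partition_product (insert p A) (Complex \<eta> \<theta>) * exp (of_int n * Complex \<eta> \<theta>) - partition_product (insert p A) (Complex \<eta> \<theta>) * exp (of_int (n - p) * Complex \<eta> \<theta>))"
      unfolding I_def by (rule Henstock_Kurzweil_Integration.integral_diff[symmetric, OF int int])
    also have "(\<lambda>\<theta>. partition_product (insert p A) (Complex \<eta> \<theta>) * exp (of_int n * Complex \<eta> \<theta>) - partition_product (insert p A) (Complex \<eta> \<theta>) * exp (of_int (n - p) * Complex \<eta> \<theta>)) = (\<lambda>\<theta>. partition_product A (Complex \<eta> \<theta>) * exp (of_int n * Complex \<eta> \<theta>))"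
    proof
      fix \<theta>
      define z where "z = Complex \<eta> \<theta>"
      have nz: "1 - exp (- (z * of_int p)) \<noteq> 0"
        by (rule one_minus_exp_nonzero) (use p1 assms(3) in \<open>simp add: z_def\<close>)
      have e: "exp (of_int (n - p) * z) = exp (of_int n * z) * exp (- (z * of_int p))"
        by (simp add: exp_add[symmetric] algebra_simps)
      have pr: "partition_product (insert p A) z = 1 / (1 - exp (- (z * of_int p))) * partition_product A z"
        using insert.hyps by (simp add: partition_product_def)
      show "partition_product (insert p A) (Complex \<eta> \<theta>) * exp (of_int n * Complex \<eta> \<theta>) - partition_product (insert p A) (Complex \<eta> \<theta>) * exp (of_int (n - p) * Complex \<eta> \<theta>) = partition_product A (Complex \<eta> \<theta>) * exp (of_int n * Complex \<eta> \<theta>)"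
        unfolding z_def[symmetric] e pr using nz by (simp add: divide_simps) (simp add: algebra_simps)
    qed
    also have "integral {-pi..pi} \<dots> = of_real (2 * pi * card (partitions_into A n))"
      by (rule insert.IH) (use pos in auto)
    finally have "I n - I (n - p) = of_real (2 * pi * card (partitions_into A n))" .
    moreover have "card (partitions_into (insert p A) n) = card (partitions_into A n) + card (partitions_into (insert p A) (n - p))"
      by (rule card_partitions_into_insert[OF pos insert.hyps(2)])
    ultimately show ?thesis by (simp add: d_def algebra_simps)
  qed
  have steps: "d n = d (n - int j * p)" for j n
  proof (induction j)
    case (Suc j)
    have "d (n - int j * p) = d (n - int j * p - p)" by (rule step)
    then show ?case using Suc by (simp add: algebra_simps)
  qed simp
  obtain K where K: "\<And>\<theta>. \<theta> \<in> {-pi..pi} \<Longrightarrow> norm (partition_product (insert p A) (Complex \<eta> \<theta>)) \<le> K"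
  proof -
    have "compact ((\<lambda>\<theta>. partition_product (insert p A) (Complex \<eta> \<theta>) * exp (of_int 0 * Complex \<eta> \<theta>)) ` {-pi..pi})"
      by (rule compact_continuous_image[OF partition_product_continuous[OF assms(3) pos] compact_Icc])
    then obtain K where "\<And>x. x \<in> (\<lambda>\<theta>. partition_product (insert p A) (Complex \<eta> \<theta>) * exp (of_int 0 * Complex \<eta> \<theta>)) ` {-pi..pi} \<Longrightarrow> norm x \<le> K"
      using compact_imp_bounded bounded_iff by metis
    then show ?thesis using that[of K] by simp
  qed
  have Ibd: "norm (I n) \<le> K * exp (of_int n * \<eta>) * (2 * pi)" for n
  proof -
    have "norm (I n) \<le> integral {-pi..pi} (\<lambda>\<theta>. K * exp (of_int n * \<eta>))"
      unfolding I_def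
    proof (rule integral_norm_bound_integral[OF int])
      show "norm (partition_product (insert p A) (Complex \<eta> \<theta>) * exp (of_int n * Complex \<eta> \<theta>)) \<le> K * exp (of_int n * \<eta>)" if "\<theta> \<in> {-pi..pi}" for \<theta>
        unfolding norm_mult using K[OF that] by (intro mult_mono) (auto intro: order_trans[OF norm_ge_zero])
    qed (intro integrable_const_ivl)
    then show ?thesis by (simp add: mult_ac)
  qed
  have "(\<lambda>j. d (n - int j * p)) \<longlonglongrightarrow> 0"
  proof (rule Lim_null_comparison)
    show "\<forall>\<^sub>F j in sequentially. norm (d (n - int j * p)) \<le> K * exp (of_int (n - int j * p) * \<eta>) * (2 * pi)"
      using eventually_gt_at_top[of "nat n"]
    proof eventually_elim
      case (elim j)
      have "int j * 1 \<le> int j * p" using p1 by (intro mult_left_mono) auto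
      then have "n - int j * p < 0" using elim by linarith
      then have "partitions_into (insert p A) (n - int j * p) = {}" using pos by (intro partitions_into_negative) auto
      then show ?case using Ibd[of "n - int j * p"] by (simp add: d_def)
    qed
    have "(\<lambda>j. K * exp (of_int n * \<eta>) * (2 * pi) * exp (- (of_int p * \<eta>)) ^ j) \<longlonglongrightarrow> K * exp (of_int n * \<eta>) * (2 * pi) * 0"
      using p1 assms(3) by (intro tendsto_mult tendsto_const LIMSEQ_power_zero) simp
    moreover have "K * exp (of_int n * \<eta>) * (2 * pi) * exp (- (of_int p * \<eta>)) ^ j = K * exp (of_int (n - int j * p) * \<eta>) * (2 * pi)" for j
      by (simp add: exp_of_nat_mult[symmetric] exp_add[symmetric] algebra_simps)
    ultimately show "(\<lambda>j. K * exp (of_int (n - int j * p) * \<eta>) * (2 * pi)) \<longlonglongrightarrow> 0" by simp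
  qed
  moreover have "(\<lambda>j. d (n - int j * p)) = (\<lambda>j. d n)" using steps by auto
  ultimately have "d n = 0" by (simp add: tendsto_const_iff LIMSEQ_const_iff)
  then show ?case by (simp add: d_def I_def)
qed

context quad_seq
begin

text \<open>With only the first \<open>M\<close> polygonal numbers as parts the count is exact as
  soon as \<open>M \<ge> n\<close>, because \<open>polygonal k m \<ge> m\<close>. The passage to the
  infinite product is dominated convergence, the majorant being the value at the real point
  \<open>\<eta>\<close>.\<close>

lemma coefficient_integral:
  assumes k: "k \<ge> 3" and Qk: "\<And>m. Q m = of_int (polygonal k (Suc m))" and \<eta>: "0 < \<eta>"
  shows "(\<lambda>\<theta>. exp (H (Complex \<eta> \<theta>) + of_nat n * Complex \<eta> \<theta>)) integrable_on {-pi..pi}"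
    and "integral {-pi..pi} (\<lambda>\<theta>. exp (H (Complex \<eta> \<theta>) + of_nat n * Complex \<eta> \<theta>)) = of_real (2 * pi * p_gonal k n)"
proof -
  have two: "2 * polygonal k m = (k - 2) * (int m * (int m - 1)) + 2 * int m" for m
    unfolding two_mult_polygonal by (simp add: algebra_simps power2_eq_square)
  have ge: "int m \<le> polygonal k m" for m
  proof -
    have "0 \<le> (k - 2) * (int m * (int m - 1))" using k by (cases m) auto
    then show ?thesis using two[of m] by linarith
  qed
  \<comment> \<open>Distinct indices give distinct parts, so the product over the set of parts is
    the product over the indices.\<close>
  have inj: "inj (\<lambda>m. polygonal k (Suc m))"
  proof (rule linorder_injI)
    fix x y :: nat assume xy: "x < y"
    have "Q x < Q y" unfolding Q_def using xy a c by (intro mult_strict_left_mono mult_strict_mono) auto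
    then show "polygonal k (Suc x) \<noteq> polygonal k (Suc y)" unfolding Qk by simp
  qed
  define A where "A = (\<lambda>M. (\<lambda>m. polygonal k (Suc m)) ` {..<M})"
  have Apos: "1 \<le> x" if "x \<in> A M" for x M using that polygonal_pos[OF k] by (auto simp: A_def)
  have card: "card (partitions_into (A M) (int n)) = p_gonal k n" if M: "n \<le> M" for M
  proof -
    have "partitions_into (A M) (int n) = polygonal_partitions k n"
    proof (intro equalityI subsetI)
      fix X assume "X \<in> partitions_into (A M) (int n)"
      then show "X \<in> polygonal_partitions k n"
        unfolding partitions_into_def polygonal_partitions_def A_def by fastforce
    next
      fix X assume X: "X \<in> polygonal_partitions k n"
      then have sub: "set_mset X \<subseteq> {polygonal k m | m. m \<ge> 1}" and sum: "sum_mset X = int n"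
        by (auto simp: polygonal_partitions_def)
      have "\<forall>x\<in>#X. x \<le> int n"
        using partitions_into_bounds[OF _ sub] polygonal_pos[OF k] sum by auto
      have "x \<in> A M" if xX: "x \<in># X" for x
      proof -
        obtain m where m: "x = polygonal k m" "m \<ge> 1" using sub xX by auto
        have "x \<le> int n" using \<open>\<forall>x\<in>#X. x \<le> int n\<close> xX by blast
        then have "int m \<le> int n" using ge[of m] m(1) by linarith
        then show ?thesis unfolding A_def m(1) using m(2) M by (intro image_eqI[of _ _ "m - 1"]) auto
      qed
      then show "X \<in> partitions_into (A M) (int n)" using sum by (auto simp: partitions_into_def)
    qed
    then show ?thesis by (simp add: p_gonal_def)
  qed
  define f where "f = (\<lambda>M \<theta>. partition_product (A M) (Complex \<eta> \<theta>) * exp (of_int (int n) * Complex \<eta> \<theta>))"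
  define g where "g = (\<lambda>\<theta>. exp (H (Complex \<eta> \<theta>) + of_nat n * Complex \<eta> \<theta>))"
  have fexp: "f M \<theta> = exp ((\<Sum>m<M. log_factor (Complex \<eta> \<theta> * of_real (Q m))) + of_nat n * Complex \<eta> \<theta>)" for M \<theta>
  proof -
    have "partition_product (A M) (Complex \<eta> \<theta>) = (\<Prod>m<M. 1 / (1 - exp (- (Complex \<eta> \<theta> * of_int (polygonal k (Suc m))))))"
      unfolding partition_product_def A_def
      by (subst prod.reindex) (auto intro: inj_on_subset[OF inj])
    also have "\<dots> = (\<Prod>m<M. exp (log_factor (Complex \<eta> \<theta> * of_real (Q m))))"
    proof (rule prod.cong[OF refl])
      fix m
      have "0 < Re (Complex \<eta> \<theta> * of_real (Q m))" using \<eta> Q_pos[of m] by simp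
      then have "1 - exp (- (Complex \<eta> \<theta> * of_real (Q m))) \<noteq> 0" by (rule one_minus_exp_nonzero)
      then have "exp (log_factor (Complex \<eta> \<theta> * of_real (Q m))) = 1 / (1 - exp (- (Complex \<eta> \<theta> * of_real (Q m))))"
        by (simp add: log_factor_def exp_minus divide_inverse)
      then show "1 / (1 - exp (- (Complex \<eta> \<theta> * of_int (polygonal k (Suc m))))) = exp (log_factor (Complex \<eta> \<theta> * of_real (Q m)))"
        by (simp add: Qk)
    qed
    also have "\<dots> = exp (\<Sum>m<M. log_factor (Complex \<eta> \<theta> * of_real (Q m)))" by (simp add: exp_sum)
    finally show ?thesis by (simp add: f_def exp_add)
  qed
  have fint: "f M integrable_on {-pi..pi}" for M
    unfolding f_def using integrable_continuous_real[OF partition_product_continuous[OF \<eta> Apos]] .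
  have lf: "Re (log_factor X) \<le> norm (log_factor X)" for X by (rule complex_Re_le_cmod)
  have real: "log_factor (of_real (\<eta> * Q m)) = of_real (- ln (1 - exp (- (\<eta> * Q m))))" for m
    by (rule log_factor_of_real) (use \<eta> Q_pos in simp)
  have Rele: "Re (log_factor (Complex \<eta> \<theta> * of_real (Q m))) \<le> Re (log_factor (of_real \<eta> * of_real (Q m)))" for \<theta> m
  proof -
    define X where "X = Complex \<eta> \<theta> * of_real (Q m)"
    have X: "0 < Re X" "Re X = \<eta> * Q m" using \<eta> Q_pos[of m] by (auto simp: X_def)
    have nz: "1 - exp (- X) \<noteq> 0" by (rule one_minus_exp_nonzero[OF X(1)])
    have "1 - exp (- (\<eta> * Q m)) \<le> norm (1 - exp (- X))"
      using norm_triangle_ineq2[of 1 "exp (- X)"] X(2) by simp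
    then have "ln (1 - exp (- (\<eta> * Q m))) \<le> ln (norm (1 - exp (- X)))"
      using X by (intro ln_mono) auto
    moreover have "Re (log_factor X) = - ln (norm (1 - exp (- X)))" using nz by (simp add: log_factor_def)
    ultimately show ?thesis using real[of m] by (simp add: X_def)
  qed
  have sumsR: "(\<lambda>m. Re (log_factor (of_real \<eta> * of_real (Q m)))) sums Re (H (of_real \<eta>))"
    by (intro sums_Re H_properties(1)) (use \<eta> in simp)
  have nonneg: "0 \<le> Re (log_factor (of_real \<eta> * of_real (Q m)))" for m
  proof -
    have "ln (1 - exp (- (\<eta> * Q m))) \<le> 0" using \<eta> Q_pos[of m] by (intro ln_le_zero_iff[THEN iffD2]) auto
    then show ?thesis using real[of m] by simp
  qed
  have bd: "norm (f M \<theta>) \<le> exp (Re (H (of_real \<eta>)) + n * \<eta>)" for M \<theta>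
  proof -
    have "(\<Sum>m<M. Re (log_factor (Complex \<eta> \<theta> * of_real (Q m)))) \<le> (\<Sum>m<M. Re (log_factor (of_real \<eta> * of_real (Q m))))"
      by (intro sum_mono Rele)
    also have "\<dots> \<le> Re (H (of_real \<eta>))"
      using sum_le_suminf[of "\<lambda>m. Re (log_factor (of_real \<eta> * of_real (Q m)))" "{..<M}"] sumsR nonneg by (auto simp: sums_iff)
    finally show ?thesis unfolding fexp norm_exp_eq_Re by simp
  qed
  have lim: "(\<lambda>M. f M \<theta>) \<longlonglongrightarrow> g \<theta>" for \<theta>
  proof -
    have "(\<lambda>M. \<Sum>m<M. log_factor (Complex \<eta> \<theta> * of_real (Q m))) \<longlonglongrightarrow> H (Complex \<eta> \<theta>)"
      using H_properties(1)[of "Complex \<eta> \<theta>"] \<eta> by (simp add: sums_def)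
    then show ?thesis unfolding fexp g_def by (intro tendsto_exp tendsto_add tendsto_const)
  qed
  note dom = dominated_convergence[OF fint integrable_const_ivl[of "exp (Re (H (of_real \<eta>)) + n * \<eta>)" "-pi" pi] bd lim]
  show "(\<lambda>\<theta>. exp (H (Complex \<eta> \<theta>) + of_nat n * Complex \<eta> \<theta>)) integrable_on {-pi..pi}"
    using dom(1) unfolding g_def .
  have "(\<lambda>M. integral {-pi..pi} (f M)) \<longlonglongrightarrow> integral {-pi..pi} g" by (rule dom(2))
  moreover have "\<forall>\<^sub>F M in sequentially. integral {-pi..pi} (f M) = of_real (2 * pi * p_gonal k n)"
    using eventually_ge_at_top[of n]
  proof eventually_elim
    case (elim M)
    have "finite (A M)" by (simp add: A_def)
    from card_partitions_into_integral[where n = "int n", OF this Apos[of _ M] \<eta>] show ?case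
      unfolding f_def card[OF elim] .
  qed
  ultimately have "(\<lambda>M::nat. complex_of_real (2 * pi * p_gonal k n)) \<longlonglongrightarrow> integral {-pi..pi} g"
    by (rule Lim_transform_eventually)
  then have "integral {-pi..pi} g = of_real (2 * pi * p_gonal k n)"
    by (simp add: LIMSEQ_const_iff)
  then show "integral {-pi..pi} (\<lambda>\<theta>. exp (H (Complex \<eta> \<theta>) + of_nat n * Complex \<eta> \<theta>)) = of_real (2 * pi * p_gonal k n)"
    unfolding g_def .
qed

end

section \<open>The central arc\<close>

lemma exp_neg_le_power:
  assumes x: "0 < (x::real)"
  shows "exp (- x) \<le> fact m / x ^ m"
proof -
  have "x ^ m /\<^sub>R fact m \<le> (\<Sum>n. x ^ n /\<^sub>R fact n)"
    using sum_le_suminf[OF summable_exp_generic[of x], of "{m}"] x by simp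
  then have "x ^ m / fact m \<le> exp x" by (simp add: exp_def divide_inverse mult.commute)
  then have "1 / exp x \<le> 1 / (x ^ m / fact m)" using x by (intro divide_left_mono) auto
  then show ?thesis by (simp add: exp_minus divide_inverse mult.commute)
qed

text \<open>The Laplace expansion is in powers of \<open>sqrt (t / L)\<close>; with vanishing odd
  coefficients it becomes one in powers of \<open>t\<close>.\<close>

lemma sum_even_terms:
  fixes f :: "nat \<Rightarrow> complex"
  assumes "\<And>i. odd i \<Longrightarrow> f i = 0"
  shows "(\<Sum>i\<le>Suc (2 * J). f i) = (\<Sum>i\<le>J. f (2 * i))"
  by (induction J) (use assms in simp_all)

context quad_seq
begin

lemma L_pos: "0 < L"
proof -
  have "0 < zeta (3/2)"
    unfolding zeta_def by (intro suminf_pos summable_zeta) auto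
  then show ?thesis using a by (simp add: L_def)
qed

lemma H_holomorphic: "H holomorphic_on {z. 0 < Re z}"
  unfolding holomorphic_on_open[OF open_halfspace_Re_gt] using H_properties(2) by blast

lemma ball_half_props:
  assumes "h \<le> 1/2" "w \<in> ball (1::complex) h"
  shows "0 < Re w" "w \<notin> \<real>\<^sub>\<le>\<^sub>0" "csqrt w \<noteq> 0"
proof -
  have "\<bar>Re (1 - w)\<bar> < 1/2" using abs_Re_le_cmod[of "1 - w"] assms by (auto simp: dist_norm)
  then have "\<bar>1 - Re w\<bar> < 1/2" by simp
  then show re: "0 < Re w" by linarith
  show "w \<notin> \<real>\<^sub>\<le>\<^sub>0" using re by (auto simp: complex_nonpos_Reals_iff)
  then show "csqrt w \<noteq> 0" by auto
qed

lemma T_holomorphic: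
  assumes "h \<le> 1/2" "0 < t"
  shows "T t holomorphic_on ball 1 h"
proof -
  have "(\<lambda>w. H (w * of_real (t\<^sup>2))) holomorphic_on ball 1 h"
    by (rule holomorphic_on_compose_gen[OF _ H_holomorphic, unfolded o_def])
       (use ball_half_props(1)[OF assms(1)] assms(2) in \<open>auto intro!: holomorphic_intros\<close>)
  then show ?thesis
    unfolding T_def[abs_def] using assms(2) ball_half_props(2,3)[OF assms(1)]
    by (intro holomorphic_on_diff holomorphic_on_divide holomorphic_on_mult holomorphic_on_const holomorphic_on_csqrt' holomorphic_on_ident) auto
qed

text \<open>\<open>T\<close> is exponentiated because, unlike \<open>H\<close>, it stays bounded as
  \<open>t\<close> tends to \<open>0\<close>. The limit of \<open>T t 1\<close> is recorded for the
  estimate on the rest of the contour.\<close>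

lemma exp_T_expansion:
  obtains h G where "0 < h" "h \<le> 1/2" "\<And>J. uexp_coeffs (ball 1 h) J (\<lambda>t w. exp (T t w)) G"
    "\<And>j. G j holomorphic_on ball 1 h" "G 0 1 = of_real (exp D0)" "((\<lambda>t. T t 1) \<longlongrightarrow> of_real D0) (at_right 0)"
proof -
  obtain h G' where h: "0 < h" "h \<le> 1/2" and G': "\<And>J. uexp_coeffs (ball 1 h) J T G'"
    "\<And>j. G' j holomorphic_on ball 1 h" "\<And>w. w \<in> ball 1 h \<Longrightarrow> G' 0 w = of_real D0 + of_real \<kappa> * Ln w"
    by (rule log_expansion) (rule that; assumption)
  have one: "1 \<in> ball (1::complex) h" using h by simp
  have "uexp (ball 1 h) J (\<lambda>t w. exp (T t w))" for J
    by (rule uexp_exp) (use G'(1) in \<open>auto simp: uexp_def\<close>)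
  then obtain G where G: "\<And>J. uexp_coeffs (ball 1 h) J (\<lambda>t w. exp (T t w)) G"
    using uexp_coeffs_all_orders by blast
  have hol: "G j holomorphic_on ball 1 h" for j
  proof (rule uexp_coeffs_holomorphic[OF G open_ball _ order_refl])
    show "\<forall>\<^sub>F t in at_right 0. (\<lambda>w. exp (T t w)) holomorphic_on ball 1 h"
      using eventually_small_right[OF zero_less_one]
      by eventually_elim (intro holomorphic_on_exp' T_holomorphic h, simp)
  qed
  have lT: "((\<lambda>t. T t 1) \<longlongrightarrow> of_real D0) (at_right 0)"
    using tendsto_uniform_limitI[OF uexp_coeffs_uniform_limit[OF G'(1), of 0 0] one] G'(3)[OF one] by simp
  have "((\<lambda>t. exp (T t 1)) \<longlongrightarrow> G 0 1) (at_right 0)"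
    using tendsto_uniform_limitI[OF uexp_coeffs_uniform_limit[OF G, of 0 0] one] by simp
  moreover have "((\<lambda>t. exp (T t 1)) \<longlongrightarrow> exp (of_real D0)) (at_right 0)" by (intro tendsto_exp lT)
  ultimately have "G 0 1 = exp (of_real D0)" by (rule tendsto_unique[rotated]) simp
  then have "G 0 1 = of_real (exp D0)" by (simp add: exp_of_real)
  then show ?thesis using that[OF h G hol _ lT] by blast
qed

text \<open>The integral over the arc in the variable \<open>u\<close>, with the saddle value, the
  power of \<open>t\<close> and the Gaussian width \<open>s = sqrt (t / L)\<close> divided out. As
  \<open>u\<^sup>2 / s\<^sup>2 = u\<^sup>2 * L / t\<close>, the exponent is \<open>L / t\<close>
  times the excess over the saddle value.\<close>

definition central_arc :: "real \<Rightarrow> real \<Rightarrow> complex" where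
  "central_arc r t = (1 / of_real (sqrt (t / L))) * (\<integral>u. indicator {-r..r} u *\<^sub>R
     (exp (of_real (u\<^sup>2 / (sqrt (t / L))\<^sup>2) * saddle (of_real u)) * exp (T t (1 + \<i> * of_real u))) \<partial>lborel)"

lemma gaussian_scale:
  assumes s: "0 < s"
  shows "integrable lborel (\<lambda>u::real. exp (- (u\<^sup>2 / s\<^sup>2 / 4)))"
    and "(1 / s) * (\<integral>u. exp (- (u\<^sup>2 / s\<^sup>2 / 4)) \<partial>lborel) = (\<integral>v. exp (- (v\<^sup>2 / 4)) \<partial>(lborel :: real measure))"
proof -
  have i: "integrable lborel (\<lambda>v::real. exp (- (v\<^sup>2 / 4)))"
    using integrable_gaussian_moment[of 0] by simp
  from lborel_integrable_real_affine[OF this, of "1/s" 0]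
  show "integrable lborel (\<lambda>u::real. exp (- (u\<^sup>2 / s\<^sup>2 / 4)))" using s by (simp add: power_divide)
  have "(\<integral>v. exp (- (v\<^sup>2 / 4)) \<partial>(lborel :: real measure)) = \<bar>1/s\<bar> *\<^sub>R (\<integral>u. exp (- ((0 + 1/s * u)\<^sup>2 / 4)) \<partial>lborel)"
    by (rule lborel_integral_real_affine) (use s in simp)
  then show "(1 / s) * (\<integral>u. exp (- (u\<^sup>2 / s\<^sup>2 / 4)) \<partial>lborel) = (\<integral>v. exp (- (v\<^sup>2 / 4)) \<partial>(lborel :: real measure))"
    using s by (simp add: power_divide)
qed

text \<open>Two expansions are nested. Under the integral \<open>exp (T t w)\<close> is expanded in
  \<open>t\<close> with coefficients \<open>G j w\<close>; each of these gives a Laplace integral,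
  expanded in turn in \<open>s = sqrt (t / L)\<close> with even powers only, so that the result is
  again in powers of \<open>t\<close>.\<close>

lemma central_expansion:
  obtains r k where "0 < r" "r < 1" "r \<le> 1/4" "k 0 = of_real (sqrt (8 * pi / 3) * exp D0)"
    "\<And>J. \<exists>C. \<forall>\<^sub>F t in at_right 0. norm (central_arc r t - (\<Sum>j\<le>J. k j * of_real t ^ j)) \<le> C * t ^ Suc J"
    "\<And>t. 0 < t \<Longrightarrow> continuous_on {-r..r} (\<lambda>u. exp (T t (1 + \<i> * of_real u)))"
    "continuous_on {-r..r} (\<lambda>u. saddle (of_real u))"
proof -
  obtain h G where h: "0 < h" "h \<le> 1/2" and G: "\<And>J. uexp_coeffs (ball 1 h) J (\<lambda>t w. exp (T t w)) G"
    and hol: "\<And>j. G j holomorphic_on ball 1 h" and G0: "G 0 1 = of_real (exp D0)"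
    by (rule exp_T_expansion) (rule that; assumption)
  obtain \<rho>' where \<rho>': "0 < \<rho>'" "\<rho>' < 1" "\<And>u. u \<in> ball 0 \<rho>' \<Longrightarrow> Re (saddle u) \<le> - 1 / 4"
    by (rule saddle_decay) (rule that; assumption)
  define \<rho> where "\<rho> = min \<rho>' h"
  have \<rho>: "0 < \<rho>" "\<rho> \<le> \<rho>'" "\<rho> \<le> h" "\<rho> < 1" "\<rho> \<le> 1/2" using \<rho>' h by (auto simp: \<rho>_def)
  define r where "r = \<rho> / 4"
  have r: "0 < r" "r \<le> \<rho> / 4" "r < 1" "r \<le> 1/4" "r < \<rho>" using \<rho> by (auto simp: r_def)
  have wb: "1 + \<i> * u \<in> ball 1 h" if "u \<in> ball 0 \<rho>" for u using that \<rho> by (auto simp: dist_norm norm_mult)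
  have sub: "complex_of_real u \<in> ball 0 \<rho>" if "u \<in> {-r..r}" for u using that r by auto
  have sadhol: "saddle holomorphic_on ball 0 \<rho>" by (rule holomorphic_on_subset[OF saddle_holomorphic]) (use \<rho> in auto)
  have saddec: "Re (saddle u) \<le> - 1 / 4" if "u \<in> ball 0 \<rho>" for u using \<rho>'(3)[of u] that \<rho> by auto
  have ehol: "(\<lambda>u. G j (1 + \<i> * u)) holomorphic_on ball 0 \<rho>" for j
    by (rule holomorphic_on_compose_gen[OF _ hol, unfolded o_def]) (use wb in \<open>auto intro!: holomorphic_intros\<close>)
  have contT: "continuous_on {-r..r} (\<lambda>u. exp (T t (1 + \<i> * of_real u)))" if t: "0 < t" for t
  proof -
    have "continuous_on (ball 1 h) (T t)" by (rule holomorphic_on_imp_continuous_on[OF T_holomorphic[OF h(2) t]])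
    then have "continuous_on {-r..r} (\<lambda>u. T t (1 + \<i> * of_real u))"
      by (rule continuous_on_compose2) (use wb sub in \<open>auto intro!: continuous_intros\<close>)
    then show ?thesis by (intro continuous_intros)
  qed
  have contS: "continuous_on {-r..r} (\<lambda>u. saddle (of_real u))"
    by (rule continuous_on_compose2[OF holomorphic_on_imp_continuous_on[OF sadhol]]) (use sub in \<open>auto intro!: continuous_intros\<close>)
  have contG: "continuous_on {-r..r} (\<lambda>u. G j (1 + \<i> * of_real u))" for j
    by (rule continuous_on_compose2[OF holomorphic_on_imp_continuous_on[OF hol[of j]]]) (use wb sub in \<open>auto intro!: continuous_intros\<close>)
  define A where "A = (\<lambda>j s. (1 / of_real s) * (\<integral>u. indicator {-r..r} u *\<^sub>R (exp (of_real (u\<^sup>2 / s\<^sup>2) * saddle (of_real u)) * G j (1 + \<i> * of_real u)) \<partial>lborel))"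
  have lap: "\<exists>k C. k 0 = of_real (sqrt (8 * pi / 3)) * G j 1 \<and> (\<forall>i. odd i \<longrightarrow> k i = 0) \<and>
     (\<forall>s. 0 < s \<longrightarrow> s \<le> 1 \<longrightarrow> norm (A j s - (\<Sum>i\<le>N. k i * of_real s ^ i)) \<le> C * s ^ Suc N)" for j N
  proof -
    obtain M where M: "\<And>w. w \<in> ball 1 h \<Longrightarrow> norm (G j w) \<le> M" using uexp_coeffs_boundedE[OF G] by metis
    have bd: "norm (G j (1 + \<i> * u)) \<le> M" if "u \<in> ball 0 \<rho>" for u using M wb[OF that] by blast
    show ?thesis
    proof (rule laplace_expansion[OF \<rho>(1) sadhol saddec saddle_0 ehol bd r(1,2), of N])
      fix k C assume "k 0 = of_real (sqrt (8 * pi / 3)) * G j (1 + \<i> * 0)" "\<And>i. odd i \<Longrightarrow> k i = 0"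
        "\<And>s. 0 < s \<Longrightarrow> s \<le> 1 \<Longrightarrow>
        norm ((1 / of_real s) * (\<integral>u. indicator {-r..r} u *\<^sub>R (exp (of_real (u\<^sup>2 / s\<^sup>2) * saddle (of_real u)) * G j (1 + \<i> * of_real u)) \<partial>lborel)
        - (\<Sum>i\<le>N. k i * of_real s ^ i)) \<le> C * s ^ Suc N"
      then show ?thesis unfolding A_def by (intro exI[of _ k] exI[of _ C]) auto
    qed assumption+
  qed
  define \<sigma> where "\<sigma> = (\<lambda>t. sqrt (t / L))"
  have \<sigma>: "0 < \<sigma> t" "(\<sigma> t)\<^sup>2 = t / L" if "0 < t" for t using that L_pos by (auto simp: \<sigma>_def)
  have \<sigma>1: "\<forall>\<^sub>F t in at_right 0. 0 < t \<and> \<sigma> t \<le> 1"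
    using eventually_small_right[OF L_pos] by eventually_elim (auto simp: \<sigma>_def)
  \<comment> \<open>A one-point parameter set turns the calculus of uniform expansions into one for
    functions of \<open>t\<close> alone.\<close>
  have uA: "uexp (UNIV::unit set) J (\<lambda>t _. A j (\<sigma> t))" for j J
  proof -
    \<comment> \<open>Order \<open>2 * J + 1\<close> in \<open>s\<close> leaves an error
      \<open>s ^ (2 * J + 2)\<close>, that is \<open>(t / L) ^ Suc J\<close>.\<close>
    obtain k C where k: "\<And>i. odd i \<Longrightarrow> k i = 0" "\<And>s. 0 < s \<Longrightarrow> s \<le> 1 \<Longrightarrow> norm (A j s - (\<Sum>i\<le>Suc (2 * J). k i * of_real s ^ i)) \<le> C * s ^ Suc (Suc (2 * J))"
      using lap[of j "Suc (2 * J)"] by blast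
    have "uexp_coeffs (UNIV::unit set) J (\<lambda>t _. A j (\<sigma> t)) (\<lambda>i _. k (2 * i) / of_real L ^ i)"
    proof (rule uexp_coeffsI)
      show "\<exists>B. \<forall>p\<in>(UNIV::unit set). norm (k (2 * i) / of_real L ^ i) \<le> B" for i by blast
      show "\<forall>\<^sub>F t in at_right 0. \<forall>p\<in>(UNIV::unit set). norm (A j (\<sigma> t) - (\<Sum>i\<le>J. k (2 * i) / of_real L ^ i * of_real t ^ i)) \<le> (C / L ^ Suc J) * t ^ Suc J"
        using \<sigma>1
      proof eventually_elim
        case (elim t)
        have pw: "complex_of_real (\<sigma> t) ^ (2 * i) = of_real t ^ i / of_real L ^ i" for i
          unfolding power_mult using \<sigma>(2)[of t] elim by (metis of_real_divide of_real_power power_divide)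
        have pw': "\<sigma> t ^ Suc (Suc (2 * J)) = t ^ Suc J / L ^ Suc J"
        proof -
          have "\<sigma> t ^ Suc (Suc (2 * J)) = ((\<sigma> t)\<^sup>2) ^ Suc J" by (simp only: power_mult[symmetric]) simp
          then show ?thesis using \<sigma>(2)[of t] elim by (simp add: power_divide)
        qed
        have "(\<Sum>i\<le>Suc (2 * J). k i * of_real (\<sigma> t) ^ i) = (\<Sum>i\<le>J. k (2 * i) * of_real (\<sigma> t) ^ (2 * i))"
          by (rule sum_even_terms) (use k(1) in simp)
        also have "\<dots> = (\<Sum>i\<le>J. k (2 * i) / of_real L ^ i * of_real t ^ i)"
          unfolding pw by simp
        finally show ?case using k(2)[of "\<sigma> t"] \<sigma>(1)[of t] elim unfolding pw' by simp
      qed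
    qed
    then show ?thesis unfolding uexp_def by blast
  qed
  \<comment> \<open>The Gaussian mass in the scaled variable: thanks to the prefactor
    \<open>1 / s\<close>, the error in the amplitude passes through the integral without losing
    powers of \<open>t\<close>.\<close>
  define K0 where "K0 = (\<integral>v. exp (- (v\<^sup>2 / 4)) \<partial>(lborel :: real measure))"
  have dec: "\<exists>C. \<forall>\<^sub>F t in at_right 0. norm (central_arc r t - (\<Sum>j\<le>J. of_real t ^ j * A j (\<sigma> t))) \<le> C * t ^ Suc J" for J
  proof -
    obtain C where C: "C \<ge> 0" "\<forall>\<^sub>F t in at_right 0. \<forall>w\<in>ball 1 h. norm (exp (T t w) - (\<Sum>j\<le>J. G j w * of_real t ^ j)) \<le> C * t ^ Suc J"
      by (rule uexp_coeffsE[OF G[of J]])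
    have "\<forall>\<^sub>F t in at_right 0. norm (central_arc r t - (\<Sum>j\<le>J. of_real t ^ j * A j (\<sigma> t))) \<le> (K0 * C) * t ^ Suc J"
      using C(2) \<sigma>1
    proof eventually_elim
      case (elim t)
      define s where "s = \<sigma> t"
      have t: "0 < t" and s: "0 < s" using elim \<sigma>(1) by (auto simp: s_def)
      define E where "E = (\<lambda>u::real. exp (of_real (u\<^sup>2 / s\<^sup>2) * saddle (of_real u)))"
      have cE: "continuous_on {-r..r} E" unfolding E_def using s by (intro continuous_intros contS) auto
      define f where "f = (\<lambda>u::real. indicator {-r..r} u *\<^sub>R (E u * exp (T t (1 + \<i> * of_real u))))"
      define g where "g = (\<lambda>j. \<lambda>u::real. indicator {-r..r} u *\<^sub>R (E u * G j (1 + \<i> * of_real u)))"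
      have fi: "integrable lborel f"
        using borel_integrable_atLeastAtMost'[OF continuous_on_mult[OF cE contT[OF t]]] unfolding f_def set_integrable_def by simp
      have gi: "integrable lborel (g j)" for j
        using borel_integrable_atLeastAtMost'[OF continuous_on_mult[OF cE contG[of j]]] unfolding g_def set_integrable_def by simp
      have Z: "central_arc r t = (1 / of_real s) * (\<integral>u. f u \<partial>lborel)" by (simp add: central_arc_def f_def E_def s_def \<sigma>_def)
      have Aj: "A j s = (1 / of_real s) * (\<integral>u. g j u \<partial>lborel)" for j by (simp add: A_def g_def E_def)
      have "central_arc r t - (\<Sum>j\<le>J. of_real t ^ j * A j s) = (1 / of_real s) * ((\<integral>u. f u \<partial>lborel) - (\<Sum>j\<le>J. of_real t ^ j * (\<integral>u. g j u \<partial>lborel)))"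
        unfolding Z Aj by (simp add: right_diff_distrib sum_distrib_left mult_ac)
      also have "(\<Sum>j\<le>J. of_real t ^ j * (\<integral>u. g j u \<partial>lborel)) = (\<integral>u. (\<Sum>j\<le>J. of_real t ^ j * g j u) \<partial>lborel)"
        by (subst Bochner_Integration.integral_sum) (auto intro!: integrable_mult_right gi)
      also have "(\<integral>u. f u \<partial>lborel) - (\<integral>u. (\<Sum>j\<le>J. of_real t ^ j * g j u) \<partial>lborel) = (\<integral>u. f u - (\<Sum>j\<le>J. of_real t ^ j * g j u) \<partial>lborel)"
        by (rule Bochner_Integration.integral_diff[symmetric, OF fi]) (intro Bochner_Integration.integrable_sum integrable_mult_right gi)
      finally have eq: "central_arc r t - (\<Sum>j\<le>J. of_real t ^ j * A j s) = (1 / of_real s) * (\<integral>u. f u - (\<Sum>j\<le>J. of_real t ^ j * g j u) \<partial>lborel)" .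
      have "norm (\<integral>u. f u - (\<Sum>j\<le>J. of_real t ^ j * g j u) \<partial>lborel) \<le> (\<integral>u. exp (- (u\<^sup>2 / s\<^sup>2 / 4)) * (C * t ^ Suc J) \<partial>lborel)"
      proof (rule Bochner_Integration.integral_norm_bound_integral)
        show "integrable lborel (\<lambda>u. f u - (\<Sum>j\<le>J. of_real t ^ j * g j u))"
          by (intro Bochner_Integration.integrable_diff fi Bochner_Integration.integrable_sum integrable_mult_right gi)
        show "integrable lborel (\<lambda>u. exp (- (u\<^sup>2 / s\<^sup>2 / 4)) * (C * t ^ Suc J))"
          by (rule integrable_mult_left[OF gaussian_scale(1)[OF s]])
        fix u :: real
        have nn: "0 \<le> exp (- (u\<^sup>2 / s\<^sup>2 / 4)) * (C * t ^ Suc J)" using C(1) t by simp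
        show "norm (f u - (\<Sum>j\<le>J. of_real t ^ j * g j u)) \<le> exp (- (u\<^sup>2 / s\<^sup>2 / 4)) * (C * t ^ Suc J)"
        proof (cases "u \<in> {-r..r}")
          case True
          note ub = sub[OF True]
          have "f u - (\<Sum>j\<le>J. of_real t ^ j * g j u) = E u * (exp (T t (1 + \<i> * of_real u)) - (\<Sum>j\<le>J. G j (1 + \<i> * of_real u) * of_real t ^ j))"
            using True by (simp add: f_def g_def right_diff_distrib sum_distrib_left mult_ac)
          then have "norm (f u - (\<Sum>j\<le>J. of_real t ^ j * g j u)) = norm (E u) * norm (exp (T t (1 + \<i> * of_real u)) - (\<Sum>j\<le>J. G j (1 + \<i> * of_real u) * of_real t ^ j))"
            by (simp add: norm_mult)
          also have "\<dots> \<le> exp (- (u\<^sup>2 / s\<^sup>2 / 4)) * (C * t ^ Suc J)"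
          proof (rule mult_mono)
            have "u\<^sup>2 / s\<^sup>2 * Re (saddle (of_real u)) \<le> u\<^sup>2 / s\<^sup>2 * (- 1 / 4)"
              by (intro mult_left_mono saddec ub) auto
            then show "norm (E u) \<le> exp (- (u\<^sup>2 / s\<^sup>2 / 4))" by (simp add: E_def)
            show "norm (exp (T t (1 + \<i> * of_real u)) - (\<Sum>j\<le>J. G j (1 + \<i> * of_real u) * of_real t ^ j)) \<le> C * t ^ Suc J"
              using elim(1) wb[OF ub] by blast
          qed auto
          finally show ?thesis .
        qed (use nn in \<open>simp add: f_def g_def\<close>)
      qed
      then have "norm (central_arc r t - (\<Sum>j\<le>J. of_real t ^ j * A j s)) \<le> (1 / s) * (\<integral>u. exp (- (u\<^sup>2 / s\<^sup>2 / 4)) * (C * t ^ Suc J) \<partial>lborel)"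
        unfolding eq norm_mult using s by (simp add: norm_divide divide_right_mono)
      also have "(\<integral>u. exp (- (u\<^sup>2 / s\<^sup>2 / 4)) * (C * t ^ Suc J) \<partial>lborel) = (\<integral>u. exp (- (u\<^sup>2 / s\<^sup>2 / 4)) \<partial>lborel) * (C * t ^ Suc J)"
        by (rule integral_mult_left_zero)
      also have "(1 / s) * ((\<integral>u. exp (- (u\<^sup>2 / s\<^sup>2 / 4)) \<partial>lborel) * (C * t ^ Suc J)) = K0 * C * t ^ Suc J"
        unfolding K0_def gaussian_scale(2)[OF s, symmetric] by (simp only: mult.assoc)
      finally show ?case unfolding s_def .
    qed
    then show ?thesis by blast
  qed
  have "uexp (UNIV::unit set) J (\<lambda>t _. central_arc r t)" for J
  proof -
    obtain C where "\<forall>\<^sub>F t in at_right 0. norm (central_arc r t - (\<Sum>j\<le>J. of_real t ^ j * A j (\<sigma> t))) \<le> C * t ^ Suc J" using dec[of J] by blast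
    then have "uexp_coeffs (UNIV::unit set) J (\<lambda>t _. central_arc r t - (\<Sum>j\<le>J. of_real t ^ j * A j (\<sigma> t))) (\<lambda>_ _. 0)"
      by (intro uexp_bigo) simp
    then have 1: "uexp (UNIV::unit set) J (\<lambda>t _. central_arc r t - (\<Sum>j\<le>J. of_real t ^ j * A j (\<sigma> t)))" unfolding uexp_def by blast
    have 2: "uexp (UNIV::unit set) J (\<lambda>t _. \<Sum>j\<le>J. of_real t ^ j * A j (\<sigma> t))"
      by (intro uexp_sum uexp_times_power uA) auto
    from uexp_add[OF 1 2] show ?thesis by simp
  qed
  then obtain k where k: "\<And>J. uexp_coeffs (UNIV::unit set) J (\<lambda>t _. central_arc r t) k"
    using uexp_coeffs_all_orders by blast
  have "k 0 () = of_real (sqrt (8 * pi / 3) * exp D0)"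
  proof -
    have lk: "((\<lambda>t. central_arc r t) \<longlongrightarrow> k 0 ()) (at_right 0)"
      using tendsto_uniform_limitI[OF uexp_coeffs_uniform_limit[OF k, of 0 0], of "()"] by simp
    obtain C where C: "\<forall>\<^sub>F t in at_right 0. norm (central_arc r t - (\<Sum>j\<le>0. of_real t ^ j * A j (\<sigma> t))) \<le> C * t ^ Suc 0" using dec[of 0] by blast
    have d1: "((\<lambda>t. central_arc r t - A 0 (\<sigma> t)) \<longlongrightarrow> 0) (at_right 0)"
    proof (rule Lim_null_comparison)
      show "\<forall>\<^sub>F t in at_right 0. norm (central_arc r t - A 0 (\<sigma> t)) \<le> C * t" using C by simp
      show "((\<lambda>t. C * t) \<longlongrightarrow> 0) (at_right 0)" by (auto intro!: tendsto_eq_intros)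
    qed
    obtain k' C' where k': "k' 0 = of_real (sqrt (8 * pi / 3)) * G 0 1" "\<And>s. 0 < s \<Longrightarrow> s \<le> 1 \<Longrightarrow> norm (A 0 s - (\<Sum>i\<le>0. k' i * of_real s ^ i)) \<le> C' * s ^ Suc 0"
      using lap[of 0 0] by blast
    have "((\<lambda>t. A 0 (\<sigma> t) - k' 0) \<longlongrightarrow> 0) (at_right 0)"
    proof (rule Lim_null_comparison)
      show "\<forall>\<^sub>F t in at_right 0. norm (A 0 (\<sigma> t) - k' 0) \<le> C' * \<sigma> t"
        using \<sigma>1 by eventually_elim (use k'(2) \<sigma>(1) in simp)
      show "((\<lambda>t. C' * \<sigma> t) \<longlongrightarrow> 0) (at_right 0)" unfolding \<sigma>_def using L_pos by (auto intro!: tendsto_eq_intros)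
    qed
    from tendsto_add[OF d1 this] have "((\<lambda>t. central_arc r t - k' 0) \<longlongrightarrow> 0) (at_right 0)" by simp
    then have "((\<lambda>t. central_arc r t) \<longlongrightarrow> k' 0) (at_right 0)" by (rule LIM_zero_cancel)
    with lk have "k 0 () = k' 0" by (rule tendsto_unique[rotated]) simp
    then show ?thesis using k'(1) G0 by simp
  qed
  moreover have "\<exists>C. \<forall>\<^sub>F t in at_right 0. norm (central_arc r t - (\<Sum>j\<le>J. k j () * of_real t ^ j)) \<le> C * t ^ Suc J" for J
    using k[of J] unfolding uexp_coeffs_def by auto
  ultimately show ?thesis using that[of r "\<lambda>j. k j ()"] r(1,3,4) contT contS by blast
qed


lemma H_of_real_square:
  assumes "0 < t"
  shows "H (w * of_real (t\<^sup>2)) = T t w + of_real L / (of_real t * csqrt w) + of_real (2 * \<kappa> * ln t)"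
  by (simp add: T_def)

text \<open>The central arc supplies the expansion; the remaining contour is smaller by
  \<open>exp (- \<delta> / t)\<close>, which beats every power of \<open>t\<close>. Tying
  \<open>t\<close> to \<open>n\<close> by an exact equation leaves no linear term in the
  exponent.\<close>

lemma partition_asymptotics:
  assumes n1: "a * (1 + c) = 1" and k3: "k \<ge> 3" and Qk: "\<And>m. Q m = of_int (polygonal k (Suc m))"
  obtains b :: "nat \<Rightarrow> complex" where "b 0 = of_real (sqrt (8 * pi / 3) * exp D0)"
    "\<And>J. \<exists>C t0. 0 < t0 \<and> (\<forall>n t. 0 < t \<longrightarrow> t < t0 \<longrightarrow> real n = L / (2 * t ^ 3) \<longrightarrow>
      norm (of_real (p_gonal k n / (t\<^sup>2 * exp (2 * \<kappa> * ln t) * exp (3 / 2 * (L / t)) * sqrt (t / L) / (2 * pi))) - (\<Sum>j\<le>J. b j * of_real t ^ j)) \<le> C * t ^ Suc J)"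
proof -
  obtain r b where r: "0 < r" "r < 1" "r \<le> 1/4" and b0: "b 0 = of_real (sqrt (8 * pi / 3) * exp D0)"
    and Zb: "\<And>J. \<exists>C. \<forall>\<^sub>F t in at_right 0. norm (central_arc r t - (\<Sum>j\<le>J. b j * of_real t ^ j)) \<le> C * t ^ Suc J"
    and contT: "\<And>t. 0 < t \<Longrightarrow> continuous_on {-r..r} (\<lambda>u. exp (T t (1 + \<i> * of_real u)))"
    and contS: "continuous_on {-r..r} (\<lambda>u. saddle (of_real u))"
    by (rule central_expansion) (rule that; assumption)
  obtain \<delta> where \<delta>: "0 < \<delta>" "\<And>\<eta> \<theta>. 0 < \<eta> \<Longrightarrow> \<eta> \<le> 1 \<Longrightarrow> r * \<eta> \<le> \<bar>\<theta>\<bar> \<Longrightarrow> \<bar>\<theta>\<bar> \<le> pi \<Longrightarrow>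
    norm (exp (H (Complex \<eta> \<theta>))) \<le> exp (Re (H (of_real \<eta>)) - \<delta> / sqrt \<eta>)"
    by (rule minor_arc_bound[OF n1 r(1)]) (rule that; assumption)
  obtain h' G' where lT: "((\<lambda>t. T t 1) \<longlongrightarrow> of_real D0) (at_right 0)"
    by (rule exp_T_expansion) (rule that; assumption)
  have "\<forall>\<^sub>F t in at_right 0. dist (T t 1) (of_real D0) < 1" by (rule tendstoD[OF lT]) simp
  then obtain t1 where t1: "0 < t1" "\<And>t. 0 < t \<Longrightarrow> t < t1 \<Longrightarrow> dist (T t 1) (of_real D0) < 1"
    unfolding eventually_at_right_field by auto
  have ReT: "Re (T t 1) \<le> D0 + 1" if "0 < t" "t < t1" for t
  proof -
    have "Re (T t 1 - of_real D0) \<le> norm (T t 1 - of_real D0)" by (rule complex_Re_le_cmod)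
    then show ?thesis using t1(2)[OF that] by (simp add: dist_norm)
  qed
  have split: "norm (of_real (p_gonal k n / (t\<^sup>2 * exp (2 * \<kappa> * ln t) * exp (3 / 2 * (L / t)) * sqrt (t / L) / (2 * pi))) - central_arc r t)
      \<le> 2 * pi * exp (D0 + 1) * exp (- (\<delta> / t)) / (t\<^sup>2 * sqrt (t / L))"
    if t: "0 < t" "t < t1" "t \<le> 1" and nt: "real n = L / (2 * t ^ 3)" for n t
  proof -
    define \<eta> where "\<eta> = t\<^sup>2"
    define s where "s = sqrt (t / L)"
    define pre where "pre = exp (2 * \<kappa> * ln t) * exp (3 / 2 * (L / t))"
    have \<eta>: "0 < \<eta>" "\<eta> \<le> 1" "sqrt \<eta> = t" using t by (auto simp: \<eta>_def power_le_one)
    have s: "0 < s" "s\<^sup>2 = t / L" using t L_pos by (auto simp: s_def)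
    have pre: "0 < pre" by (simp add: pre_def)
    \<comment> \<open>Hence \<open>n * z = (L / t) * (w / 2)\<close> for
      \<open>z = w * t\<^sup>2\<close>, matching the term \<open>(L / t) / csqrt w\<close> of
      \<open>H\<close>.\<close>
    have n\<eta>: "real n * \<eta> = L / (2 * t)" using t nt by (simp add: \<eta>_def power2_eq_square power3_eq_cube)
    define F where "F = (\<lambda>\<theta>. exp (H (Complex \<eta> \<theta>) + of_nat n * Complex \<eta> \<theta>))"
    have cF: "continuous_on {-pi..pi} F"
    proof -
      have "continuous_on {-pi..pi} (\<lambda>\<theta>. H (Complex \<eta> \<theta>))"
        by (rule continuous_on_compose2[OF holomorphic_on_imp_continuous_on[OF H_holomorphic] continuous_on_Complex])
           (use \<eta> in auto)
      then show ?thesis unfolding F_def by (intro continuous_intros continuous_on_Complex)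
    qed
    have r\<eta>: "0 < r * \<eta>" "r * \<eta> \<le> pi"
    proof -
      show "0 < r * \<eta>" using r \<eta> by simp
      have "r * \<eta> \<le> 1 * 1" using r \<eta> by (intro mult_mono) auto
      then show "r * \<eta> \<le> pi" using pi_gt3 by simp
    qed
    have sF: "set_integrable lborel {-pi..pi} F" by (rule borel_integrable_atLeastAtMost'[OF cF])
    have sF1: "set_integrable lborel {-(r * \<eta>)..r * \<eta>} F"
      by (rule set_integrable_subset[OF sF]) (use r\<eta> in auto)
    have sF2: "set_integrable lborel ({-pi..pi} - {-(r * \<eta>)..r * \<eta>}) F"
      by (rule set_integrable_subset[OF sF]) auto
    have total: "(LINT \<theta>:{-pi..pi}|lborel. F \<theta>) = of_real (2 * pi * p_gonal k n)"
      using set_borel_integral_eq_integral(2)[OF sF] coefficient_integral(2)[OF k3 Qk \<eta>(1), of n] unfolding F_def by simp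
    have "(LINT \<theta>:{-pi..pi}|lborel. F \<theta>) = (LINT \<theta>:{-(r * \<eta>)..r * \<eta>} \<union> ({-pi..pi} - {-(r * \<eta>)..r * \<eta>})|lborel. F \<theta>)"
      using r\<eta> by (intro arg_cong[where f = "\<lambda>S. LINT \<theta>:S|lborel. F \<theta>"]) auto
    also have "\<dots> = (LINT \<theta>:{-(r * \<eta>)..r * \<eta>}|lborel. F \<theta>) + (LINT \<theta>:{-pi..pi} - {-(r * \<eta>)..r * \<eta>}|lborel. F \<theta>)"
      by (rule set_integral_Un[OF _ sF1 sF2]) auto
    finally have sp: "of_real (2 * pi * p_gonal k n) = (LINT \<theta>:{-(r * \<eta>)..r * \<eta>}|lborel. F \<theta>) + (LINT \<theta>:{-pi..pi} - {-(r * \<eta>)..r * \<eta>}|lborel. F \<theta>)"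
      unfolding total .
    have mid: "(LINT \<theta>:{-(r * \<eta>)..r * \<eta>}|lborel. F \<theta>) = of_real (\<eta> * pre * s) * central_arc r t"
    proof -
      have "(LINT \<theta>:{-(r * \<eta>)..r * \<eta>}|lborel. F \<theta>) = \<bar>\<eta>\<bar> *\<^sub>R (\<integral>u. indicator {-(r * \<eta>)..r * \<eta>} (0 + \<eta> * u) *\<^sub>R F (0 + \<eta> * u) \<partial>lborel)"
        unfolding set_lebesgue_integral_def by (rule lborel_integral_real_affine) (use \<eta> in simp)
      also have "(\<integral>u. indicator {-(r * \<eta>)..r * \<eta>} (0 + \<eta> * u) *\<^sub>R F (0 + \<eta> * u) \<partial>lborel) =
        (\<integral>u. of_real pre * (indicator {-r..r} u *\<^sub>R (exp (of_real (u\<^sup>2 / s\<^sup>2) * saddle (of_real u)) * exp (T t (1 + \<i> * of_real u)))) \<partial>lborel)"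
      proof (rule Bochner_Integration.integral_cong[OF refl])
        fix u :: real
        have ind: "indicator {-(r * \<eta>)..r * \<eta>} (0 + \<eta> * u) = (indicator {-r..r} u :: real)"
        proof -
          have "\<eta> * u \<le> r * \<eta> \<longleftrightarrow> u \<le> r" "- (r * \<eta>) \<le> \<eta> * u \<longleftrightarrow> - r \<le> u"
            using mult_le_cancel_left_pos[OF \<eta>(1), of u r] mult_le_cancel_left_pos[OF \<eta>(1), of "- r" u] by (simp_all add: mult.commute)
          then show ?thesis unfolding indicator_def by simp
        qed
        show "indicator {-(r * \<eta>)..r * \<eta>} (0 + \<eta> * u) *\<^sub>R F (0 + \<eta> * u) =
          of_real pre * (indicator {-r..r} u *\<^sub>R (exp (of_real (u\<^sup>2 / s\<^sup>2) * saddle (of_real u)) * exp (T t (1 + \<i> * of_real u))))"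
        proof (cases "u \<in> {-r..r}")
          case True
          define w where "w = 1 + \<i> * complex_of_real u"
          have cz: "Complex \<eta> (\<eta> * u) = w * of_real (t\<^sup>2)" by (simp add: complex_eq_iff w_def \<eta>_def)
          have un: "norm (complex_of_real u) < 1" using True r by auto
          have sq: "w / 2 + 1 / csqrt w = 3 / 2 + (of_real u)\<^sup>2 * saddle (of_real u)"
            unfolding w_def by (rule saddle_eq[OF un])
          have nz: "of_nat n * (w * of_real (t\<^sup>2)) = of_real (L / t) * (w / 2)"
          proof -
            have "of_nat n * (w * of_real (t\<^sup>2)) = complex_of_real (real n * \<eta>) * w" by (simp add: \<eta>_def)
            also have "\<dots> = of_real (L / t) * (w / 2)" unfolding n\<eta> by simp
            finally show ?thesis .
          qed
          have "H (w * of_real (t\<^sup>2)) + of_nat n * (w * of_real (t\<^sup>2)) = T t w + of_real (2 * \<kappa> * ln t) + of_real (L / t) * (w / 2 + 1 / csqrt w)"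
            unfolding H_of_real_square[OF t(1)] nz by (simp add: distrib_left)
          also have "\<dots> = of_real (2 * \<kappa> * ln t) + of_real (3 / 2 * (L / t)) + (of_real (u\<^sup>2 / s\<^sup>2) * saddle (of_real u) + T t w)"
            unfolding sq s(2) by (simp add: distrib_left mult_ac)
          finally have "F (\<eta> * u) = exp (of_real (2 * \<kappa> * ln t)) * exp (of_real (3 / 2 * (L / t))) * (exp (of_real (u\<^sup>2 / s\<^sup>2) * saddle (of_real u)) * exp (T t w))"
            unfolding F_def cz by (simp only: exp_add)
          also have "exp (of_real (2 * \<kappa> * ln t)) * exp (of_real (3 / 2 * (L / t))) = complex_of_real pre"
            unfolding exp_of_real pre_def of_real_mult[symmetric] ..
          finally show ?thesis using True unfolding ind w_def by simp
        next
          case False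
          then show ?thesis unfolding ind by simp
        qed
      qed
      also have "\<dots> = of_real pre * (of_real s * central_arc r t)"
        unfolding central_arc_def s_def[symmetric] Bochner_Integration.integral_mult_right_zero using s(1) by simp
      finally show ?thesis using \<eta>(1) by (simp add: scaleR_conv_of_real mult_ac)
    qed
    \<comment> \<open>The saddle value times the saving on the minor arcs; \<open>D0 + 1\<close>
      bounds \<open>Re (T t 1)\<close> for small \<open>t\<close>.\<close>
    define bound where "bound = pre * exp (D0 + 1) * exp (- (\<delta> / t))"
    have bF: "norm (F \<theta>) \<le> bound" if \<theta>: "\<theta> \<in> {-pi..pi} - {-(r * \<eta>)..r * \<eta>}" for \<theta>
    proof -
      have \<theta>': "r * \<eta> \<le> \<bar>\<theta>\<bar>" "\<bar>\<theta>\<bar> \<le> pi" using \<theta> by auto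
      have "norm (F \<theta>) = norm (exp (H (Complex \<eta> \<theta>))) * exp (real n * \<eta>)"
        unfolding F_def exp_add norm_mult by simp
      also have "\<dots> \<le> exp (Re (H (of_real \<eta>)) - \<delta> / sqrt \<eta>) * exp (real n * \<eta>)"
        by (intro mult_right_mono \<delta>(2) \<eta> \<theta>') auto
      also have "\<dots> = exp (Re (H (of_real \<eta>)) - \<delta> / t + L / (2 * t))" unfolding n\<eta> \<eta>(3) by (simp add: exp_add)
      also have "Re (H (of_real \<eta>)) = Re (T t 1) + L / t + 2 * \<kappa> * ln t"
      proof -
        have "complex_of_real L / (of_real t * csqrt 1) = of_real (L / t)" by simp
        then show ?thesis using H_of_real_square[OF t(1), of 1] unfolding \<eta>_def by simp
      qed
      also have "exp (Re (T t 1) + L / t + 2 * \<kappa> * ln t - \<delta> / t + L / (2 * t)) \<le> exp ((2 * \<kappa> * ln t + 3 / 2 * (L / t)) + (D0 + 1) + - (\<delta> / t))"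
      proof -
        have e: "3 / 2 * (L / t) = L / t + L / (2 * t)" using t(1) by (simp add: field_simps)
        show ?thesis unfolding e exp_le_cancel_iff using ReT[OF t(1,2)] by linarith
      qed
      also have "\<dots> = bound" unfolding bound_def pre_def by (simp only: exp_add)
      finally show ?thesis .
    qed
    have rest: "norm (LINT \<theta>:{-pi..pi} - {-(r * \<eta>)..r * \<eta>}|lborel. F \<theta>) \<le> 2 * pi * bound"
    proof -
      have b0: "0 \<le> bound" using pre by (simp add: bound_def)
      have "norm (LINT \<theta>:{-pi..pi} - {-(r * \<eta>)..r * \<eta>}|lborel. F \<theta>) \<le> (\<integral>\<theta>. indicator {-pi..pi} \<theta> * bound \<partial>lborel)"
        unfolding set_lebesgue_integral_def
      proof (rule Bochner_Integration.integral_norm_bound_integral)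
        show "integrable lborel (\<lambda>\<theta>. indicator ({-pi..pi} - {-(r * \<eta>)..r * \<eta>}) \<theta> *\<^sub>R F \<theta>)"
          using sF2 unfolding set_integrable_def .
        show "integrable lborel (\<lambda>\<theta>. indicator {-pi..pi} \<theta> * bound)" by (intro integrable_mult_left integrable_real_indicator) auto
        show "norm (indicator ({-pi..pi} - {-(r * \<eta>)..r * \<eta>}) \<theta> *\<^sub>R F \<theta>) \<le> indicator {-pi..pi} \<theta> * bound" for \<theta>
          using bF[of \<theta>] b0 by (auto simp: indicator_def)
      qed
      also have "\<dots> = 2 * pi * bound" by simp
      finally show ?thesis .
    qed
    define D where "D = t\<^sup>2 * exp (2 * \<kappa> * ln t) * exp (3 / 2 * (L / t)) * sqrt (t / L)"
    have D: "D = \<eta> * pre * s" "0 < D" using t L_pos by (auto simp: D_def \<eta>_def pre_def s_def)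
    have "of_real D * (complex_of_real (p_gonal k n / (D / (2 * pi))) - central_arc r t) = of_real (2 * pi * p_gonal k n) - of_real (\<eta> * pre * s) * central_arc r t"
      unfolding D(1)[symmetric] using D(2) by (simp add: right_diff_distrib)
    also have "\<dots> = (LINT \<theta>:{-pi..pi} - {-(r * \<eta>)..r * \<eta>}|lborel. F \<theta>)"
      unfolding sp mid by simp
    finally have "norm (of_real D * (complex_of_real (p_gonal k n / (D / (2 * pi))) - central_arc r t)) \<le> 2 * pi * bound"
      using rest by simp
    then have "norm (complex_of_real (p_gonal k n / (D / (2 * pi))) - central_arc r t) \<le> 2 * pi * bound / D"
      unfolding norm_mult using D(2) by (simp add: pos_le_divide_eq mult.commute)
    also have "2 * pi * bound / D = 2 * pi * exp (D0 + 1) * exp (- (\<delta> / t)) / (t\<^sup>2 * sqrt (t / L))"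
      unfolding D(1) bound_def using pre s \<eta> by (simp add: \<eta>_def s_def)
    finally show ?thesis unfolding D_def .
  qed
  have main: "\<exists>C t0. 0 < t0 \<and> (\<forall>n t. 0 < t \<longrightarrow> t < t0 \<longrightarrow> real n = L / (2 * t ^ 3) \<longrightarrow>
      norm (of_real (p_gonal k n / (t\<^sup>2 * exp (2 * \<kappa> * ln t) * exp (3 / 2 * (L / t)) * sqrt (t / L) / (2 * pi))) - (\<Sum>j\<le>J. b j * of_real t ^ j)) \<le> C * t ^ Suc J)" for J
  proof -
    obtain C where C: "\<forall>\<^sub>F t in at_right 0. norm (central_arc r t - (\<Sum>j\<le>J. b j * of_real t ^ j)) \<le> C * t ^ Suc J" using Zb[of J] by blast
    then obtain t2 where t2: "0 < t2" "\<And>t. 0 < t \<Longrightarrow> t < t2 \<Longrightarrow> norm (central_arc r t - (\<Sum>j\<le>J. b j * of_real t ^ j)) \<le> C * t ^ Suc J"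
      unfolding eventually_at_right_field by auto
    define K where "K = 2 * pi * exp (D0 + 1)"
    \<comment> \<open>The denominator costs three powers of \<open>t\<close>: two from
      \<open>t\<^sup>2\<close> and at most one from \<open>sqrt (t / L)\<close>.\<close>
    define m where "m = J + 4"
    define C' where "C' = K * (fact m / \<delta> ^ m) * sqrt L"
    define t0 where "t0 = min (min t1 t2) 1"
    have "norm (of_real (p_gonal k n / (t\<^sup>2 * exp (2 * \<kappa> * ln t) * exp (3 / 2 * (L / t)) * sqrt (t / L) / (2 * pi))) - (\<Sum>j\<le>J. b j * of_real t ^ j)) \<le> (C + C') * t ^ Suc J"
      if t: "0 < t" "t < t0" and nt: "real n = L / (2 * t ^ 3)" for n t
    proof -
      have t': "t < t1" "t < t2" "t \<le> 1" using t by (auto simp: t0_def)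
      have "exp (- (\<delta> / t)) \<le> fact m / (\<delta> / t) ^ m" using \<delta>(1) t by (intro exp_neg_le_power) simp
      also have "\<dots> = fact m / \<delta> ^ m * t ^ m" by (simp add: power_divide)
      finally have e: "exp (- (\<delta> / t)) \<le> fact m / \<delta> ^ m * t ^ m" .
      have sq: "t * sqrt (1 / L) \<le> sqrt (t / L)"
      proof -
        have "t * t \<le> t * 1" using t t' by (intro mult_left_mono) auto
        then have "sqrt (t * t) \<le> sqrt t" by (intro real_sqrt_le_mono) simp
        then have "t * sqrt (1 / L) \<le> sqrt t * sqrt (1 / L)" using t L_pos by (intro mult_right_mono) auto
        then show ?thesis by (simp add: real_sqrt_mult[symmetric])
      qed
      have "K * exp (- (\<delta> / t)) / (t\<^sup>2 * sqrt (t / L)) \<le> K * (fact m / \<delta> ^ m * t ^ m) / (t\<^sup>2 * (t * sqrt (1 / L)))"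
        using e sq t L_pos \<delta>(1) by (intro frac_le mult_left_mono mult_nonneg_nonneg) (auto simp: K_def)
      also have "\<dots> = C' * t ^ Suc J"
        using t L_pos by (simp add: C'_def m_def real_sqrt_divide power_add power2_eq_square power4_eq_xxxx mult_ac)
      finally have e2: "K * exp (- (\<delta> / t)) / (t\<^sup>2 * sqrt (t / L)) \<le> C' * t ^ Suc J" .
      have "norm (of_real (p_gonal k n / (t\<^sup>2 * exp (2 * \<kappa> * ln t) * exp (3 / 2 * (L / t)) * sqrt (t / L) / (2 * pi))) - central_arc r t) \<le> C' * t ^ Suc J"
        using split[OF t(1) t'(1,3) nt] e2 unfolding K_def by (rule order_trans)
      moreover have "norm (central_arc r t - (\<Sum>j\<le>J. b j * of_real t ^ j)) \<le> C * t ^ Suc J" by (rule t2(2)[OF t(1) t'(2)])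
      ultimately show ?thesis
        using norm_triangle_mono[of "of_real (p_gonal k n / (t\<^sup>2 * exp (2 * \<kappa> * ln t) * exp (3 / 2 * (L / t)) * sqrt (t / L) / (2 * pi))) - central_arc r t" "C' * t ^ Suc J" "central_arc r t - (\<Sum>j\<le>J. b j * of_real t ^ j)" "C * t ^ Suc J"]
        by (simp add: distrib_right add.commute)
    qed
    moreover have "0 < t0" using t1(1) t2(1) by (simp add: t0_def)
    ultimately show ?thesis by blast
  qed
  show ?thesis by (rule that[OF b0 main])
qed

end

section \<open>Explicit constants and the final form\<close>

lemma leading_constant:
  fixes k :: int and n :: nat
  assumes k: "k \<ge> 3" and n: "n \<ge> 1"
    and a_eq: "a = (of_int k - 2) / 2" and c_eq: "c = (4 - of_int k) / (of_int k - 2)"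
    and t_eq: "t = (quad_seq.L a / (2 * real n)) powr (1 / 3)"
  shows "t\<^sup>2 * exp (2 * quad_seq.\<kappa> c * ln t) * exp (3 / 2 * (quad_seq.L a / t)) * sqrt (t / quad_seq.L a) / (2 * pi)
     * (sqrt (8 * pi / 3) * exp (quad_seq.D0 a c))
    = C_gonal k * exp (A_gonal k * real n powr (1 / 3)) / real n powr ((5 * of_int k - 6) / (6 * (of_int k - 2)))"
proof -
  \<comment> \<open>In terms of \<open>x\<close> the data are \<open>a = x / 2\<close>,
    \<open>1 + c = 2 / x\<close> and \<open>\<kappa> = 1 / x\<close>, which explains
    \<open>Gamma (2 / (k - 2))\<close> in the constant.\<close>
  define x where "x = real_of_int k - 2"
  have x: "1 \<le> x" using k by (simp add: x_def)
  have kx: "real_of_int k = x + 2" by (simp add: x_def)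
  interpret quad_seq a c
    by standard (use x in \<open>auto simp: a_eq c_eq kx divide_simps\<close>)
  define Z where "Z = zeta (3/2)"
  have Z: "0 < Z" unfolding Z_def zeta_def by (intro suminf_pos summable_zeta) auto
  define g where "g = Gamma (2 / x)"
  have g: "0 < g" using x by (simp add: g_def Gamma_real_pos)
  have c1: "1 + c = 2 / x" using x by (simp add: c_eq kx field_simps)
  have \<kappa>: "\<kappa> = 1 / x" by (simp add: \<kappa>_def c1)
  have lnL: "ln L = (ln 2 + ln pi - ln x) / 2 + ln Z - ln 2"
  proof -
    have e: "L = sqrt (2 * pi / x) * Z / 2" unfolding L_def Z_def by (simp add: a_eq kx)
    show ?thesis unfolding e using x Z by (simp add: ln_div ln_mult_pos ln_sqrt)
  qed
  have tpos: "0 < t" using L_pos n by (simp add: t_eq)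
  have lnt: "ln t = (ln L - ln 2 - ln (real n)) / 3"
    using L_pos n by (simp add: t_eq ln_powr ln_div ln_mult_pos)
  have Lt: "3 / 2 * (L / t) = A_gonal k * real n powr (1 / 3)"
  proof -
    have e1: "ln (L / t) = ln ((sqrt (pi / x) * Z) powr (2/3) * real n powr (1/3))"
    proof -
      have "ln ((sqrt (pi / x) * Z) powr (2/3) * real n powr (1/3)) = 2/3 * ((ln pi - ln x) / 2 + ln Z) + 1/3 * ln (real n)"
        using x Z n by (simp add: ln_mult_pos ln_powr ln_sqrt ln_div)
      moreover have "ln (L / t) = ln L - ln t" using L_pos tpos by (rule ln_divide_pos)
      ultimately show ?thesis unfolding lnt lnL by (simp add: field_simps)
    qed
    have "0 < L / t" "0 < (sqrt (pi / x) * Z) powr (2/3) * real n powr (1/3)" using L_pos tpos x Z n by auto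
    then have "L / t = (sqrt (pi / x) * Z) powr (2/3) * real n powr (1/3)" using e1 by simp
    then show ?thesis by (simp add: A_gonal_def x_def Z_def)
  qed
  have sq83: "ln (sqrt (8 * pi / 3)) = (3 * ln 2 + ln pi - ln 3) / 2"
  proof -
    have "ln (8 :: real) = ln (2 ^ 3)" by simp
    also have "\<dots> = 3 * ln 2" by (subst ln_realpow) auto
    finally show ?thesis by (simp add: ln_sqrt ln_div ln_mult_pos)
  qed
  have lnD0: "D0 = (ln x - ln 2) / x + ln g - (ln 2 + ln pi)"
  proof -
    have "ln a = ln x - ln 2" using x by (simp add: a_eq kx ln_div)
    then show ?thesis unfolding D0_def c1 \<kappa> g_def by (simp add: ln_mult_pos)
  qed
  \<comment> \<open>The two large exponentials agree by \<open>Lt\<close>. The remaining factors are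
    positive and are compared through their logarithms, which are linear in \<open>ln 2\<close>,
    \<open>ln 3\<close>, \<open>ln pi\<close>, \<open>ln x\<close>, \<open>ln g\<close>,
    \<open>ln Z\<close> and \<open>ln n\<close>.\<close>
  define lhs where "lhs = t\<^sup>2 * exp (2 * \<kappa> * ln t) * sqrt (t / L) / (2 * pi) * (sqrt (8 * pi / 3) * exp D0)"
  define rhs where "rhs = C_gonal k / real n powr ((5 * of_int k - 6) / (6 * (of_int k - 2)))"
  have lhs0: "0 < lhs" unfolding lhs_def using tpos L_pos by simp
  have Ck: "C_gonal k = (x powr ((4 - x) / (6 * x)) * g * Z powr ((x + 2) / (3 * x))) / (2 powr ((3 * x + 4) / (2 * x)) * sqrt 3 * pi powr ((4 * x - 1) / (3 * x)))"
    unfolding C_gonal_def Let_def kx g_def Z_def by (simp add: algebra_simps)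
  have rhs0: "0 < rhs" unfolding rhs_def Ck using x g Z n by simp
  have e65: "(5 * real_of_int k - 6) / (6 * (real_of_int k - 2)) = (5 * x + 4) / (6 * x)" by (simp add: kx algebra_simps)
  have "ln lhs = 2 * ln t + 2 * \<kappa> * ln t + (ln t - ln L) / 2 - (ln 2 + ln pi) + ((3 * ln 2 + ln pi - ln 3) / 2 + D0)"
  proof -
    have "ln lhs = ln (t\<^sup>2 * exp (2 * \<kappa> * ln t) * sqrt (t / L)) - ln (2 * pi) + (ln (sqrt (8 * pi / 3)) + D0)"
      unfolding lhs_def using tpos L_pos by (subst ln_mult_pos; simp add: ln_div ln_mult_pos)
    also have "ln (t\<^sup>2 * exp (2 * \<kappa> * ln t) * sqrt (t / L)) = 2 * ln t + 2 * \<kappa> * ln t + (ln t - ln L) / 2"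
      using tpos L_pos by (simp add: ln_mult_pos ln_realpow ln_sqrt ln_div)
    finally show ?thesis unfolding sq83 by (simp add: ln_mult_pos)
  qed
  moreover have "ln rhs = (4 - x) / (6 * x) * ln x + ln g + (x + 2) / (3 * x) * ln Z
     - ((3 * x + 4) / (2 * x) * ln 2 + ln 3 / 2 + (4 * x - 1) / (3 * x) * ln pi) - (5 * x + 4) / (6 * x) * ln (real n)"
    unfolding rhs_def Ck e65 using x g Z n by (simp add: ln_div ln_mult_pos ln_powr ln_sqrt)
  moreover have "2 * ln t + 2 * \<kappa> * ln t + (ln t - ln L) / 2 - (ln 2 + ln pi) + ((3 * ln 2 + ln pi - ln 3) / 2 + D0)
    = (4 - x) / (6 * x) * ln x + ln g + (x + 2) / (3 * x) * ln Z
     - ((3 * x + 4) / (2 * x) * ln 2 + ln 3 / 2 + (4 * x - 1) / (3 * x) * ln pi) - (5 * x + 4) / (6 * x) * ln (real n)"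
    unfolding lnD0 \<kappa> lnt lnL using x by (simp add: field_simps)
  ultimately have "ln lhs = ln rhs" by simp
  then have "lhs = rhs" using lhs0 rhs0 by simp
  then have "lhs * exp (3 / 2 * (L / t)) = rhs * exp (A_gonal k * real n powr (1 / 3))" by (simp only: Lt)
  then show ?thesis unfolding lhs_def rhs_def by (simp only: times_divide_eq_left times_divide_eq_right mult_ac)
qed

theorem theorem1p1:
  fixes k :: int
  assumes "k \<ge> 3"
  shows "\<exists>B :: nat \<Rightarrow> complex. \<forall>N\<ge>1. \<exists>E :: nat \<Rightarrow> complex.
    E \<in> O(\<lambda>n. of_real (real n powr (- (real N + 1) / 3))) \<and>
    (\<forall>\<^sub>F n in sequentially.
      of_nat (p_gonal k n) =
        of_real (C_gonal k * exp (A_gonal k * real n powr (1 / 3))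
          / real n powr ((5 * of_int k - 6) / (6 * (of_int k - 2))))
        * (1 + (\<Sum>j=1..N. B j / of_real (real n powr (real j / 3))) + E n))"
proof -
  define x where "x = real_of_int k - 2"
  have x: "1 \<le> x" using assms by (simp add: x_def)
  define a where "a = (real_of_int k - 2) / 2"
  define c where "c = (4 - real_of_int k) / (real_of_int k - 2)"
  have ac: "a = x / 2" "c = (2 - x) / x" by (auto simp: a_def c_def x_def)
  interpret quad_seq a c
    by standard (use x in \<open>auto simp: ac divide_simps\<close>)
  have n1: "a * (1 + c) = 1" using x by (simp add: ac field_simps)
  have Qk: "Q m = of_int (polygonal k (Suc m))" for m
  proof -
    define M where "M = real (Suc m)"
    have "2 * real_of_int (polygonal k (Suc m)) = real_of_int (2 * polygonal k (Suc m))" by simp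
    also have "\<dots> = (real_of_int k - 2) * M\<^sup>2 + (4 - real_of_int k) * M"
      unfolding two_mult_polygonal M_def by simp
    also have "\<dots> = x * M\<^sup>2 + (2 - x) * M" by (simp add: x_def)
    also have "\<dots> = 2 * (x / 2 * (M * (M + (2 - x) / x)))" using x by (simp add: field_simps power2_eq_square)
    also have "x / 2 * (M * (M + (2 - x) / x)) = Q m" by (simp add: Q_def M_def flip: ac)
    finally show ?thesis by simp
  qed
  obtain b :: "nat \<Rightarrow> complex" where b0: "b 0 = of_real (sqrt (8 * pi / 3) * exp D0)"
    and b: "\<And>J. \<exists>C t0. 0 < t0 \<and> (\<forall>n t. 0 < t \<longrightarrow> t < t0 \<longrightarrow> real n = L / (2 * t ^ 3) \<longrightarrow>
      norm (of_real (p_gonal k n / (t\<^sup>2 * exp (2 * \<kappa> * ln t) * exp (3 / 2 * (L / t)) * sqrt (t / L) / (2 * pi))) - (\<Sum>j\<le>J. b j * of_real t ^ j)) \<le> C * t ^ Suc J)"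
    by (rule partition_asymptotics[OF n1 assms Qk]) (rule that; assumption)
  \<comment> \<open>The coefficient of order \<open>0\<close>; dividing by it makes the expansion
    begin with \<open>1\<close>.\<close>
  define v where "v = sqrt (8 * pi / 3) * exp D0"
  have v: "0 < v" "b 0 = of_real v" by (auto simp: v_def b0)
  define t where "t = (\<lambda>n::nat. (L / (2 * real n)) powr (1 / 3))"
  define \<tau> where "\<tau> = (L / 2) powr (1 / 3)"
  have \<tau>: "0 < \<tau>" using L_pos by (simp add: \<tau>_def)
  have tn: "t n = \<tau> / real n powr (1 / 3)" if "1 \<le> n" for n
    using that L_pos unfolding t_def \<tau>_def by (simp add: powr_divide flip: divide_divide_eq_left)
  have tpos: "0 < t n" if "1 \<le> n" for n using L_pos that by (simp add: t_def)
  have t3: "real n = L / (2 * t n ^ 3)" if "1 \<le> n" for n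
  proof -
    have "t n ^ 3 = t n powr 3" using tpos[OF that] by (simp add: powr_numeral)
    also have "\<dots> = L / (2 * real n)" unfolding t_def powr_powr using L_pos that by simp
    finally show ?thesis using L_pos that by simp
  qed
  have t0: "t \<longlonglongrightarrow> 0" unfolding t_def using L_pos by real_asymp
  define pref where "pref = (\<lambda>n::nat. (t n)\<^sup>2 * exp (2 * \<kappa> * ln (t n)) * exp (3 / 2 * (L / t n)) * sqrt (t n / L) / (2 * pi))"
  define P0 where "P0 = (\<lambda>n::nat. C_gonal k * exp (A_gonal k * real n powr (1 / 3)) / real n powr ((5 * of_int k - 6) / (6 * (of_int k - 2))))"
  have P0: "P0 n = pref n * v" "0 < pref n" if "1 \<le> n" for n
  proof -
    show "P0 n = pref n * v" unfolding P0_def pref_def v_def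
      by (rule leading_constant[symmetric, OF assms that a_def c_def]) (simp add: t_def)
    show "0 < pref n" using tpos[OF that] L_pos by (simp add: pref_def)
  qed
  \<comment> \<open>As \<open>t n\<close> is \<open>\<tau> / n powr (1 / 3)\<close>, powers of
    \<open>\<tau>\<close> pass into the coefficients, which are the same for every
    \<open>N\<close>.\<close>
  define B where "B = (\<lambda>j. b j * of_real \<tau> ^ j / of_real v)"
  show ?thesis
  proof (rule exI[of _ B], intro allI impI)
    fix N :: nat assume N: "1 \<le> N"
    \<comment> \<open>The relative error, defined by solving for it. At \<open>n = 0\<close> the
      divisor \<open>P0 0\<close> is \<open>0\<close>; both claims about \<open>E\<close> concern
      large \<open>n\<close>.\<close>
    define E where "E = (\<lambda>n. of_nat (p_gonal k n) / of_real (P0 n) - 1 - (\<Sum>j=1..N. B j / of_real (real n powr (real j / 3))))"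
    obtain C t1 where C: "0 < t1" "\<And>n t. 0 < t \<Longrightarrow> t < t1 \<Longrightarrow> real n = L / (2 * t ^ 3) \<Longrightarrow>
      norm (of_real (p_gonal k n / (t\<^sup>2 * exp (2 * \<kappa> * ln t) * exp (3 / 2 * (L / t)) * sqrt (t / L) / (2 * pi))) - (\<Sum>j\<le>N. b j * of_real t ^ j)) \<le> C * t ^ Suc N"
      using b[of N] by blast
    have "\<forall>\<^sub>F n in sequentially. t n < t1" by (rule order_tendstoD(2)[OF t0 C(1)])
    then have bd: "\<forall>\<^sub>F n in sequentially. norm (E n) \<le> (C * \<tau> ^ Suc N / v) * norm (complex_of_real (real n powr (- (real N + 1) / 3)))"
      using eventually_ge_at_top[of 1]
    proof eventually_elim
      case (elim n)
      note n = elim(2)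
      have pw: "complex_of_real (t n) ^ j = of_real \<tau> ^ j / of_real (real n powr (real j / 3))" for j
      proof -
        have "t n ^ j = \<tau> ^ j / (real n powr (1 / 3)) ^ j" by (simp add: tn[OF n] power_divide)
        also have "(real n powr (1 / 3)) ^ j = real n powr (real j / 3)"
          using n by (simp add: powr_realpow[symmetric] powr_powr)
        finally show ?thesis by (metis of_real_divide of_real_power)
      qed
      have s: "(\<Sum>j\<le>N. b j * of_real (t n) ^ j) = of_real v * (1 + (\<Sum>j=1..N. B j / of_real (real n powr (real j / 3))))"
      proof -
        have "(\<Sum>j\<le>N. b j * of_real (t n) ^ j) = b 0 + (\<Sum>j=1..N. b j * of_real (t n) ^ j)"
          by (simp add: atMost_atLeast0 sum.atLeast_Suc_atMost)
        also have "(\<Sum>j=1..N. b j * of_real (t n) ^ j) = of_real v * (\<Sum>j=1..N. B j / of_real (real n powr (real j / 3)))"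
          unfolding sum_distrib_left pw B_def using v(1) by simp
        finally show ?thesis unfolding v(2) by (simp add: distrib_left)
      qed
      have "of_real v * E n = of_real (p_gonal k n / pref n) - (\<Sum>j\<le>N. b j * of_real (t n) ^ j)"
        unfolding E_def s P0(1)[OF n] using v(1) P0(2)[OF n] by (simp add: field_simps)
      then have "norm (of_real v * E n) \<le> C * t n ^ Suc N"
        using C(2)[OF tpos[OF n] elim(1) t3[OF n]] unfolding pref_def by simp
      then have "norm (E n) \<le> C * t n ^ Suc N / v"
        unfolding norm_mult using v(1) by (simp add: pos_le_divide_eq mult.commute)
      also have "t n ^ Suc N = \<tau> ^ Suc N * real n powr (- (real N + 1) / 3)"
      proof -
        have "t n ^ Suc N = \<tau> ^ Suc N / (real n powr (1 / 3)) ^ Suc N" by (simp only: tn[OF n] power_divide)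
        also have "(real n powr (1 / 3)) ^ Suc N = real n powr (1 / 3 * real (Suc N))"
          using n by (simp only: powr_powr[symmetric]) (subst powr_realpow, simp_all)
        also have "\<tau> ^ Suc N / real n powr (1 / 3 * real (Suc N)) = \<tau> ^ Suc N * real n powr (- (1 / 3 * real (Suc N)))"
          by (simp only: powr_minus divide_inverse)
        also have "- (1 / 3 * real (Suc N)) = - (real N + 1) / 3" by (simp add: field_simps)
        finally show ?thesis .
      qed
      finally show ?case by (simp add: mult_ac)
    qed
    have "E \<in> O(\<lambda>n. of_real (real n powr (- (real N + 1) / 3)))" by (rule bigoI[OF bd])
    moreover have "\<forall>\<^sub>F n in sequentially. of_nat (p_gonal k n) = of_real (P0 n) * (1 + (\<Sum>j=1..N. B j / of_real (real n powr (real j / 3))) + E n)"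
      using eventually_ge_at_top[of 1]
    proof eventually_elim
      case (elim n)
      have "P0 n \<noteq> 0" using P0[OF elim] v(1) by simp
      then show ?case by (simp add: E_def)
    qed
    ultimately show "\<exists>E. E \<in> O(\<lambda>n. of_real (real n powr (- (real N + 1) / 3))) \<and>
      (\<forall>\<^sub>F n in sequentially. of_nat (p_gonal k n) = of_real (C_gonal k * exp (A_gonal k * real n powr (1 / 3))
          / real n powr ((5 * of_int k - 6) / (6 * (of_int k - 2)))) * (1 + (\<Sum>j=1..N. B j / of_real (real n powr (real j / 3))) + E n))"
      unfolding P0_def by blast
  qed
qed

end
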